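(* It is consistent (relative to the consistency of ZFC) that GCH holds and there is a function $g:[\omega_2]^2\to\omega_1$ such that (1) $g$ establishes $\omega_2\not\rightarrow[(\omega_1;\omega)]^2_{\omega_1}$, and (2) there is no uncountable $g$-rainbow set.
   Context: $[X]^2$ is the set of two-element subsets of $X$. For sets $A,B$ of ordinals, $[A,B]=\{\{\alpha,\beta\}:\alpha\in A,\ \beta\in B,\ \alpha\ne\beta\}$, and $g''[A,B]$ is the image of this set under $g$. A function $g:[\omega_2]^2\to\omega_1$ establishes $\omega_2\not\rightarrow[(\omega_1;\omega)]^2_{\omega_1}$ if $g''[A,B]=\omega_1$ whenever $A\subseteq\omega_2$ has order type $\omega_1$, $B\subseteq\omega_2$ has order type $\omega$, and every element of $A$ is smaller than every element of $B$. A set $R\subseteq\omega_2$ is $g$-rainbow if $g\restriction[R]^2$ is one-to-one. *)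

theory Defs
  imports Main
begin

text \<open>
  First-order formulas over the signature with one binary relation symbol (membership) and equality,
  with de Bruijn indices. There are no function symbols, so the only terms are variables.
\<close>

datatype fm = Bot | Mem nat nat | Eq nat nat | Imp fm fm | All fm

primrec closed_below :: "nat \<Rightarrow> fm \<Rightarrow> bool" where
  "closed_below n Bot \<longleftrightarrow> True"
| "closed_below n (Mem i j) \<longleftrightarrow> i < n \<and> j < n"
| "closed_below n (Eq i j) \<longleftrightarrow> i < n \<and> j < n"
| "closed_below n (Imp p q) \<longleftrightarrow> closed_below n p \<and> closed_below n q"
| "closed_below n (All p) \<longleftrightarrow> closed_below (Suc n) p"

definition lift :: "(nat \<Rightarrow> nat) \<Rightarrow> nat \<Rightarrow> nat" where
  "lift f = case_nat 0 (\<lambda>i. Suc (f i))"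

primrec ren :: "(nat \<Rightarrow> nat) \<Rightarrow> fm \<Rightarrow> fm" where
  "ren f Bot = Bot"
| "ren f (Mem i j) = Mem (f i) (f j)"
| "ren f (Eq i j) = Eq (f i) (f j)"
| "ren f (Imp p q) = Imp (ren f p) (ren f q)"
| "ren f (All p) = All (ren (lift f) p)"

text \<open>\<open>inst t p\<close> is the body \<open>p\<close> of a quantifier with the variable \<open>t\<close> put for the bound variable.\<close>

definition inst :: "nat \<Rightarrow> fm \<Rightarrow> fm" where
  "inst t = ren (case_nat t (\<lambda>i. i))"

text \<open>
  Natural deduction for classical first-order logic with equality. In the rule \<open>AllI\<close> the context is
  shifted, so that the index 0 is the eigenvariable.
\<close>

inductive derives :: "fm set \<Rightarrow> fm \<Rightarrow> bool" (infix "\<turnstile>" 50) where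
  Assm: "p \<in> \<Gamma> \<Longrightarrow> \<Gamma> \<turnstile> p"
| ImpI: "insert p \<Gamma> \<turnstile> q \<Longrightarrow> \<Gamma> \<turnstile> Imp p q"
| ImpE: "\<Gamma> \<turnstile> Imp p q \<Longrightarrow> \<Gamma> \<turnstile> p \<Longrightarrow> \<Gamma> \<turnstile> q"
| RAA: "insert (Imp p Bot) \<Gamma> \<turnstile> Bot \<Longrightarrow> \<Gamma> \<turnstile> p"
| AllI: "ren Suc ` \<Gamma> \<turnstile> p \<Longrightarrow> \<Gamma> \<turnstile> All p"
| AllE: "\<Gamma> \<turnstile> All p \<Longrightarrow> \<Gamma> \<turnstile> inst t p"
| EqRefl: "\<Gamma> \<turnstile> Eq i i"
| EqSubst: "\<Gamma> \<turnstile> Eq i j \<Longrightarrow> \<Gamma> \<turnstile> inst i p \<Longrightarrow> \<Gamma> \<turnstile> inst j p"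

definition consistent :: "fm set \<Rightarrow> bool" where
  "consistent T \<longleftrightarrow> \<not> T \<turnstile> Bot"

text \<open>
  To write concrete formulas with named bound variables, variables are represented by de Bruijn
  levels: a variable is the number of quantifiers in whose scope its binder stands. A \<open>form\<close> maps the
  number \<open>n\<close> of variables in scope to a formula; at that depth, level \<open>x < n\<close> is the index
  \<open>n - Suc x\<close>, and a new quantifier binds level \<open>n\<close>. A sentence \<open>F\<close> denotes the closed formula \<open>F 0\<close>.
\<close>

type_synonym var = nat
type_synonym form = "nat \<Rightarrow> fm"

definition fmem :: "var \<Rightarrow> var \<Rightarrow> form" (infix "\<^bold>\<in>" 50) where
  "(x \<^bold>\<in> y) = (\<lambda>n. Mem (n - Suc x) (n - Suc y))"

definition feq :: "var \<Rightarrow> var \<Rightarrow> form" (infix "\<^bold>=" 50) where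
  "(x \<^bold>= y) = (\<lambda>n. Eq (n - Suc x) (n - Suc y))"

definition fimp :: "form \<Rightarrow> form \<Rightarrow> form" (infixr "\<^bold>\<longrightarrow>" 25) where
  "(P \<^bold>\<longrightarrow> Q) = (\<lambda>n. Imp (P n) (Q n))"

definition fnot :: "form \<Rightarrow> form" ("\<^bold>\<not> _" [40] 40) where
  "(\<^bold>\<not> P) = (P \<^bold>\<longrightarrow> (\<lambda>n. Bot))"

definition fconj :: "form \<Rightarrow> form \<Rightarrow> form" (infixr "\<^bold>\<and>" 35) where
  "(P \<^bold>\<and> Q) = (\<^bold>\<not> (P \<^bold>\<longrightarrow> \<^bold>\<not> Q))"

definition fdisj :: "form \<Rightarrow> form \<Rightarrow> form" (infixr "\<^bold>\<or>" 30) where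
  "(P \<^bold>\<or> Q) = (\<^bold>\<not> P \<^bold>\<longrightarrow> Q)"

definition fiff :: "form \<Rightarrow> form \<Rightarrow> form" (infixr "\<^bold>\<longleftrightarrow>" 25) where
  "(P \<^bold>\<longleftrightarrow> Q) = ((P \<^bold>\<longrightarrow> Q) \<^bold>\<and> (Q \<^bold>\<longrightarrow> P))"

definition fall :: "(var \<Rightarrow> form) \<Rightarrow> form" (binder "\<^bold>\<forall>" 10) where
  "(\<^bold>\<forall>x. P x) = (\<lambda>n. All (P n (Suc n)))"

definition fex :: "(var \<Rightarrow> form) \<Rightarrow> form" (binder "\<^bold>\<exists>" 10) where
  "(\<^bold>\<exists>x. P x) = (\<^bold>\<not> (\<^bold>\<forall>x. \<^bold>\<not> P x))"

definition fex1 :: "(var \<Rightarrow> form) \<Rightarrow> form" (binder "\<^bold>\<exists>!" 10) where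
  "(\<^bold>\<exists>!x. P x) = (\<^bold>\<exists>x. P x \<^bold>\<and> (\<^bold>\<forall>y. P y \<^bold>\<longrightarrow> y \<^bold>= x))"

text \<open>
  For a formula \<open>p\<close> used in an axiom schema, \<open>app p vs\<close> puts the variables \<open>vs\<close> for the first
  \<open>length vs\<close> indices of \<open>p\<close>; the further indices are the parameters and become the outermost
  levels 0, 1, ..., which are bound by the universal closure below.
\<close>

definition app :: "fm \<Rightarrow> var list \<Rightarrow> form" where
  "app p vs = (\<lambda>n. ren (\<lambda>i. n - Suc (if i < length vs then vs ! i else i - length vs)) p)"

definition univ_closure :: "nat \<Rightarrow> form \<Rightarrow> fm" where
  "univ_closure k F = (All ^^ k) (F k)"

definition subset :: "var \<Rightarrow> var \<Rightarrow> form" where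
  "subset x y = (\<^bold>\<forall>z. z \<^bold>\<in> x \<^bold>\<longrightarrow> z \<^bold>\<in> y)"

definition is_empty :: "var \<Rightarrow> form" where
  "is_empty x = (\<^bold>\<forall>z. \<^bold>\<not> z \<^bold>\<in> x)"

definition is_upair :: "var \<Rightarrow> var \<Rightarrow> var \<Rightarrow> form" where
  "is_upair p x y = (\<^bold>\<forall>z. z \<^bold>\<in> p \<^bold>\<longleftrightarrow> z \<^bold>= x \<^bold>\<or> z \<^bold>= y)"

definition is_succ :: "var \<Rightarrow> var \<Rightarrow> form" where
  "is_succ s x = (\<^bold>\<forall>z. z \<^bold>\<in> s \<^bold>\<longleftrightarrow> z \<^bold>\<in> x \<^bold>\<or> z \<^bold>= x)"

definition is_Pow :: "var \<Rightarrow> var \<Rightarrow> form" where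
  "is_Pow p x = (\<^bold>\<forall>z. z \<^bold>\<in> p \<^bold>\<longleftrightarrow> subset z x)"

definition Extensionality :: form where
  "Extensionality = (\<^bold>\<forall>x. \<^bold>\<forall>y. (\<^bold>\<forall>z. z \<^bold>\<in> x \<^bold>\<longleftrightarrow> z \<^bold>\<in> y) \<^bold>\<longrightarrow> x \<^bold>= y)"

definition Foundation :: form where
  "Foundation = (\<^bold>\<forall>x. \<^bold>\<not> is_empty x \<^bold>\<longrightarrow> (\<^bold>\<exists>y. y \<^bold>\<in> x \<^bold>\<and> \<^bold>\<not> (\<^bold>\<exists>z. z \<^bold>\<in> x \<^bold>\<and> z \<^bold>\<in> y)))"

definition Pairing :: form where
  "Pairing = (\<^bold>\<forall>x. \<^bold>\<forall>y. \<^bold>\<exists>p. is_upair p x y)"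

definition Union_ax :: form where
  "Union_ax = (\<^bold>\<forall>x. \<^bold>\<exists>u. \<^bold>\<forall>z. z \<^bold>\<in> u \<^bold>\<longleftrightarrow> (\<^bold>\<exists>y. y \<^bold>\<in> x \<^bold>\<and> z \<^bold>\<in> y))"

definition Power_set :: form where
  "Power_set = (\<^bold>\<forall>x. \<^bold>\<exists>p. is_Pow p x)"

definition Infinity :: form where
  "Infinity = (\<^bold>\<exists>x. (\<^bold>\<exists>e. is_empty e \<^bold>\<and> e \<^bold>\<in> x) \<^bold>\<and> (\<^bold>\<forall>y. y \<^bold>\<in> x \<^bold>\<longrightarrow> (\<^bold>\<exists>s. is_succ s y \<^bold>\<and> s \<^bold>\<in> x)))"

definition Choice :: form where
  "Choice = (\<^bold>\<forall>x. (\<^bold>\<forall>y. y \<^bold>\<in> x \<^bold>\<longrightarrow> \<^bold>\<not> is_empty y)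
      \<^bold>\<and> (\<^bold>\<forall>y. \<^bold>\<forall>z. y \<^bold>\<in> x \<^bold>\<and> z \<^bold>\<in> x \<^bold>\<and> \<^bold>\<not> y \<^bold>= z \<^bold>\<longrightarrow> \<^bold>\<not> (\<^bold>\<exists>u. u \<^bold>\<in> y \<^bold>\<and> u \<^bold>\<in> z))
    \<^bold>\<longrightarrow> (\<^bold>\<exists>c. \<^bold>\<forall>y. y \<^bold>\<in> x \<^bold>\<longrightarrow> (\<^bold>\<exists>!u. u \<^bold>\<in> y \<^bold>\<and> u \<^bold>\<in> c)))"

definition Separation :: "fm \<Rightarrow> form" where
  "Separation p = (\<^bold>\<forall>a. \<^bold>\<exists>b. \<^bold>\<forall>x. x \<^bold>\<in> b \<^bold>\<longleftrightarrow> x \<^bold>\<in> a \<^bold>\<and> app p [x])"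

definition Replacement :: "fm \<Rightarrow> form" where
  "Replacement p =
    (\<^bold>\<forall>a. (\<^bold>\<forall>x. x \<^bold>\<in> a \<^bold>\<longrightarrow> (\<^bold>\<forall>y. \<^bold>\<forall>z. app p [x, y] \<^bold>\<and> app p [x, z] \<^bold>\<longrightarrow> y \<^bold>= z))
      \<^bold>\<longrightarrow> (\<^bold>\<exists>b. \<^bold>\<forall>y. y \<^bold>\<in> b \<^bold>\<longleftrightarrow> (\<^bold>\<exists>x. x \<^bold>\<in> a \<^bold>\<and> app p [x, y])))"

definition ZFC :: "fm set" where
  "ZFC =
    {Extensionality 0, Foundation 0, Pairing 0, Union_ax 0, Power_set 0, Infinity 0, Choice 0}
    \<union> {univ_closure k (Separation p) |p k. closed_below (k + 1) p}
    \<union> {univ_closure k (Replacement p) |p k. closed_below (k + 2) p}"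

definition is_opair :: "var \<Rightarrow> var \<Rightarrow> var \<Rightarrow> form" where
  "is_opair p x y = (\<^bold>\<exists>a. \<^bold>\<exists>b. is_upair a x x \<^bold>\<and> is_upair b x y \<^bold>\<and> is_upair p a b)"

definition maps :: "var \<Rightarrow> var \<Rightarrow> var \<Rightarrow> form" where
  "maps f x y = (\<^bold>\<exists>p. is_opair p x y \<^bold>\<and> p \<^bold>\<in> f)"

definition is_function :: "var \<Rightarrow> var \<Rightarrow> var \<Rightarrow> form" where
  "is_function f a b = ((\<^bold>\<forall>p. p \<^bold>\<in> f \<^bold>\<longrightarrow> (\<^bold>\<exists>x. \<^bold>\<exists>y. x \<^bold>\<in> a \<^bold>\<and> y \<^bold>\<in> b \<^bold>\<and> is_opair p x y))
    \<^bold>\<and> (\<^bold>\<forall>x. x \<^bold>\<in> a \<^bold>\<longrightarrow> (\<^bold>\<exists>!y. maps f x y)))"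

definition is_injection :: "var \<Rightarrow> var \<Rightarrow> var \<Rightarrow> form" where
  "is_injection f a b = (is_function f a b
    \<^bold>\<and> (\<^bold>\<forall>x. \<^bold>\<forall>x'. \<^bold>\<forall>y. maps f x y \<^bold>\<and> maps f x' y \<^bold>\<longrightarrow> x \<^bold>= x'))"

definition is_bijection :: "var \<Rightarrow> var \<Rightarrow> var \<Rightarrow> form" where
  "is_bijection f a b = (is_injection f a b \<^bold>\<and> (\<^bold>\<forall>y. y \<^bold>\<in> b \<^bold>\<longrightarrow> (\<^bold>\<exists>x. maps f x y)))"

definition equipotent :: "var \<Rightarrow> var \<Rightarrow> form" where
  "equipotent a b = (\<^bold>\<exists>f. is_bijection f a b)"

definition is_image :: "var \<Rightarrow> var \<Rightarrow> var \<Rightarrow> form" where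
  "is_image y g c = (\<^bold>\<forall>z. z \<^bold>\<in> y \<^bold>\<longleftrightarrow> (\<^bold>\<exists>x. x \<^bold>\<in> c \<^bold>\<and> maps g x z))"

definition transitive :: "var \<Rightarrow> form" where
  "transitive x = (\<^bold>\<forall>y. y \<^bold>\<in> x \<^bold>\<longrightarrow> subset y x)"

definition well_ordered_by_mem :: "var \<Rightarrow> form" where
  "well_ordered_by_mem x =
    ((\<^bold>\<forall>y. y \<^bold>\<in> x \<^bold>\<longrightarrow> \<^bold>\<not> y \<^bold>\<in> y)
    \<^bold>\<and> (\<^bold>\<forall>y. \<^bold>\<forall>z. \<^bold>\<forall>u. y \<^bold>\<in> x \<^bold>\<and> z \<^bold>\<in> x \<^bold>\<and> u \<^bold>\<in> x \<^bold>\<and> y \<^bold>\<in> z \<^bold>\<and> z \<^bold>\<in> u \<^bold>\<longrightarrow> y \<^bold>\<in> u)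
    \<^bold>\<and> (\<^bold>\<forall>y. \<^bold>\<forall>z. y \<^bold>\<in> x \<^bold>\<and> z \<^bold>\<in> x \<^bold>\<longrightarrow> y \<^bold>\<in> z \<^bold>\<or> y \<^bold>= z \<^bold>\<or> z \<^bold>\<in> y)
    \<^bold>\<and> (\<^bold>\<forall>s. subset s x \<^bold>\<and> \<^bold>\<not> is_empty s
        \<^bold>\<longrightarrow> (\<^bold>\<exists>m. m \<^bold>\<in> s \<^bold>\<and> (\<^bold>\<forall>y. y \<^bold>\<in> s \<^bold>\<longrightarrow> m \<^bold>= y \<^bold>\<or> m \<^bold>\<in> y))))"

definition ordinal :: "var \<Rightarrow> form" where
  "ordinal x = (transitive x \<^bold>\<and> well_ordered_by_mem x)"

definition limit_ordinal :: "var \<Rightarrow> form" where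
  "limit_ordinal x = (ordinal x \<^bold>\<and> \<^bold>\<not> is_empty x
    \<^bold>\<and> (\<^bold>\<forall>y. y \<^bold>\<in> x \<^bold>\<longrightarrow> (\<^bold>\<exists>z. z \<^bold>\<in> x \<^bold>\<and> y \<^bold>\<in> z)))"

definition is_omega :: "var \<Rightarrow> form" where
  "is_omega w = (limit_ordinal w \<^bold>\<and> (\<^bold>\<forall>y. y \<^bold>\<in> w \<^bold>\<longrightarrow> \<^bold>\<not> limit_ordinal y))"

definition cardinal :: "var \<Rightarrow> form" where
  "cardinal k = (ordinal k \<^bold>\<and> (\<^bold>\<forall>a. a \<^bold>\<in> k \<^bold>\<longrightarrow> \<^bold>\<not> equipotent a k))"

definition infinite_cardinal :: "var \<Rightarrow> form" where
  "infinite_cardinal k = (cardinal k \<^bold>\<and> (\<^bold>\<exists>w. is_omega w \<^bold>\<and> subset w k))"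

definition is_succ_cardinal :: "var \<Rightarrow> var \<Rightarrow> form" where
  "is_succ_cardinal l k = (cardinal l \<^bold>\<and> k \<^bold>\<in> l
    \<^bold>\<and> (\<^bold>\<forall>m. cardinal m \<^bold>\<and> k \<^bold>\<in> m \<^bold>\<longrightarrow> subset l m))"

definition GCH :: form where
  "GCH = (\<^bold>\<forall>k. \<^bold>\<forall>l. \<^bold>\<forall>p. infinite_cardinal k \<^bold>\<and> is_succ_cardinal l k \<^bold>\<and> is_Pow p k
    \<^bold>\<longrightarrow> equipotent p l)"

definition has_order_type :: "var \<Rightarrow> var \<Rightarrow> form" where
  "has_order_type a ot = (\<^bold>\<exists>f. is_bijection f ot a
    \<^bold>\<and> (\<^bold>\<forall>x. \<^bold>\<forall>y. \<^bold>\<forall>x'. \<^bold>\<forall>y'. maps f x x' \<^bold>\<and> maps f y y' \<^bold>\<longrightarrow> (x \<^bold>\<in> y \<^bold>\<longleftrightarrow> x' \<^bold>\<in> y')))"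

definition uncountable :: "var \<Rightarrow> form" where
  "uncountable x = (\<^bold>\<forall>w. is_omega w \<^bold>\<longrightarrow> \<^bold>\<not> (\<^bold>\<exists>f. is_injection f x w))"

definition is_pairs :: "var \<Rightarrow> var \<Rightarrow> form" where
  "is_pairs d x = (\<^bold>\<forall>p. p \<^bold>\<in> d \<^bold>\<longleftrightarrow>
    (\<^bold>\<exists>u. \<^bold>\<exists>v. u \<^bold>\<in> x \<^bold>\<and> v \<^bold>\<in> x \<^bold>\<and> \<^bold>\<not> u \<^bold>= v \<^bold>\<and> is_upair p u v))"

definition is_cross :: "var \<Rightarrow> var \<Rightarrow> var \<Rightarrow> form" where
  "is_cross c a b = (\<^bold>\<forall>p. p \<^bold>\<in> c \<^bold>\<longleftrightarrow>
    (\<^bold>\<exists>u. \<^bold>\<exists>v. u \<^bold>\<in> a \<^bold>\<and> v \<^bold>\<in> b \<^bold>\<and> \<^bold>\<not> u \<^bold>= v \<^bold>\<and> is_upair p u v))"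

text \<open>
  In the following two definitions \<open>w\<close>, \<open>o1\<close>, \<open>o2\<close> stand for the first three infinite cardinals
  and \<open>g\<close> for a function from the two-element subsets of \<open>o2\<close> to \<open>o1\<close>.
\<close>

definition establishes :: "var \<Rightarrow> var \<Rightarrow> var \<Rightarrow> var \<Rightarrow> form" where
  "establishes g w o1 o2 = (\<^bold>\<forall>a. \<^bold>\<forall>b.
    subset a o2 \<^bold>\<and> has_order_type a o1 \<^bold>\<and> subset b o2 \<^bold>\<and> has_order_type b w
      \<^bold>\<and> (\<^bold>\<forall>x. \<^bold>\<forall>y. x \<^bold>\<in> a \<^bold>\<and> y \<^bold>\<in> b \<^bold>\<longrightarrow> x \<^bold>\<in> y)
    \<^bold>\<longrightarrow> (\<^bold>\<exists>c. is_cross c a b \<^bold>\<and> is_image o1 g c))"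

definition rainbow :: "var \<Rightarrow> var \<Rightarrow> var \<Rightarrow> form" where
  "rainbow r g o2 = (subset r o2
    \<^bold>\<and> (\<^bold>\<exists>d. is_pairs d r
        \<^bold>\<and> (\<^bold>\<forall>p. \<^bold>\<forall>q. \<^bold>\<forall>z. p \<^bold>\<in> d \<^bold>\<and> q \<^bold>\<in> d \<^bold>\<and> maps g p z \<^bold>\<and> maps g q z \<^bold>\<longrightarrow> p \<^bold>= q)))"

definition ex_colouring_without_rainbow :: form where
  "ex_colouring_without_rainbow =
    (\<^bold>\<exists>w. \<^bold>\<exists>o1. \<^bold>\<exists>o2. \<^bold>\<exists>d. \<^bold>\<exists>g.
      is_omega w \<^bold>\<and> is_succ_cardinal o1 w \<^bold>\<and> is_succ_cardinal o2 o1
      \<^bold>\<and> is_pairs d o2 \<^bold>\<and> is_function g d o1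
      \<^bold>\<and> establishes g w o1 o2
      \<^bold>\<and> \<^bold>\<not> (\<^bold>\<exists>r. rainbow r g o2 \<^bold>\<and> uncountable r))"

end

theory Submission
  imports Defs "HOL-Library.Countable_Set"
begin

text \<open>
  A consistent ZFC has a countable model, perhaps ill-founded; a class of a model is a relation that
  is definable with parameters. Its constructible universe satisfies CH and is the ground model.
  Let \<open>o1\<close>, \<open>o2\<close> be its first uncountable cardinals. A forcing condition consists of a colouring of
  the pairs of a countable set \<open>a\<close> of ordinals below \<open>o2\<close> and of countably many promises: a promise for
  \<open>b\<close> and \<open>\<nu>\<close> says that every new point below \<open>b\<close> has the colour \<open>\<nu>\<close> with some element of \<open>b\<close>.
  Moreover, on each nonempty \<open>d\<close> in \<open>a\<close> without maximum, a new point above \<open>d\<close> repeats a colour or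
  copies an old point \<open>\<eta>\<close> above \<open>d\<close>. Promises yield property (1). For (2) let \<open>d\<close> be the first \<open>\<omega>\<close>
  elements of an uncountable set: of its further points, uncountably many are new over one condition,
  and if none of them repeats a colour on \<open>d\<close> then two of them copy the same old point, hence have
  equal colours with each element of \<open>d\<close>.

  The forcing is \<open>\<sigma>\<close>-closed, and CH makes any \<open>o2\<close> conditions contain two compatible ones, so \<open>o1\<close> and
  \<open>o2\<close> are preserved. GCH and choice are not proved in the extension but in its submodel \<open>L[A]\<close>,
  where \<open>A\<close> codes the colouring, surjections that keep \<open>o1\<close> and \<open>o2\<close>, and the subsets of \<open>\<omega>\<close>;
  condensation gives GCH from \<open>o1\<close> upwards because \<open>A\<close> is essentially a subset of \<open>o2\<close>.
\<close>

text \<open>The two properties pull apart: promises spread colours, while (2) needs coincidences.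
  They are compatible because a promise concerns the colours of a new point with points above it,
  repetition and copying its colours with points below it; a single new point may keep all promises
  and have one constant colour downwards. Copying is allowed besides repetition for the sake of
  amalgamation: there a point of one condition copies a point of the other that has the same colours
  over the common part. As the model may be ill-founded, nothing outside can recurse along its
  membership: recursion takes place inside, induction is limited to definable classes, and the
  extension is a quotient of the names. Passing to \<open>L[A]\<close> trades names for well-orders
  against one definable well-order of the universe. Condensation at a cardinal \<open>k\<close>
  requires all ordinals below the bound of the ordinals in \<open>A\<close> to have size at most
  \<open>k\<close>. The bound is \<open>o2\<close>, so this fails for \<open>k\<close> = \<omega>;
  for that reason \<open>A\<close> also lists the old subsets of \<omega>, which are all of them,
  since a \<sigma>-closed forcing adds none.\<close>

notation (input) iff (infixr "<->" 25)

section \<open>Semantics and completeness of first-order logic\<close>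

text \<open>The carrier is a parameter because satisfaction is later relativized to the
  constructible class and to single levels of it, not only to whole models.\<close>

primrec sat_on :: "'a set => ('a => 'a => bool) => (nat => 'a) => fm => bool" where
  "sat_on U E e Bot <-> False"
| "sat_on U E e (Mem i j) <-> E (e i) (e j)"
| "sat_on U E e (Eq i j) <-> e i = e j"
| "sat_on U E e (Imp p q) <-> (sat_on U E e p --> sat_on U E e q)"
| "sat_on U E e (All p) <-> (\<forall>x\<in>U. sat_on U E (case_nat x e) p)"

abbreviation sat :: "('a => 'a => bool) => (nat => 'a) => fm => bool" where
  "sat \<equiv> sat_on UNIV"

lemma case_nat_lift: "case_nat x e \<circ> lift f = case_nat x (e \<circ> f)"
  by (auto simp: fun_eq_iff lift_def split: nat.split)

lemma comp_case_nat: "f \<circ> case_nat x e = case_nat (f x) (f \<circ> e)"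
  by (auto simp: fun_eq_iff split: nat.split)

lemma sat_on_ren: "sat_on U E e (ren f p) = sat_on U E (e \<circ> f) p"
  by (induction p arbitrary: e f) (simp_all add: case_nat_lift)

lemma sat_on_inst: "sat_on U E e (inst t p) = sat_on U E (case_nat (e t) e) p"
proof -
  have "e \<circ> case_nat t (%i. i) = case_nat (e t) e"
    by (auto simp: fun_eq_iff split: nat.split)
  then show ?thesis by (simp add: inst_def sat_on_ren)
qed

lemma sound: "\<Gamma> \<turnstile> p ==> \<forall>q\<in>\<Gamma>. sat E e q ==> sat E e p"
proof (induction arbitrary: e rule: derives.induct)
  case (RAA p \<Gamma>)
  then show ?case by force
next
  case (AllI \<Gamma> p)
  have "sat E (case_nat x e) p" for x
    using AllI.prems by (intro AllI.IH) (auto simp: sat_on_ren comp_def)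
  then show ?case by simp
next
  case (EqSubst \<Gamma> i j p)
  have "e i = e j" using EqSubst.IH(1)[OF EqSubst.prems] by simp
  then show ?case using EqSubst.IH(2)[OF EqSubst.prems] by (simp add: sat_on_inst)
qed (auto simp: sat_on_inst)

lemma consistent_if_model: "(!!p. p \<in> T ==> sat E e p) ==> consistent T"
  unfolding consistent_def using sound[of T Bot E e] by auto

text \<open>Moves a model with a carrier onto a full type, so that the set theory below can quantify
  over all of \<open>'a\<close>.\<close>

lemma sat_on_reindex:
  assumes "bij_betw j UNIV U"
  shows "sat_on U E (j \<circ> e) p = sat (%x y. E (j x) (j y)) e p"
proof (induction p arbitrary: e)
  case (Eq i k)
  then show ?case using assms by (auto simp: bij_betw_def inj_eq)
next
  case (All p)
  have "(\<forall>x\<in>U. P x) = (ALL x. P (j x))" for P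
    using assms unfolding bij_betw_def by blast
  then show ?case by (simp add: All[symmetric] comp_case_nat del: comp_apply)
qed auto

lemma ren_ren: "ren f (ren g p) = ren (f \<circ> g) p"
proof (induction p arbitrary: f g)
  case (All p)
  have "lift f \<circ> lift g = lift (f \<circ> g)"
    by (auto simp: fun_eq_iff lift_def split: nat.split)
  then show ?case using All by (simp del: comp_apply)
qed auto

lemma ren_id [simp]: "ren (%i. i) p = p"
proof (induction p)
  case (All p)
  have "lift (%i. i) = (%i. i)"
    by (auto simp: fun_eq_iff lift_def split: nat.split)
  then show ?case using All by simp
qed auto

primrec fv :: "fm => nat set" where
  "fv Bot = {}"
| "fv (Mem i j) = {i, j}"
| "fv (Eq i j) = {i, j}"
| "fv (Imp p q) = fv p \<union> fv q"
| "fv (All p) = {i. Suc i \<in> fv p}"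

lemma finite_fv: "finite (fv p)"
proof (induction p)
  case (All p)
  have "fv (All p) = Suc -` fv p" by auto
  then show ?case using All by (simp add: finite_vimageI)
qed auto

lemma ren_cong: "(!!i. i \<in> fv p ==> f i = g i) ==> ren f p = ren g p"
proof (induction p arbitrary: f g)
  case (All p)
  have "ren (lift f) p = ren (lift g) p"
    by (rule All.IH) (use All.prems in \<open>auto simp: lift_def split: nat.split\<close>)
  then show ?case by simp
next
  case (Imp p q)
  have "ren f p = ren g p" "ren f q = ren g q"
    by (rule Imp.IH; simp add: Imp.prems)+
  then show ?case by simp
qed simp_all

lemma fv_ren: "fv (ren f p) = f ` fv p"
proof (induction p arbitrary: f)
  case (All p)
  have "Suc i \<in> lift f ` A <-> i \<in> f ` {k. Suc k \<in> A}" for i A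
  proof
    assume "Suc i \<in> lift f ` A"
    then obtain a where "a \<in> A" "lift f a = Suc i" by auto
    then show "i \<in> f ` {k. Suc k \<in> A}" by (cases a) (auto simp: lift_def)
  next
    assume "i \<in> f ` {k. Suc k \<in> A}"
    then obtain k where "Suc k \<in> A" "i = f k" by auto
    then show "Suc i \<in> lift f ` A" by (intro image_eqI[of _ _ "Suc k"]) (simp_all add: lift_def)
  qed
  then show ?case using All by auto
qed auto

lemma sat_on_cong: "(!!i. i \<in> fv p ==> e i = e' i) ==> sat_on U E e p = sat_on U E e' p"
proof (induction p arbitrary: e e')
  case (All p)
  have "sat_on U E (case_nat x e) p = sat_on U E (case_nat x e') p" for x
    by (rule All.IH) (use All.prems in \<open>auto split: nat.split\<close>)
  then show ?case by simp
next
  case (Imp p q)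
  have "sat_on U E e p = sat_on U E e' p" "sat_on U E e q = sat_on U E e' q"
    by (rule Imp.IH; simp add: Imp.prems)+
  then show ?case by simp
qed simp_all

lemma derives_ren: "\<Gamma> \<turnstile> p ==> ren f ` \<Gamma> \<turnstile> ren f p"
proof (induction arbitrary: f rule: derives.induct)
  case (ImpI p \<Gamma> q)
  then show ?case using derives.ImpI by auto
next
  case (RAA p \<Gamma>)
  then show ?case using derives.RAA[of "ren f p" "ren f ` \<Gamma>"] by auto
next
  case (AllI \<Gamma> p)
  have "ren (lift f) ` ren Suc ` \<Gamma> = ren Suc ` ren f ` \<Gamma>"
    by (auto simp: image_image ren_ren comp_def lift_def)
  then show ?case using AllI.IH[of "lift f"] derives.AllI by auto
next
  case (AllE \<Gamma> p t)
  have "ren f (inst t p) = inst (f t) (ren (lift f) p)"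
    by (auto simp: inst_def ren_ren lift_def comp_def fun_eq_iff split: nat.split intro!: arg_cong2[of _ _ _ _ ren])
  then show ?case using AllE.IH[of f] derives.AllE[of "ren f ` \<Gamma>" "ren (lift f) p" "f t"] by simp
next
  case (EqSubst \<Gamma> i j p)
  have "ren f (inst t p) = inst (f t) (ren (lift f) p)" for t
    by (auto simp: inst_def ren_ren lift_def comp_def fun_eq_iff split: nat.split intro!: arg_cong2[of _ _ _ _ ren])
  then show ?case using EqSubst.IH(1)[of f] EqSubst.IH(2)[of f] derives.EqSubst[of "ren f ` \<Gamma>" "f i" "f j" "ren (lift f) p"] by simp
next
  case (ImpE \<Gamma> p q)
  then show ?case using derives.ImpE by fastforce
qed (auto intro: derives.Assm derives.EqRefl)

lemma derives_mono: "\<Gamma> \<turnstile> p ==> \<Gamma> \<subseteq> \<Delta> ==> \<Delta> \<turnstile> p"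
proof (induction arbitrary: \<Delta> rule: derives.induct)
  case (ImpI p \<Gamma> q)
  then show ?case by (meson derives.ImpI insert_mono)
next
  case (RAA p \<Gamma>)
  then show ?case by (meson derives.RAA insert_mono)
next
  case (AllI \<Gamma> p)
  then show ?case by (meson derives.AllI image_mono)
next
  case (EqSubst \<Gamma> i j p)
  then show ?case using derives.EqSubst[of \<Delta> i j p] by simp
next
  case (ImpE \<Gamma> p q)
  then show ?case using derives.ImpE[of \<Delta> p q] by simp
qed (auto intro: derives.intros)

lemma derives_finite: "\<Gamma> \<turnstile> p ==> EX \<Delta>. finite \<Delta> & \<Delta> \<subseteq> \<Gamma> & \<Delta> \<turnstile> p"
proof (induction rule: derives.induct)
  case (Assm p \<Gamma>)
  then show ?case by (intro exI[of _ "{p}"]) (auto intro: derives.Assm)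
next
  case (ImpI p \<Gamma> q)
  then obtain \<Delta> where "finite \<Delta>" "\<Delta> \<subseteq> insert p \<Gamma>" "\<Delta> \<turnstile> q" by blast
  moreover have "\<Delta> - {p} \<turnstile> Imp p q"
    by (rule derives.ImpI, rule derives_mono[OF \<open>\<Delta> \<turnstile> q\<close>]) auto
  ultimately show ?case by (intro exI[of _ "\<Delta> - {p}"]) auto
next
  case (ImpE \<Gamma> p q)
  then obtain \<Delta> \<Delta>' where "finite \<Delta>" "\<Delta> \<subseteq> \<Gamma>" "\<Delta> \<turnstile> Imp p q" "finite \<Delta>'" "\<Delta>' \<subseteq> \<Gamma>" "\<Delta>' \<turnstile> p" by blast
  moreover from this have "\<Delta> \<union> \<Delta>' \<turnstile> q"
    by (intro derives.ImpE[of _ p q]) (auto elim: derives_mono)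
  ultimately show ?case by (intro exI[of _ "\<Delta> \<union> \<Delta>'"]) auto
next
  case (RAA p \<Gamma>)
  then obtain \<Delta> where "finite \<Delta>" "\<Delta> \<subseteq> insert (Imp p Bot) \<Gamma>" "\<Delta> \<turnstile> Bot" by blast
  moreover have "\<Delta> - {Imp p Bot} \<turnstile> p"
    by (rule derives.RAA, rule derives_mono[OF \<open>\<Delta> \<turnstile> Bot\<close>]) auto
  ultimately show ?case by (intro exI[of _ "\<Delta> - {Imp p Bot}"]) auto
next
  case (AllI \<Gamma> p)
  then obtain \<Delta> where "finite \<Delta>" "\<Delta> \<subseteq> ren Suc ` \<Gamma>" "\<Delta> \<turnstile> p" by blast
  then obtain \<Delta>' where "finite \<Delta>'" "\<Delta>' \<subseteq> \<Gamma>" "\<Delta> = ren Suc ` \<Delta>'"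
    using finite_subset_image by metis
  then show ?case using \<open>\<Delta> \<turnstile> p\<close> derives.AllI by blast
next
  case (AllE \<Gamma> p t)
  then show ?case using derives.AllE by blast
next
  case (EqRefl \<Gamma> i)
  then show ?case using derives.EqRefl by blast
next
  case (EqSubst \<Gamma> i j p)
  then obtain \<Delta> \<Delta>' where "finite \<Delta>" "\<Delta> \<subseteq> \<Gamma>" "\<Delta> \<turnstile> Eq i j" "finite \<Delta>'" "\<Delta>' \<subseteq> \<Gamma>" "\<Delta>' \<turnstile> inst i p" by blast
  moreover from this have "\<Delta> \<union> \<Delta>' \<turnstile> inst j p"
    by (intro derives.EqSubst[of _ i j p]) (auto elim: derives_mono)
  ultimately show ?case by (intro exI[of _ "\<Delta> \<union> \<Delta>'"]) auto
qed

lemma ren_Suc_if_notin_fv: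
  assumes "v \<notin> fv q"
  shows "ren (%i. if i = v then 0 else Suc i) q = ren Suc q"
  using assms by (intro ren_cong) auto

text \<open>Renaming a fresh \<open>v\<close> to 0 and every other variable to its successor shifts
  the context and turns \<open>inst v p\<close> back into \<open>p\<close>, the form that the rule
  \<open>AllI\<close> expects.\<close>

lemma generalize:
  assumes "\<Gamma> \<turnstile> inst v p" "!!q. q \<in> \<Gamma> ==> v \<notin> fv q" "v \<notin> fv (All p)"
  shows "\<Gamma> \<turnstile> All p"
proof -
  let ?f = "%i. if i = v then 0 else Suc i"
  have "ren ?f ` \<Gamma> = ren Suc ` \<Gamma>"
    using assms(2) ren_Suc_if_notin_fv by (intro image_cong) auto
  moreover have "ren ?f (inst v p) = ren (%i. i) p"
    unfolding inst_def ren_ren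
    by (rule ren_cong) (use assms(3) in \<open>auto split: nat.split\<close>)
  ultimately show ?thesis using derives_ren[OF assms(1), of ?f] by (auto intro: derives.AllI)
qed

instance fm :: countable by countable_datatype

text \<open>Variables serve as Henkin constants. One step decides \<open>p\<close> and, if
  \<open>p\<close> negates a universal formula, at once adds a named counterexample; running through
  all formulas then yields maximality and witnesses together.\<close>

definition henkin_step :: "fm set => fm => fm set" where
  "henkin_step \<Gamma> p = (if consistent (insert p \<Gamma>) then
     insert p \<Gamma> \<union> {Imp (inst v q) Bot |v q. p = Imp (All q) Bot & v = (SOME v. v \<notin> \<Union>(fv ` insert p \<Gamma>))}
     else \<Gamma>)"

lemma henkin_step_consistent:
  assumes c: "consistent \<Gamma>" and f: "infinite (- \<Union>(fv ` \<Gamma>))"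
  shows "consistent (henkin_step \<Gamma> p)" "infinite (- \<Union>(fv ` henkin_step \<Gamma> p))" "\<Gamma> \<subseteq> henkin_step \<Gamma> p"
proof -
  have f': "infinite (- \<Union>(fv ` insert q \<Delta>))" if "infinite (- \<Union>(fv ` \<Delta>))" for q \<Delta>
  proof -
    have "- \<Union>(fv ` insert q \<Delta>) = - \<Union>(fv ` \<Delta>) - fv q" by auto
    then show ?thesis using that finite_fv by (metis Diff_infinite_finite)
  qed
  have "consistent (henkin_step \<Gamma> p) & infinite (- \<Union>(fv ` henkin_step \<Gamma> p))"
  proof (cases "consistent (insert p \<Gamma>) & (EX q. p = Imp (All q) Bot)")
    case True
    then obtain q where p: "p = Imp (All q) Bot" and cp: "consistent (insert p \<Gamma>)" by blast
    define v where "v = (SOME v. v \<notin> \<Union>(fv ` insert p \<Gamma>))"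
    have "EX v. v \<notin> \<Union>(fv ` insert p \<Gamma>)"
      using f'[OF f, of p] by (metis ComplD finite.emptyI ex_in_conv)
    then have v: "v \<notin> \<Union>(fv ` insert p \<Gamma>)" unfolding v_def by (rule someI_ex)
    have eq: "henkin_step \<Gamma> p = insert (Imp (inst v q) Bot) (insert p \<Gamma>)"
      using cp by (auto simp: henkin_step_def p v_def)
    have "consistent (henkin_step \<Gamma> p)"
      unfolding consistent_def eq
    proof
      assume "insert (Imp (inst v q) Bot) (insert p \<Gamma>) \<turnstile> Bot"
      then have "insert p \<Gamma> \<turnstile> inst v q" by (rule derives.RAA)
      then have "insert p \<Gamma> \<turnstile> All q" by (rule generalize) (use v p in auto)
      moreover have "insert p \<Gamma> \<turnstile> Imp (All q) Bot" by (rule derives.Assm) (simp add: p)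
      ultimately show False using cp derives.ImpE unfolding consistent_def by blast
    qed
    then show ?thesis using f'[OF f'[OF f]] by (simp add: eq)
  next
    case False
    then have "henkin_step \<Gamma> p = (if consistent (insert p \<Gamma>) then insert p \<Gamma> else \<Gamma>)"
      by (auto simp: henkin_step_def)
    then show ?thesis using c f f'[OF f] by auto
  qed
  then show "consistent (henkin_step \<Gamma> p)" "infinite (- \<Union>(fv ` henkin_step \<Gamma> p))" by auto
  show "\<Gamma> \<subseteq> henkin_step \<Gamma> p" by (auto simp: henkin_step_def)
qed

primrec henkin_chain :: "fm set => nat => fm set" where
  "henkin_chain T 0 = T"
| "henkin_chain T (Suc n) = henkin_step (henkin_chain T n) (from_nat n)"

lemma henkin_extension:
  assumes "consistent T" "infinite (- \<Union>(fv ` T))"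
  obtains H where "T \<subseteq> H" "consistent H" "!!p. p \<in> H <-> H \<turnstile> p"
    "!!p. p \<notin> H ==> Imp p Bot \<in> H"
    "!!q. (!!t. inst t q \<in> H) ==> All q \<in> H"
proof -
  let ?C = "henkin_chain T"
  define H where "H = (\<Union>n. ?C n)"
  have C: "consistent (?C n) & infinite (- \<Union>(fv ` ?C n))" for n
    by (induction n) (use assms henkin_step_consistent in auto)
  have "mono ?C" by (rule mono_iff_le_Suc[THEN iffD2]) (use C henkin_step_consistent(3) in auto)
  have cons: "consistent H"
    unfolding consistent_def
  proof
    assume "H \<turnstile> Bot"
    then obtain \<Delta> where d: "finite \<Delta>" "\<Delta> \<subseteq> H" "\<Delta> \<turnstile> Bot" using derives_finite by blast
    have "EX n. \<Delta> \<subseteq> ?C n"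
      using d(1,2)
    proof (induction rule: finite_induct)
      case (insert x F)
      then obtain n m where "F \<subseteq> ?C n" "x \<in> ?C m" by (auto simp: H_def)
      then have "insert x F \<subseteq> ?C (max n m)"
        using monoD[OF \<open>mono ?C\<close>, of n "max n m"] monoD[OF \<open>mono ?C\<close>, of m "max n m"] by auto
      then show ?case by blast
    qed auto
    then show False using C d(3) derives_mono unfolding consistent_def by blast
  qed
  have step: "henkin_step (?C (to_nat p)) p \<subseteq> H" for p
    using henkin_chain.simps(2)[of T "to_nat p"] by (auto simp: H_def simp del: henkin_chain.simps)
  have max: "H \<turnstile> Imp p Bot" if "p \<notin> H" for p
  proof -
    have "~ consistent (insert p (?C (to_nat p)))"
      using that step[of p] by (auto simp: henkin_step_def split: if_splits)
    then have "?C (to_nat p) \<turnstile> Imp p Bot" by (auto simp: consistent_def intro: derives.ImpI)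
    then show ?thesis by (rule derives_mono) (auto simp: H_def)
  qed
  have iff: "p \<in> H <-> H \<turnstile> p" for p
    using max[of p] cons derives.ImpE derives.Assm unfolding consistent_def by blast
  have all: "All q \<in> H" if t: "!!t. inst t q \<in> H" for q
  proof (rule ccontr)
    let ?p = "Imp (All q) Bot"
    assume "All q \<notin> H"
    then have "?p \<in> H" using max iff by blast
    have "insert ?p (?C (to_nat ?p)) \<subseteq> H"
      using \<open>?p \<in> H\<close> by (auto simp: H_def)
    then have "consistent (insert ?p (?C (to_nat ?p)))"
      using cons derives_mono unfolding consistent_def by blast
    then obtain v where "Imp (inst v q) Bot \<in> H"
      using step[of ?p] by (auto simp: henkin_step_def)
    then show False using t[of v] cons iff derives.ImpE unfolding consistent_def by blast
  qed
  show thesis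
  proof (rule that[of H])
    show "T \<subseteq> H" unfolding H_def using UN_upper[of 0 UNIV ?C] by simp
  qed (use cons max iff all in auto)
qed

lemma model_existence_on:
  assumes T: "consistent T"
  obtains U :: "nat set" and E e where "range e \<subseteq> U" "!!p. p \<in> T ==> sat_on U E e p"
proof -
  \<comment> \<open>\<open>T\<close> may mention every variable, so its variables are doubled; the
    odd ones are then available as witnesses.\<close>
  let ?T = "ren (%i. 2 * i) ` T"
  have "consistent ?T"
    unfolding consistent_def
  proof
    assume "?T \<turnstile> Bot"
    then have "ren (%i. i div 2) ` ?T \<turnstile> Bot" using derives_ren by fastforce
    then show False using T by (simp add: image_image ren_ren comp_def consistent_def)
  qed
  moreover have "infinite (- \<Union>(fv ` ?T))"
  proof
    assume "finite (- \<Union>(fv ` ?T))"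
    moreover have "range (%i. 2 * i + 1) \<subseteq> - \<Union>(fv ` ?T)"
      by (auto simp: fv_ren) presburger
    moreover have "infinite (range (%i::nat. 2 * i + 1))"
      by (rule range_inj_infinite) (auto simp: inj_def)
    ultimately show False using finite_subset by blast
  qed
  ultimately obtain H where H: "?T \<subseteq> H" "consistent H" "!!p. p \<in> H <-> H \<turnstile> p"
    "!!p. p \<notin> H ==> Imp p Bot \<in> H" "!!q. (!!t. inst t q \<in> H) ==> All q \<in> H"
    using henkin_extension by metis
  have notboth: "p \<in> H ==> Imp p Bot \<notin> H" for p
    using H(2,3) derives.ImpE unfolding consistent_def by blast
  have imp: "Imp p q \<in> H <-> (p \<in> H --> q \<in> H)" for p q
  proof -
    have "H \<turnstile> Imp p q" if "q \<in> H" using that H(3) derives_mono derives.ImpI by (metis subset_insertI)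
    moreover have "H \<turnstile> Imp p q" if "p \<notin> H"
    proof (rule derives.ImpI, rule derives.RAA)
      have "Imp p Bot \<in> H" using that H(4) by blast
      then show "insert (Imp q Bot) (insert p H) \<turnstile> Bot"
        by (intro derives.ImpE[of _ p Bot] derives.Assm) auto
    qed
    ultimately show ?thesis using H(3) derives.ImpE by blast
  qed
  have all: "All q \<in> H <-> (ALL t. inst t q \<in> H)" for q
    using H(3,5) derives.AllE by blast
  have sub: "Eq i j \<in> H ==> ren (case_nat i f) q \<in> H ==> ren (case_nat j f) q \<in> H" for i j f q
  proof -
    have r: "ren (case_nat t f) q = inst t (ren (lift f) q)" for t
      by (simp add: inst_def ren_ren comp_def fun_eq_iff lift_def)
         (auto intro!: arg_cong2[of _ _ _ _ ren] simp: fun_eq_iff split: nat.split)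
    show "Eq i j \<in> H ==> ren (case_nat i f) q \<in> H ==> ren (case_nat j f) q \<in> H"
      unfolding r using H(3) derives.EqSubst by blast
  qed
  have refl: "Eq i i \<in> H" for i using H(3) derives.EqRefl by blast
  have sym: "Eq i j \<in> H ==> Eq j i \<in> H" for i j
    using sub[of i j "%_. i" "Eq 0 1"] refl by simp
  have trans: "Eq i j \<in> H ==> Eq j k \<in> H ==> Eq i k \<in> H" for i j k
    using sub[of j k "%_. i" "Eq 1 0"] by simp
  \<comment> \<open>The least member of each class of provably equal variables represents it, so
    that equality becomes true equality on \<open>range r\<close>.\<close>
  define r where "r i = (LEAST j. Eq i j \<in> H)" for i
  have r1: "Eq i (r i) \<in> H" for i unfolding r_def by (rule LeastI[of _ i]) (rule refl)
  have r2: "r i = r j <-> Eq i j \<in> H" for i j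
  proof
    show "r i = r j ==> Eq i j \<in> H" using r1[of i] r1[of j] sym trans by metis
    assume "Eq i j \<in> H"
    then have "Eq i k \<in> H <-> Eq j k \<in> H" for k using sym trans by metis
    then show "r i = r j" by (simp add: r_def)
  qed
  have mem: "Mem (r i) (r j) \<in> H <-> Mem i j \<in> H" for i j
  proof -
    have "Mem (r i) (r j) \<in> H <-> Mem i (r j) \<in> H"
      using sub[of i "r i" "%_. r j" "Mem 0 1"] sub[of "r i" i "%_. r j" "Mem 0 1"] r1[of i] sym by auto
    also have "\<dots> <-> Mem i j \<in> H"
      using sub[of j "r j" "%_. i" "Mem 1 0"] sub[of "r j" j "%_. i" "Mem 1 0"] r1[of j] sym by auto
    finally show ?thesis .
  qed
  have rr: "r (r i) = r i" for i using r2 r1 sym by blast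
  \<comment> \<open>Stated for all renamings \<open>f\<close> because the instances of a quantified
    body are again renamings of it.\<close>
  have truth: "ren f p \<in> H <-> sat_on (range r) (%i j. Mem i j \<in> H) (r \<circ> f) p" for f p
  proof (induction p arbitrary: f)
    case Bot
    have "Bot \<notin> H" using H(2,3) unfolding consistent_def by blast
    then show ?case by simp
  next
    case (All p)
    have "inst t (ren (lift f) p) = ren (case_nat t f) p" for t
      by (auto simp: inst_def ren_ren comp_def lift_def fun_eq_iff intro!: arg_cong2[of _ _ _ _ ren] split: nat.split)
    then have "ren f (All p) \<in> H <-> (ALL t. sat_on (range r) (%i j. Mem i j \<in> H) (case_nat (r t) (r \<circ> f)) p)"
      using All by (simp add: all comp_case_nat del: comp_apply)
    then show ?case by (simp del: comp_apply)
  qed (auto simp: imp mem r2)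
  show thesis
  proof (rule that[of "r \<circ> (%i. 2 * i)" "range r" "%i j. Mem i j \<in> H"])
    show "range (r \<circ> (%i. 2 * i)) \<subseteq> range r" by auto
    show "sat_on (range r) (%i j. Mem i j \<in> H) (r \<circ> (%i. 2 * i)) p" if "p \<in> T" for p
      using truth[of "%i. 2 * i" p] that H(1) by auto
  qed
qed

section \<open>Definable classes\<close>

definition mrg :: "(nat => 'a) => (nat => 'a) => nat => 'a" where
  "mrg c e n = (if even n then e (n div 2) else c (n div 2))"

text \<open>
  \<open>dfn E P\<close>: the relation \<open>P\<close>, read as a property of assignments, is first-order definable over \<open>E\<close>
  with parameters; in \<open>mrg c e\<close> the odd variables carry the parameters.
\<close>

definition dfn :: "('a => 'a => bool) => ((nat => 'a) => bool) => bool" where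
  "dfn E P <-> (EX p c. ALL e. P e = sat E (mrg c e) p)"

text \<open>A function counts as definable when its graph is: variable 0 holds the value and the
  arguments move up by one. The closure rules for \<open>dfn\<close> and \<open>dft\<close> replace
  a language of terms, and the simplifier proves definability by walking through a HOL
  expression.\<close>

definition dft :: "('a => 'a => bool) => ((nat => 'a) => 'a) => bool" where
  "dft E t <-> dfn E (%e. e 0 = t (%i. e (Suc i)))"

lemma dfn_sat: "dfn E (%e. sat E (%i. e (f i)) p)"
proof -
  have "sat E (%i. e (f i)) p = sat E (mrg e e) (ren (%i. 2 * f i) p)" for e :: "nat => 'a"
    by (simp add: sat_on_ren mrg_def comp_def)
  moreover have "sat E (mrg c e) (ren (%i. 2 * f i) p) = sat E (mrg e e) (ren (%i. 2 * f i) p)" for c e :: "nat => 'a"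
    by (simp add: sat_on_ren mrg_def comp_def)
  ultimately show ?thesis unfolding dfn_def by metis
qed

lemma dfn_ren:
  assumes "dfn E P"
  shows "dfn E (%e. P (%i. e (f i)))"
proof -
  obtain p c where "!!e. P e = sat E (mrg c e) p" using assms unfolding dfn_def by blast
  then obtain p c where p: "!!e. P e = sat E (mrg c e) p" by blast
  let ?g = "%n. if even n then 2 * f (n div 2) else n"
  have "mrg c e \<circ> ?g = mrg c (%i. e (f i))" for e :: "nat => 'a"
    by (auto simp: fun_eq_iff mrg_def elim!: oddE)
  then have "P (%i. e (f i)) = sat E (mrg c e) (ren ?g p)" for e
    unfolding p sat_on_ren by (rule arg_cong2[of _ _ _ _ "sat E", OF sym refl])
  then show ?thesis unfolding dfn_def by blast
qed

lemma dfn_imp [simp]: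
  assumes "dfn E P" "dfn E Q"
  shows "dfn E (%e. P e --> Q e)"
proof -
  obtain p c q d where pq: "!!e. P e = sat E (mrg c e) p" "!!e. Q e = sat E (mrg d e) q"
    using assms unfolding dfn_def by blast
  \<comment> \<open>\<open>mrg d c\<close> interleaves the two parameter sequences: its even places
    hold those of \<open>P\<close> (k = 0), its odd places those of \<open>Q\<close> (k =
    1).\<close>
  let ?f = "%k n. if even n then n else 2 * (2 * (n div 2) + k) + 1"
  have "mrg (mrg d c) e \<circ> ?f 0 = mrg c e" "mrg (mrg d c) e \<circ> ?f 1 = mrg d e" for e :: "nat => 'a"
    by (auto simp: fun_eq_iff mrg_def elim!: oddE)
  then have "(P e --> Q e) = sat E (mrg (mrg d c) e) (Imp (ren (?f 0) p) (ren (?f 1) q))" for e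
    by (simp add: sat_on_ren pq del: comp_apply)
  then show ?thesis unfolding dfn_def by blast
qed

lemma dfn_all [simp]:
  assumes "dfn E (%e. P (%i. e (Suc i)) (e 0))"
  shows "dfn E (%e. ALL x. P e x)"
proof -
  obtain p c where p: "!!e. P (%i. e (Suc i)) (e 0) = sat E (mrg c e) p" using assms unfolding dfn_def by blast
  let ?f = "%n. if n = 0 then 0 else if even n then n - 1 else Suc n"
  have "case_nat x (mrg c e) \<circ> ?f = mrg c (case_nat x e)" for x and e :: "nat => 'a"
  proof
    fix n
    show "(case_nat x (mrg c e) \<circ> ?f) n = mrg c (case_nat x e) n"
      by (cases n) (auto simp: mrg_def elim!: evenE oddE)
  qed
  then have "(ALL x. P e x) = sat E (mrg c e) (All (ren ?f p))" for e
    using p[of "case_nat x e" for x] by (simp add: sat_on_ren del: comp_apply)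
  then show ?thesis unfolding dfn_def by blast
qed

lemma dfn_const [simp]: "dfn E (%e. B)"
proof -
  have "dfn E (%e. sat E (%i. e i) (if B then Imp Bot Bot else Bot))" by (rule dfn_sat)
  then show ?thesis by (cases B) auto
qed

lemma dfn_not [simp]: "dfn E P ==> dfn E (%e. ~ P e)"
  using dfn_imp[OF _ dfn_const[of E False], of P] by simp

lemma dfn_and [simp]: "dfn E P ==> dfn E Q ==> dfn E (%e. P e & Q e)"
  using dfn_not[OF dfn_imp[OF _ dfn_not], of E P Q] by simp

lemma dfn_or [simp]: "dfn E P ==> dfn E Q ==> dfn E (%e. P e | Q e)"
  using dfn_imp[OF dfn_not, of E P Q] by (simp add: disj_imp)

lemma dfn_iff [simp]: "dfn E P ==> dfn E Q ==> dfn E (%e. P e <-> Q e)"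
  using dfn_and[OF dfn_imp[of E P Q] dfn_imp[of E Q P]] by (simp add: iff_conv_conj_imp)

lemma dfn_ex [simp]:
  assumes "dfn E (%e. P (%i. e (Suc i)) (e 0))"
  shows "dfn E (%e. EX x. P e x)"
  using dfn_not[OF dfn_all[of E "%e x. ~ P e x"], OF dfn_not[OF assms]] by simp

lemma dfn_vars: "dfn E (%e. E (e i) (e j))" "dfn E (%e. e i = e j)"
  using dfn_sat[of E "%i. i" "Mem i j"] dfn_sat[of E "%i. i" "Eq i j"] by simp_all

lemma dft_var [simp]: "dft E (%e. e i)"
  using dfn_vars(2)[of E 0 "Suc i"] by (simp add: dft_def)

lemma dft_const [simp]: "dft E (%e. c)"
proof -
  have "dfn E (%e. sat E (mrg (%_. c) e) (Eq 0 1))" unfolding dfn_def by blast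
  then show ?thesis by (simp add: dft_def mrg_def)
qed

lemma dfn_subst:
  assumes "dfn E (%e. P (%i. e (Suc i)) (e 0))" "dft E t"
  shows "dfn E (%e. P e (t e))"
  using dfn_ex[OF dfn_and[OF assms(2)[unfolded dft_def] assms(1)]] by simp

text \<open>\<open>f\<close> allows the remaining arguments to be shifted as well, the form in which
  goals arise under further binders.\<close>

lemma dfn_binder:
  assumes "dfn E (%e. P (%i. e (Suc i)) (e 0))" "dft E t"
  shows "dfn E (%e. P (%i. e (f i)) (t e))"
  by (rule dfn_subst[OF _ assms(2)])
     (use dfn_ren[OF assms(1), of "case_nat 0 (%i. Suc (f i))"] in simp)

lemma dfn_binder2:
  assumes "dfn E (%e. P (%i. e (Suc (Suc i))) (e 1) (e 0))" "dft E t" "dft E u"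
  shows "dfn E (%e. P (%i. e (f i)) (t e) (u e))"
proof -
  let ?g = "%n. case n of 0 => 0 | Suc m => (case m of 0 => 1 | Suc i => Suc (Suc (f i)))"
  have 1: "dfn E (%e. P (%i. e (Suc (Suc (f i)))) (e 1) (e 0))"
    using dfn_ren[OF assms(1), of ?g] by simp
  have u: "dft E (%e. u (%i. e (Suc i)))"
    unfolding dft_def using dfn_ren[OF assms(3)[unfolded dft_def], of "case_nat 0 (%i. Suc (Suc i))"] by simp
  have 2: "dfn E (%e. P (%i. e (Suc (f i))) (e 0) (u (%i. e (Suc i))))"
    by (rule dfn_subst[OF _ u]) (use 1 in simp)
  show ?thesis by (rule dfn_subst[OF 2 assms(2)])
qed

lemma dfn_mem:
  assumes "dft E t" "dft E u"
  shows "dfn E (%e. E (t e) (u e))"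
  using dfn_binder2[of E "%_. E", OF dfn_vars(1) assms] .

lemma dfn_eq [simp]:
  assumes "dft E t" "dft E u"
  shows "dfn E (%e. t e = u e)"
  using dfn_binder2[of E "%_. (=)", OF dfn_vars(2) assms] .

lemma dft_ren: "dft E t ==> dft E (%e. t (%i. e (f i)))"
  unfolding dft_def using dfn_ren[of E "%e. e 0 = t (%i. e (Suc i))" "case_nat 0 (%i. Suc (f i))"] by simp

lemmas dft_rens = dft_ren[where f = Suc] dft_ren[where f = "%i. Suc (Suc i)"]
  dft_ren[where f = "%i. Suc (Suc (Suc i))"] dft_ren[where f = "%i. Suc (Suc (Suc (Suc i)))"]

lemma dfn_if [simp]: "dfn E P ==> dfn E Q ==> dfn E R ==> dfn E (%e. if P e then Q e else R e)"
  using dfn_and[OF dfn_imp[of E P Q] dfn_imp[OF dfn_not, of E P R]] by (simp add: if_bool_eq_conj)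

lemma dft_if [simp]: "dfn E P ==> dft E t ==> dft E u ==> dft E (%e. if P e then t e else u e)"
proof -
  assume a: "dfn E P" "dft E t" "dft E u"
  have "dfn E (%e. if P (%i. e (Suc i)) then e 0 = t (%i. e (Suc i)) else e 0 = u (%i. e (Suc i)))"
    by (rule dfn_if) (use a dfn_ren[of E P Suc] in \<open>simp_all add: dft_def\<close>)
  then show ?thesis by (simp add: dft_def if_distrib cong: if_cong)
qed

lemma dfn_app1:
  "dfn E (%e. P (e 0)) ==> dft E t ==> dfn E (%e. P (t e))"
  using dfn_binder[of E "%_. P"] by simp

lemma dfn_app2:
  assumes "dfn E (%e. P (e 0) (e 1))" "dft E t" "dft E u"
  shows "dfn E (%e. P (t e) (u e))"
proof -
  have "dfn E (%e. P (e 1) (e 0))"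
    using dfn_ren[OF assms(1), of "%i. case i of 0 => 1 | Suc _ => 0"] by simp
  then show ?thesis using dfn_binder2[of E "%_. P" t u] assms by simp
qed

lemma dft_app1:
  assumes "dft E (%e. F (e 0))" "dft E t"
  shows "dft E (%e. F (t e))"
proof -
  have "dfn E (%e. e 0 = F (e 1))" using assms(1) by (simp add: dft_def)
  from dfn_app2[OF this dft_var[of E 0] dft_ren[OF assms(2), of Suc]] show ?thesis by (simp add: dft_def)
qed

lemma dft_app2:
  assumes F: "dft E (%e. F (e 0) (e 1))" and t: "dft E t" and u: "dft E u"
  shows "dft E (%e. F (t e) (u e))"
proof -
  have "dfn E (%e. e 0 = F (e 1) (e 2))" using F by (simp add: dft_def numeral_2_eq_2)
  from dfn_ren[OF this, of "%n. if n = 0 then Suc (Suc 0) else if n = 1 then 1 else 0"]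
  have "dfn E (%e. e (Suc (Suc 0)) = F (e 1) (e 0))" by (simp add: numeral_2_eq_2)
  from dfn_binder2[of E "%e x y. e 0 = F x y" _ _ Suc, OF this] 
  have "dfn E (%e. e (Suc 0) = F (t' e) (u' e))" if "dft E t'" "dft E u'" for t' u' using that by simp
  note 1 = this
  have "dfn E (%e. e 0 = F (e (Suc 0)) (e (Suc (Suc 0))))"
    using \<open>dfn E (%e. e 0 = F (e 1) (e 2))\<close> by (simp add: numeral_2_eq_2)
  from dfn_ren[OF this, of "%n. if n = 0 then 2 else if n = 1 then 1 else 0"]
  have *: "dfn E (%e. (%e x y. e 0 = F x y) (%i. e (Suc (Suc i))) (e 1) (e 0))" by (simp add: numeral_2_eq_2)
  have "dfn E (%e. (%e x y. e 0 = F x y) (%i. e (id i)) (t (%i. e (Suc i))) (u (%i. e (Suc i))))"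
    by (rule dfn_binder2[OF *]) (use dft_ren t u in auto)
  then show ?thesis by (simp add: dft_def)
qed

lemma dft_app3:
  assumes F: "dft E (%e. F (e 0) (e 1) (e 2))" and t: "dft E t" and u: "dft E u" and v: "dft E v"
  shows "dft E (%e. F (t e) (u e) (v e))"
proof -
  have "dfn E (%e. e 0 = F (e 1) (e (Suc 1)) (e (Suc (Suc 1))))" using F by (simp add: dft_def numeral_2_eq_2)
  from dfn_ren[OF this, of "%n. if n = 0 then 3 else if n = 1 then 2 else if n = 2 then 1 else 0"]
  have *: "dfn E (%e. (%e x y. e 1 = F (e 0) x y) (%i. e (Suc (Suc i))) (e 1) (e 0))"
    by (simp add: numeral_2_eq_2 numeral_3_eq_3)
  have "dfn E (%e. (%e x y. e 1 = F (e 0) x y) (%i. e (id i)) (u (%i. e (Suc (Suc i)))) (v (%i. e (Suc (Suc i)))))"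
    by (rule dfn_binder2[OF *]) (use dft_ren[of E u "%i. Suc (Suc i)"] dft_ren[of E v "%i. Suc (Suc i)"] u v in auto)
  then have **: "dfn E (%e. (%e x. e 0 = F x (u (%i. e (Suc i))) (v (%i. e (Suc i)))) (%i. e (Suc i)) (e 0))" by simp
  have "dfn E (%e. (%e x. e 0 = F x (u (%i. e (Suc i))) (v (%i. e (Suc i)))) e (t (%i. e (Suc i))))"
    by (rule dfn_subst[OF **]) (rule dft_ren[OF t])
  then show ?thesis by (simp add: dft_def)
qed

section \<open>Models of ZF\<close>

text \<open>Both schemata range over HOL predicates that satisfy \<open>dfn\<close>; formulas
  thereby disappear from the set theory, at the price of a definability side condition on each
  use.\<close>

locale zf =
  fixes mem :: "'a => 'a => bool" (infix "eps" 50)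
  assumes ext: "(!!z. z eps x <-> z eps y) ==> x = y"
    and found: "y eps x ==> EX y. y eps x & (ALL z. z eps x --> ~ z eps y)"
    and pair_ax: "EX p. ALL z. z eps p <-> z = x | z = y"
    and union_ax: "EX u. ALL z. z eps u <-> (EX y. y eps x & z eps y)"
    and pow_ax: "EX p. ALL z. z eps p <-> (ALL w. w eps z --> w eps x)"
    and inf_ax: "EX x. (EX e. (ALL z. ~ z eps e) & e eps x) & (ALL y. y eps x --> (EX s. (ALL z. z eps s <-> z eps y | z = y) & s eps x))"
    and sep_ax: "dfn mem (%e. P (e 0)) ==> EX b. ALL x. x eps b <-> x eps a & P x"
    and repl_ax: "dfn mem (%e. F (e 0) (e 1)) ==> (!!x y z. x eps a ==> F x y ==> F x z ==> y = z)
      ==> EX b. ALL y. y eps b <-> (EX x. x eps a & F x y)"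
begin

abbreviation D where "D \<equiv> dfn mem"
abbreviation T where "T \<equiv> dft mem"

lemmas D_mem [simp] = dfn_mem[of mem]

definition isset :: "('a => bool) => bool" where
  "isset P <-> (EX s. ALL x. x eps s <-> P x)"

definition emp :: 'a where "emp = (SOME s. ALL x. ~ x eps s)"

text \<open>The class \<open>P\<close> as a set; the empty set if it is a proper class.\<close>

definition Coll :: "('a => bool) => 'a" where
  "Coll P = (if isset P then SOME s. ALL x. x eps s <-> P x else emp)"

lemma not_mem_emp [simp]: "~ x eps emp"
proof -
  have "EX s. ALL x. ~ x eps s" using sep_ax[of "%_. False"] by simp
  from someI_ex[OF this] show ?thesis unfolding emp_def by blast
qed

lemma mem_Coll: "isset P ==> x eps Coll P <-> P x"
  unfolding Coll_def isset_def using someI_ex[of "%s. ALL x. x eps s <-> P x"] by simp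

text \<open>The proper-class case is included, which makes the equation first-order in all cases;
  hence \<open>T_Coll\<close> applies before a class is known to be a set.\<close>

lemma eq_Coll_iff: "y = Coll P <-> (ALL x. x eps y <-> P x) | ~ (EX s. ALL x. x eps s <-> P x) & (ALL x. ~ x eps y)"
proof (cases "isset P")
  case True
  then have "y = Coll P <-> (ALL x. x eps y <-> P x)" using mem_Coll ext by metis
  then show ?thesis using True by (auto simp: isset_def)
next
  case False
  then have "y = Coll P <-> (ALL x. ~ x eps y)" by (auto simp: Coll_def intro: ext)
  then show ?thesis using False by (auto simp: isset_def)
qed

lemma T_Coll [simp]:
  assumes "D (%e. P (%i. e (Suc i)) (e 0))"
  shows "T (%e. Coll (P e))"
  unfolding dft_def eq_Coll_iff by (simp add: dfn_binder[OF assms])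

lemma isset_sep: "D (%e. P (e 0)) ==> (!!x. P x ==> x eps a) ==> isset P"
  unfolding isset_def using sep_ax[of P a] by metis

lemma Coll_mem [simp]: "Coll (%z. z eps y) = y"
  by (rule sym) (simp add: eq_Coll_iff)

lemma Coll_cong: "(!!x. P x <-> Q x) ==> Coll P = Coll Q"
  by presburger

definition upair where "upair x y = Coll (%z. z = x | z = y)"
definition sng where "sng x = upair x x"
definition opair where "opair x y = upair (upair x x) (upair x y)"
definition Union where "Union a = Coll (%x. EX y. y eps a & x eps y)"
definition un where "un a b = Union (upair a b)"
definition sub where "sub x y <-> (ALL z. z eps x --> z eps y)"
definition Pow where "Pow a = Coll (%x. sub x a)"
definition sep where "sep a P = Coll (%x. x eps a & P x)"
definition img where "img a F = Coll (%y. EX x. x eps a & y = F x)"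
definition lam where "lam a F = img a (%x. opair x (F x))"
definition prod where "prod a b = Coll (%z. EX x y. x eps a & y eps b & z = opair x y)"
text \<open>The union of all values at \<open>x\<close>: a total, definable operation that returns
  the value wherever it is unique, and the empty set off the domain. \<open>fs\<close> and
  \<open>sn\<close> below follow the same pattern.\<close>

definition ap where "ap f x = Coll (%z. EX y. opair x y eps f & z eps y)"
definition diff where "diff a b = Coll (%x. x eps a & ~ x eps b)"
definition suc where "suc x = un x (sng x)"
definition fs where "fs z = Coll (%u. EX x y. z = opair x y & u eps x)"
definition sn where "sn z = Coll (%u. EX x y. z = opair x y & u eps y)"

lemma T_upair [simp]: "T a ==> T b ==> T (%e. upair (a e) (b e))"
  unfolding upair_def by (simp add: dft_rens)
lemma T_sng [simp]: "T a ==> T (%e. sng (a e))" unfolding sng_def by simp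
lemma T_opair [simp]: "T a ==> T b ==> T (%e. opair (a e) (b e))" unfolding opair_def by simp
lemma T_Union [simp]: "T a ==> T (%e. Union (a e))" unfolding Union_def by (simp add: dft_rens)
lemma T_un [simp]: "T a ==> T b ==> T (%e. un (a e) (b e))" unfolding un_def by simp
lemma D_sub [simp]: "T a ==> T b ==> D (%e. sub (a e) (b e))" unfolding sub_def by (simp add: dft_rens)
lemma T_Pow [simp]: "T a ==> T (%e. Pow (a e))" unfolding Pow_def by (simp add: dft_rens)
lemma T_sep [simp]: "T a ==> D (%e. P (%i. e (Suc i)) (e 0)) ==> T (%e. sep (a e) (P e))"
  unfolding sep_def by (simp add: dft_rens)
lemma T_img [simp]:
  assumes "T a" "T (%e. F (%i. e (Suc i)) (e 0))"
  shows "T (%e. img (a e) (F e))"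
proof -
  have "T (%e. F (%i. e (Suc (Suc i))) (e 0))"
    using dft_ren[OF assms(2), of "case_nat 0 (%i. Suc (Suc i))"] by simp
  then show ?thesis unfolding img_def using assms(1) by (simp add: dft_rens)
qed
lemma T_lam [simp]: "T a ==> T (%e. F (%i. e (Suc i)) (e 0)) ==> T (%e. lam (a e) (F e))"
  unfolding lam_def by simp
lemma T_prod [simp]: "T a ==> T b ==> T (%e. prod (a e) (b e))" unfolding prod_def by (simp add: dft_rens)
lemma T_ap [simp]: "T a ==> T b ==> T (%e. ap (a e) (b e))" unfolding ap_def by (simp add: dft_rens)
lemma T_diff [simp]: "T a ==> T b ==> T (%e. diff (a e) (b e))" unfolding diff_def by (simp add: dft_rens)
lemma T_suc [simp]: "T a ==> T (%e. suc (a e))" unfolding suc_def by simp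
lemma T_fs [simp]: "T a ==> T (%e. fs (a e))" unfolding fs_def by (simp add: dft_rens)
lemma T_sn [simp]: "T a ==> T (%e. sn (a e))" unfolding sn_def by (simp add: dft_rens)

lemma mem_upair [simp]: "z eps upair x y <-> z = x | z = y"
  unfolding upair_def by (rule mem_Coll) (use pair_ax isset_def in auto)
lemma mem_sng [simp]: "z eps sng x <-> z = x" by (simp add: sng_def)
lemma mem_Union [simp]: "z eps Union x <-> (EX y. y eps x & z eps y)"
  unfolding Union_def by (rule mem_Coll) (use union_ax isset_def in auto)
lemma mem_un [simp]: "z eps un x y <-> z eps x | z eps y" by (auto simp: un_def)
lemma mem_Pow [simp]: "z eps Pow x <-> sub z x"
  unfolding Pow_def by (rule mem_Coll) (use pow_ax isset_def sub_def in auto)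
lemma mem_sep: "D (%e. P (e 0)) ==> z eps sep a P <-> z eps a & P z"
  unfolding sep_def by (rule mem_Coll) (use sep_ax isset_def in auto)
lemma mem_diff [simp]: "z eps diff a b <-> z eps a & ~ z eps b"
  unfolding diff_def by (rule mem_Coll, rule isset_sep[of _ a]) auto
lemma mem_suc [simp]: "z eps suc x <-> z eps x | z = x" by (auto simp: suc_def)
lemma mem_img: "T (%e. F (e 0)) ==> y eps img a F <-> (EX x. x eps a & y = F x)"
  unfolding img_def by (rule mem_Coll) (use repl_ax[of "%x y. y = F x" a] dft_app1 in \<open>auto simp: isset_def\<close>)

lemma upair_eq_iff: "upair x y = upair u v <-> x = u & y = v | x = v & y = u"
proof
  assume "upair x y = upair u v"
  then have "z = x | z = y <-> z = u | z = v" for z using mem_upair by metis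
  then show "x = u & y = v | x = v & y = u" by metis
qed (auto intro: ext)

lemma opair_inject [simp]: "opair x y = opair u v <-> x = u & y = v"
  by (auto simp: opair_def upair_eq_iff)

lemma mem_prod: "z eps prod a b <-> (EX x y. x eps a & y eps b & z = opair x y)"
  unfolding prod_def
  by (rule mem_Coll, rule isset_sep[of _ "Union (img a (%x. img b (%y. opair x y)))"])
     (auto simp: mem_img)

lemma opair_mem_prod [simp]: "opair x y eps prod a b <-> x eps a & y eps b"
  by (auto simp: mem_prod)

lemma opair_mem_UU: "opair x y eps f ==> x eps Union (Union f)" "opair x y eps f ==> y eps Union (Union f)"
  by (auto simp: opair_def) (metis mem_upair)+

lemma mem_lam: "T (%e. F (e 0)) ==> y eps lam a F <-> (EX x. x eps a & y = opair x (F x))"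
  unfolding lam_def by (rule mem_img) simp

lemma mem_ap: "z eps ap f x <-> (EX y. opair x y eps f & z eps y)"
  unfolding ap_def
proof (rule mem_Coll, rule isset_sep[of _ "Union (Union (Union f))"])
  show "z eps Union (Union (Union f))" if "EX y. opair x y eps f & z eps y" for z
    using that opair_mem_UU(2) by (subst mem_Union) blast
qed simp

lemma ap_eq: "opair x y eps f ==> (!!z. opair x z eps f ==> z = y) ==> ap f x = y"
  by (rule ext, unfold mem_ap) blast

lemma ap_lam: "T (%e. F (e 0)) ==> x eps a ==> ap (lam a F) x = F x"
  by (rule ap_eq) (auto simp: mem_lam)

lemma fs_opair [simp]: "fs (opair x y) = x"
  unfolding fs_def by (rule sym) (simp add: eq_Coll_iff)

lemma sn_opair [simp]: "sn (opair x y) = y"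
  unfolding sn_def by (rule sym) (simp add: eq_Coll_iff)

lemma sub_refl [simp]: "sub x x" and sub_emp [simp]: "sub emp x" by (auto simp: sub_def)

lemma sub_antisym: "sub x y ==> sub y x ==> x = y" by (rule ext) (auto simp: sub_def)

lemma ex_mem_iff: "(EX y. y eps x) <-> x ~= emp"
  using ext[of x emp] by auto

lemma not_mem_self [simp]: "~ x eps x"
  using found[of x "sng x"] by auto

lemma not_mem_sym: "x eps y ==> ~ y eps x"
  using found[of x "upair x y"] by auto

lemma suc_inject [simp]: "suc x = suc y <-> x = y"
  by (metis mem_suc not_mem_sym)

lemma suc_ne_emp [simp]: "suc x ~= emp" "emp ~= suc x"
  by (metis mem_suc not_mem_emp)+

subsection \<open>Natural numbers and transitive closure\<close>

definition indset where "indset J <-> emp eps J & (ALL y. y eps J --> suc y eps J)"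
definition om where "om = Coll (%n. ALL J. indset J --> n eps J)"
definition trans where "trans x <-> (ALL y. y eps x --> sub y x)"

lemma D_indset [simp]: "T a ==> D (%e. indset (a e))"
  unfolding indset_def by (simp add: dft_rens)
lemma D_trans [simp]: "T a ==> D (%e. trans (a e))"
  unfolding trans_def by (simp add: dft_rens)

lemma ex_indset: "EX J. indset J"
proof -
  obtain J e where J: "!!z. ~ z eps e" "e eps J"
    "!!y. y eps J ==> EX s. (ALL z. z eps s <-> z eps y | z = y) & s eps J" using inf_ax by blast
  have "e = emp" using J(1) by (intro ext) simp
  moreover have "suc y eps J" if y: "y eps J" for y
  proof -
    obtain s where s: "ALL z. z eps s <-> z eps y | z = y" "s eps J" using J(3)[OF y] by blast
    then have "s = suc y" by (intro ext) simp
    then show ?thesis using s by simp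
  qed
  ultimately show ?thesis using J(2) by (auto simp: indset_def)
qed

lemma mem_om: "n eps om <-> (ALL J. indset J --> n eps J)"
proof -
  obtain J where "indset J" using ex_indset by blast
  then show ?thesis unfolding om_def by (intro mem_Coll isset_sep[of _ J]) auto
qed

lemma emp_om [simp]: "emp eps om" and suc_om [simp]: "n eps om ==> suc n eps om"
  by (auto simp: mem_om indset_def)

text \<open>Restricted to definable properties, since \<open>om\<close> may contain nonstandard
  elements.\<close>

lemma om_induct:
  assumes "n eps om" "D (%e. P (e 0))" "P emp" "!!n. n eps om ==> P n ==> P (suc n)"
  shows "P n"
proof -
  have "indset (sep om P)" using assms by (auto simp: indset_def mem_sep)
  then show ?thesis using assms(1,2) mem_om mem_sep by blast
qed

lemma om_cases: "n eps om ==> n = emp | (EX m. m eps om & n = suc m)"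
  by (rule om_induct[where P = "%n. n = emp | (EX m. m eps om & n = suc m)"]) auto

lemma trans_om: "trans om"
proof -
  have "sub n om" if "n eps om" for n
    by (rule om_induct[OF that, of "%n. sub n om"]) (auto simp: sub_def)
  then show ?thesis by (simp add: trans_def)
qed

lemma ex_trans_superset: "EX t. trans t & sub x t"
proof -
  define att where "att f n <-> ap f emp = x & (ALL m. m eps n --> ap f (suc m) = Union (ap f m))" for f n
  have D_att: "D (%e. att (a e) (b e))" if "T a" "T b" for a b
    unfolding att_def using that by (simp add: dft_rens)
  have ex: "EX f. att f n" if n: "n eps om" for n
  proof (rule om_induct[OF n, of "%n. EX f. att f n"])
    show "D (%e. EX f. att f (e 0))" by (simp add: D_att)
    have "att (lam (suc emp) (%_. x)) emp" by (simp add: att_def ap_lam)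
    then show "EX f. att f emp" by blast
    fix n assume n: "n eps om" and "EX f. att f n"
    then obtain f where f: "att f n" by blast
    let ?F = "%m. if m = suc n then Union (ap f n) else ap f m"
    have "ap (lam om ?F) m = ?F m" if "m eps om" for m using that by (subst ap_lam) simp_all
    moreover have "m eps om" if "m eps suc n" for m using that n trans_om by (auto simp: trans_def sub_def)
    moreover have "m ~= suc n" if "m eps suc n" for m using that not_mem_self by blast
    ultimately have "att (lam om ?F) (suc n)" using f n by (auto simp: att_def)
    then show "EX f. att f (suc n)" by blast
  qed
  have uniq: "ap f n = ap g n" if n: "n eps om" "att f n" "att g n" for f g n
  proof -
    have "att f n & att g n --> ap f n = ap g n"
    proof (rule om_induct[OF n(1), of "%n. att f n & att g n --> ap f n = ap g n"])
      show "D (%e. att f (e 0) & att g (e 0) --> ap f (e 0) = ap g (e 0))" by (simp add: D_att)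
    qed (auto simp: att_def)
    then show ?thesis using n by blast
  qed
  have D1: "D (%e. (%n y. EX f. att f n & y = ap f n) (e 0) (e 1))" by (simp add: D_att)
  obtain b where b: "!!y. y eps b <-> (EX n. n eps om & (EX f. att f n & y = ap f n))"
    using repl_ax[OF D1, of om] uniq by blast
  have "trans (Union b)"
  proof -
    have "EX y. y eps b & w eps y" if z: "z eps y" "y eps b" and w: "w eps z" for w z y
    proof -
      obtain n f where n: "n eps om" "att f n" "y = ap f n" using z b by blast
      obtain g where g: "att g (suc n)" using ex n by fastforce
      then have "att g n" by (auto simp: att_def)
      then have "ap g n = y" using uniq n by blast
      then have "ap g (suc n) = Union y" using g by (auto simp: att_def)
      then have "Union y eps b" using b n g suc_om by metis
      then show ?thesis using z w by (intro exI[of _ "Union y"]) auto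
    qed
    then show ?thesis by (auto simp: trans_def sub_def)
  qed
  moreover have "x eps b"
  proof -
    obtain f where "att f emp" using ex emp_om by blast
    then show ?thesis using b emp_om unfolding att_def by metis
  qed
  then have "sub x (Union b)" by (auto simp: sub_def)
  ultimately show ?thesis by blast
qed

lemma eps_induct:
  assumes DP: "D (%e. P (e 0))" and step: "!!x. (!!y. y eps x ==> P y) ==> P x"
  shows "P x"
proof (rule ccontr)
  assume "~ P x"
  obtain t where t: "trans t" "sub (sng x) t" using ex_trans_superset by blast
  have "x eps sep t (%z. ~ P z)" using t \<open>~ P x\<close> DP by (simp add: mem_sep sub_def)
  then obtain y where y: "y eps sep t (%z. ~ P z)" "ALL z. z eps sep t (%z. ~ P z) --> ~ z eps y"
    using found by blast
  have "P z" if "z eps y" for z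
  proof -
    have "z eps t" using t y that DP by (auto simp: mem_sep trans_def sub_def)
    then show ?thesis using y that DP by (auto simp: mem_sep)
  qed
  then have "P y" by (rule step)
  then show False using y DP by (simp add: mem_sep)
qed

subsection \<open>Recursion on membership\<close>

definition attempt where
  "attempt F a f t <-> trans t & (ALL z. z eps t --> ap f z = F a z (lam z (ap f)))"

text \<open>The union of the values of all attempts at \<open>x\<close>, in analogy to
  \<open>ap\<close>, which avoids choosing an attempt. \<open>F\<close> is given a parameter, the
  argument and the function restricted to the elements of the argument.\<close>

definition rec where
  "rec F a x = Coll (%z. EX f t. attempt F a f t & x eps t & z eps ap f x)"

lemma D_attempt:
  assumes "T (%e. F (e 0) (e 1) (e 2))" "T a" "T f" "T t"
  shows "D (%e. attempt F (a e) (f e) (t e))"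
  unfolding attempt_def using assms by (simp add: dft_rens dft_app3[OF assms(1)])

lemma T_rec:
  assumes "T (%e. F (e 0) (e 1) (e 2))" "T a" "T x"
  shows "T (%e. rec F (a e) (x e))"
  unfolding rec_def using assms by (simp add: dft_rens D_attempt[OF assms(1)])

lemma lam_cong: "T (%e. F (e 0)) ==> T (%e. G (e 0)) ==> (!!x. x eps a ==> F x = G x) ==> lam a F = lam a G"
  by (rule ext) (auto simp: mem_lam)

lemma attempt_unique:
  assumes F: "T (%e. F (e 0) (e 1) (e 2))" and "attempt F a f t" "attempt F a g s" "x eps t" "x eps s"
  shows "ap f x = ap g x"
proof -
  have "x eps t & x eps s --> ap f x = ap g x"
  proof (rule eps_induct[where P = "%x. x eps t & x eps s --> ap f x = ap g x"])
    fix x assume IH: "!!y. y eps x ==> y eps t & y eps s --> ap f y = ap g y"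
    show "x eps t & x eps s --> ap f x = ap g x"
    proof
      assume x: "x eps t & x eps s"
      then have "lam x (ap f) = lam x (ap g)"
        by (intro lam_cong) (use IH assms(2,3) in \<open>auto simp: attempt_def trans_def sub_def\<close>)
      then show "ap f x = ap g x" using x assms(2,3) by (simp add: attempt_def)
    qed
  qed simp
  then show ?thesis using assms by blast
qed

lemma rec_attempt:
  assumes F: "T (%e. F (e 0) (e 1) (e 2))" and "attempt F a f t" "x eps t"
  shows "rec F a x = ap f x"
proof -
  have "(EX f t. attempt F a f t & x eps t & z eps ap f x) <-> z eps ap f x" for z
  proof
    assume "EX f t. attempt F a f t & x eps t & z eps ap f x"
    then obtain g s where "attempt F a g s" "x eps s" "z eps ap g x" by blast
    then show "z eps ap f x" using attempt_unique[OF F assms(2) _ assms(3)] by simp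
  qed (use assms in blast)
  then show ?thesis by (simp add: rec_def)
qed

text \<open>On the set \<open>S\<close> where attempts exist, \<open>rec\<close> itself already
  solves the equation; so \<open>rec\<close> restricted to \<open>S\<close>, extended by one value
  at \<open>x\<close>, is an attempt.\<close>

lemma ex_attempt:
  assumes F: "T (%e. F (e 0) (e 1) (e 2))"
  shows "EX f t. attempt F a f t & x eps t"
proof (rule eps_induct[where P = "%x. EX f t. attempt F a f t & x eps t"])
  show "D (%e. EX f t. attempt F a f t & e 0 eps t)" by (simp add: D_attempt[OF F])
  fix x assume IH: "!!y. y eps x ==> EX f t. attempt F a f t & y eps t"
  let ?R = "rec F a"
  have TR: "T (%e. ?R (t e))" if "T t" for t using T_rec[OF F] that by simp
  obtain u where u: "trans u" "sub x u" using ex_trans_superset by blast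
  define S where "S = sep u (%z. EX f t. attempt F a f t & z eps t)"
  have S: "z eps S <-> z eps u & (EX f t. attempt F a f t & z eps t)" for z
    unfolding S_def by (rule mem_sep) (simp add: D_attempt[OF F])
  have tS: "trans S"
  proof -
    have "w eps S" if y: "y eps S" and w: "w eps y" for y w
    proof -
      obtain f t where ft: "attempt F a f t" "y eps t" using y S by blast
      then have "w eps t" using w by (auto simp: attempt_def trans_def sub_def)
      moreover have "w eps u"
        using y w u unfolding S trans_def sub_def by blast
      ultimately show ?thesis unfolding S using ft by blast
    qed
    then show ?thesis by (auto simp: trans_def sub_def)
  qed
  have xS: "sub x S" unfolding sub_def S using u IH by (auto simp: sub_def)
  let ?F = "%z. if z eps S then ?R z else F a x (lam x ?R)"
  have TF: "T (%e. ?F (e 0))" by (simp add: TR)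
  let ?f = "lam (un S (sng x)) ?F"
  have f: "ap ?f z = ?F z" if "z eps un S (sng x)" for z using that by (subst ap_lam[OF TF]) simp_all
  have R: "?R z = F a z (lam z ?R)" if zS: "z eps S" for z
  proof -
    obtain f t where ft: "attempt F a f t" "z eps t" using zS S by blast
    have "lam z (ap f) = lam z ?R"
      by (rule lam_cong) (use ft rec_attempt[OF F ft(1)] in \<open>auto simp: TR attempt_def trans_def sub_def\<close>)
    then show ?thesis using rec_attempt[OF F ft] ft by (simp add: attempt_def)
  qed
  have l: "lam z (ap ?f) = lam z ?R" if "sub z S" for z
    by (rule lam_cong) (use f that in \<open>auto simp: TR sub_def\<close>)
  have "attempt F a ?f (un S (sng x))"
    unfolding attempt_def
  proof (intro conjI allI impI)
    show "trans (un S (sng x))" using tS xS by (auto simp: trans_def sub_def)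
    fix z assume z: "z eps un S (sng x)"
    then have zs: "sub z S" using tS xS by (auto simp: trans_def)
    show "ap ?f z = F a z (lam z (ap ?f))"
      unfolding l[OF zs] f[OF z]
    proof (cases "z eps S")
      case False
      then have "z = x" using z by simp
      then show "(if z eps S then ?R z else F a x (lam x ?R)) = F a z (lam z ?R)" using False by simp
    qed (use R[of z] in \<open>simp only: if_True\<close>)
  qed
  then show "EX f t. attempt F a f t & x eps t" by (meson mem_sng mem_un)
qed

lemma rec_eq:
  assumes F: "T (%e. F (e 0) (e 1) (e 2))"
  shows "rec F a x = F a x (lam x (rec F a))"
proof -
  obtain f t where ft: "attempt F a f t" "x eps t" using ex_attempt[OF F] by blast
  have "lam x (ap f) = lam x (rec F a)"
    by (rule lam_cong) (use ft rec_attempt[OF F ft(1)] in \<open>auto simp: T_rec[OF F] attempt_def trans_def sub_def\<close>)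
  then show ?thesis using rec_attempt[OF F ft] ft by (simp add: attempt_def)
qed

end

text \<open>Pairing, union and power set are asked for only up to a superset and replacement in the
  form of collection; inner models and generic extensions provide these forms directly.\<close>

lemma zf_intro:
  assumes ext: "!!x y. (!!z. mem z x <-> mem z y) ==> x = y"
    and found: "!!x y. mem y x ==> EX y. mem y x & (ALL z. mem z x --> ~ mem z y)"
    and sep: "!!P a. dfn mem (%e. P (e 0)) ==> EX b. ALL x. mem x b <-> mem x a & P x"
    and pair: "!!x y. EX p. mem x p & mem y p"
    and union: "!!x. EX u. ALL y z. mem y x --> mem z y --> mem z u"
    and pow: "!!x. EX p. ALL z. (ALL w. mem w z --> mem w x) --> mem z p"
    and inf: "EX x. (EX e. (ALL z. ~ mem z e) & mem e x) & (ALL y. mem y x --> (EX s. (ALL z. mem z s <-> mem z y | z = y) & mem s x))"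
    and coll: "!!F a. dfn mem (%e. F (e 0) (e 1)) ==> EX b. ALL x. mem x a --> (EX y. F x y) --> (EX y. mem y b & F x y)"
  shows "zf mem"
proof
  note [simp] = dfn_mem[of mem]
  show "(!!z. mem z x <-> mem z y) ==> x = y" for x y by (rule ext)
  show "mem y x ==> EX y. mem y x & (ALL z. mem z x --> ~ mem z y)" for x y by (rule found)
  show "dfn mem (%e. P (e 0)) ==> EX b. ALL x. mem x b <-> mem x a & P x" for P a by (rule sep)
  show "EX p. ALL z. mem z p <-> z = x | z = y" for x y
  proof -
    obtain p where "mem x p" "mem y p" using pair by blast
    moreover obtain b where "ALL z. mem z b <-> mem z p & (z = x | z = y)"
      using sep[of "%z. z = x | z = y" p] by auto
    ultimately show ?thesis by blast
  qed
  show "EX u. ALL z. mem z u <-> (EX y. mem y x & mem z y)" for x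
  proof -
    obtain u where "ALL y z. mem y x --> mem z y --> mem z u" using union by blast
    moreover obtain b where "ALL z. mem z b <-> mem z u & (EX y. mem y x & mem z y)"
      using sep[of "%z. EX y. mem y x & mem z y" u] by auto
    ultimately show ?thesis by blast
  qed
  show "EX p. ALL z. mem z p <-> (ALL w. mem w z --> mem w x)" for x
  proof -
    obtain u where "ALL z. (ALL w. mem w z --> mem w x) --> mem z u" using pow by blast
    moreover obtain b where "ALL z. mem z b <-> mem z u & (ALL w. mem w z --> mem w x)"
      using sep[of "%z. ALL w. mem w z --> mem w x" u] by auto
    ultimately show ?thesis by blast
  qed
  show "EX x. (EX e. (ALL z. ~ mem z e) & mem e x) & (ALL y. mem y x --> (EX s. (ALL z. mem z s <-> mem z y | z = y) & mem s x))"
    by (rule inf)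
  show "EX b. ALL y. mem y b <-> (EX x. mem x a & F x y)"
    if F: "dfn mem (%e. F (e 0) (e 1))" and u: "!!x y z. mem x a ==> F x y ==> F x z ==> y = z" for F a
  proof -
    obtain c where c: "ALL x. mem x a --> (EX y. F x y) --> (EX y. mem y c & F x y)" using coll[OF F] by blast
    have "dfn mem (%e. EX x. mem x a & F x (e 0))" by (simp add: dfn_app2[OF F])
    then obtain b where "ALL y. mem y b <-> mem y c & (EX x. mem x a & F x y)"
      using sep[of "%y. EX x. mem x a & F x y" c] by auto
    then show ?thesis using c u by (intro exI[of _ b]) metis
  qed
qed

context zf
begin

subsection \<open>Ordinals\<close>

text \<open>Foundation in the background makes this short form agree with the usual one, a
  transitive set well-ordered by membership; see \<open>Ord_iff\<close>.\<close>

definition Ord where "Ord x <-> trans x & (ALL y. y eps x --> trans y)"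

lemma D_Ord [simp]: "T a ==> D (%e. Ord (a e))"
  unfolding Ord_def by (simp add: dft_rens)

lemma Ord_in: "Ord x ==> y eps x ==> Ord y"
  unfolding Ord_def trans_def sub_def by blast

lemma Ord_trans: "Ord x ==> y eps x ==> z eps y ==> z eps x"
  unfolding Ord_def trans_def sub_def by blast

lemma OrdI: "(!!y z. y eps x ==> z eps y ==> z eps x) ==> (!!y. y eps x ==> Ord y) ==> Ord x"
  unfolding Ord_def trans_def sub_def by blast

lemma Ord_linear: "Ord x ==> Ord y ==> x eps y | x = y | y eps x"
proof -
  have "Ord x --> (ALL y. Ord y --> x eps y | x = y | y eps x)" for x
  proof (rule eps_induct[where P = "%x. Ord x --> (ALL y. Ord y --> x eps y | x = y | y eps x)"])
    fix x assume IH: "!!z. z eps x ==> Ord z --> (ALL y. Ord y --> z eps y | z = y | y eps z)"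
    show "Ord x --> (ALL y. Ord y --> x eps y | x = y | y eps x)"
    proof (intro impI allI)
      fix y assume x: "Ord x" and "Ord y"
      have "Ord y --> x eps y | x = y | y eps x"
      proof (rule eps_induct[where P = "%y. Ord y --> x eps y | x = y | y eps x"])
        fix y assume IH2: "!!z. z eps y ==> Ord z --> x eps z | x = z | z eps x"
        show "Ord y --> x eps y | x = y | y eps x"
        proof
          assume y: "Ord y"
          have 1: "y eps x | sub x y"
            using IH y x Ord_in Ord_trans unfolding sub_def by blast
          have 2: "x eps y | sub y x"
            using IH2 y x Ord_in Ord_trans unfolding sub_def by blast
          show "x eps y | x = y | y eps x" using 1 2 sub_antisym by blast
        qed
      qed simp
      then show "x eps y | x = y | y eps x" using \<open>Ord y\<close> by blast
    qed
  qed simp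
  then show "Ord x ==> Ord y ==> x eps y | x = y | y eps x" by blast
qed

lemma Ord_sub_iff: "Ord x ==> Ord y ==> sub x y <-> x eps y | x = y"
  using Ord_linear[of x y] Ord_trans[of y x] not_mem_self unfolding sub_def by blast

lemma Ord_not_mem: "Ord x ==> Ord y ==> ~ x eps y <-> sub y x"
  using Ord_sub_iff[of y x] Ord_linear[of x y] not_mem_sym not_mem_self by blast

lemma Ord_emp [simp]: "Ord emp" by (rule OrdI) auto

lemma Ord_suc [simp]: "Ord x ==> Ord (suc x)"
  by (rule OrdI) (auto dest: Ord_in Ord_trans)

lemma Ord_Union: "(!!y. y eps x ==> Ord y) ==> Ord (Union x)"
proof (rule OrdI)
  assume o: "!!y. y eps x ==> Ord y"
  show "z eps Union x" if "y eps Union x" "z eps y" for y z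
    using that o Ord_trans unfolding mem_Union by blast
  show "Ord y" if "y eps Union x" for y
    using that o Ord_in unfolding mem_Union by blast
qed

lemma Ord_om_elem: "n eps om ==> Ord n"
  by (rule om_induct[of n Ord]) auto

lemma Ord_om [simp]: "Ord om"
  using trans_om Ord_om_elem by (auto simp: Ord_def)

lemma not_all_Ord: "EX x. Ord x & ~ x eps s"
proof (rule ccontr)
  assume "~ ?thesis"
  then have s: "x eps sep s Ord <-> Ord x" for x by (auto simp: mem_sep)
  have "Ord (sep s Ord)" by (rule OrdI, unfold s) (blast intro: Ord_in)+
  then show False using s not_mem_self by blast
qed

text \<open>The least ordinal with \<open>P\<close> as the intersection of all of them; the
  existence guard turns the case without any into the empty set, so that \<open>Lst P\<close> is an
  ordinal for every definable \<open>P\<close>.\<close>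

definition Lst where
  "Lst P = Coll (%z. (EX x. Ord x & P x) & (ALL x. Ord x & P x --> z eps x))"

lemma T_Lst [simp]: "D (%e. P (%i. e (Suc i)) (e 0)) ==> T (%e. Lst (P e))"
  unfolding Lst_def by (simp add: dfn_binder[of mem P])

lemma Lst_props:
  assumes D: "D (%e. P (e 0))" and x: "Ord x" "P x"
  shows "Ord (Lst P) & P (Lst P) & (ALL y. y eps Lst P --> ~ P y)"
proof -
  have "EX m. Ord m & P m & (ALL y. y eps m --> ~ P y)"
  proof (rule ccontr)
    assume *: "~ ?thesis"
    have "Ord x --> ~ P x"
    proof (rule eps_induct[where P = "%x. Ord x --> ~ P x"])
      show "Ord x --> ~ P x" if "!!y. y eps x ==> Ord y --> ~ P y" for x
        using that * Ord_in by blast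
    qed (simp add: D)
    then show False using x by blast
  qed
  then obtain m where m: "Ord m" "P m" "!!y. y eps m ==> ~ P y" by blast
  have "((EX x. Ord x & P x) & (ALL x. Ord x & P x --> z eps x)) <-> z eps m" for z
    using m Ord_not_mem[of _ m] unfolding sub_def by blast
  then have "Lst P = m" by (simp add: Lst_def)
  then show ?thesis using m by blast
qed

lemma Lst_Ord: "D (%e. P (e 0)) ==> Ord x ==> P x ==> Ord (Lst P)"
  and Lst_prop: "D (%e. P (e 0)) ==> Ord x ==> P x ==> P (Lst P)"
  and Lst_least: "D (%e. P (e 0)) ==> Ord x ==> P x ==> ~ x eps Lst P"
  using Lst_props by blast+

lemma Lst_sub: "D (%e. P (e 0)) ==> Ord x ==> P x ==> sub (Lst P) x"
  using Ord_not_mem[of x "Lst P"] Lst_least[of P x] Lst_Ord[of P x] by blast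

definition inter where "inter a b = diff a (diff a b)"
lemma T_inter [simp]: "T a ==> T b ==> T (%e. inter (a e) (b e))" unfolding inter_def by simp
lemma mem_inter [simp]: "x eps inter a b <-> x eps a & x eps b" by (auto simp: inter_def)

subsection \<open>Transitive collapse\<close>

text \<open>Mostowski's collapse of \<open>Y\<close>, defined for every \<open>x\<close> by
  forgetting the elements outside \<open>Y\<close>.\<close>

definition colF where "colF Y x f = Coll (%z. EX y. y eps x & y eps Y & z = ap f y)"
definition col where "col = rec colF"

lemma T_colF: "T (%e. colF (e 0) (e 1) (e 2))"
  unfolding colF_def by (simp add: dft_rens)

lemma T_col [simp]: "T a ==> T b ==> T (%e. col (a e) (b e))"
  unfolding col_def by (rule T_rec[OF T_colF])

lemma mem_col: "z eps col Y x <-> (EX y. y eps x & y eps Y & z = col Y y)"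
proof -
  have "col Y x = colF Y x (lam x (col Y))"
    unfolding col_def by (rule rec_eq[OF T_colF])
  also have "\<dots> = Coll (%z. EX y. y eps x & y eps Y & z = col Y y)"
    unfolding colF_def by (rule Coll_cong) (auto simp: ap_lam)
  also have "\<dots> = img (inter x Y) (col Y)" unfolding img_def by (rule Coll_cong) auto
  finally have "col Y x = img (inter x Y) (col Y)" .
  then show ?thesis by (auto simp: mem_img)
qed

lemma Ord_col: "Ord x ==> Ord (col Y x)"
proof -
  have "Ord x --> Ord (col Y x)"
  proof (rule eps_induct[where P = "%x. Ord x --> Ord (col Y x)"])
    fix x assume IH: "!!y. y eps x ==> Ord y --> Ord (col Y y)"
    show "Ord x --> Ord (col Y x)"
    proof (rule impI, rule OrdI)
      assume x: "Ord x"
      show "Ord y" if y: "y eps col Y x" for y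
      proof -
        obtain w where w: "w eps x" "y = col Y w" using y mem_col[of y Y x] by auto
        then show ?thesis using IH[of w] Ord_in[OF x w(1)] by simp
      qed
      show "z eps col Y x" if y: "y eps col Y x" and z: "z eps y" for y z
      proof -
        obtain w where w: "w eps x" "w eps Y" "y = col Y w" using y mem_col[of y Y x] by auto
        then obtain v where v: "v eps w" "v eps Y" "z = col Y v" using z mem_col[of z Y w] by auto
        then show ?thesis using Ord_trans[OF x w(1)] mem_col[of z Y x] by blast
      qed
    qed
  qed simp
  then show "Ord x ==> Ord (col Y x)" by blast
qed

lemma col_mono: "y eps x ==> y eps Y ==> col Y y eps col Y x"
  unfolding mem_col by blast

lemma col_sub: "Ord x ==> sub (col Y x) x"
proof -
  have "Ord x --> sub (col Y x) x"
  proof (rule eps_induct[where P = "%x. Ord x --> sub (col Y x) x"])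
    fix x assume IH: "!!y. y eps x ==> Ord y --> sub (col Y y) y"
    show "Ord x --> sub (col Y x) x"
      unfolding sub_def mem_col
    proof (intro impI allI, elim exE conjE)
      fix z y assume x: "Ord x" and y: "y eps x" "y eps Y" "z = col Y y"
      then have o: "Ord y" using Ord_in by blast
      then have "sub z y" using IH y by blast
      then have "z eps y | z = y" using Ord_sub_iff[of z y] o Ord_col y(3) by blast
      then show "z eps x" using Ord_trans x y by blast
    qed
  qed simp
  then show "Ord x ==> sub (col Y x) x" by blast
qed

lemma col_inj_Ord:
  assumes "!!y. y eps Y ==> Ord y" "y eps Y" "y' eps Y" "col Y y = col Y y'"
  shows "y = y'"
  using Ord_linear[of y y'] assms col_mono[of y y' Y] col_mono[of y' y Y] not_mem_self by metis

lemma col_mem_Ord: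
  assumes "!!y. y eps Y ==> Ord y" "y eps Y" "y' eps Y" "col Y y eps col Y y'"
  shows "y eps y'"
  using Ord_linear[of y y'] assms col_mono[of y' y Y] not_mem_self not_mem_sym by metis

definition otp where "otp Y = img Y (col Y)"
lemma mem_otp: "z eps otp Y <-> (EX y. y eps Y & z = col Y y)" unfolding otp_def by (simp add: mem_img)

lemma Ord_otp: "(!!y. y eps Y ==> Ord y) ==> Ord (otp Y)"
proof (rule OrdI)
  fix y z assume o: "!!y. y eps Y ==> Ord y"
  show "z eps otp Y" if y: "y eps otp Y" "z eps y"
  proof -
    obtain w where "w eps Y" "y = col Y w" using \<open>y eps otp Y\<close> mem_otp by blast
    then show ?thesis using \<open>z eps y\<close> mem_col[of z Y w] mem_otp[of z] by blast
  qed
  show "Ord y" if y: "y eps otp Y" for y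
  proof -
    obtain w where "w eps Y" "y = col Y w" using y mem_otp by blast
    then show ?thesis using o Ord_col by simp
  qed
qed

lemma otp_sub: "(!!y. y eps Y ==> y eps a) ==> Ord a ==> sub (otp Y) a"
  unfolding sub_def
proof (intro allI impI)
  fix z assume Y: "!!y. y eps Y ==> y eps a" and a: "Ord a" and "z eps otp Y"
  then obtain y where y: "y eps Y" "z = col Y y" unfolding mem_otp by blast
  then have "Ord y" using Y a Ord_in by blast
  then have "z eps y | z = y" using Ord_sub_iff[of z y] Ord_col[of y Y] col_sub[of y Y] y by blast
  then show "z eps a" using y Y a Ord_trans by blast
qed

subsection \<open>Coverings\<close>

text \<open>Since \<open>ap\<close> is total, an arbitrary set can serve as the map. Sizes compared
  in this way compose within ZF and are preserved upwards by end embeddings.\<close>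

definition cov where "cov k X <-> (EX f. ALL x. x eps X --> (EX i. i eps k & ap f i = x))"

lemma D_cov [simp]: "T a ==> T b ==> D (%e. cov (a e) (b e))"
  unfolding cov_def by (simp add: dft_rens)

lemma cov_img: "T (%e. F (e 0)) ==> (!!x. x eps X ==> EX i. i eps k & F i = x) ==> cov k X"
  unfolding cov_def by (rule exI[of _ "lam k F"]) (metis ap_lam)

lemma cov_imgs: "T (%e. F (e 0)) ==> cov k (img k F)"
  by (rule cov_img[of F]) (auto simp: mem_img)

lemma cov_sub: "cov k X ==> sub Y X ==> cov k Y"
  unfolding cov_def sub_def by blast

lemma cov_mono: "cov k X ==> sub k l ==> cov l X"
  unfolding cov_def sub_def by blast

lemma cov_refl [simp]: "cov k k"
  by (rule cov_img[of "%x. x"]) auto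

lemma cov_subset: "sub Y k ==> cov k Y"
  using cov_sub[OF cov_refl] .

lemma cov_trans: "cov k Y ==> cov Y X ==> cov k X"
proof -
  assume "cov k Y" "cov Y X"
  then obtain f g where f: "!!x. x eps Y ==> EX i. i eps k & ap f i = x" and g: "!!x. x eps X ==> EX i. i eps Y & ap g i = x"
    unfolding cov_def by blast
  show ?thesis by (rule cov_img[of "%i. ap g (ap f i)"]) (use f g in \<open>simp, blast\<close>)
qed

lemma Cantor: "~ cov k (Pow k)"
proof
  assume "cov k (Pow k)"
  then obtain f where f: "!!x. sub x k ==> EX i. i eps k & ap f i = x" unfolding cov_def by auto
  let ?d = "sep k (%i. ~ i eps ap f i)"
  have d: "i eps ?d <-> i eps k & ~ i eps ap f i" for i by (rule mem_sep) simp
  then obtain i where "i eps k" "ap f i = ?d" using f[of ?d] by (auto simp: sub_def)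
  then show False using d[of i] by simp
qed

text \<open>A finite set of ordinals has a maximum, by removing the value at the last index. This
  stands in for a theory of finite sets: \<open>om\<close> is infinite because it has no
  maximum.\<close>

lemma cov_om_max:
  assumes "n eps om" "cov n B" "!!x. x eps B ==> Ord x" "b eps B"
  shows "EX m. m eps B & (ALL x. x eps B --> x eps m | x = m)"
proof -
  let ?M = "%B. EX m. m eps B & (ALL x. x eps B --> x eps m | x = m)"
  let ?P = "%n. ALL B. cov n B --> (ALL x. x eps B --> Ord x) --> B ~= emp --> ?M B"
  have "?P n"
  proof (rule om_induct[OF assms(1), of ?P])
    show "D (%e. ?P (e 0))" by simp
    show "?P emp" using ex_mem_iff by (auto simp: cov_def)
    fix n assume IH: "?P n"
    show "?P (suc n)"
    proof (intro allI impI)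
      fix B assume B: "cov (suc n) B" "ALL x. x eps B --> Ord x" "B ~= emp"
      then obtain f where f: "!!x. x eps B ==> EX i. i eps suc n & ap f i = x" unfolding cov_def by blast
      let ?b = "ap f n"
      let ?B = "diff B (sng ?b)"
      have "cov n ?B" unfolding cov_def by (rule exI[of _ f]) (use f in auto)
      show "?M B"
      proof (cases "?B = emp")
        case True
        then have "x = ?b" if "x eps B" for x using that not_mem_emp[of x] by (metis mem_diff mem_sng)
        then show ?thesis using B(3) ex_mem_iff by metis
      next
        case False
        then obtain m where m: "m eps B" "m ~= ?b" "!!x. x eps B ==> x ~= ?b ==> x eps m | x = m"
          using IH[rule_format, OF \<open>cov n ?B\<close>] B(2) by auto
        show ?thesis
        proof (cases "?b eps B & m eps ?b")
          case True
          then show ?thesis using m B(2) Ord_trans by blast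
        next
          case False
          then show ?thesis using m B(2) Ord_linear[of m ?b] by blast
        qed
      qed
    qed
  qed
  then show ?thesis using assms ex_mem_iff by blast
qed

lemma not_cov_om: "n eps om ==> ~ cov n om"
proof
  assume n: "n eps om" "cov n om"
  obtain m where "m eps om" "!!x. x eps om ==> x eps m | x = m"
    using cov_om_max[OF n Ord_om_elem emp_om] by blast
  then have "suc m eps m | suc m = m" by simp
  then show False using not_mem_sym[of m "suc m"] not_mem_self[of m] mem_suc[of m m] by metis
qed

end

section \<open>End embeddings\<close>

text \<open>The image of \<open>j\<close> is transitive in the second model, so bounded notions
  agree. The two uses are the ground model inside its generic extension and the constructible
  universe inside a model.\<close>

locale emb = M: zf E1 + N: zf E2
  for E1 :: "'a => 'a => bool" and E2 :: "'b => 'b => bool" +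
  fixes j :: "'a => 'b"
  assumes j_mem [simp]: "E2 (j x) (j y) <-> E1 x y"
    and j_down: "E2 w (j y) ==> EX x. w = j x"
begin

lemma j_eq [simp]: "j x = j y <-> x = y"
  using M.ext[of x y] by (metis j_mem)

lemma j_eqI:
  assumes "!!z. E1 z a <-> E2 (j z) b" "!!w. E2 w b ==> EX x. w = j x"
  shows "j a = b"
  by (rule N.ext) (metis assms j_down j_mem)

lemma j_all: "(ALL w. E2 w (j a) --> P w) <-> (ALL x. E1 x a --> P (j x))"
  by (metis j_down j_mem)

lemma j_ex: "(EX w. E2 w (j a) & P w) <-> (EX x. E1 x a & P (j x))"
  by (metis j_down j_mem)

lemma j_emp [simp]: "j M.emp = N.emp" by (rule j_eqI) auto
lemma j_upair [simp]: "j (M.upair x y) = N.upair (j x) (j y)" by (rule j_eqI) auto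
lemma j_sng [simp]: "j (M.sng x) = N.sng (j x)" by (rule j_eqI) auto
lemma j_opair [simp]: "j (M.opair x y) = N.opair (j x) (j y)" by (simp add: M.opair_def N.opair_def)
lemma j_un [simp]: "j (M.un x y) = N.un (j x) (j y)" by (rule j_eqI) (auto dest: j_down)
lemma j_diff [simp]: "j (M.diff x y) = N.diff (j x) (j y)" by (rule j_eqI) (auto dest: j_down)
lemma j_inter [simp]: "j (M.inter x y) = N.inter (j x) (j y)" by (rule j_eqI) (auto dest: j_down)
lemma j_suc [simp]: "j (M.suc x) = N.suc (j x)" by (simp add: M.suc_def N.suc_def)
lemma j_sub [simp]: "N.sub (j x) (j y) <-> M.sub x y"
  by (simp add: N.sub_def M.sub_def j_all)
lemma j_trans [simp]: "N.trans (j x) <-> M.trans x"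
  by (simp add: N.trans_def M.trans_def j_all)
lemma j_Ord [simp]: "N.Ord (j x) <-> M.Ord x"
  by (simp add: N.Ord_def M.Ord_def j_all)

lemma j_opair_down: "N.opair u v = j z ==> EX x y. u = j x & v = j y & z = M.opair x y"
proof -
  assume a: "N.opair u v = j z"
  have "E2 (N.upair u u) (j z)" "E2 (N.upair u v) (j z)" by (simp_all flip: a add: N.opair_def)
  then obtain p where p: "N.upair u v = j p" using j_down by metis
  have "E2 u (j p)" "E2 v (j p)" by (simp_all flip: p)
  then obtain x y where "u = j x" "v = j y" using j_down by metis
  then show ?thesis using a by (metis j_eq j_opair)
qed

lemma mem_j_prod: "E2 w (N.prod (j x) (j y)) <-> (EX u v. E1 u x & E1 v y & w = j (M.opair u v))"
proof -
  have "E2 w (N.prod (j x) (j y)) <-> (EX u. E2 u (j x) & (EX v. E2 v (j y) & w = N.opair u v))"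
    unfolding N.mem_prod by blast
  then show ?thesis unfolding j_ex by simp
qed

lemma j_prod [simp]: "j (M.prod x y) = N.prod (j x) (j y)"
proof (rule j_eqI)
  fix z show "E1 z (M.prod x y) <-> E2 (j z) (N.prod (j x) (j y))"
    unfolding M.mem_prod mem_j_prod by (simp del: j_opair)
  fix w assume "E2 w (N.prod (j x) (j y))"
  then show "EX x. w = j x" unfolding mem_j_prod by blast
qed

lemma j_ap [simp]: "j (M.ap f x) = N.ap (j f) (j x)"
proof (rule j_eqI)
  have *: "E2 (N.opair (j x) y) (j f) <-> (EX y'. y = j y' & E1 (M.opair x y') f)" for y
  proof
    assume a: "E2 (N.opair (j x) y) (j f)"
    then obtain z where z: "N.opair (j x) y = j z" using j_down by blast
    then obtain y' where "y = j y'" "z = M.opair x y'" using j_opair_down[OF z] by auto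
    moreover have "E1 z f" using a unfolding z j_mem .
    ultimately show "EX y'. y = j y' & E1 (M.opair x y') f" by auto
  qed (auto simp flip: j_opair)
  fix z show "E1 z (M.ap f x) <-> E2 (j z) (N.ap (j f) (j x))"
    unfolding M.mem_ap N.mem_ap * by auto
  fix w assume "E2 w (N.ap (j f) (j x))"
  then show "EX x. w = j x" unfolding N.mem_ap * by (auto dest: j_down)
qed

lemma j_om [simp]: "j M.om = N.om"
proof (rule N.ext)
  fix z
  have "N.indset (j M.om)"
    unfolding N.indset_def
  proof (intro conjI allI impI)
    show "E2 N.emp (j M.om)" by (simp flip: j_emp)
    fix y assume "E2 y (j M.om)"
    then obtain n where "y = j n" "E1 n M.om" using j_down j_mem by metis
    then show "E2 (N.suc y) (j M.om)" by (simp flip: j_suc)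
  qed
  then have 1: "E2 z N.om ==> E2 z (j M.om)" using N.mem_om by blast
  \<comment> \<open>Induction in the first model does not apply, as membership in
    \<open>N.om\<close> need not be definable there; foundation in the second model supplies a
    minimal counterexample instead.\<close>
  have 2: "E2 z N.om" if "E2 z (j M.om)"
  proof (rule ccontr)
    assume "~ E2 z N.om"
    then have "E2 z (N.diff (j M.om) N.om)" using that by simp
    then obtain y where y: "E2 y (N.diff (j M.om) N.om)" "!!w. E2 w (N.diff (j M.om) N.om) ==> ~ E2 w y"
      using N.found by blast
    then obtain n where n: "y = j n" "E1 n M.om" using j_down j_mem by (metis N.mem_diff)
    then consider "n = M.emp" | m where "E1 m M.om" "n = M.suc m" using M.om_cases by blast
    then show False
    proof cases
      case 1
      then show False using y(1) n by simp
    next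
      case 2
      have "~ E2 (j m) (N.diff (j M.om) N.om)" using y(2)[of "j m"] n 2 by auto
      then have "E2 (j m) N.om" using 2(1) N.mem_diff j_mem by blast
      then show False using y(1) n 2 by simp
    qed
  qed
  show "E2 z (j M.om) <-> E2 z N.om" using 1 2 by blast
qed

lemma j_cov: "M.cov k X ==> N.cov (j k) (j X)"
proof -
  assume "M.cov k X"
  then obtain f where f: "!!x. E1 x X ==> EX i. E1 i k & M.ap f i = x" unfolding M.cov_def by blast
  have "EX i. E2 i (j k) & N.ap (j f) i = w" if w: "E2 w (j X)" for w
  proof -
    obtain x where x: "w = j x" using j_down w by blast
    then obtain i where "E1 i k" "M.ap f i = x" using f w by auto
    then show ?thesis using x by (intro exI[of _ "j i"]) (simp flip: j_ap)
  qed
  then show ?thesis unfolding N.cov_def by blast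
qed

end

context zf
begin

section \<open>Pairing of ordinals\<close>

text \<open>
  Pairs of ordinals are ordered by their maximum first and then lexicographically; \<open>tp\<close> enumerates
  them along the ordinals, each value being the least pair that does not occur before.
\<close>

definition plt where
  "plt a b c d <-> un a b eps un c d | un a b = un c d & (a eps c | a = c & b eps d)"

definition lp where
  "lp Q = (let m = Lst (%m. EX a b. Ord a & Ord b & un a b = m & Q a b);
               a = Lst (%a. EX b. Ord b & un a b = m & Q a b)
           in opair a (Lst (%b. un a b = m & Q a b)))"

definition tpF where "tpF p x f = lp (%a b. ~ (EX y. y eps x & ap f y = opair a b))"
definition tp where "tp = rec tpF emp"
definition pl where "pl x = fs (tp x)"
definition prr where "prr x = sn (tp x)"
definition pr where "pr a b = Lst (%x. tp x = opair a b)"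

lemma T_lp:
  assumes "D (%e. Q (%i. e (Suc (Suc i))) (e 1) (e 0))"
  shows "T (%e. lp (Q e))"
  unfolding lp_def Let_def by (simp add: dfn_binder2[OF assms])

lemma T_tpF: "T (%e. tpF (e 0) (e 1) (e 2))"
  unfolding tpF_def by (rule T_lp) simp

lemma T_tp [simp]: "T a ==> T (%e. tp (a e))"
  unfolding tp_def by (rule T_rec[OF T_tpF]) simp_all
lemma T_pl [simp]: "T a ==> T (%e. pl (a e))" unfolding pl_def by simp
lemma T_prr [simp]: "T a ==> T (%e. prr (a e))" unfolding prr_def by simp
lemma T_pr [simp]: "T a ==> T b ==> T (%e. pr (a e) (b e))" unfolding pr_def by (simp add: dft_rens)

lemma un_Ord: "Ord a ==> Ord b ==> un a b = (if a eps b then b else a)"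
proof (rule ext)
  fix z assume "Ord a" "Ord b"
  then show "z eps un a b <-> z eps (if a eps b then b else a)"
    using Ord_not_mem[of a b] Ord_trans[of b a z] by (auto simp: sub_def)
qed

lemma Ord_un [simp]: "Ord a ==> Ord b ==> Ord (un a b)"
  by (simp add: un_Ord)

lemma plt_linear: "Ord a ==> Ord b ==> Ord c ==> Ord d ==> plt a b c d | a = c & b = d | plt c d a b"
  unfolding plt_def using Ord_linear[of "un a b" "un c d"] Ord_linear[of a c] Ord_linear[of b d] by force

lemma lp:
  assumes D: "D (%e. Q (e 0) (e 1))" and ab: "Ord a" "Ord b" "Q a b"
  obtains c d where "lp Q = opair c d" "Ord c" "Ord d" "Q c d"
    "!!a b. Ord a ==> Ord b ==> Q a b ==> ~ plt a b c d"
proof -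
  note [simp] = dfn_app2[OF D]
  let ?M = "%m. EX a b. Ord a & Ord b & un a b = m & Q a b"
  let ?m = "Lst ?M"
  have m: "?M ?m" by (rule Lst_prop[of ?M "un a b"]) (use ab in auto)
  have m': "~ un a b eps ?m" if "Ord a" "Ord b" "Q a b" for a b
    by (rule Lst_least[of ?M]) (use that in auto)
  let ?A = "%a. EX b. Ord b & un a b = ?m & Q a b"
  obtain a0 where a0: "Ord a0" "?A a0" using m by blast
  have a: "?A (Lst ?A)" "Ord (Lst ?A)"
    by (rule Lst_prop[of ?A a0] Lst_Ord[of ?A a0]; use a0 in simp)+
  have a': "~ a eps Lst ?A" if "Ord a" "?A a" for a
    by (rule Lst_least[of ?A]) (use that in simp_all)
  let ?B = "%b. un (Lst ?A) b = ?m & Q (Lst ?A) b"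
  obtain b0 where b0: "Ord b0" "?B b0" using a by blast
  have b: "?B (Lst ?B)" "Ord (Lst ?B)"
    by (rule Lst_prop[of ?B b0] Lst_Ord[of ?B b0]; use b0 in simp)+
  have b': "~ b eps Lst ?B" if "Ord b" "?B b" for b
    by (rule Lst_least[of ?B]) (use that in simp_all)
  show thesis
  proof (rule that[of "Lst ?A" "Lst ?B"])
    show "lp Q = opair (Lst ?A) (Lst ?B)" by (simp add: lp_def Let_def)
    fix a b assume "Ord a" "Ord b" "Q a b"
    then show "~ plt a b (Lst ?A) (Lst ?B)"
      unfolding plt_def using m'[of a b] a'[of a] b'[of b] b(1) by auto
  qed (use a b in blast)+
qed

lemma tp_lp: "tp x = lp (%a b. ~ (EX y. y eps x & tp y = opair a b))"
proof -
  have "tp x = tpF emp x (lam x tp)" unfolding tp_def by (rule rec_eq[OF T_tpF])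
  also have "\<dots> = lp (%a b. ~ (EX y. y eps x & tp y = opair a b))"
  proof -
    have "(EX y. y eps x & ap (lam x tp) y = z) <-> (EX y. y eps x & tp y = z)" for z
      by (auto simp: ap_lam)
    then show ?thesis by (simp add: tpF_def)
  qed
  finally show ?thesis .
qed

lemma tp_props:
  shows tp_eq: "tp x = opair (pl x) (prr x)" and Ord_pl: "Ord (pl x)" and Ord_prr: "Ord (prr x)"
    and tp_new: "y eps x ==> tp y ~= tp x"
    and tp_least: "Ord a ==> Ord b ==> plt a b (pl x) (prr x) ==> EX y. y eps x & tp y = opair a b"
proof -
  let ?Q = "%a b. ~ (EX y. y eps x & tp y = opair a b)"
  obtain w where w: "Ord w" "~ w eps img x (%y. fs (tp y))" using not_all_Ord by blast
  then have Qa: "?Q w emp" by (force simp: mem_img)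
  have DQ: "D (%e. ?Q (e 0) (e 1))" by simp
  obtain c d where cd: "lp ?Q = opair c d" "Ord c" "Ord d" "?Q c d"
    "!!a b. Ord a ==> Ord b ==> ?Q a b ==> ~ plt a b c d"
    by (rule lp[of ?Q w emp, OF DQ w(1) Ord_emp Qa]) blast
  have t: "tp x = opair c d" unfolding tp_lp[of x] by (rule cd(1))
  then have e: "pl x = c" "prr x = d" by (simp_all add: pl_def prr_def)
  show "tp x = opair (pl x) (prr x)" "Ord (pl x)" "Ord (prr x)" using t cd e by simp_all
  show "y eps x ==> tp y ~= tp x" using cd(4) t by auto
  show "Ord a ==> Ord b ==> plt a b (pl x) (prr x) ==> EX y. y eps x & tp y = opair a b"
    using cd(5)[of a b] e by blast
qed

lemma tp_inj: "Ord x ==> Ord y ==> tp x = tp y ==> x = y"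
  using Ord_linear[of x y] tp_new[of x y] tp_new[of y x] by auto

text \<open>If the pair never occurred, every ordinal would be sent to an earlier pair; these all
  lie in one set, and the ordinals would inject into a set.\<close>

lemma tp_surj:
  assumes "Ord a" "Ord b"
  shows "EX x. Ord x & tp x = opair a b"
proof (rule ccontr)
  assume n: "~ ?thesis"
  let ?S = "suc (un a b)"
  have S: "tp x eps prod ?S ?S" if x: "Ord x" for x
  proof -
    have "~ plt a b (pl x) (prr x)" using tp_least[OF assms] x n Ord_in by blast
    moreover have "~ (a = pl x & b = prr x)" using n x tp_eq[of x] by auto
    ultimately have "plt (pl x) (prr x) a b" using plt_linear[OF assms Ord_pl[of x] Ord_prr[of x]] by blast
    then have u: "un (pl x) (prr x) eps ?S" by (auto simp: plt_def)
    have o: "Ord ?S" using assms by simp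
    have "pl x = un (pl x) (prr x) | pl x eps un (pl x) (prr x)" "prr x = un (pl x) (prr x) | prr x eps un (pl x) (prr x)"
      using Ord_linear[OF Ord_pl[of x] Ord_prr[of x]] by (auto simp: un_Ord[OF Ord_pl Ord_prr])
    then have "pl x eps ?S" "prr x eps ?S" using Ord_trans[OF o u] u by auto
    then show ?thesis using tp_eq[of x] by simp
  qed
  let ?I = "img (prod ?S ?S) (%z. Lst (%x. tp x = z))"
  obtain x where x: "Ord x" "~ x eps ?I" using not_all_Ord by blast
  have "Lst (%y. tp y = tp x) = x"
    by (rule tp_inj) (use x Lst_Ord[of "%y. tp y = tp x" x] Lst_prop[of "%y. tp y = tp x" x] in simp_all)
  then have "x eps ?I" using S[OF x(1)] by (subst mem_img) auto
  then show False using x by simp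
qed

lemma pr_props:
  assumes "Ord a" "Ord b"
  shows Ord_pr: "Ord (pr a b)" and pl_pr: "pl (pr a b) = a" and prr_pr: "prr (pr a b) = b"
proof -
  obtain x where x: "Ord x" "tp x = opair a b" using tp_surj[OF assms] by blast
  have "tp (pr a b) = opair a b" unfolding pr_def by (rule Lst_prop[of _ x]) (use x in simp_all)
  then show "pl (pr a b) = a" "prr (pr a b) = b" by (simp_all add: pl_def prr_def)
  show "Ord (pr a b)" unfolding pr_def by (rule Lst_Ord[of _ x]) (use x in simp_all)
qed

lemma pr_pl_prr: "Ord x ==> pr (pl x) (prr x) = x"
  by (rule tp_inj) (simp_all add: Ord_pr Ord_pl Ord_prr tp_eq[of x] tp_eq[of "pr (pl x) (prr x)"] pl_pr prr_pr)

lemma mem_pr: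
  assumes "Ord a" "Ord b"
  shows "z eps pr a b <-> (EX c d. Ord c & Ord d & plt c d a b & z = pr c d)"
proof
  assume z: "z eps pr a b"
  then have oz: "Ord z" using Ord_in Ord_pr[OF assms] by blast
  have ne: "tp z ~= tp (pr a b)" using tp_new z by blast
  have t: "tp (pr a b) = opair a b" using tp_eq[of "pr a b"] assms by (simp add: pl_pr prr_pr)
  have "~ plt a b (pl z) (prr z)"
  proof
    assume "plt a b (pl z) (prr z)"
    then obtain y where "y eps z" "tp y = opair a b" using tp_least[OF assms] by blast
    moreover from this have "y eps pr a b" using z Ord_trans[OF Ord_pr[OF assms]] by blast
    ultimately show False using t tp_new[of y "pr a b"] by simp
  qed
  moreover have "~ (a = pl z & b = prr z)" using ne t tp_eq[of z] by auto
  ultimately have "plt (pl z) (prr z) a b" using plt_linear[OF assms Ord_pl[of z] Ord_prr[of z]] by blast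
  then show "EX c d. Ord c & Ord d & plt c d a b & z = pr c d"
    using pr_pl_prr[OF oz] Ord_pl[of z] Ord_prr[of z] by (intro exI[of _ "pl z"] exI[of _ "prr z"]) simp
next
  assume "EX c d. Ord c & Ord d & plt c d a b & z = pr c d"
  then obtain c d where cd: "Ord c" "Ord d" "plt c d a b" "z = pr c d" by blast
  have "plt c d (pl (pr a b)) (prr (pr a b))" using cd assms by (simp add: pl_pr prr_pr)
  then obtain y where y: "y eps pr a b" "tp y = opair c d" using tp_least[OF cd(1,2)] by blast
  then have "y = z" using tp_inj[of y z] cd tp_eq[of z] Ord_in[OF Ord_pr[OF assms]]
    by (simp add: pl_pr prr_pr Ord_pr)
  then show "z eps pr a b" using y by simp
qed

text \<open>Induction on the maximum m: for y < m the diagonal pair (y, y) precedes (a, b), and its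
  index is at least y.\<close>

lemma sub_pr:
  assumes "Ord a" "Ord b"
  shows "sub (un a b) (pr a b)"
proof -
  let ?P = "%m. ALL a b. Ord a & Ord b & un a b = m --> sub m (pr a b)"
  have "?P (un a b)"
  proof (rule eps_induct[where P = ?P])
    show "D (%e. ?P (e 0))" by simp
    fix m assume IH: "!!y. y eps m ==> ?P y"
    show "?P m"
    proof (intro allI impI)
      fix a b assume ab: "Ord a & Ord b & un a b = m"
      have "y eps pr a b" if y: "y eps m" for y
      proof -
        have o: "Ord y" using ab y Ord_in Ord_un by blast
        have yy: "un y y = y" by (rule ext) simp
        have 1: "sub y (pr y y)" using IH[OF y] o yy by blast
        have "plt y y a b" using y ab yy by (simp add: plt_def)
        then have 2: "pr y y eps pr a b" using mem_pr ab o by blast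
        show ?thesis using 1 2 Ord_sub_iff[OF o Ord_pr[OF o o]] Ord_trans[OF Ord_pr, of a b "pr y y" y] ab by auto
      qed
      then show "sub m (pr a b)" by (simp add: sub_def)
    qed
  qed
  then show ?thesis using assms by blast
qed

text \<open>Strictness depends on a nonzero first component: the index of (0, \<omega>) is \<omega>
  itself. This is why the tags of operations start at 1.\<close>

lemma pr_mem_pr:
  assumes "Ord i" "Ord c" "i ~= emp"
  shows "c eps pr i c"
proof -
  have ei: "emp eps i" using Ord_linear[OF assms(1) Ord_emp] assms(3) by auto
  have "plt emp c i c"
    using ei assms Ord_linear[of c i] Ord_linear[OF Ord_emp assms(2)] not_mem_sym[of i c] by (auto simp: plt_def un_Ord)
  then have 1: "pr emp c eps pr i c" using mem_pr assms Ord_emp by blast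
  have "sub (un emp c) (pr emp c)" using sub_pr assms Ord_emp by blast
  moreover have "un emp c = c" by (rule ext) simp
  ultimately have "c eps pr emp c | c = pr emp c" using Ord_sub_iff[OF assms(2) Ord_pr[OF Ord_emp assms(2)]] by simp
  then show ?thesis
  proof
    assume "c eps pr emp c"
    then show ?thesis by (rule Ord_trans[OF Ord_pr[OF assms(1,2)] 1])
  next
    assume "c = pr emp c"
    then show ?thesis using 1 by metis
  qed
qed

definition icard where "icard k <-> Ord k & sub om k & (ALL a. a eps k --> ~ cov a k)"

lemma D_icard [simp]: "T a ==> D (%e. icard (a e))"
  unfolding icard_def by (simp add: dft_rens)

lemma icard_om [simp]: "icard om"
  unfolding icard_def using not_cov_om by simp

text \<open>Hilbert's hotel: 0 goes to the new point and each positive integer to its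
  predecessor.\<close>

lemma cov_suc: "sub om x ==> cov x (suc x)"
proof -
  assume x: "sub om x"
  let ?F = "%i. if i = emp then x else if i eps om then Union i else i"
  have U: "Union (suc n) = n" if "n eps om" for n
    using Ord_trans[OF Ord_om_elem[OF that]] by (intro ext) auto
  show ?thesis
  proof (rule cov_img[of ?F])
    show "T (%e. ?F (e 0))" by simp
    fix y assume y: "y eps suc x"
    show "EX i. i eps x & ?F i = y"
    proof (cases "y = x")
      case True
      then show ?thesis using x by (intro exI[of _ emp]) (auto simp: sub_def)
    next
      case False
      show ?thesis
      proof (cases "y eps om")
        case True
        then show ?thesis using x U by (intro exI[of _ "suc y"]) (auto simp: sub_def)
      next
        case n: False
        then have "y ~= emp" using emp_om by blast
        then show ?thesis using y False n by (intro exI[of _ y]) auto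
      qed
    qed
  qed
qed

lemma suc_icard: "icard k ==> x eps k ==> suc x eps k"
proof (rule ccontr)
  assume k: "icard k" "x eps k" "~ suc x eps k"
  then have o: "Ord k" "Ord x" using Ord_in by (auto simp: icard_def)
  have "suc x = k" using k o Ord_linear[of "suc x" k] not_mem_sym[of k x] by (metis Ord_suc mem_suc not_mem_self)
  moreover have "sub om x"
  proof (rule ccontr)
    assume "~ sub om x"
    then have "x eps om" using Ord_not_mem[OF o(2) Ord_om] by blast
    then have "k eps om" using \<open>suc x = k\<close> suc_om by metis
    then have "k eps k" using k(1) by (auto simp: icard_def sub_def)
    then show False by simp
  qed
  ultimately show False using k cov_suc by (auto simp: icard_def)
qed

lemma plt_bound:
  assumes "Ord a" "Ord b" "Ord c" "Ord d" "plt c d a b"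
  shows "c eps suc (un a b)" "d eps suc (un a b)"
proof -
  have "un c d eps suc (un a b)" using assms(5) by (auto simp: plt_def)
  moreover have "c = un c d | c eps un c d" "d = un c d | d eps un c d"
    using Ord_linear[of c d] assms by (auto simp: un_Ord)
  moreover have "Ord (suc (un a b))" using assms by simp
  ultimately show "c eps suc (un a b)" "d eps suc (un a b)" using Ord_trans by metis+
qed

text \<open>Otherwise \<omega> would be the index of a pair of natural numbers. Every such pair is
  either first or has an immediate predecessor, whereas \<omega> is neither zero nor a
  successor.\<close>

lemma pr_om: "a eps om ==> b eps om ==> pr a b eps om"
proof (rule ccontr)
  assume ab: "a eps om" "b eps om" "~ pr a b eps om"
  then have oab: "Ord a" "Ord b" using Ord_om_elem by auto
  define c d where "c = pl om" and "d = prr om"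
  have ocd: "Ord c" "Ord d" and p: "pr c d = om"
    unfolding c_def d_def using Ord_pl Ord_prr pr_pl_prr Ord_om by auto
  have "om eps pr a b | om = pr a b"
    using ab(3) Ord_linear[of om "pr a b"] Ord_pr[OF oab] Ord_om by blast
  then have "plt c d a b | (c = a & d = b)"
    unfolding mem_pr[OF oab] using p ocd oab by (metis pl_pr prr_pr)
  then have cd1: "c eps suc (un a b) & d eps suc (un a b) | (c = a & d = b)"
    using plt_bound[OF oab ocd] by blast
  moreover have "suc (un a b) eps om" using ab(1,2) oab by (simp add: un_Ord)
  ultimately have cd: "c eps om" "d eps om" using ab(1,2) Ord_trans[OF Ord_om] by blast+
  have "EX c' d'. Ord c' & Ord d' & plt c' d' c d & (ALL u v. Ord u & Ord v & plt u v c d --> ~ plt c' d' u v)"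
  proof -
    have un_self: "un x x = x" and un_emp: "un x emp = x" "un emp x = x" for x by (rule ext, simp)+
    \<comment> \<open>With maximum m the pairs run (0, m), ..., (m-1, m), (m, 0), ..., (m, m). The
      predecessor of (m, 0) is (m-1, m), that of (0, m) is (m-1, m-1); otherwise the coordinate that
      increased last drops by one, the first if it is below the second and else the second.\<close>
    consider "d = emp" "c = emp" | c' where "d = emp" "c = suc c'" "c' eps om"
      | d' where "d = suc d'" "d' eps om" "c = emp" | d' c' where "d = suc d'" "d' eps om" "c = suc c'" "c' eps om" "c eps d"
      | d' where "d = suc d'" "d' eps om" "~ c eps d"
      using om_cases[OF cd(1)] om_cases[OF cd(2)] by blast
    then show ?thesis
    proof cases
      case 1
      have "~ plt x y emp emp" for x y by (simp add: plt_def un_self)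
      then have "~ z eps pr emp emp" for z using mem_pr[OF Ord_emp Ord_emp] by blast
      then have "om = emp" using p 1 ext[of om emp] by auto
      then show ?thesis using emp_om by simp
    next
      case 2
      then have o: "Ord c'" using Ord_om_elem by blast
      have e: "un c' c = c" "un c d = c" using o 2 by (simp_all add: un_Ord)
      show ?thesis
      proof (intro exI conjI allI impI)
        show "Ord c'" "Ord c" using o ocd by simp_all
        show "plt c' c c d" unfolding plt_def e using 2 by simp
        fix u v assume "Ord u & Ord v & plt u v c d"
        then have "un u v eps c | un u v = c & (u eps c' | u = c')"
          unfolding plt_def e using 2 by auto
        moreover have "c eps v ==> c eps un u v" by simp
        ultimately show "~ plt c' c u v"
          unfolding plt_def e using not_mem_sym[of "un u v" c] not_mem_self[of c] not_mem_self[of c'] not_mem_sym[of u c'] by metis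
      qed
    next
      case 3
      then have o: "Ord d'" using Ord_om_elem by blast
      have e: "un c d = d" "un d' d' = d'" using 3 un_emp un_self by auto
      show ?thesis
      proof (intro exI conjI allI impI)
        show "Ord d'" "Ord d'" using o by simp_all
        show "plt d' d' c d" unfolding plt_def e using 3 by simp
        fix u v assume "Ord u & Ord v & plt u v c d"
        then have "un u v eps d | un u v = d & u = emp & v eps d"
          unfolding plt_def e using 3 by auto
        then have "un u v eps d' | un u v = d'" using 3 un_emp(2)[of v] not_mem_self[of d] by auto
        moreover have "d' eps u | d' eps v ==> d' eps un u v" by simp
        ultimately show "~ plt d' d' u v"
          unfolding plt_def e using not_mem_sym[of "un u v" d'] not_mem_self[of d'] by metis
      qed
    next
      case 4
      then have o: "Ord c'" "Ord d'" "Ord c" "Ord d" using Ord_om_elem cd by blast+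
      have cd': "c' eps d" using 4 Ord_trans[OF o(4)] by auto
      show ?thesis
      proof (intro exI conjI allI impI)
        show "Ord c'" "Ord d" using o by simp_all
        have e: "un c' d = d" "un c d = d" using o cd' 4 by (simp_all add: un_Ord)
        show "plt c' d c d" unfolding plt_def e using 4 by simp
        fix u v assume uv: "Ord u & Ord v & plt u v c d"
        then have "un u v eps d | un u v = d & (u eps c | u = c & v eps d)" unfolding plt_def e by blast
        moreover have "~ (un u v = d & u = c & v eps d)"
          using uv 4(5) un_Ord[of u v] not_mem_self[of d] by (auto split: if_splits)
        moreover have "v = d" if "un u v = d" "u = c'"
          using that uv cd' un_Ord[of u v] not_mem_self[of d] by (auto split: if_splits)
        moreover note e(1)
        moreover have "u eps c <-> u eps c' | u = c'" using 4 by simp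
        ultimately show "~ plt c' d u v"
          unfolding plt_def using not_mem_sym[of "un u v" d] not_mem_self not_mem_sym[of u c'] by metis
      qed
    next
      case 5
      then have o: "Ord d'" "Ord c" "Ord d" using Ord_om_elem cd by blast+
      have d': "d' eps c | d' = c" "~ c eps d'" using 5 o Ord_linear[of c d'] by auto
      have "un c d = c" using o 5 by (simp add: un_Ord)
      have "un c d' = c" using o d' by (simp add: un_Ord)
      show ?thesis
      proof (intro exI conjI allI impI)
        show "Ord c" "Ord d'" using o by simp_all
        show "plt c d' c d" unfolding plt_def \<open>un c d = c\<close> \<open>un c d' = c\<close> using 5 by simp
        fix u v assume uv: "Ord u & Ord v & plt u v c d"
        then have "un u v eps c | un u v = c & (u eps c | u = c & (v eps d' | v = d'))"
          unfolding plt_def \<open>un c d = c\<close> using 5 by simp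
        then show "~ plt c d' u v"
          unfolding plt_def \<open>un c d' = c\<close> using not_mem_sym[of "un u v" c] not_mem_self not_mem_sym[of u c] not_mem_sym[of v d'] by metis
      qed
    qed
  qed
  then obtain c' d' where p': "Ord c'" "Ord d'" "plt c' d' c d"
    "!!u v. Ord u ==> Ord v ==> plt u v c d ==> ~ plt c' d' u v" by blast
  have "pr c' d' eps om" using mem_pr[OF ocd, of "pr c' d'"] p p' by auto
  \<comment> \<open>The successor of the predecessor's index is still below \<omega>, hence indexes
    a pair strictly in between.\<close>
  then have s: "suc (pr c' d') eps om" by simp
  then obtain u v where uv: "Ord u" "Ord v" "plt u v c d" "suc (pr c' d') = pr u v"
    using mem_pr[OF ocd, of "suc (pr c' d')"] unfolding p by blast
  have "pr c' d' eps pr u v" by (simp flip: uv(4))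
  then obtain x y where xy: "Ord x" "Ord y" "plt x y u v" "pr c' d' = pr x y"
    using mem_pr[OF uv(1,2), of "pr c' d'"] by blast
  have "c' = x" "d' = y"
    using arg_cong[OF xy(4), of pl] arg_cong[OF xy(4), of prr] p'(1,2) xy(1,2) by (simp_all add: pl_pr prr_pr)
  then show False using p'(4)[OF uv(1-3)] xy by simp
qed

lemma cov_prod_if_closed:
  assumes "!!a b. a eps k ==> b eps k ==> pr a b eps k" "Ord k" "cov k X" "cov k Y"
  shows "cov k (prod X Y)"
proof -
  obtain f g where fg: "!!x. x eps X ==> EX i. i eps k & ap f i = x" "!!x. x eps Y ==> EX i. i eps k & ap g i = x"
    using assms(3,4) unfolding cov_def by blast
  show ?thesis
  proof (rule cov_img[of "%z. opair (ap f (pl z)) (ap g (prr z))"])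
    fix z assume "z eps prod X Y"
    then obtain x y where z: "x eps X" "y eps Y" "z = opair x y" by (auto simp: mem_prod)
    then obtain a b where ab: "a eps k" "ap f a = x" "b eps k" "ap g b = y" using fg by metis
    then have "Ord a" "Ord b" using Ord_in assms(2) by blast+
    then show "EX i. i eps k & opair (ap f (pl i)) (ap g (prr i)) = z"
      using ab z assms(1) by (intro exI[of _ "pr a b"]) (simp add: pl_pr prr_pr)
  qed simp
qed

text \<open>Hessenberg's argument by induction on \<open>k\<close>: if the index of (a, b) reached
  \<open>k\<close>, then \<open>k\<close> would be covered by m \<times> m for some m <
  \<open>k\<close>. The least ordinal covering m is a smaller infinite cardinal, closed under
  pairing by induction, and would cover \<open>k\<close>.\<close>

lemma pr_icard:
  assumes "icard k" "a eps k" "b eps k"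
  shows "pr a b eps k"
proof -
  let ?P = "%k. icard k --> (ALL a b. a eps k & b eps k --> pr a b eps k)"
  have "?P k"
  proof (rule eps_induct[where P = ?P])
    show "D (%e. ?P (e 0))" by simp
    fix k assume IH: "!!y. y eps k ==> ?P y"
    show "?P k"
    proof (intro impI allI, rule ccontr)
      fix a b assume k: "icard k" and ab: "a eps k & b eps k" and n: "~ pr a b eps k"
      have o: "Ord k" "Ord a" "Ord b" using k ab Ord_in by (auto simp: icard_def)
      let ?m = "suc (un a b)"
      have om: "Ord ?m" using o by simp
      have mk: "?m eps k" using suc_icard[OF k] ab o by (simp add: un_Ord)
      have "sub k (pr a b)" using Ord_not_mem[OF Ord_pr[OF o(2,3)] o(1)] n by blast
      have c1: "cov (prod ?m ?m) k"
      proof (rule cov_img[of "%z. pr (fs z) (sn z)"])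
        fix z assume "z eps k"
        then have "z eps pr a b" using \<open>sub k (pr a b)\<close> by (simp add: sub_def)
        then obtain c d where cd: "Ord c" "Ord d" "plt c d a b" "z = pr c d" using mem_pr o by blast
        then show "EX i. i eps prod ?m ?m & pr (fs i) (sn i) = z"
          using plt_bound[OF o(2,3) cd(1,2,3)] by (intro exI[of _ "opair c d"]) simp
      qed simp
      have infm: "sub om ?m"
      proof (rule ccontr)
        assume "~ sub om ?m"
        then have "?m eps om" using Ord_not_mem[OF om Ord_om] by blast
        then have "un a b eps om" using Ord_trans[OF Ord_om] by simp
        moreover have "a = un a b | a eps un a b" "b = un a b | b eps un a b"
          using Ord_linear[of a b] o by (auto simp: un_Ord)
        ultimately have "a eps om" "b eps om" using Ord_trans[OF Ord_om] by metis+
        then have "pr a b eps om" by (rule pr_om)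
        then show False using k n by (auto simp: icard_def sub_def)
      qed
      let ?C = "%m. cov m ?m"
      let ?\<mu> = "Lst ?C"
      have \<mu>: "Ord ?\<mu>" "?C ?\<mu>" "sub ?\<mu> ?m"
        by (rule Lst_Ord[of ?C ?m] Lst_prop[of ?C ?m] Lst_sub[of ?C ?m]; simp add: om)+
      have l: "~ ?C y" if "y eps ?\<mu>" for y
        using Lst_least[of ?C y] Ord_in[OF \<mu>(1) that] that by auto
      have "sub om ?\<mu>"
      proof (rule ccontr)
        assume "~ sub om ?\<mu>"
        then have "?\<mu> eps om" using Ord_not_mem[OF \<mu>(1) Ord_om] by blast
        then show False using not_cov_om cov_sub[OF \<mu>(2) infm] by blast
      qed
      then have ic: "icard ?\<mu>"
        unfolding icard_def using \<mu> l cov_trans by blast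
      have mk': "?\<mu> eps k" using \<mu>(3) mk Ord_sub_iff[OF \<mu>(1) om] Ord_trans[OF o(1) mk, of ?\<mu>] by auto
      have cl: "pr a b eps ?\<mu>" if "a eps ?\<mu>" "b eps ?\<mu>" for a b
        using IH[OF mk'] ic that by blast
      have "cov ?\<mu> (prod ?m ?m)" by (rule cov_prod_if_closed[OF cl \<mu>(1,2,2)])
      then have "cov ?\<mu> k" using c1 cov_trans by blast
      then show False using k mk' by (auto simp: icard_def)
    qed
  qed
  then show ?thesis using assms by blast
qed

lemma cov_prod: "icard k ==> cov k X ==> cov k Y ==> cov k (prod X Y)"
  by (rule cov_prod_if_closed) (auto intro: pr_icard simp: icard_def)

text \<open>The order of pairs is expressed through the order of their components, which the
  collapse preserves. Condensation uses this to follow indices.\<close>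

lemma col_pr:
  assumes X: "!!x. x eps X ==> Ord x & pl x eps X & prr x eps X" "!!a b. a eps X ==> b eps X ==> pr a b eps X"
    and x: "x eps X"
  shows "col X x = pr (col X (pl x)) (col X (prr x))"
proof -
  let ?s = "col X"
  have o: "Ord x" if "x eps X" for x using X that by blast
  have so: "Ord (?s x)" if "x eps X" for x using o that Ord_col by blast
  have un_s: "un (?s a) (?s b) = ?s (un a b) & un a b eps X" if "a eps X" "b eps X" for a b
  proof (cases "a eps b")
    case True
    then show ?thesis using that o so col_mono[of a b X] by (simp add: un_Ord)
  next
    case False
    then have "~ ?s a eps ?s b" using col_mem_Ord[of X a b] that o by blast
    then show ?thesis using False that o so by (simp add: un_Ord)
  qed
  have mem_s: "?s a eps ?s b <-> a eps b" if "a eps X" "b eps X" for a b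
    using col_mono[of a b X] col_mem_Ord[of X a b] that o by blast
  have eq_s: "?s a = ?s b <-> a = b" if "a eps X" "b eps X" for a b
    using col_inj_Ord[of X a b] that o by blast
  have plt_s: "plt (?s a) (?s b) (?s c) (?s d) <-> plt a b c d" if "a eps X" "b eps X" "c eps X" "d eps X" for a b c d
    unfolding plt_def using un_s[OF that(1,2)] un_s[OF that(3,4)] mem_s eq_s that by simp
  have "x eps X --> ?s x = pr (?s (pl x)) (?s (prr x))"
  proof (rule eps_induct[where P = "%x. x eps X --> ?s x = pr (?s (pl x)) (?s (prr x))"])
    fix x assume IH: "!!y. y eps x ==> y eps X --> ?s y = pr (?s (pl y)) (?s (prr y))"
    show "x eps X --> ?s x = pr (?s (pl x)) (?s (prr x))"
    proof
      assume x: "x eps X"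
      have px: "pl x eps X" "prr x eps X" using X x by auto
      show "?s x = pr (?s (pl x)) (?s (prr x))"
      proof (rule ext)
        fix z
        have "z eps ?s x <-> (EX y. y eps x & y eps X & z = ?s y)" by (rule mem_col)
        also have "\<dots> <-> (EX c d. c eps X & d eps X & plt c d (pl x) (prr x) & z = pr (?s c) (?s d))"
        proof
          assume "EX y. y eps x & y eps X & z = ?s y"
          then obtain y where y: "y eps x" "y eps X" "z = ?s y" by blast
          have "y eps pr (pl x) (prr x)" using y x o pr_pl_prr by simp
          then obtain c d where cd: "Ord c" "Ord d" "plt c d (pl x) (prr x)" "y = pr c d"
            using mem_pr[OF Ord_pl Ord_prr] by blast
          then have e: "pl y = c" "prr y = d" using pl_pr prr_pr by auto
          have "c eps X" "d eps X" using X(1)[OF y(2)] e by auto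
          moreover have "z = pr (?s c) (?s d)" using IH[OF y(1)] y(2,3) e by simp
          ultimately show "EX c d. c eps X & d eps X & plt c d (pl x) (prr x) & z = pr (?s c) (?s d)"
            using cd(3) by blast
        next
          assume "EX c d. c eps X & d eps X & plt c d (pl x) (prr x) & z = pr (?s c) (?s d)"
          then obtain c d where cd: "c eps X" "d eps X" "plt c d (pl x) (prr x)" "z = pr (?s c) (?s d)" by blast
          have "pr c d eps pr (pl x) (prr x)" using cd o mem_pr[OF Ord_pl Ord_prr] by blast
          then have 1: "pr c d eps x" using pr_pl_prr x o by simp
          have 2: "pr c d eps X" using X(2) cd by blast
          have "z = ?s (pr c d)" using IH[OF 1] 2 cd o by (simp add: pl_pr prr_pr)
          then show "EX y. y eps x & y eps X & z = ?s y" using 1 2 by blast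
        qed
        also have "\<dots> <-> z eps pr (?s (pl x)) (?s (prr x))"
        proof
          assume "EX c d. c eps X & d eps X & plt c d (pl x) (prr x) & z = pr (?s c) (?s d)"
          then show "z eps pr (?s (pl x)) (?s (prr x))"
            using mem_pr[OF so[OF px(1)] so[OF px(2)], of z] plt_s[OF _ _ px] so by blast
        next
          assume "z eps pr (?s (pl x)) (?s (prr x))"
          then obtain c d where cd: "Ord c" "Ord d" "plt c d (?s (pl x)) (?s (prr x))" "z = pr c d"
            using mem_pr[OF so[OF px(1)] so[OF px(2)]] by blast
          have u: "un (pl x) (prr x) eps X" "un (?s (pl x)) (?s (prr x)) = ?s (un (pl x) (prr x))"
            using un_s[OF px] by auto
          have low: "EX c'. c' eps X & c = ?s c'" if "c eps suc (un (?s (pl x)) (?s (prr x)))" for c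
            using that u mem_col[of c X "un (pl x) (prr x)"] by auto
          obtain c' d' where "c' eps X" "c = ?s c'" "d' eps X" "d = ?s d'"
            using low plt_bound[OF so[OF px(1)] so[OF px(2)] cd(1,2,3)] by blast
          then show "EX c d. c eps X & d eps X & plt c d (pl x) (prr x) & z = pr (?s c) (?s d)"
            using cd plt_s[OF _ _ px] by blast
        qed
        finally show "z eps ?s x <-> z eps pr (?s (pl x)) (?s (prr x))" .
      qed
    qed
  qed simp
  then show ?thesis using x by blast
qed

end

section \<open>Sets constructible from a set\<close>

text \<open>Freezes the odd arguments as parameters; specializing a definable relation to fixed
  values rests on it.\<close>

lemma dfn_params:
  assumes "dfn E P"
  shows "dfn E (%e. P (mrg c e))"
proof -
  obtain q d where q: "!!e. P e = sat E (mrg d e) q" using assms unfolding dfn_def by blast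
  let ?f = "%n. if even n then (if even (n div 2) then 2 * (n div 2 div 2) else 2 * (2 * (n div 2 div 2)) + 1)
    else 2 * (2 * (n div 2) + 1) + 1"
  have "mrg (mrg d c) e \<circ> ?f = mrg d (mrg c e)" for e
    by (auto simp: fun_eq_iff mrg_def elim!: oddE)
  then have "P (mrg c e) = sat E (mrg (mrg d c) e) (ren ?f q)" for e
    unfolding q sat_on_ren by (rule arg_cong2[of _ _ _ _ "sat E", OF sym refl])
  then show ?thesis unfolding dfn_def by blast
qed

lemma sat_on_closed_below:
  assumes "closed_below k p" "!!i. i < k ==> e i = e' i"
  shows "sat_on U E e p = sat_on U E e' p"
proof -
  have "closed_below k p ==> fv p \<subseteq> {..<k}" for k
  proof (induction p arbitrary: k)
    case (All p)
    then show ?case by fastforce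
  qed auto
  then show ?thesis using assms by (intro sat_on_cong) blast
qed

context zf
begin

primrec nn :: "nat => 'a" where
  "nn 0 = emp"
| "nn (Suc k) = suc (nn k)"

lemma nn_om [simp]: "nn k eps om" by (induction k) auto

lemma Ord_nn [simp]: "Ord (nn k)" using Ord_om_elem nn_om by blast

lemma nn_less: "i < k ==> nn i eps nn k"
  by (induction k) (auto simp: less_Suc_eq)

lemma nn_eq [simp]: "nn i = nn k <-> i = k"
  using nn_less[of i k] nn_less[of k i] not_mem_self by (metis linorder_cases)

definition dm where "dm x = Coll (%u. EX v. opair u v eps x)"
definition rn where "rn x = Coll (%v. EX u. opair u v eps x)"
text \<open>Goedel operations fitted to tuples that are nested to the right: \<open>swp\<close>
  exchanges the first two entries, while \<open>mrel\<close> and \<open>erel\<close> are the two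
  atomic relations between the first two entries, followed by any tail from
  \<open>y\<close>.\<close>

definition swp where "swp x = Coll (%z. EX a b s. z = opair a (opair b s) & opair b (opair a s) eps x)"
definition mrel where "mrel x y = Coll (%z. EX a b s. z = opair a (opair b s) & a eps x & b eps x & s eps y & a eps b)"
definition erel where "erel x y = Coll (%z. EX a s. z = opair a (opair a s) & a eps x & s eps y)"

lemma T_dm [simp]: "T a ==> T (%e. dm (a e))" unfolding dm_def by (simp add: dft_rens)
lemma T_rn [simp]: "T a ==> T (%e. rn (a e))" unfolding rn_def by (simp add: dft_rens)
lemma T_swp [simp]: "T a ==> T (%e. swp (a e))" unfolding swp_def by (simp add: dft_rens)
lemma T_mrel [simp]: "T a ==> T b ==> T (%e. mrel (a e) (b e))" unfolding mrel_def by (simp add: dft_rens)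
lemma T_erel [simp]: "T a ==> T b ==> T (%e. erel (a e) (b e))" unfolding erel_def by (simp add: dft_rens)

lemma mem_dm: "u eps dm x <-> (EX v. opair u v eps x)"
  unfolding dm_def
proof (rule mem_Coll, rule isset_sep[of _ "Union (Union x)"])
  show "u eps Union (Union x)" if "EX v. opair u v eps x" for u using that opair_mem_UU(1) by blast
qed simp

lemma mem_rn: "v eps rn x <-> (EX u. opair u v eps x)"
  unfolding rn_def
proof (rule mem_Coll, rule isset_sep[of _ "Union (Union x)"])
  show "u eps Union (Union x)" if "EX v. opair v u eps x" for u using that opair_mem_UU(2) by blast
qed simp

lemma mem_swp: "z eps swp x <-> (EX a b s. z = opair a (opair b s) & opair b (opair a s) eps x)"
  unfolding swp_def
proof (rule mem_Coll, rule isset_sep[of _ "img x (%w. opair (fs (sn w)) (opair (fs w) (sn (sn w))))"])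
  show "z eps img x (%w. opair (fs (sn w)) (opair (fs w) (sn (sn w))))"
    if "EX a b s. z = opair a (opair b s) & opair b (opair a s) eps x" for z
    using that by (subst mem_img, simp) (elim exE conjE, rule exI, rule conjI, assumption, simp)
qed simp

lemma mem_mrel: "z eps mrel x y <-> (EX a b s. z = opair a (opair b s) & a eps x & b eps x & s eps y & a eps b)"
  unfolding mrel_def by (rule mem_Coll, rule isset_sep[of _ "prod x (prod x y)"]) auto

lemma mem_erel: "z eps erel x y <-> (EX a s. z = opair a (opair a s) & a eps x & s eps y)"
  unfolding erel_def by (rule mem_Coll, rule isset_sep[of _ "prod x (prod x y)"]) auto

text \<open>\<open>A\<close> enters only through the operation 9, as a predicate; it becomes a
  member of the universe as soon as it is included in a constructible set.\<close>

definition gop where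
  "gop A i u v = (if i = nn 1 then upair u v else if i = nn 2 then diff u v else if i = nn 3 then prod u v
    else if i = nn 4 then dm u else if i = nn 5 then rn u else if i = nn 6 then swp u
    else if i = nn 7 then mrel u v else if i = nn 8 then erel u v else if i = nn 9 then inter u A else emp)"

text \<open>
  The universe of sets constructible from \<open>A\<close> is enumerated along the ordinals: the index
  \<open>pr i (pr a b)\<close> applies the \<open>i\<close>-th operation to the sets with the indices \<open>a\<close> and \<open>b\<close>, where the
  operation 10 collects all sets with an index below \<open>a\<close>.
\<close>

definition PhiF where
  "PhiF A x f = (if pl x = nn 10 then img (pl (prr x)) (ap f)
     else gop A (pl x) (ap f (pl (prr x))) (ap f (prr (prr x))))"
definition Phi where "Phi = rec PhiF"
definition cst where "cst A x <-> (EX i. Ord i & Phi A i = x)"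

lemma T_gop [simp]: "T a ==> T i ==> T u ==> T v ==> T (%e. gop (a e) (i e) (u e) (v e))"
  unfolding gop_def by simp
lemma T_PhiF: "T (%e. PhiF (e 0) (e 1) (e 2))" unfolding PhiF_def by simp
lemma T_Phi [simp]: "T a ==> T x ==> T (%e. Phi (a e) (x e))"
  unfolding Phi_def by (rule T_rec[OF T_PhiF])
lemma D_cst [simp]: "T a ==> T x ==> D (%e. cst (a e) (x e))" unfolding cst_def by (simp add: dft_rens)

text \<open>With a nonzero tag both components are smaller than the index, so the recursion for
  \<open>Phi\<close> really looks back; for the tag 0 the value is empty anyway.\<close>

lemma comps_mem:
  assumes "Ord x" "pl x ~= emp"
  shows "pl (prr x) eps x" "prr (prr x) eps x"
proof -
  have c: "prr x eps x" using pr_mem_pr[OF Ord_pl Ord_prr assms(2), of x] pr_pl_prr[OF assms(1)] by simp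
  have "sub (un (pl (prr x)) (prr (prr x))) (prr x)"
    using sub_pr[OF Ord_pl Ord_prr, of "prr x" "prr x"] pr_pl_prr[OF Ord_prr] by simp
  then have "sub (pl (prr x)) (prr x)" "sub (prr (prr x)) (prr x)" by (auto simp: sub_def)
  then show "pl (prr x) eps x" "prr (prr x) eps x"
    using Ord_sub_iff[OF Ord_pl Ord_prr] Ord_sub_iff[OF Ord_prr Ord_prr] c Ord_trans[OF assms(1) c] by auto
qed

lemma Phi_eq:
  assumes x: "Ord x"
  shows "Phi A x = (if pl x = nn 10 then img (pl (prr x)) (Phi A)
     else gop A (pl x) (Phi A (pl (prr x))) (Phi A (prr (prr x))))"
proof -
  have 1: "Phi A x = PhiF A x (lam x (Phi A))" unfolding Phi_def by (rule rec_eq[OF T_PhiF])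
  have l: "ap (lam x (Phi A)) y = Phi A y" if "y eps x" for y using that by (simp add: ap_lam)
  show ?thesis
  proof (cases "pl x = emp")
    case True
    have "emp ~= nn k" if "k ~= 0" for k using nn_eq[of 0 k] that by simp
    then show ?thesis unfolding 1 PhiF_def by (simp add: True gop_def)
  next
    case False
    note m = comps_mem[OF x False]
    have "img (pl (prr x)) (ap (lam x (Phi A))) = img (pl (prr x)) (Phi A)"
      unfolding img_def by (rule Coll_cong) (use l Ord_trans[OF x m(1)] in auto)
    then show ?thesis unfolding 1 PhiF_def by (simp add: l m)
  qed
qed

lemma Phi_pr:
  assumes "Ord a" "Ord b"
  shows "Phi A (pr (nn k) (pr a b)) = (if k = 10 then img a (Phi A) else gop A (nn k) (Phi A a) (Phi A b))"
  using assms by (subst Phi_eq) (simp_all add: Ord_pr pl_pr prr_pr)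

lemma cst_gop: "cst A u ==> cst A v ==> k ~= 10 ==> cst A (gop A (nn k) u v)"
  unfolding cst_def using Phi_pr[of _ _ A k] Ord_pr[OF Ord_nn Ord_pr] by metis

lemma cst_img: "Ord a ==> cst A (img a (Phi A))"
  unfolding cst_def using Phi_pr[of a emp A 10] Ord_pr[OF Ord_nn Ord_pr[OF _ Ord_emp]] by auto

lemma cst_ops:
  assumes "cst A u" "cst A v"
  shows "cst A (upair u v)" "cst A (diff u v)" "cst A (prod u v)" "cst A (dm u)" "cst A (rn u)"
    "cst A (swp u)" "cst A (mrel u v)" "cst A (erel u v)" "cst A (inter u A)" "cst A emp"
    "cst A (opair u v)" "cst A (inter u v)" "cst A (sng u)"
proof -
  have *: "cst A (upair x y)" if "cst A x" "cst A y" for x y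
    using cst_gop[OF that, of 1] by (simp add: gop_def)
  show "cst A (upair u v)" "cst A (opair u v)" "cst A (sng u)" using * assms by (auto simp: opair_def sng_def)
  have **: "cst A (diff x y)" if "cst A x" "cst A y" for x y
    using cst_gop[OF that, of 2] by (simp add: gop_def del: nn.simps)
  show "cst A (diff u v)" "cst A (inter u v)" using ** assms by (auto simp: inter_def)
  show "cst A (prod u v)" "cst A (dm u)" "cst A (rn u)" "cst A (swp u)" "cst A (mrel u v)" "cst A (erel u v)"
    "cst A (inter u A)" "cst A emp"
    using cst_gop[OF assms, of 3] cst_gop[OF assms, of 4] cst_gop[OF assms, of 5] cst_gop[OF assms, of 6]
      cst_gop[OF assms, of 7] cst_gop[OF assms, of 8] cst_gop[OF assms, of 9] cst_gop[OF assms, of 11]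
    by (simp_all add: gop_def del: nn.simps)
qed

definition tcl where "tcl x = Coll (%z. ALL t. trans t & x eps t --> z eps t)"

lemma T_tcl [simp]: "T a ==> T (%e. tcl (a e))" unfolding tcl_def by (simp add: dft_rens)

lemma mem_tcl: "z eps tcl x <-> (ALL t. trans t & x eps t --> z eps t)"
proof -
  obtain t where "trans t" "sub (sng x) t" using ex_trans_superset by blast
  then show ?thesis unfolding tcl_def
    by (intro mem_Coll isset_sep[of _ t]) (auto simp: sub_def)
qed

lemma tcl_self [simp]: "x eps tcl x" by (simp add: mem_tcl)

lemma trans_tcl: "trans (tcl x)"
  unfolding trans_def sub_def mem_tcl by blast

lemma tcl_least: "trans t ==> x eps t ==> z eps tcl x ==> z eps t"
  unfolding mem_tcl by blast

text \<open>Used as a bound: starting from a transitive set, four steps reach every ordered triple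
  over it.\<close>

definition pstep where "pstep s = un s (img (prod s s) (%z. upair (fs z) (sn z)))"

lemma mem_pstep: "z eps pstep s <-> z eps s | (EX x y. x eps s & y eps s & z = upair x y)"
proof -
  have "(EX w. w eps prod s s & z = upair (fs w) (sn w)) <-> (EX x y. x eps s & y eps s & z = upair x y)"
  proof
    assume "EX x y. x eps s & y eps s & z = upair x y"
    then obtain x y where "x eps s" "y eps s" "z = upair x y" by blast
    then show "EX w. w eps prod s s & z = upair (fs w) (sn w)" by (intro exI[of _ "opair x y"]) simp
  next
    assume "EX w. w eps prod s s & z = upair (fs w) (sn w)"
    then obtain x y where "x eps s" "y eps s" "z = upair x y" by (auto simp: mem_prod)
    then show "EX x y. x eps s & y eps s & z = upair x y" by blast
  qed
  then show ?thesis unfolding pstep_def mem_un by (subst mem_img) simp_all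
qed

lemma trans_pstep: "trans s ==> trans (pstep s)"
  unfolding trans_def sub_def mem_pstep by auto

lemma pstep_opair: "x eps s ==> y eps s ==> opair x y eps pstep (pstep s)"
  unfolding opair_def mem_pstep by blast

lemma pstep_mono: "x eps s ==> x eps pstep s"
  unfolding mem_pstep by blast

lemma opair_comps: "trans s ==> opair x y eps s ==> x eps s & y eps s"
proof -
  assume s: "trans s" "opair x y eps s"
  have "upair x y eps opair x y" by (simp add: opair_def)
  then have "upair x y eps s" using s unfolding trans_def sub_def by blast
  moreover have "x eps upair x y" "y eps upair x y" by auto
  ultimately show ?thesis using s unfolding trans_def sub_def by blast
qed

text \<open>Elements of products are ordered pairs, whose inner unordered pairs must be
  constructible too; transitivity alone is too weak for the induction. Each value lies within four
  pairing steps of the closures of earlier values, and pairing preserves constructibility.\<close>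

lemma cst_tcl: "Ord i ==> z eps tcl (Phi A i) ==> cst A z"
proof -
  let ?P = "%i. Ord i --> (ALL z. z eps tcl (Phi A i) --> cst A z)"
  have "?P i"
  proof (rule eps_induct[where P = ?P])
    show "D (%e. ?P (e 0))" by simp
    fix x assume IH: "!!y. y eps x ==> ?P y"
    show "?P x"
    proof (intro impI)
      assume x: "Ord x"
      have main: "ALL z. z eps tcl (Phi A x) --> cst A z"
        if s: "trans s" "!!z. z eps s ==> cst A z" "!!z. z eps Phi A x ==> z eps pstep (pstep (pstep (pstep s)))" for s
      proof -
        let ?t = "pstep (pstep (pstep (pstep s)))"
        have st: "ALL z. z eps pstep s --> cst A z" if "ALL z. z eps s --> cst A z" for s
          using that cst_ops(1) unfolding mem_pstep by blast
        have t: "ALL z. z eps ?t --> cst A z" by (intro st) (use s in blast)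
        have "trans ?t" using s trans_pstep by blast
        then have "trans (un ?t (sng (Phi A x)))" using s(3) by (auto simp: trans_def sub_def)
        then have "z eps ?t | z = Phi A x" if "z eps tcl (Phi A x)" for z
          using tcl_least[of "un ?t (sng (Phi A x))" "Phi A x" z] that by simp
        moreover have "cst A (Phi A x)" using x unfolding cst_def by blast
        ultimately show ?thesis using t by blast
      qed
      show "ALL z. z eps tcl (Phi A x) --> cst A z"
      proof (cases "pl x = emp")
        case True
        have "emp ~= nn k" if "k ~= 0" for k using nn_eq[of 0 k] that by simp
        then have "Phi A x = emp" by (subst Phi_eq[OF x]) (simp add: True gop_def)
        then show ?thesis by (intro main[of emp]) (auto simp: trans_def)
      next
        case False
        let ?a = "pl (prr x)" let ?b = "prr (prr x)"
        have m: "?a eps x" "?b eps x" using comps_mem[OF x False] by auto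
        show ?thesis
        proof (cases "pl x = nn 10")
          case True
          let ?s = "Union (img ?a (%y. tcl (Phi A y)))"
          have ms: "z eps ?s <-> (EX y. y eps ?a & z eps tcl (Phi A y))" for z
            unfolding mem_Union by (subst mem_img) auto
          show ?thesis
          proof (rule main[of ?s])
            show "trans ?s" unfolding trans_def sub_def ms using trans_tcl unfolding trans_def sub_def by blast
            show "cst A z" if "z eps ?s" for z
              using that IH Ord_trans[OF x m(1)] Ord_in[OF x] unfolding ms by blast
            show "z eps pstep (pstep (pstep (pstep ?s)))" if "z eps Phi A x" for z
            proof -
              have "EX y. y eps ?a & z = Phi A y" using that Phi_eq[OF x, of A] True by (simp add: mem_img)
              then have "z eps ?s" unfolding ms by auto
              then show ?thesis by (intro pstep_mono)
            qed
          qed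
        next
          case n10: False
          let ?u = "Phi A ?a" let ?v = "Phi A ?b"
          let ?s = "un (tcl ?u) (tcl ?v)"
          have P: "Phi A x = gop A (pl x) ?u ?v" using Phi_eq[OF x, of A] n10 by simp
          have ts: "trans ?s" using trans_tcl[of ?u] trans_tcl[of ?v] by (auto simp: trans_def sub_def)
          have us: "z eps ?s" if "z eps ?u | z eps ?v" for z
            using that tcl_self trans_tcl unfolding mem_un trans_def sub_def by blast
          have tr: "opair c (opair d e) eps pstep (pstep (pstep (pstep ?s)))" if "c eps ?s" "d eps ?s" "e eps ?s" for c d e
            using pstep_opair[OF pstep_mono[OF pstep_mono[OF that(1)]] pstep_opair[OF that(2,3)]] .
          show ?thesis
          proof (rule main[OF ts])
            show "cst A z" if "z eps ?s" for z using that IH m Ord_in[OF x] by auto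
            fix z assume z: "z eps Phi A x"
            have "z eps ?s | z = ?u | z = ?v | z eps prod ?u ?v | (EX c d e. c eps ?s & d eps ?s & e eps ?s & z = opair c (opair d e))"
            proof (rule ccontr)
              assume c: "~ ?thesis"
              have cu: "!!c d. opair c d eps ?u ==> c eps ?s & d eps ?s" using us opair_comps[OF ts] by blast
              have "~ z eps upair ?u ?v" using c by auto
              moreover have "~ z eps diff ?u ?v" "~ z eps inter ?u A" using c us[of z] by auto
              moreover have "~ z eps prod ?u ?v" using c by blast
              moreover have "~ z eps dm ?u" "~ z eps rn ?u" using c cu unfolding mem_dm mem_rn by blast+
              moreover have "~ z eps swp ?u"
              proof
                assume "z eps swp ?u"
                then obtain a b w where w: "z = opair a (opair b w)" "opair b (opair a w) eps ?u" unfolding mem_swp by blast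
                then have "b eps ?s" "a eps ?s" "w eps ?s" using cu opair_comps[OF ts] by blast+
                then show False using c w by blast
              qed
              moreover have "~ z eps mrel ?u ?v" "~ z eps erel ?u ?v" using c us unfolding mem_mrel mem_erel by blast+
              ultimately have "~ z eps gop A (pl x) ?u ?v" unfolding gop_def by simp
              then show False using z P by simp
            qed
            then consider "z eps ?s" | "z = ?u | z = ?v" | c d where "c eps ?s" "d eps ?s" "z = opair c d"
              | c d e where "c eps ?s" "d eps ?s" "e eps ?s" "z = opair c (opair d e)"
              using us unfolding mem_prod by blast
            then show "z eps pstep (pstep (pstep (pstep ?s)))"
            proof cases
              case 2
              then have "z eps ?s" by auto
              then show ?thesis by (intro pstep_mono)
            next
              case 3
              then show ?thesis using pstep_opair pstep_mono by blast
            next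
              case 4
              then show ?thesis using tr by blast
            qed (intro pstep_mono)
          qed
        qed
      qed
    qed
  qed
  then show "Ord i ==> z eps tcl (Phi A i) ==> cst A z" by blast
qed

lemma cst_trans: "cst A x ==> y eps x ==> cst A y"
proof -
  assume "cst A x" "y eps x"
  then obtain i where "Ord i" "Phi A i = x" by (auto simp: cst_def)
  moreover have "y eps tcl x" using \<open>y eps x\<close> tcl_self[of x] trans_tcl[of x] unfolding trans_def sub_def by blast
  ultimately show ?thesis using cst_tcl by blast
qed

subsection \<open>Separation in the constructible universe\<close>

primrec tup :: "nat => (nat => 'a) => 'a" where
  "tup 0 e = emp"
| "tup (Suc k) e = opair (e 0) (tup k (%i. e (Suc i)))"

lemma tup_eq_iff: "tup k e = tup k e' <-> (ALL i<k. e i = e' i)"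
proof (induction k arbitrary: e e')
  case (Suc k)
  then show ?case by (auto simp: less_Suc_eq_0_disj)
qed simp

lemma cst_emp [simp]: "cst A emp"
proof -
  have "cst A (img emp (Phi A))" by (rule cst_img) simp
  then show ?thesis using cst_ops(10) by blast
qed

lemma cst_tup: "(!!i. i < k ==> cst A (e i)) ==> cst A (tup k e)"
  by (induction k arbitrary: e) (auto intro!: cst_ops(11))

text \<open>Environments are infinite, but only their first \<open>k\<close> entries enter the
  tuple; \<open>k\<close> is a standard number, as formulas live outside the model.\<close>

definition tups where
  "tups A u k R <-> (EX y. cst A y & (ALL z. z eps y <-> (EX e. (ALL i. e i eps u) & z = tup k e & R e)))"

lemma ex_env_Suc: "(EX e. (ALL i. e i eps u) & P e) <-> (EX x e. x eps u & (ALL i. e i eps u) & P (case_nat x e))"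
proof
  assume "EX e. (ALL i. e i eps u) & P e"
  then obtain e where e: "ALL i. e i eps u" "P e" by blast
  have "case_nat (e 0) (%i. e (Suc i)) = e" by (auto simp: fun_eq_iff split: nat.split)
  then show "EX x e. x eps u & (ALL i. e i eps u) & P (case_nat x e)"
    using e by (intro exI[of _ "e 0"] exI[of _ "%i. e (Suc i)"]) simp
next
  assume "EX x e. x eps u & (ALL i. e i eps u) & P (case_nat x e)"
  then obtain x e where "x eps u" "ALL i. e i eps u" "P (case_nat x e)" by blast
  then show "EX e. (ALL i. e i eps u) & P e" by (intro exI[of _ "case_nat x e"]) (simp split: nat.split)
qed

lemma tups_prod:
  assumes "cst A u" "tups A u k R"
  shows "tups A u (Suc k) (%e. R (%i. e (Suc i)))"
proof -
  obtain y where y: "cst A y" "!!z. z eps y <-> (EX e. (ALL i. e i eps u) & z = tup k e & R e)"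
    using assms(2) unfolding tups_def by blast
  have "z eps prod u y <-> (EX e. (ALL i. e i eps u) & z = tup (Suc k) e & R (%i. e (Suc i)))" for z
    by (subst ex_env_Suc) (simp add: mem_prod y(2), blast)
  then show ?thesis unfolding tups_def using cst_ops(3)[OF assms(1) y(1)] by blast
qed

lemma tups_True: "cst A u ==> tups A u k (%_. True)"
proof (induction k)
  case 0
  \<comment> \<open>Over the empty set there is no environment, hence not even the empty
    tuple.\<close>
  show ?case
  proof (cases "u = emp")
    case True
    then show ?thesis unfolding tups_def by (intro exI[of _ emp]) simp
  next
    case False
    then obtain x where "x eps u" using ex_mem_iff by blast
    then show ?thesis unfolding tups_def using cst_ops(13)[OF cst_emp cst_emp]
      by (intro exI[of _ "sng emp"]) auto
  qed
next
  case (Suc k)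
  then show ?case using tups_prod[of A u k "%_. True"] by simp
qed

lemma tups_swp:
  assumes "cst A u" "tups A u (Suc (Suc k)) R"
  shows "tups A u (Suc (Suc k)) (%e. R (case_nat (e 1) (case_nat (e 0) (%i. e (Suc (Suc i))))))"
proof -
  obtain y where y: "cst A y" "!!z. z eps y <-> (EX e. (ALL i. e i eps u) & z = tup (Suc (Suc k)) e & R e)"
    using assms(2) unfolding tups_def by blast
  let ?f = "%e. case_nat (e 1) (case_nat (e 0) (%i. e (Suc (Suc i))))"
  have f: "ALL i. ?f e i eps u" if "ALL i. e i eps u" for e using that by (simp split: nat.split)
  have ff: "?f (?f e) = e" for e :: "nat => 'a" by (auto simp: fun_eq_iff split: nat.split)
  have "z eps swp y <-> (EX e. (ALL i. e i eps u) & z = tup (Suc (Suc k)) e & R (?f e))" for z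
  proof
    assume "z eps swp y"
    then obtain a b s e where e: "z = opair a (opair b s)" "ALL i. e i eps u" "opair b (opair a s) = tup (Suc (Suc k)) e" "R e"
      unfolding mem_swp y(2) by blast
    then have "z = tup (Suc (Suc k)) (?f e)" by simp
    then show "EX e. (ALL i. e i eps u) & z = tup (Suc (Suc k)) e & R (?f e)"
      using e f[OF e(2)] ff[of e] by (intro exI[of _ "?f e"]) simp
  next
    assume "EX e. (ALL i. e i eps u) & z = tup (Suc (Suc k)) e & R (?f e)"
    then obtain e where e: "ALL i. e i eps u" "z = tup (Suc (Suc k)) e" "R (?f e)" by blast
    have "tup (Suc (Suc k)) (?f e) eps y" unfolding y(2) using f[OF e(1)] e(3) by blast
    then show "z eps swp y" unfolding mem_swp e(2)
      by (intro exI[of _ "e 0"] exI[of _ "e 1"] exI[of _ "tup k (%i. e (Suc (Suc i)))"]) simp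
  qed
  then show ?thesis unfolding tups_def using cst_ops(6)[OF y(1) y(1)] by blast
qed

text \<open>Two adjacent variables suffice: prepending an entry moves both positions up, and
  \<open>swp\<close> brings one of them back to the front. The diagonal is settled by the constant
  \<open>c\<close>.\<close>

lemma tups_atom:
  assumes u: "cst A u"
    and B: "!!k. tups A u (Suc (Suc k)) (%e. R (e 0) (e 1))"
    and refl: "!!x. R x x <-> c"
  shows "i < k ==> j < k ==> tups A u k (%e. R (e i) (e j))"
proof -
  have F: "tups A u k (%_. False)" for k unfolding tups_def by (intro exI[of _ emp]) simp
  have B': "tups A u (Suc (Suc k)) (%e. R (e 1) (e 0))" for k
    using tups_swp[OF u B[of k]] by simp
  have 1: "tups A u (Suc (j + Suc k)) (%e. R (e 0) (e (Suc j)))" for j k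
  proof (induction j)
    case (Suc j)
    show ?case using tups_swp[OF u tups_prod[OF u Suc, simplified]] by simp
  qed (use B in simp)
  have 2: "tups A u (Suc (j + Suc k)) (%e. R (e (Suc j)) (e 0))" for j k
  proof (induction j)
    case (Suc j)
    show ?case using tups_swp[OF u tups_prod[OF u Suc, simplified]] by simp
  qed (use B' in simp)
  have 3: "i < k ==> j < k ==> tups A u k (%e. R (e i) (e j))" for i j
  proof (induction k arbitrary: i j)
    case (Suc k)
    show ?case
    proof (cases i)
      case 0
      show ?thesis
      proof (cases j)
        case 0
        then show ?thesis using \<open>i = 0\<close> refl tups_True[OF u] F by (cases c) simp_all
      next
        case (Suc j')
        then have "Suc k = Suc (j' + Suc (k - Suc j'))" using Suc.prems by simp
        then show ?thesis using 1[of j' "k - Suc j'"] \<open>i = 0\<close> Suc by simp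
      qed
    next
      case (Suc i')
      show ?thesis
      proof (cases j)
        case 0
        then have "Suc k = Suc (i' + Suc (k - Suc i'))" using Suc.prems Suc by simp
        then show ?thesis using 2[of i' "k - Suc i'"] \<open>j = 0\<close> Suc by simp
      next
        case (Suc j')
        then show ?thesis using tups_prod[OF u Suc.IH[of i' j']] Suc.prems \<open>i = Suc i'\<close> by simp
      qed
    qed
  qed simp
  then show "i < k ==> j < k ==> tups A u k (%e. R (e i) (e j))" .
qed

text \<open>Goedel's normal form theorem, by induction on the formula: implication through
  differences, the quantifier as the complement of a projected complement.\<close>

lemma tups_sat:
  assumes u: "cst A u"
  shows "closed_below k p ==> tups A u k (%e. sat_on {x. x eps u} mem e p)"
proof (induction p arbitrary: k)
  case Bot
  show ?case unfolding tups_def by (intro exI[of _ emp]) simp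
next
  case (Mem i j)
  have B: "tups A u (Suc (Suc k)) (%e. e 0 eps e 1)" for k
  proof -
    obtain y where y: "cst A y" "!!z. z eps y <-> (EX e. (ALL i. e i eps u) & z = tup k e & True)"
      using tups_True[OF u, of k] unfolding tups_def by blast
    have "z eps mrel u y <-> (EX e. (ALL i. e i eps u) & z = tup (Suc (Suc k)) e & e 0 eps e 1)" for z
    proof
      assume "z eps mrel u y"
      then obtain a b e where e: "z = opair a (opair b (tup k e))" "a eps u" "b eps u" "ALL i. e i eps u" "a eps b"
        unfolding mem_mrel y(2) by blast
      then show "EX e. (ALL i. e i eps u) & z = tup (Suc (Suc k)) e & e 0 eps e 1"
        by (intro exI[of _ "case_nat a (case_nat b e)"]) (simp split: nat.split)
    next
      assume "EX e. (ALL i. e i eps u) & z = tup (Suc (Suc k)) e & e 0 eps e 1"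
      then obtain e where e: "ALL i. e i eps u" "z = tup (Suc (Suc k)) e" "e 0 eps e 1" by blast
      moreover have "tup k (%i. e (Suc (Suc i))) eps y" unfolding y(2) using e(1) by (intro exI[of _ "%i. e (Suc (Suc i))"]) simp
      ultimately show "z eps mrel u y" unfolding mem_mrel
        by (intro exI[of _ "e 0"] exI[of _ "e 1"] exI[of _ "tup k (%i. e (Suc (Suc i)))"]) simp
    qed
    then show ?thesis unfolding tups_def using cst_ops(7)[OF u y(1)] by blast
  qed
  show ?case using tups_atom[OF u B, of False i k j] Mem by simp
next
  case (Eq i j)
  have B: "tups A u (Suc (Suc k)) (%e. e 0 = e 1)" for k
  proof -
    obtain y where y: "cst A y" "!!z. z eps y <-> (EX e. (ALL i. e i eps u) & z = tup k e & True)"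
      using tups_True[OF u, of k] unfolding tups_def by blast
    have "z eps erel u y <-> (EX e. (ALL i. e i eps u) & z = tup (Suc (Suc k)) e & e 0 = e 1)" for z
    proof
      assume "z eps erel u y"
      then obtain a e where e: "z = opair a (opair a (tup k e))" "a eps u" "ALL i. e i eps u"
        unfolding mem_erel y(2) by blast
      then show "EX e. (ALL i. e i eps u) & z = tup (Suc (Suc k)) e & e 0 = e 1"
        by (intro exI[of _ "case_nat a (case_nat a e)"]) (simp split: nat.split)
    next
      assume "EX e. (ALL i. e i eps u) & z = tup (Suc (Suc k)) e & e 0 = e 1"
      then obtain e where e: "ALL i. e i eps u" "z = tup (Suc (Suc k)) e" "e 0 = e 1" by blast
      moreover have "tup k (%i. e (Suc (Suc i))) eps y" unfolding y(2) using e(1) by (intro exI[of _ "%i. e (Suc (Suc i))"]) simp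
      ultimately show "z eps erel u y" unfolding mem_erel
        by (intro exI[of _ "e 0"] exI[of _ "tup k (%i. e (Suc (Suc i)))"]) simp
    qed
    then show ?thesis unfolding tups_def using cst_ops(8)[OF u y(1)] by blast
  qed
  show ?case using tups_atom[OF u B, of True i k j] Eq by simp
next
  case (Imp p q)
  let ?S = "%e p. sat_on {x. x eps u} mem e p"
  have cb: "closed_below k p" "closed_below k q" using Imp.prems by auto
  obtain w where w: "cst A w" "!!z. z eps w <-> (EX e. (ALL i. e i eps u) & z = tup k e & True)"
    using tups_True[OF u, of k] unfolding tups_def by blast
  obtain x where x: "cst A x" "!!z. z eps x <-> (EX e. (ALL i. e i eps u) & z = tup k e & ?S e p)"
    using Imp.IH(1)[OF cb(1)] unfolding tups_def by blast
  obtain y where y: "cst A y" "!!z. z eps y <-> (EX e. (ALL i. e i eps u) & z = tup k e & ?S e q)"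
    using Imp.IH(2)[OF cb(2)] unfolding tups_def by blast
  have c: "?S e p = ?S e' p" "?S e q = ?S e' q" if "tup k e = tup k e'" for e e'
    by (rule sat_on_closed_below[OF cb(1)] sat_on_closed_below[OF cb(2)]; use that tup_eq_iff in blast)+
  have "z eps diff w (diff x y) <-> (EX e. (ALL i. e i eps u) & z = tup k e & ?S e (Imp p q))" for z
  proof
    assume z: "z eps diff w (diff x y)"
    then obtain e where e: "ALL i. e i eps u" "z = tup k e" using w by auto
    have "?S e q" if "?S e p"
    proof -
      have "z eps x" using x that e by blast
      then have "z eps y" using z by simp
      then obtain e' where "z = tup k e'" "?S e' q" using y by blast
      then show ?thesis using c e by metis
    qed
    then show "EX e. (ALL i. e i eps u) & z = tup k e & ?S e (Imp p q)" using e by auto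
  next
    assume "EX e. (ALL i. e i eps u) & z = tup k e & ?S e (Imp p q)"
    then obtain e where e: "ALL i. e i eps u" "z = tup k e" "?S e p --> ?S e q" by auto
    have "z eps y" if "z eps x"
    proof -
      obtain e' where "z = tup k e'" "?S e' p" using \<open>z eps x\<close> x by blast
      then have "?S e p" using c e by metis
      then show ?thesis using y e by blast
    qed
    then show "z eps diff w (diff x y)" using w e by auto
  qed
  moreover have "cst A (diff w (diff x y))" using cst_ops(2)[OF w(1) cst_ops(2)[OF x(1) y(1)]] .
  ultimately show ?case unfolding tups_def by blast
next
  case (All p)
  let ?S = "%e p. sat_on {x. x eps u} mem e p"
  have cb: "closed_below (Suc k) p" using All.prems by simp
  obtain w where w: "cst A w" "!!z. z eps w <-> (EX e. (ALL i. e i eps u) & z = tup k e & True)"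
    using tups_True[OF u, of k] unfolding tups_def by blast
  obtain v where v: "cst A v" "!!z. z eps v <-> (EX e. (ALL i. e i eps u) & z = tup (Suc k) e & True)"
    using tups_True[OF u, of "Suc k"] unfolding tups_def by blast
  obtain x where x: "cst A x" "!!z. z eps x <-> (EX e. (ALL i. e i eps u) & z = tup (Suc k) e & ?S e p)"
    using All.IH[OF cb] unfolding tups_def by blast
  have c: "?S e p = ?S e' p" if "tup (Suc k) e = tup (Suc k) e'" for e e'
    by (rule sat_on_closed_below[OF cb]; use that tup_eq_iff in blast)
  have vx: "opair a (tup k e) eps diff v x <-> a eps u & ~ ?S (case_nat a e) p" if e: "ALL i. e i eps u" for a e
  proof -
    have t: "opair a (tup k e) = tup (Suc k) (case_nat a e)" by simp
    have "a eps u" if "opair a (tup k e) eps v" using that v by auto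
    moreover have "opair a (tup k e) eps v" if "a eps u"
      unfolding v(2) t using that e by (intro exI[of _ "case_nat a e"]) (simp split: nat.split)
    moreover have "opair a (tup k e) eps x <-> ?S (case_nat a e) p" if "a eps u"
    proof
      assume "opair a (tup k e) eps x"
      then obtain e' where "tup (Suc k) (case_nat a e) = tup (Suc k) e'" "?S e' p" unfolding x(2) t by blast
      then show "?S (case_nat a e) p" using c by blast
    next
      assume "?S (case_nat a e) p"
      then show "opair a (tup k e) eps x"
        unfolding x(2) t using that e by (intro exI[of _ "case_nat a e"]) (simp split: nat.split)
    qed
    ultimately show ?thesis by auto
  qed
  have "z eps diff w (rn (diff v x)) <-> (EX e. (ALL i. e i eps u) & z = tup k e & ?S e (All p))" for z
  proof
    assume z: "z eps diff w (rn (diff v x))"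
    then obtain e where e: "ALL i. e i eps u" "z = tup k e" using w by auto
    have "~ (EX a. opair a (tup k e) eps diff v x)" using z e(2) unfolding mem_diff mem_rn by blast
    then have "?S e (All p)" using vx[OF e(1)] by auto
    then show "EX e. (ALL i. e i eps u) & z = tup k e & ?S e (All p)" using e by blast
  next
    assume "EX e. (ALL i. e i eps u) & z = tup k e & ?S e (All p)"
    then obtain e where e: "ALL i. e i eps u" "z = tup k e" "?S e (All p)" by blast
    then have "~ opair a (tup k e) eps diff v x" for a using vx[OF e(1), of a] by auto
    then have "~ z eps rn (diff v x)" unfolding mem_rn e(2) by blast
    moreover have "z eps w" using e w by blast
    ultimately show "z eps diff w (rn (diff v x))" by simp
  qed
  moreover have "cst A (diff w (rn (diff v x)))"
    using cst_ops(2)[OF w(1) cst_ops(5)[OF cst_ops(2)[OF v(1) x(1)] w(1)]] .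
  ultimately show ?case unfolding tups_def by blast
qed

lemma cst_sep:
  assumes u: "cst A u" and p: "closed_below (Suc n) p" and c: "!!i. c i eps u"
  shows "EX y. cst A y & (ALL x. x eps y <-> x eps u & sat_on {x. x eps u} mem (case_nat x c) p)"
proof -
  let ?S = "%e p. sat_on {x. x eps u} mem e p"
  obtain d where d: "cst A d" "!!z. z eps d <-> (EX e. (ALL i. e i eps u) & z = tup (Suc n) e & ?S e p)"
    using tups_sat[OF u p] unfolding tups_def by blast
  have t: "cst A (tup n c)" using cst_tup[of n A c] cst_trans[OF u c] by blast
  \<comment> \<open>Intersecting with this product fixes the parameters; the domain then reads off
    the first entry.\<close>
  let ?y = "dm (inter d (prod u (sng (tup n c))))"
  have "x eps ?y <-> x eps u & ?S (case_nat x c) p" for x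
  proof -
    have tx: "opair x (tup n c) = tup (Suc n) (case_nat x c)" by simp
    have "x eps ?y <-> x eps u & opair x (tup n c) eps d" unfolding mem_dm by auto
    also have "\<dots> <-> x eps u & ?S (case_nat x c) p"
    proof (rule conj_cong[OF refl])
      assume x: "x eps u"
      show "opair x (tup n c) eps d <-> ?S (case_nat x c) p"
      proof
        assume "opair x (tup n c) eps d"
        then obtain e where e: "tup (Suc n) (case_nat x c) = tup (Suc n) e" "?S e p" unfolding d(2) tx by blast
        have "?S (case_nat x c) p = ?S e p"
          by (rule sat_on_closed_below[OF p]) (use e(1) tup_eq_iff in blast)
        then show "?S (case_nat x c) p" using e(2) by blast
      next
        assume "?S (case_nat x c) p"
        then show "opair x (tup n c) eps d"
          unfolding d(2) tx using x c by (intro exI[of _ "case_nat x c"]) (simp split: nat.split)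
      qed
    qed
    finally show ?thesis .
  qed
  moreover have "cst A ?y"
    using cst_ops(4)[OF cst_ops(12)[OF d(1) cst_ops(3)[OF u cst_ops(13)[OF t t]]] t] .
  ultimately show ?thesis by blast
qed

end

lemma case_nat_eta [simp]: "case_nat (e 0) (%i. e (Suc i)) = e"
  by (auto simp: fun_eq_iff split: nat.split)

lemma dft_params:
  assumes "dft E t"
  shows "dft E (%e. t (mrg c e))"
proof -
  let ?f = "%n. case n of 0 => 0 | Suc i => if even i then 2 * Suc (i div 2) else 2 * (i div 2) + 1"
  from dfn_params[OF dfn_ren[OF assms[unfolded dft_def], of ?f], of c]
  have "dfn E (%e. mrg c e (?f 0) = t (%i. mrg c e (?f (Suc i))))" .
  moreover have "(%i. mrg c e (?f (Suc i))) = mrg c (%i. e (Suc i))" for e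
    by (auto simp: fun_eq_iff mrg_def)
  ultimately show ?thesis unfolding dft_def by (simp add: mrg_def)
qed

lemma closed_below_mono: "closed_below k p ==> k \<le> l ==> closed_below l p"
proof (induction p arbitrary: k l)
  case (All p)
  then show ?case using All.IH[of "Suc k" "Suc l"] by simp
next
  case (Imp p q)
  then show ?case using Imp.IH[of k l] by simp
qed auto

lemma ex_closed_below: "EX k. closed_below k p"
proof (induction p)
  case (Imp p q)
  then obtain k l where "closed_below k p" "closed_below l q" by blast
  then show ?case by (intro exI[of _ "max k l"]) (auto elim: closed_below_mono)
next
  case (All p)
  then obtain k where "closed_below k p" by blast
  then show ?case by (intro exI[of _ k]) (auto elim: closed_below_mono)
next
  case (Mem i j)
  then show ?case by (intro exI[of _ "Suc (max i j)"]) auto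
next
  case (Eq i j)
  then show ?case by (intro exI[of _ "Suc (max i j)"]) auto
qed auto

context zf
begin

subsection \<open>Reflection\<close>

definition V where "V A a = img a (Phi A)"

lemma T_V [simp]: "T a ==> T b ==> T (%e. V (a e) (b e))"
  unfolding V_def by (simp add: dft_rens)
lemma mem_V: "x eps V A a <-> (EX i. i eps a & x = Phi A i)" unfolding V_def by (rule mem_img) simp
lemma V_mono: "sub a b ==> x eps V A a ==> x eps V A b" unfolding mem_V sub_def by blast
lemma V_cst: "Ord a ==> x eps V A a ==> cst A x" unfolding mem_V cst_def using Ord_in by blast
lemma cst_V: "Ord a ==> cst A (V A a)" unfolding V_def by (rule cst_img)

lemma ex_Ord_bound: "EX c. Ord c & (ALL x. x eps s & Ord x --> x eps c)"
proof -
  have m: "x eps sep s Ord <-> x eps s & Ord x" for x by (simp add: mem_sep)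
  have "Ord (Union (sep s Ord))" by (rule Ord_Union) (simp add: m)
  moreover have "x eps suc (Union (sep s Ord))" if x: "x eps s" "Ord x" for x
  proof -
    have "sub x (Union (sep s Ord))" using x m unfolding sub_def mem_Union by blast
    then show ?thesis using Ord_sub_iff x \<open>Ord (Union (sep s Ord))\<close> by auto
  qed
  ultimately show ?thesis using Ord_suc by blast
qed

lemma cst_subset_V:
  assumes "!!x. x eps s ==> cst A x"
  obtains a where "Ord a" "!!x. x eps s ==> x eps V A a"
proof -
  let ?i = "%x. Lst (%i. Phi A i = x)"
  obtain a where a: "Ord a" "!!x. x eps img s ?i ==> Ord x ==> x eps a" using ex_Ord_bound by metis
  have "x eps V A a" if x: "x eps s" for x
  proof -
    obtain i where i: "Ord i" "Phi A i = x" using assms x unfolding cst_def by blast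
    have "Ord (?i x)" "Phi A (?i x) = x"
      by (rule Lst_Ord[of "%i. Phi A i = x" i] Lst_prop[of "%i. Phi A i = x" i]; simp add: i)+
    moreover have "?i x eps img s ?i" using x by (subst mem_img) auto
    ultimately show ?thesis using a unfolding mem_V by metis
  qed
  then show thesis using that a by blast
qed

abbreviation Lsat where "Lsat A \<equiv> sat_on {x. cst A x} mem"

lemma D_Lsat: "D (%e. Lsat A e p)"
proof (induction p)
  case (All p)
  have "D (%e. ALL x. cst A x --> Lsat A (case_nat x e) p)"
    using dfn_all[of mem "%e x. cst A x --> Lsat A (case_nat x e) p"] All by simp
  then show ?case by simp
qed simp_all

text \<open>Replacement for functions of environments. An environment is no object of the model, but
  \<open>G\<close> depends on \<open>k\<close> entries only, and these are bounded one after the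
  other by forming images.\<close>

lemma bound_env:
  assumes "T (%e. G (e 0) (%i. e (Suc i)))" "!!b e e'. (ALL i<k. e i = e' i) ==> G b e = G b e'"
  shows "EX H. T (%e. H (e 0)) & (ALL b e. (ALL i. e i eps b) --> G b e eps H b)"
  using assms
proof (induction k arbitrary: G)
  case 0
  have "T (%e. sng (G (e 0) (%_. e 0)))" using dft_ren[OF 0(1), of "%_. 0"] by simp
  moreover have "G b e eps sng (G b (%_. b))" for b e using 0(2)[of e "%_. b" b] by simp
  ultimately show ?case by (intro exI[of _ "%b. sng (G b (%_. b))"]) blast
next
  case (Suc k)
  let ?G = "%b e. img b (%x. G b (case_nat x e))"
  have TG: "T (%e. ?G (e 0) (%i. e (Suc i)))"
  proof (rule T_img)
    let ?f = "%n. case n of 0 => 1 | Suc m => (case m of 0 => 0 | Suc i => Suc (Suc i))"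
    have "(%i. e (?f (Suc i))) = case_nat (e 0) (%i. e (Suc (Suc i)))" for e :: "nat => 'a"
      by (auto simp: fun_eq_iff split: nat.split)
    then show "T (%e. G (e (Suc 0)) (case_nat (e 0) (%i. e (Suc (Suc i)))))"
      using dft_ren[OF Suc.prems(1), of ?f] by simp
  qed simp
  have "EX H. T (%e. H (e 0)) & (ALL b e. (ALL i. e i eps b) --> ?G b e eps H b)"
  proof (rule Suc.IH[OF TG])
    fix b and e e' :: "nat => 'a" assume "ALL i<k. e i = e' i"
    then have "G b (case_nat x e) = G b (case_nat x e')" for x
      by (intro Suc.prems(2)) (auto simp: less_Suc_eq_0_disj)
    then show "?G b e = ?G b e'" by simp
  qed
  then obtain H where H: "T (%e. H (e 0))" "!!b e. ALL i. e i eps b ==> ?G b e eps H b" by blast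
  have "G b e eps Union (H b)" if e: "ALL i. e i eps b" for b e
  proof -
    let ?c = "%i. e (Suc i)"
    have "T (%e. G b (case_nat (e 0) ?c))"
    proof -
      let ?g = "%n. case n of 0 => 1 | Suc m => (case m of 0 => 0 | Suc i => 2 * Suc i + 1)"
      let ?d = "case_nat b ?c"
      have "(%i. mrg ?d e' (?g (Suc i))) = case_nat (e' 0) ?c" for e'
        by (auto simp: fun_eq_iff mrg_def split: nat.split)
      then show ?thesis
        using dft_params[OF dft_ren[OF Suc.prems(1), of ?g], of ?d] by (simp add: mrg_def)
    qed
    then have "G b e eps ?G b ?c" using e by (subst mem_img) (auto intro!: exI[of _ "e 0"])
    moreover have "?G b ?c eps H b" by (rule H(2)) (use e in simp)
    ultimately show ?thesis unfolding mem_Union by (intro exI[of _ "?G b ?c"]) (rule conjI)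
  qed
  moreover have "T (%e. Union (H (e 0)))" using H(1) by simp
  ultimately show ?case by (intro exI[of _ "%b. Union (H b)"]) blast
qed

text \<open>The Tarski-Vaught condition for all subformulas: parameters in level \<open>b\<close>
  that admit a counterexample have one in level \<open>g\<close>. A level with \<open>b = g\<close>
  reflects the formula.\<close>

primrec wit :: "'a => 'a => 'a => fm => bool" where
  "wit A b g Bot = True"
| "wit A b g (Mem i j) = True"
| "wit A b g (Eq i j) = True"
| "wit A b g (Imp p q) = (wit A b g p & wit A b g q)"
| "wit A b g (All p) = (wit A b g p & (ALL e. (ALL i. e i eps V A b) -->
    (EX x. cst A x & ~ Lsat A (case_nat x e) p) --> (EX x. x eps V A g & ~ Lsat A (case_nat x e) p)))"

lemma wit_mono: "wit A b g p ==> sub g g' ==> wit A b g' p"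
  by (induction p) (auto intro: V_mono, meson V_mono)

lemma ex_wit: "EX h. T (%e. h (e 0)) & (ALL b. Ord b --> Ord (h b) & wit A b (h b) p)"
proof (induction p)
  case (Imp p q)
  then obtain h h' where h: "T (%e. h (e 0))" "T (%e. h' (e 0))"
    "!!b. Ord b ==> Ord (h b) & wit A b (h b) p" "!!b. Ord b ==> Ord (h' b) & wit A b (h' b) q" by blast
  have s: "sub x (un x y)" "sub y (un x y)" for x y by (auto simp: sub_def)
  show ?case
  proof (intro exI[of _ "%b. un (h b) (h' b)"] conjI allI impI)
    show "T (%e. un (h (e 0)) (h' (e 0)))" using h by simp
    fix b assume b: "Ord b"
    show "Ord (un (h b) (h' b))" using h b by simp
    have "wit A b (un (h b) (h' b)) p" by (rule wit_mono[OF _ s(1)]) (use h b in blast)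
    moreover have "wit A b (un (h b) (h' b)) q" by (rule wit_mono[OF _ s(2)]) (use h b in blast)
    ultimately show "wit A b (un (h b) (h' b)) (Imp p q)" by simp
  qed
next
  case (All p)
  then obtain h where h: "T (%e. h (e 0))" "!!b. Ord b ==> Ord (h b) & wit A b (h b) p" by blast
  obtain k where k: "!!i. i \<in> fv p ==> i < k" using finite_fv[of p] finite_nat_bounded[of "fv p"] by blast
  let ?G = "%b e. Lst (%i. ~ Lsat A (case_nat (Phi A i) e) p)"
  have D1: "D (%e. (%e x. Lsat A (case_nat x e) p) (%i. e (Suc i)) (e 0))" using D_Lsat[of A p] by simp
  have T1: "T (%e. ?G (e 0) (%i. e (Suc i)))"
    by (rule T_Lst, rule dfn_not) (use dfn_binder[OF D1, of "%e. Phi A (e 0)" "%i. Suc (Suc i)"] in simp)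
  have G_cong: "?G b e = ?G b e'" if e: "ALL i<k. e i = e' i" for b e e'
  proof -
    have "Lsat A (case_nat x e) p = Lsat A (case_nat x e') p" for x
      by (rule sat_on_cong) (use e k in \<open>auto split: nat.split dest: k Suc_lessD\<close>)
    then show ?thesis by simp
  qed
  obtain H where H: "T (%e. H (e 0))" "!!b e. ALL i. e i eps b ==> ?G b e eps H b"
    using bound_env[of ?G k, OF T1 G_cong] by blast
  let ?h = "%b. un (h b) (suc (Union (sep (H (V A b)) Ord)))"
  have Th: "T (%e. ?h (e 0))" using h(1) by (simp add: dft_app1[OF H(1)])
  have "Ord (?h b) & wit A b (?h b) (All p)" if b: "Ord b" for b
  proof
    have m: "x eps sep (H (V A b)) Ord <-> x eps H (V A b) & Ord x" for x by (simp add: mem_sep)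
    have o: "Ord (Union (sep (H (V A b)) Ord))" by (rule Ord_Union) (simp add: m)
    then show "Ord (?h b)" using h(2) b by simp
    have "wit A b (?h b) p" by (rule wit_mono[of A b "h b"]) (use h b in \<open>auto simp: sub_def\<close>)
    moreover have "EX x. x eps V A (?h b) & ~ Lsat A (case_nat x e) p"
      if e: "ALL i. e i eps V A b" and x: "cst A x" "~ Lsat A (case_nat x e) p" for e x
    proof -
      obtain i where i: "Ord i" "Phi A i = x" using x unfolding cst_def by blast
      have De: "D (%e'. ~ Lsat A (case_nat (Phi A (e' 0)) e) p)"
      proof -
        have "D (%e'. Lsat A (mrg e e') (ren (%n. case n of 0 => 0 | Suc m => 2 * m + 1) p))"
          by (rule dfn_params[OF D_Lsat])
        moreover have "mrg e e' \<circ> (%n. case n of 0 => 0 | Suc m => 2 * m + 1) = case_nat (e' 0) e" for e'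
          by (auto simp: fun_eq_iff mrg_def split: nat.split)
        ultimately have "D (%e'. Lsat A (case_nat (e' 0) e) p)" by (simp add: sat_on_ren del: comp_apply)
        from dfn_app1[OF this, of "%e. Phi A (e 0)"] show ?thesis by simp
      qed
      let ?i = "?G b e"
      let ?P = "%i. ~ Lsat A (case_nat (Phi A i) e) p"
      have Pi: "?P i" using i x by simp
      have l: "Ord ?i" "?P ?i"
        using Lst_Ord[of ?P i, OF De i(1) Pi] Lst_prop[of ?P i, OF De i(1) Pi] .
      have "?i eps H (V A b)" using H(2)[of e "V A b"] e by blast
      then have "sub ?i (Union (sep (H (V A b)) Ord))" using l m unfolding sub_def mem_Union by blast
      then have "?i eps ?h b" using Ord_sub_iff[OF l(1) o] by auto
      then show ?thesis using l(2) unfolding mem_V by blast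
    qed
    ultimately show "wit A b (?h b) (All p)" by auto
  qed
  then show ?case using Th by (intro exI[of _ ?h]) simp
qed (rule exI[of _ "%b. b"], simp)+

lemma wit_reflect:
  "wit A a a p ==> Ord a ==> ALL i. e i eps V A a ==> sat_on {x. x eps V A a} mem e p = Lsat A e p"
proof (induction p arbitrary: e)
  case (All p)
  have 1: "sat_on {x. x eps V A a} mem (case_nat x e) p = Lsat A (case_nat x e) p" if "x eps V A a" for x
    by (rule All.IH) (use All.prems that in \<open>auto split: nat.split\<close>)
  have "(EX x. cst A x & ~ Lsat A (case_nat x e) p) --> (EX x. x eps V A a & ~ Lsat A (case_nat x e) p)"
    using All.prems by simp
  then show ?case using 1 V_cst[OF All.prems(2)] by (simp, blast)
qed auto

lemma reflection:
  assumes b: "Ord b"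
  shows "EX a. Ord a & sub b a & (ALL e. (ALL i. e i eps V A a) --> sat_on {x. x eps V A a} mem e p = Lsat A e p)"
proof -
  obtain h where h: "T (%e. h (e 0))" "!!b. Ord b ==> Ord (h b) & wit A b (h b) p" using ex_wit by blast
  \<comment> \<open>The levels grow along \<open>om\<close>: each stage contains the witnesses for
    the earlier stages, and the added successor keeps the sequence increasing. At the limit the
    Tarski-Vaught condition holds.\<close>
  define F where "F a x f = un a (Union (img x (%y. un (h (ap f y)) (suc (ap f y)))))" for a x f
  have TF: "T (%e. F (e 0) (e 1) (e 2))" unfolding F_def by (simp add: dft_app1[OF h(1)])
  define s where "s = rec F b"
  have Ts: "T (%e. s (t e))" if "T t" for t unfolding s_def using T_rec[OF TF] that by simp
  have ms: "z eps s x <-> z eps b | (EX y. y eps x & (z eps h (s y) | z eps suc (s y)))" for z x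
  proof -
    have "s x = F b x (lam x s)" unfolding s_def by (rule rec_eq[OF TF])
    moreover have "ap (lam x s) y = s y" if "y eps x" for y using that Ts by (simp add: ap_lam)
    moreover have "T (%e. un (h (ap (lam x s) (e 0))) (suc (ap (lam x s) (e 0))))"
      by (simp add: dft_app1[OF h(1)])
    ultimately show ?thesis unfolding F_def by (auto simp: mem_img)
  qed
  have Os: "Ord (s x)" for x
  proof (rule eps_induct[where P = "%x. Ord (s x)"])
    show "D (%e. Ord (s (e 0)))" by (simp add: Ts)
    fix x assume IH: "!!y. y eps x ==> Ord (s y)"
    show "Ord (s x)"
    proof (rule OrdI)
      fix z assume "z eps s x"
      then have c: "z eps b | (EX y. y eps x & (z eps h (s y) | z eps suc (s y)))" unfolding ms .
      then show "Ord z" using b IH h(2) Ord_in Ord_suc by blast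
      fix w assume "w eps z"
      then show "w eps s x" unfolding ms using c b IH h(2) Ord_trans Ord_suc by blast
    qed
  qed
  have s1: "sub (h (s y)) (s x)" "s y eps s x" if "y eps x" for x y
    using that ms[of _ x] unfolding sub_def by auto
  let ?a = "s om"
  have fin: "EX n. n eps om & (ALL i<k. e i eps V A (s n))" if e: "ALL i. e i eps V A ?a" for e :: "nat => 'a" and k
  proof (induction k)
    case (Suc k)
    then obtain n where n: "n eps om" "ALL i<k. e i eps V A (s n)" by blast
    obtain i where i: "i eps ?a" "e k = Phi A i" using e unfolding mem_V by blast
    then consider "i eps b" | m where "m eps om" "i eps h (s m) | i eps suc (s m)" using ms[of i om] by blast
    then obtain m where m: "m eps om" "i eps s m"
    proof cases
      case 1
      then show thesis using that[of emp] ms[of i emp] by simp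
    next
      case 2
      then show thesis using that[of "suc m"] ms[of i "suc m"] by auto
    qed
    have "s n eps s m | s n = s m | s m eps s n" using s1(2) Ord_linear[OF Ord_om_elem[OF n(1)] Ord_om_elem[OF m(1)]] by blast
    then have "sub (s m) (s n) | sub (s n) (s m)"
      using Ord_sub_iff[OF Os Os] by blast
    then show ?case
    proof
      assume "sub (s m) (s n)"
      then have "i eps s n" using m by (simp add: sub_def)
      then have "e k eps V A (s n)" using i unfolding mem_V by blast
      then show ?thesis using n less_Suc_eq by auto
    next
      assume s: "sub (s n) (s m)"
      have "e k eps V A (s m)" using i m unfolding mem_V by blast
      moreover have "ALL i<k. e i eps V A (s m)" using n(2) V_mono[OF s] by blast
      ultimately show ?thesis using m less_Suc_eq by auto
    qed
  qed (use emp_om in \<open>blast\<close>)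
  have w: "wit A (s n) (h (s n)) p" for n using h(2) Os by blast
  have "(ALL n. n eps om --> wit A (s n) (h (s n)) q) ==> wit A ?a ?a q" for q
  proof (induction q)
    case (All q)
    have "EX x. x eps V A ?a & ~ Lsat A (case_nat x e) q"
      if e: "ALL i. e i eps V A ?a" and x: "cst A x" "~ Lsat A (case_nat x e) q" for e x
    proof -
      obtain k where k: "!!i. i \<in> fv q ==> i < k" using finite_fv[of q] finite_nat_bounded[of "fv q"] by blast
      obtain n where n: "n eps om" "ALL i<Suc k. e i eps V A (s n)" using fin[OF e] by blast
      \<comment> \<open>An environment over the limit need not lie in any one stage; its irrelevant
        entries are replaced.\<close>
      let ?e = "%i. if i < k then e i else e 0"
      have c: "Lsat A (case_nat x ?e) q = Lsat A (case_nat x e) q" for x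
        by (rule sat_on_cong) (auto split: nat.split dest: k Suc_lessD)
      have "ALL i. ?e i eps V A (s n)" using n(2) by simp
      moreover have "wit A (s n) (h (s n)) (All q)" using All.prems n(1) by blast
      ultimately have "(EX x. cst A x & ~ Lsat A (case_nat x ?e) q) --> (EX x. x eps V A (h (s n)) & ~ Lsat A (case_nat x ?e) q)"
        unfolding wit.simps by (elim conjE) (erule allE[of _ ?e], blast)
      then obtain y where "y eps V A (h (s n))" "~ Lsat A (case_nat y ?e) q"
        using x unfolding c by blast
      then show ?thesis using V_mono[OF s1(1)[OF n(1)]] unfolding c by blast
    qed
    then show ?case using All by auto
  qed auto
  then have "wit A ?a ?a p" using w by blast
  moreover have "sub b ?a" using ms unfolding sub_def by blast
  ultimately show ?thesis using wit_reflect Os by blast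
qed

text \<open>The formula is reflected to a level that contains \<open>a\<close>, its elements and the
  relevant parameters; over a single level \<open>cst_sep\<close> applies.\<close>

lemma cst_separation:
  assumes a: "cst A a" and c: "!!i. cst A (c i)"
  shows "EX y. cst A y & (ALL x. x eps y <-> x eps a & Lsat A (case_nat x c) p)"
proof -
  obtain k where k: "closed_below k p" using ex_closed_below by blast
  have "EX b. Ord b & a eps V A b & (ALL x. x eps a --> x eps V A b) & (ALL i<k. c i eps V A b)" for k
  proof (induction k)
    case 0
    have "cst A x" if "x eps un a (sng a)" for x using that a cst_trans by auto
    then show ?case using cst_subset_V[of "un a (sng a)" A] by (metis mem_sng mem_un not_less0)
  next
    case (Suc k)
    then obtain b where b: "Ord b" "a eps V A b" "ALL x. x eps a --> x eps V A b" "ALL i<k. c i eps V A b" by blast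
    obtain i where i: "Ord i" "Phi A i = c k" using c unfolding cst_def by blast
    have "sub b (un b (suc i))" by (simp add: sub_def)
    then have "ALL x. x eps V A b --> x eps V A (un b (suc i))" using V_mono by blast
    moreover have "c k eps V A (un b (suc i))" unfolding mem_V using i by auto
    ultimately show ?case using b i by (intro exI[of _ "un b (suc i)"]) (auto simp: less_Suc_eq)
  qed
  then obtain b where b: "Ord b" "a eps V A b" "!!x. x eps a ==> x eps V A b" "!!i. i < k ==> c i eps V A b" by blast
  obtain a' where a': "Ord a'" "sub b a'"
    "!!e. ALL i. e i eps V A a' ==> sat_on {x. x eps V A a'} mem e p = Lsat A e p"
    using reflection[OF b(1), of A p] by blast
  let ?u = "V A a'"
  \<comment> \<open>Parameters beyond \<open>k\<close> may lie outside the level and are replaced by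
    \<open>a\<close>.\<close>
  let ?d = "%i. if i < k then c i else a"
  have d: "?d i eps ?u" for i using V_mono[OF a'(2)] b by simp
  obtain y where y: "cst A y" "!!x. x eps y <-> x eps ?u & sat_on {x. x eps ?u} mem (case_nat x ?d) p"
    using cst_sep[OF cst_V[OF a'(1)] closed_below_mono[OF k le_SucI[OF order_refl]], of ?d] d by blast
  have "x eps inter a y <-> x eps a & Lsat A (case_nat x c) p" for x
  proof (cases "x eps a")
    case True
    then have x: "x eps ?u" using V_mono[OF a'(2)] b by blast
    have "sat_on {x. x eps ?u} mem (case_nat x ?d) p = Lsat A (case_nat x ?d) p"
      by (rule a'(3)) (use x d in \<open>simp split: nat.split\<close>)
    also have "\<dots> = Lsat A (case_nat x c) p"
      by (rule sat_on_closed_below[OF k]) (auto split: nat.split)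
    finally show ?thesis using x y(2) True by simp
  qed simp
  then show ?thesis using cst_ops(12)[OF a y(1)] by blast
qed

text \<open>The least missing ordinal would consist of exactly the ordinals in some level. Being an
  ordinal is a bounded property, so separation would construct it.\<close>

lemma cst_Ord: "Ord i ==> cst A i"
proof (rule ccontr)
  assume i: "Ord i" "~ cst A i"
  let ?P = "%i. ~ cst A i"
  let ?m = "Lst ?P"
  have m: "Ord ?m" "~ cst A ?m"
    by (rule Lst_Ord[of ?P i] Lst_prop[of ?P i]; use i in simp)+
  have low: "cst A x" if "x eps ?m" for x
    using Lst_least[of ?P x] Ord_in[OF m(1) that] that by auto
  obtain a where a: "Ord a" "!!x. x eps ?m ==> x eps V A a" using cst_subset_V[of ?m A] low by blast
  \<comment> \<open>\<open>?tr i\<close> says that variable \<open>i\<close> is transitive;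
    \<open>?p\<close> below is the conjunction, written with implication and falsity, of
    \<open>?tr 0\<close> and the transitivity of all elements.\<close>
  let ?tr = "%i. All (Imp (Mem 0 (Suc i)) (All (Imp (Mem 0 1) (Mem 0 (Suc (Suc i))))))"
  let ?q = "All (Imp (Mem 0 1) (?tr 0))"
  have tr: "Lsat A e (?tr i) <-> trans (e i)" if "cst A (e i)" for e i
  proof -
    have "Lsat A e (?tr i) <-> (ALL y. cst A y --> y eps e i --> (ALL z. cst A z --> z eps y --> z eps e i))" by simp
    also have "\<dots> <-> trans (e i)" unfolding trans_def sub_def using cst_trans that by blast
    finally show ?thesis .
  qed
  let ?p = "Imp (Imp (?tr 0) (Imp ?q Bot)) Bot"
  have p: "Lsat A (case_nat x (%_. emp)) ?p <-> Ord x" if x: "cst A x" for x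
  proof -
    let ?c = "case_nat x (%_. emp)"
    have "Lsat A (case_nat y ?c) (?tr 0) = trans y" if "cst A y" for y
      using tr[of "case_nat y ?c" 0] that by (simp del: sat_on.simps)
    then have "Lsat A ?c ?q <-> (ALL y. cst A y --> y eps x --> trans y)"
      by (simp only: sat_on.simps(5) mem_Collect_eq sat_on.simps(2,4)) simp
    also have "\<dots> <-> (ALL y. y eps x --> trans y)" using cst_trans x by blast
    finally have q: "Lsat A ?c ?q <-> (ALL y. y eps x --> trans y)" .
    have "Lsat A ?c (?tr 0) = trans x" using tr[of ?c 0] x by (simp del: sat_on.simps)
    then show ?thesis unfolding sat_on.simps(1,4) Ord_def q by blast
  qed
  obtain y where y: "cst A y" "!!x. x eps y <-> x eps V A a & Lsat A (case_nat x (%_. emp)) ?p"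
    using cst_separation[OF cst_V[OF a(1), of A], of "%_. emp" ?p] cst_emp by blast
  have "y = ?m"
  proof (rule ext)
    fix x
    have "x eps y <-> x eps V A a & Ord x" using y(2) p V_cst[OF a(1)] by blast
    moreover have "x eps ?m" if "x eps V A a" "Ord x"
    proof (rule ccontr)
      assume "~ x eps ?m"
      then have "?m = x | ?m eps x" using Ord_linear[OF m(1) that(2)] by blast
      then show False using m(2) V_cst[OF a(1) that(1)] cst_trans by blast
    qed
    ultimately show "x eps y <-> x eps ?m" using a(2) m(1) Ord_in by blast
  qed
  then show False using y m by simp
qed

end

section \<open>Inner models\<close>

text \<open>The first model is a definable class with all ordinals of the second, and its definable
  relations stay definable there. This makes statements about both models at once amenable to
  induction in the second one.\<close>

locale inner = emb +
  assumes rel_D: "dfn E1 P ==> EX Q. dfn E2 Q & (ALL e. P e = Q (%i. j (e i)))"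
    and D_range: "dfn E2 (%e. EX x. e 0 = j x)"
    and j_Ords: "N.Ord x ==> EX y. x = j y"
begin

definition mixed where "mixed P <-> (EX Q. N.D (%e. Q (e 0)) & (ALL x. P x = Q (j x)))"

lemma j_induct:
  assumes "mixed P" "!!x. (!!y. E1 y x ==> P y) ==> P x"
  shows "P x"
proof -
  obtain Q where Q: "N.D (%e. Q (e 0))" "!!x. P x = Q (j x)" using assms(1) unfolding mixed_def by blast
  have "(EX x. u = j x) --> Q u" for u
  proof (rule N.eps_induct[where P = "%u. (EX x. u = j x) --> Q u"])
    show "N.D (%e. (EX x. e 0 = j x) --> Q (e 0))" using dfn_imp[OF D_range Q(1)] .
    fix u assume IH: "!!y. E2 y u ==> (EX x. y = j x) --> Q y"
    show "(EX x. u = j x) --> Q u"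
    proof
      assume "EX x. u = j x"
      then obtain x where x: "u = j x" by blast
      have "P y" if "E1 y x" for y using IH[of "j y"] that x Q(2) by auto
      then show "Q u" using assms(2) Q(2) x by blast
    qed
  qed
  then show ?thesis using Q(2) by blast
qed

lemma mixed_eq:
  assumes F: "M.T (%e. F (e 0))" and G: "N.T (%e. G (e 0))"
  shows "mixed (%x. j (F x) = G (j x))"
proof -
  have "dfn E1 (%e. e 0 = F (e 1))" using F by (simp add: dft_def)
  then obtain Q where Q: "N.D Q" "!!e. (e 0 = F (e 1)) = Q (%i. j (e i))" using rel_D by blast
  let ?Q = "%u v. Q (%i. if i = 0 then u else v)"
  have e: "(u = F v) = ?Q (j u) (j v)" for u v
    using Q(2)[of "%i. if i = 0 then u else v"] by (simp add: if_distrib[of j])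
  have DQ: "N.D (%e. ?Q (e 0) (e 1))"
    using dfn_ren[OF Q(1), of "%i. if i = 0 then 0 else 1"] by (simp add: if_distrib)
  let ?R = "%u. (EX x. G u = j x) & ?Q (G u) u"
  have "N.D (%e. ?R (e 0))" using dfn_app1[OF D_range G] dfn_app2[OF DQ G dft_var] by simp
  moreover have "(j (F x) = G (j x)) = ?R (j x)" for x
  proof
    assume "j (F x) = G (j x)"
    then have g: "G (j x) = j (F x)" by simp
    show "?R (j x)" unfolding g using e[of "F x" x] by auto
  next
    assume R: "?R (j x)"
    then obtain y where y: "G (j x) = j y" by blast
    have "?Q (j y) (j x)" using conjunct2[OF R] unfolding y .
    then show "j (F x) = G (j x)" using e[of y x] y by simp
  qed
  ultimately show ?thesis unfolding mixed_def by (intro exI[of _ ?R]) simp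
qed

lemma mixed_imp_Ord: "mixed P ==> mixed (%x. M.Ord x --> P x)"
  unfolding mixed_def
proof (elim exE conjE)
  fix Q assume "N.D (%e. Q (e 0))" "ALL x. P x = Q (j x)"
  then show "EX Q. N.D (%e. Q (e 0)) & (ALL x. (M.Ord x --> P x) = Q (j x))"
    by (intro exI[of _ "%u. N.Ord u --> Q u"]) simp
qed

lemma j_plt [simp]: "N.plt (j a) (j b) (j c) (j d) <-> M.plt a b c d"
  by (simp add: N.plt_def M.plt_def flip: j_un)

text \<open>Neither pair can precede the other: the smaller one would already have occurred below
  \<open>x\<close>, where both models agree by induction.\<close>

lemma j_tp: "j (M.tp x) = N.tp (j x)"
proof (rule j_induct[where P = "%x. j (M.tp x) = N.tp (j x)"])
  show "mixed (%x. j (M.tp x) = N.tp (j x))" by (rule mixed_eq) simp_all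
  fix x assume IH: "!!y. E1 y x ==> j (M.tp y) = N.tp (j y)"
  let ?c = "M.pl x" and ?d = "M.prr x"
  obtain c d where cd: "N.pl (j x) = j c" "N.prr (j x) = j d" using N.Ord_pl N.Ord_prr j_Ords by metis
  have o: "M.Ord c" "M.Ord d" using N.Ord_pl[of "j x"] N.Ord_prr[of "j x"] cd by simp_all
  have hit: "(EX y. E2 y (j x) & N.tp y = N.opair (j a) (j b)) <-> (EX y. E1 y x & M.tp y = M.opair a b)" for a b
  proof -
    have "(N.tp (j y) = N.opair (j a) (j b)) = (M.tp y = M.opair a b)" if "E1 y x" for y
      unfolding IH[OF that, symmetric] by (simp flip: j_opair)
    then show ?thesis unfolding j_ex by blast
  qed
  have 1: "~ M.plt ?c ?d c d"
  proof
    assume "M.plt ?c ?d c d"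
    then have "N.plt (j ?c) (j ?d) (N.pl (j x)) (N.prr (j x))" unfolding cd by simp
    then have "EX y. E2 y (j x) & N.tp y = N.opair (j ?c) (j ?d)"
      using N.tp_least[of "j ?c" "j ?d" "j x"] M.Ord_pl M.Ord_prr by simp
    then show False unfolding hit using M.tp_new M.tp_eq[of x] by metis
  qed
  have 2: "~ M.plt c d ?c ?d"
  proof
    assume "M.plt c d ?c ?d"
    then have "EX y. E1 y x & M.tp y = M.opair c d" using M.tp_least o by blast
    then obtain y where y: "E2 y (j x)" "N.tp y = N.opair (j c) (j d)" unfolding hit[symmetric] by blast
    then show False using N.tp_new[OF y(1)] N.tp_eq[of "j x"] unfolding cd by simp
  qed
  have "?c = c & ?d = d" using M.plt_linear[OF M.Ord_pl M.Ord_prr o] 1 2 by blast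
  then show "j (M.tp x) = N.tp (j x)" using N.tp_eq[of "j x"] M.tp_eq[of x] unfolding cd by simp
qed

lemma j_pl [simp]: "j (M.pl x) = N.pl (j x)" and j_prr [simp]: "j (M.prr x) = N.prr (j x)"
  using j_tp[of x] M.tp_eq[of x] N.tp_eq[of "j x"] by simp_all

lemma j_nn [simp]: "j (M.nn k) = N.nn k" by (induction k) simp_all

lemma j_dm [simp]: "j (M.dm x) = N.dm (j x)"
proof (rule j_eqI)
  have *: "(EX v. E2 (N.opair u v) (j x)) <-> (EX u'. u = j u' & (EX v. E1 (M.opair u' v) x))" for u
  proof
    assume "EX v. E2 (N.opair u v) (j x)"
    then obtain v z where z: "N.opair u v = j z" "E1 z x" using j_down j_mem by metis
    then show "EX u'. u = j u' & (EX v. E1 (M.opair u' v) x)" using j_opair_down[OF z(1)] by auto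
  next
    assume "EX u'. u = j u' & (EX v. E1 (M.opair u' v) x)"
    then show "EX v. E2 (N.opair u v) (j x)" by (metis j_mem j_opair)
  qed
  show "E1 z (M.dm x) <-> E2 (j z) (N.dm (j x))" for z unfolding M.mem_dm N.mem_dm * by simp
  show "E2 w (N.dm (j x)) ==> EX x. w = j x" for w unfolding N.mem_dm * by blast
qed

lemma j_rn [simp]: "j (M.rn x) = N.rn (j x)"
proof (rule j_eqI)
  have *: "(EX v. E2 (N.opair v u) (j x)) <-> (EX u'. u = j u' & (EX v. E1 (M.opair v u') x))" for u
  proof
    assume "EX v. E2 (N.opair v u) (j x)"
    then obtain v z where z: "N.opair v u = j z" "E1 z x" using j_down j_mem by metis
    then show "EX u'. u = j u' & (EX v. E1 (M.opair v u') x)" using j_opair_down[OF z(1)] by auto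
  next
    assume "EX u'. u = j u' & (EX v. E1 (M.opair v u') x)"
    then show "EX v. E2 (N.opair v u) (j x)" by (metis j_mem j_opair)
  qed
  show "E1 z (M.rn x) <-> E2 (j z) (N.rn (j x))" for z unfolding M.mem_rn N.mem_rn * by simp
  show "E2 w (N.rn (j x)) ==> EX x. w = j x" for w unfolding N.mem_rn * by blast
qed

lemma j_swp [simp]: "j (M.swp x) = N.swp (j x)"
proof (rule j_eqI)
  have *: "E2 z (N.swp (j x)) <-> (EX w. z = j w & E1 w (M.swp x))" for z
  proof
    assume "E2 z (N.swp (j x))"
    then obtain a b s where z: "z = N.opair a (N.opair b s)" "E2 (N.opair b (N.opair a s)) (j x)"
      unfolding N.mem_swp by blast
    then obtain w where w: "N.opair b (N.opair a s) = j w" using j_down by blast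
    obtain b' v where b: "b = j b'" "N.opair a s = j v" "w = M.opair b' v" using j_opair_down[OF w] by blast
    obtain a' s' where a: "a = j a'" "s = j s'" "v = M.opair a' s'" using j_opair_down[OF b(2)] by blast
    have "E1 w x" using z(2) unfolding w by simp
    then have "E1 (M.opair a' (M.opair b' s')) (M.swp x)" unfolding M.mem_swp using a b by blast
    then show "EX w. z = j w & E1 w (M.swp x)" using z(1) a b by (intro exI[of _ "M.opair a' (M.opair b' s')"]) simp
  next
    assume "EX w. z = j w & E1 w (M.swp x)"
    then obtain a b s where "z = j (M.opair a (M.opair b s))" "E1 (M.opair b (M.opair a s)) x" unfolding M.mem_swp by blast
    then show "E2 z (N.swp (j x))" unfolding N.mem_swp by (metis j_mem j_opair)
  qed
  show "E1 z (M.swp x) <-> E2 (j z) (N.swp (j x))" for z unfolding * by simp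
  show "E2 w (N.swp (j x)) ==> EX x. w = j x" for w unfolding * by blast
qed

lemma j_mrel [simp]: "j (M.mrel x y) = N.mrel (j x) (j y)"
proof (rule j_eqI)
  have *: "E2 z (N.mrel (j x) (j y)) <-> (EX a b s. z = j (M.opair a (M.opair b s)) & E1 a x & E1 b x & E1 s y & E1 a b)" for z
  proof
    assume "E2 z (N.mrel (j x) (j y))"
    then obtain a b s where z: "z = N.opair a (N.opair b s)" "E2 a (j x)" "E2 b (j x)" "E2 s (j y)" "E2 a b"
      unfolding N.mem_mrel by blast
    obtain a' b' s' where "a = j a'" "b = j b'" "s = j s'" using z(2,3,4) j_down by metis
    then show "EX a b s. z = j (M.opair a (M.opair b s)) & E1 a x & E1 b x & E1 s y & E1 a b"
      using z by (intro exI[of _ a'] exI[of _ b'] exI[of _ s']) simp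
  next
    assume "EX a b s. z = j (M.opair a (M.opair b s)) & E1 a x & E1 b x & E1 s y & E1 a b"
    then obtain a b s where "z = j (M.opair a (M.opair b s))" "E1 a x" "E1 b x" "E1 s y" "E1 a b" by blast
    then show "E2 z (N.mrel (j x) (j y))" unfolding N.mem_mrel
      by (intro exI[of _ "j a"] exI[of _ "j b"] exI[of _ "j s"]) simp
  qed
  show "E1 z (M.mrel x y) <-> E2 (j z) (N.mrel (j x) (j y))" for z unfolding * M.mem_mrel by (simp del: j_opair)
  show "E2 w (N.mrel (j x) (j y)) ==> EX x. w = j x" for w unfolding * by blast
qed

lemma j_erel [simp]: "j (M.erel x y) = N.erel (j x) (j y)"
proof (rule j_eqI)
  have *: "E2 z (N.erel (j x) (j y)) <-> (EX a s. z = j (M.opair a (M.opair a s)) & E1 a x & E1 s y)" for z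
  proof
    assume "E2 z (N.erel (j x) (j y))"
    then obtain a s where z: "z = N.opair a (N.opair a s)" "E2 a (j x)" "E2 s (j y)"
      unfolding N.mem_erel by blast
    obtain a' s' where "a = j a'" "s = j s'" using z(2,3) j_down by metis
    then show "EX a s. z = j (M.opair a (M.opair a s)) & E1 a x & E1 s y"
      using z by (intro exI[of _ a'] exI[of _ s']) simp
  next
    assume "EX a s. z = j (M.opair a (M.opair a s)) & E1 a x & E1 s y"
    then obtain a s where "z = j (M.opair a (M.opair a s))" "E1 a x" "E1 s y" by blast
    then show "E2 z (N.erel (j x) (j y))" unfolding N.mem_erel
      by (intro exI[of _ "j a"] exI[of _ "j s"]) simp
  qed
  show "E1 z (M.erel x y) <-> E2 (j z) (N.erel (j x) (j y))" for z unfolding * M.mem_erel by (simp del: j_opair)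
  show "E2 w (N.erel (j x) (j y)) ==> EX x. w = j x" for w unfolding * by blast
qed

lemma j_gop: "j (M.gop A i u v) = N.gop (j A) (j i) (j u) (j v)"
proof -
  have n: "(j i = N.nn k) = (i = M.nn k)" for k by (simp flip: j_nn)
  show ?thesis unfolding M.gop_def N.gop_def n by (simp del: M.nn.simps N.nn.simps)
qed

lemma j_Phi: "M.Ord x ==> j (M.Phi A x) = N.Phi (j A) (j x)"
proof -
  let ?P = "%x. M.Ord x --> j (M.Phi A x) = N.Phi (j A) (j x)"
  have "?P x"
  proof (rule j_induct[where P = ?P])
    show "mixed ?P" by (rule mixed_imp_Ord, rule mixed_eq) simp_all
    fix x assume IH: "!!y. E1 y x ==> ?P y"
    show "?P x"
    proof
      assume x: "M.Ord x"
      then have x': "N.Ord (j x)" by simp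
      have IH': "j (M.Phi A y) = N.Phi (j A) (j y)" if "E1 y x" for y using IH[OF that] M.Ord_in[OF x that] by blast
      have p: "N.pl (j x) = j (M.pl x)" "N.pl (N.prr (j x)) = j (M.pl (M.prr x))" "N.prr (N.prr (j x)) = j (M.prr (M.prr x))"
        by simp_all
      have n: "(j i = N.nn k) = (i = M.nn k)" for k i by (simp flip: j_nn)
      show "j (M.Phi A x) = N.Phi (j A) (j x)"
      proof (cases "M.pl x = M.emp")
        case True
        have "M.emp ~= M.nn k" "N.emp ~= N.nn k" if "k ~= 0" for k
          using M.nn_eq[of 0 k] N.nn_eq[of 0 k] that by simp_all
        then show ?thesis
          by (subst M.Phi_eq[OF x], subst N.Phi_eq[OF x']) (simp add: True M.gop_def N.gop_def flip: j_pl)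
      next
        case False
        note m = M.comps_mem[OF x False]
        have i: "j (M.img (M.pl (M.prr x)) (M.Phi A)) = N.img (j (M.pl (M.prr x))) (N.Phi (j A))"
        proof (rule j_eqI)
          have low: "j (M.Phi A y) = N.Phi (j A) (j y)" if "E1 y (M.pl (M.prr x))" for y
            using IH'[OF M.Ord_trans[OF x m(1) that]] .
          have *: "E2 z (N.img (j (M.pl (M.prr x))) (N.Phi (j A))) <-> (EX y. E1 y (M.pl (M.prr x)) & z = j (M.Phi A y))" for z
            unfolding N.mem_img[OF N.T_Phi[OF dft_const dft_var]] j_ex using low by auto
          show "E1 z (M.img (M.pl (M.prr x)) (M.Phi A)) <-> E2 (j z) (N.img (j (M.pl (M.prr x))) (N.Phi (j A)))" for z
            unfolding * M.mem_img[OF M.T_Phi[OF dft_const dft_var]] by simp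
          show "E2 w (N.img (j (M.pl (M.prr x))) (N.Phi (j A))) ==> EX x. w = j x" for w unfolding * by blast
        qed
        show ?thesis
          by (subst M.Phi_eq[OF x], subst N.Phi_eq[OF x'], unfold p n)
            (simp add: i j_gop IH'[OF m(1)] IH'[OF m(2)] del: j_pl j_prr M.nn.simps)
      qed
    qed
  qed
  then show "M.Ord x ==> j (M.Phi A x) = N.Phi (j A) (j x)" by blast
qed

end

context zf
begin

context
  fixes A and j :: "'b => 'a"
  assumes j: "bij_betw j UNIV {x. cst A x}"
begin

lemma cst_iff_range: "cst A x <-> (EX y. x = j y)"
  using j unfolding bij_betw_def by blast

lemma j_cst: "cst A (j y)" using cst_iff_range by blast

lemma j_inj: "j x = j y <-> x = y"
  using j unfolding bij_betw_def by (meson UNIV_I inj_onD)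

lemma Lsat_sat: "sat (%x y. j x eps j y) e p = Lsat A (%i. j (e i)) p"
  using sat_on_reindex[OF j, of mem e p] by (simp add: comp_def)

lemma cst_rel_D:
  assumes "dfn (%x y. j x eps j y) P"
  shows "EX Q. D Q & (ALL e. P e = Q (%i. j (e i)))"
proof -
  obtain p c where p: "!!e. P e = sat (%x y. j x eps j y) (mrg c e) p" using assms unfolding dfn_def by blast
  have "(%i. j (mrg c e i)) = mrg (%i. j (c i)) (%i. j (e i))" for e by (auto simp: fun_eq_iff mrg_def)
  then have "P e = Lsat A (mrg (%i. j (c i)) (%i. j (e i))) p" for e unfolding p Lsat_sat by simp
  moreover have "D (%e. Lsat A (mrg (%i. j (c i)) e) p)" by (rule dfn_params[OF D_Lsat])
  ultimately show ?thesis by blast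
qed

text \<open>Union, power set and collection reduce to placing a set of constructible sets inside one
  level, which is itself constructible.\<close>

lemma zf_cst: "zf (%x y. j x eps j y)"
proof (rule zf_intro)
  show "x = y" if "!!z. j z eps j x <-> j z eps j y" for x y
  proof -
    have "z eps j x <-> z eps j y" for z using that cst_iff_range cst_trans[OF j_cst] by metis
    then show ?thesis using ext[of "j x" "j y"] j_inj by blast
  qed
  show "EX y. j y eps j x & (ALL z. j z eps j x --> ~ j z eps j y)" if y: "j y eps j x" for x y
  proof -
    obtain m where m: "m eps j x" "ALL z. z eps j x --> ~ z eps m" using found y by blast
    then show ?thesis using cst_iff_range cst_trans[OF j_cst] by metis
  qed
  show "EX b. ALL x. j x eps j b <-> j x eps j a & P x" if P: "dfn (%x y. j x eps j y) (%e. P (e 0))" for P a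
  proof -
    obtain p c where p: "!!e. P (e 0) = sat (%x y. j x eps j y) (mrg c e) p" using P unfolding dfn_def by blast
    let ?f = "%n. if even n then 0 else Suc (n div 2)"
    have "P x = Lsat A (case_nat (j x) (%i. j (c i))) (ren ?f p)" for x
    proof -
      have "case_nat (j x) (%i. j (c i)) \<circ> ?f = (%i. j (mrg c (%_. x) i))"
        by (auto simp: fun_eq_iff mrg_def)
      then show ?thesis using p[of "%_. x"] by (simp add: Lsat_sat sat_on_ren del: comp_apply)
    qed
    moreover obtain y where "cst A y" "!!x. x eps y <-> x eps j a & Lsat A (case_nat x (%i. j (c i))) (ren ?f p)"
      using cst_separation[OF j_cst[of a], of "%i. j (c i)" "ren ?f p"] j_cst by blast
    ultimately show ?thesis using cst_iff_range by metis
  qed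
  show "EX p. j x eps j p & j y eps j p" for x y
  proof -
    obtain p where "upair (j x) (j y) = j p" using cst_ops(1)[OF j_cst j_cst] cst_iff_range by blast
    then show ?thesis by (metis mem_upair)
  qed
  have V: "EX p. ALL x. x eps s --> x eps j p" if s: "!!x. x eps s ==> cst A x" for s
  proof -
    obtain a where a: "Ord a" "!!x. x eps s ==> x eps V A a" using cst_subset_V s by metis
    then show ?thesis using cst_V[OF a(1)] cst_iff_range by metis
  qed
  show "EX u. ALL y z. j y eps j x --> j z eps j y --> j z eps j u" for x
  proof -
    have "cst A z" if "z eps Union (j x)" for z using that cst_trans j_cst by (metis mem_Union)
    from V[OF this] show ?thesis by (metis mem_Union)
  qed
  show "EX p. ALL z. (ALL w. j w eps j z --> j w eps j x) --> j z eps j p" for x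
  proof -
    have m: "z eps sep (Pow (j x)) (cst A) <-> sub z (j x) & cst A z" for z by (simp add: mem_sep)
    obtain p where p: "!!z. sub z (j x) ==> cst A z ==> z eps j p" using V[of "sep (Pow (j x)) (cst A)"] m by blast
    have "j z eps j p" if "ALL w. j w eps j z --> j w eps j x" for z
    proof (rule p[OF _ j_cst])
      show "sub (j z) (j x)" unfolding sub_def using that cst_iff_range cst_trans[OF j_cst] by metis
    qed
    then show ?thesis by blast
  qed
  show "EX x. (EX e. (ALL z. ~ j z eps j e) & j e eps j x) & (ALL y. j y eps j x --> (EX s. (ALL z. j z eps j s <-> j z eps j y | z = y) & j s eps j x))"
  proof -
    obtain w where w: "om = j w" using cst_Ord[OF Ord_om] cst_iff_range by blast
    obtain e where e: "emp = j e" using cst_emp cst_iff_range by blast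
    have "EX s. (ALL z. j z eps j s <-> j z eps j y | z = y) & j s eps j w" if y: "j y eps j w" for y
    proof -
      have s: "suc (j y) eps om" using y w suc_om by simp
      then obtain s where "suc (j y) = j s" using cst_trans[OF cst_Ord[OF Ord_om]] cst_iff_range by metis
      then show ?thesis using s w j_inj by (metis mem_suc)
    qed
    moreover have "ALL z. ~ j z eps j e" "j e eps j w" using emp_om by (simp_all flip: e w)
    ultimately show ?thesis by blast
  qed
  show "EX b. ALL x. j x eps j a --> (EX y. F x y) --> (EX y. j y eps j b & F x y)"
    if F: "dfn (%x y. j x eps j y) (%e. F (e 0) (e 1))" for F a
  proof -
    obtain Q where Q: "D Q" "!!e. F (e 0) (e 1) = Q (%i. j (e i))" using cst_rel_D[OF F] by blast
    let ?Q = "%u v. Q (%i. if i = 0 then u else v)"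
    have e: "F x y = ?Q (j x) (j y)" for x y
      using Q(2)[of "%i. if i = 0 then x else y"] by (simp add: if_distrib[of j])
    have DQ: "D (%e. ?Q (e 0) (e 1))"
      using dfn_ren[OF Q(1), of "%i. if i = 0 then 0 else 1"] by (simp add: if_distrib)
    let ?G = "%x. Lst (%i. ?Q x (Phi A i))"
    have D1: "D (%e. ?Q (t e) (Phi A (e 0)))" if "T t" for t
      using dfn_app2[OF DQ that, of "%e. Phi A (e 0)"] by simp
    have TG: "T (%e. ?G (e 0))" by (rule T_Lst) (use D1[of "%e. e (Suc 0)"] in simp)
    obtain b where b: "Ord b" "!!x. x eps img (j a) ?G ==> Ord x ==> x eps b" using ex_Ord_bound by metis
    obtain b' where b': "V A b = j b'" using cst_V[OF b(1)] cst_iff_range by blast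
    have "EX y. j y eps j b' & F x y" if x: "j x eps j a" and y: "F x y" for x y
    proof -
      obtain i where i: "Ord i" "Phi A i = j y" using j_cst unfolding cst_def by blast
      let ?P = "%i. ?Q (j x) (Phi A i)"
      have Pi: "?P i" unfolding i(2) using y e by simp
      have l: "Ord (?G (j x))" "?Q (j x) (Phi A (?G (j x)))"
        using Lst_Ord[of ?P i, OF D1[OF dft_const] i(1) Pi] Lst_prop[of ?P i, OF D1[OF dft_const] i(1) Pi] .
      have "?G (j x) eps img (j a) ?G" using x unfolding mem_img[OF TG] by blast
      then have "Phi A (?G (j x)) eps V A b" using b(2) l(1) unfolding mem_V by blast
      moreover obtain z where "Phi A (?G (j x)) = j z" using l(1) cst_iff_range unfolding cst_def by blast
      ultimately show ?thesis using l(2) e b' by metis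
    qed
    then show ?thesis by blast
  qed
qed

lemma inner_cst: "inner (%x y. j x eps j y) mem j"
proof -
  interpret K: zf "%x y. j x eps j y" by (rule zf_cst)
  show ?thesis
  proof
    show "EX x. w = j x" if "w eps j y" for w y using cst_trans[OF j_cst that] cst_iff_range by blast
    show "EX Q. D Q & (ALL e. P e = Q (%i. j (e i)))" if "dfn (%x y. j x eps j y) P" for P
      using cst_rel_D[OF that] .
    have "D (%e. cst A (e 0))" by simp
    then show "D (%e. EX x. e 0 = j x)" unfolding cst_iff_range .
    show "EX y. x = j y" if "Ord x" for x using cst_Ord[OF that] cst_iff_range by blast
  qed simp
qed

text \<open>The enumeration is absolute, so the inner model sees each of its sets as constructible,
  provided that the predicate \<open>A\<close> is a member of it.\<close>

lemma constructible_in_cst: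
  assumes "j A' = A"
  shows "EX i. zf.Ord (%x y. j x eps j y) i & zf.Phi (%x y. j x eps j y) A' i = x"
proof -
  interpret I: inner "%x y. j x eps j y" mem j by (rule inner_cst)
  obtain i where i: "Ord i" "Phi A i = j x" using j_cst unfolding cst_def by blast
  obtain k where k: "i = j k" using cst_Ord[OF i(1)] cst_iff_range by blast
  have kO: "I.M.Ord k" using i(1) I.j_Ord[of k] unfolding k by blast
  have "j (I.M.Phi A' k) = Phi A (j k)" using I.j_Phi[OF kO, of A'] unfolding assms .
  also have "\<dots> = j x" using i(2) unfolding k .
  finally have "I.M.Phi A' k = x" unfolding j_inj .
  then show ?thesis using kO by blast
qed

end

end

section \<open>Bijections and cardinals\<close>

context zf
begin

lemma Ord_Lst: "D (%e. P (e 0)) ==> Ord (Lst P)"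
proof (cases "EX x. Ord x & P x")
  case False
  then have "Lst P = Coll (%z. False)" unfolding Lst_def by (intro Coll_cong) auto
  also have "\<dots> = Coll (%z. z eps emp)" by (intro Coll_cong) simp
  also have "\<dots> = emp" by (rule Coll_mem)
  finally show ?thesis using Ord_emp by simp
qed (use Lst_Ord in blast)

definition isbij where
  "isbij f a b <-> (ALL p. p eps f --> (EX x y. x eps a & y eps b & p = opair x y)) & (ALL x. x eps a --> (EX!y. opair x y eps f))
    & (ALL x x' y. opair x y eps f & opair x' y eps f --> x = x') & (ALL y. y eps b --> (EX x. opair x y eps f))"

definition equi where "equi a b <-> (EX f. isbij f a b)"

lemma equiI:
  assumes "T (%e. F (e 0))" "!!x. x eps a ==> F x eps b" "!!x y. x eps a ==> y eps a ==> F x = F y ==> x = y"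
    "!!y. y eps b ==> EX x. x eps a & F x = y"
  shows "equi a b"
proof -
  have m: "p eps lam a F <-> (EX x. x eps a & p = opair x (F x))" for p by (rule mem_lam[OF assms(1)])
  have "isbij (lam a F) a b" unfolding isbij_def m opair_inject using assms(2,3) assms(4)[THEN ex_forward] by blast
  then show ?thesis unfolding equi_def by blast
qed

lemma isbij_ap: "isbij f a b ==> opair x y eps f ==> ap f x = y & x eps a & y eps b"
proof -
  assume f: "isbij f a b" "opair x y eps f"
  then have "x eps a" "y eps b" unfolding isbij_def by (metis opair_inject)+
  moreover have "ap f x = y" by (rule ap_eq[OF f(2)]) (use f \<open>x eps a\<close> in \<open>auto simp: isbij_def\<close>)
  ultimately show ?thesis by simp
qed

lemma equi_cov: "equi a b ==> cov a b" "equi a b ==> cov b a"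
proof -
  assume "equi a b"
  then obtain f where f: "isbij f a b" unfolding equi_def by blast
  show "cov a b" unfolding cov_def
    by (rule exI[of _ f]) (use isbij_ap[OF f] f in \<open>unfold isbij_def, blast\<close>)
  have D: "D (%e. opair (e 0) y eps f)" for y by simp
  let ?F = "%y. Coll (%z. EX x. opair x y eps f & z eps x)"
  show "cov b a"
  proof (rule cov_img[of ?F])
    show "T (%e. ?F (e 0))" by simp
    fix x assume "x eps a"
    then obtain y where y: "opair x y eps f" using f unfolding isbij_def by blast
    have "(EX x'. opair x' y eps f & z eps x') <-> z eps x" for z using y f unfolding isbij_def by blast
    then have "?F y = x" by simp
    then show "EX i. i eps b & ?F i = x" using isbij_ap[OF f y] by blast
  qed
qed

text \<open>Least preimages embed \<open>X\<close> into \<open>l\<close>; the order type of their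
  range is at most \<open>l\<close> and covers \<open>X\<close>, so by minimality it equals
  \<open>l\<close>.\<close>

lemma equi_if_cov:
  assumes l: "Ord l" "cov l X" "!!a. a eps l ==> ~ cov a X"
  shows "equi X l"
proof -
  obtain f where f: "!!x. x eps X ==> EX i. i eps l & ap f i = x" using l(2) unfolding cov_def by blast
  let ?h = "%x. Lst (%i. i eps l & ap f i = x)"
  have h: "?h x eps l" "ap f (?h x) = x" if "x eps X" for x
  proof -
    obtain i where i: "i eps l" "ap f i = x" using f \<open>x eps X\<close> by blast
    have "Ord i" using i l Ord_in by blast
    then have "?h x eps l & ap f (?h x) = x"
      using Lst_prop[of "%i. i eps l & ap f i = x" i] i by simp
    then show "?h x eps l" "ap f (?h x) = x" by auto
  qed
  let ?Y = "img X ?h"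
  have Y: "y eps ?Y <-> (EX x. x eps X & y = ?h x)" for y by (rule mem_img) simp
  have YO: "Ord y" if "y eps ?Y" for y using that h l Ord_in unfolding Y by blast
  have sl: "sub (otp ?Y) l" by (rule otp_sub) (use h l Y in auto)
  have e: "equi X (otp ?Y)"
  proof (rule equiI[of "%x. col ?Y (?h x)"])
    show "T (%e. col ?Y (?h (e 0)))" by simp
    fix x assume x: "x eps X"
    then have hx: "?h x eps ?Y" unfolding Y by blast
    then show "col ?Y (?h x) eps otp ?Y" unfolding mem_otp by blast
    fix y assume y: "y eps X" "col ?Y (?h x) = col ?Y (?h y)"
    have "?h y eps ?Y" using y unfolding Y by blast
    from col_inj_Ord[of ?Y, OF YO hx this y(2)] have "?h x = ?h y" .
    from arg_cong[OF this, of "ap f"] show "x = y" unfolding h(2)[OF x] h(2)[OF y(1)] .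
  next
    fix y assume "y eps otp ?Y"
    then show "EX x. x eps X & col ?Y (?h x) = y" unfolding mem_otp Y by blast
  qed
  have "otp ?Y = l"
    using Ord_sub_iff[OF Ord_otp l(1)] sl YO l(3) equi_cov(2)[OF e] by blast
  then show ?thesis using e by simp
qed

lemma equi_sym: "equi a b ==> equi b a"
proof -
  assume "equi a b"
  then obtain f where f: "isbij f a b" unfolding equi_def by blast
  let ?F = "%y. Coll (%z. EX x. opair x y eps f & z eps x)"
  have F: "?F y = x" if y: "opair x y eps f" for x y
  proof -
    have "(EX x'. opair x' y eps f & z eps x') <-> z eps x" for z using y f unfolding isbij_def by blast
    then show "?F y = x" by simp
  qed
  show ?thesis
  proof (rule equiI[of ?F])
    show "T (%e. ?F (e 0))" by simp
    show "?F x eps a" if x: "x eps b" for x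
    proof -
      obtain w where w: "opair w x eps f" using f x unfolding isbij_def by blast
      show ?thesis unfolding F[OF w] using isbij_ap[OF f w] by blast
    qed
    show "x = y" if x: "x eps b" "y eps b" "?F x = ?F y" for x y
    proof -
      have o: "EX w. opair w x eps f" if "x eps b" for x using f that unfolding isbij_def by blast
      obtain w v where w: "opair w x eps f" "opair v y eps f" using o[OF x(1)] o[OF x(2)] by blast
      have "w = v" using x(3) by (simp only: F[OF w(1)] F[OF w(2)])
      then show ?thesis using isbij_ap[OF f w(1)] isbij_ap[OF f w(2)] by simp
    qed
    show "EX x. x eps b & ?F x = y" if y: "y eps a" for y
    proof -
      obtain w where w: "opair y w eps f" using f y unfolding isbij_def by blast
      then show ?thesis using F isbij_ap[OF f w] by blast
    qed
  qed
qed

text \<open>Being no bijective image of a smaller ordinal amounts to not being covered by one.\<close>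

definition card where "card k <-> Ord k & (ALL a. a eps k --> ~ cov a k)"

lemma card_iff: "card k <-> Ord k & (ALL a. a eps k --> ~ equi a k)"
proof -
  have "equi a' k" if k: "Ord k" "a eps k" "cov a k" and a': "a' = Lst (%a. cov a k)" for a a'
  proof -
    have o: "Ord a" using k Ord_in by blast
    have "Ord a'" "cov a' k" unfolding a'
      using Lst_Ord[of "%a. cov a k" a] Lst_prop[of "%a. cov a k" a] o k by simp_all
    moreover have "~ cov b k" if "b eps a'" for b
      using Lst_least[of "%a. cov a k" b] Ord_in[OF \<open>Ord a'\<close> that] that unfolding a' by auto
    ultimately show ?thesis using equi_if_cov equi_sym by blast
  qed
  moreover have "Lst (%a. cov a k) eps k" if k: "Ord k" "a eps k" "cov a k" for a
  proof -
    have o: "Ord a" using k Ord_in by blast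
    have "sub (Lst (%a. cov a k)) a" "Ord (Lst (%a. cov a k))"
      using Lst_sub[of "%a. cov a k" a] Lst_Ord[of "%a. cov a k" a] o k by simp_all
    then show ?thesis using Ord_sub_iff[OF _ o] Ord_trans[OF k(1,2)] k(2) by auto
  qed
  ultimately show ?thesis unfolding card_def using equi_cov by blast
qed

end

section \<open>Models of ZF in which every set is constructible from a given set\<close>

locale zfL = zf +
  fixes A
  assumes VL: "EX i. Ord i & Phi A i = x"
begin

definition idx where "idx x = Lst (%i. Phi A i = x)"
text \<open>Global choice by the least index. It is definable, so choices can be made uniformly
  inside other definitions.\<close>

definition ch where "ch P = Phi A (Lst (%i. P (Phi A i)))"

lemma T_idx [simp]: "T a ==> T (%e. idx (a e))" unfolding idx_def by (simp add: dft_rens)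

lemma T_ch [simp]:
  assumes "D (%e. P (%i. e (Suc i)) (e 0))"
  shows "T (%e. ch (P e))"
  unfolding ch_def
  by (rule T_Phi[OF dft_const], rule T_Lst) (use dfn_binder[OF assms, of "%e. Phi A (e 0)" Suc] in simp)

lemma Ord_idx: "Ord (idx x)" unfolding idx_def by (rule Ord_Lst) simp

lemma Phi_idx [simp]: "Phi A (idx x) = x"
proof -
  obtain i where "Ord i" "Phi A i = x" using VL by blast
  then show ?thesis unfolding idx_def using Lst_prop[of "%i. Phi A i = x" i] by simp
qed

lemma idx_sub: "Ord i ==> Phi A i = x ==> sub (idx x) i"
  unfolding idx_def by (rule Lst_sub) simp_all

lemma ch: "D (%e. P (e 0)) ==> P x ==> P (ch P)"
proof -
  assume D: "D (%e. P (e 0))" and "P x"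
  have D': "D (%e. P (Phi A (e 0)))" by (rule dfn_app1[OF D]) simp
  have "P (Phi A (idx x))" using \<open>P x\<close> by simp
  then show ?thesis unfolding ch_def using Lst_prop[of "%i. P (Phi A i)" "idx x", OF D' Ord_idx] by blast
qed

lemma choice:
  assumes "!!y. y eps x ==> y ~= emp" "!!y z u. y eps x ==> z eps x ==> u eps y ==> u eps z ==> y = z"
  shows "EX c. ALL y. y eps x --> (EX!u. u eps y & u eps c)"
proof (intro exI allI impI)
  let ?c = "img x (%y. ch (%u. u eps y))"
  have m: "u eps ?c <-> (EX y. y eps x & u = ch (%u. u eps y))" for u by (rule mem_img) simp
  have c: "ch (%u. u eps y) eps y" if y: "y eps x" for y
  proof -
    obtain u where "u eps y" using assms(1)[OF y] ex_mem_iff by blast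
    then show ?thesis by (intro ch[of "%u. u eps y"]) simp_all
  qed
  fix y assume y: "y eps x"
  show "EX!u. u eps y & u eps ?c"
  proof (rule ex1I[of _ "ch (%u. u eps y)"])
    show "ch (%u. u eps y) eps y & ch (%u. u eps y) eps ?c" unfolding m using c y by blast
    fix u assume u: "u eps y & u eps ?c"
    then obtain z where z: "z eps x" "u = ch (%u. u eps z)" unfolding m by blast
    then have "z = y" using assms(2)[OF z(1) y, of u] c u by blast
    then show "u = ch (%u. u eps y)" using z by simp
  qed
qed

lemma cov_Union:
  assumes k: "icard k" and "cov k X" "!!x. x eps X ==> cov k x"
  shows "cov k (Union X)"
proof -
  obtain f where f: "!!x. x eps X ==> EX i. i eps k & ap f i = x" using assms(2) unfolding cov_def by blast
  let ?P = "%x g. ALL y. y eps x --> (EX i. i eps k & ap g i = y)"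
  have g: "?P x (ch (?P x))" if x: "x eps X" for x
  proof -
    obtain g where "?P x g" using assms(3)[OF x] unfolding cov_def by blast
    then show ?thesis by (intro ch[of "?P x" g]) simp
  qed
  show ?thesis
  proof (rule cov_img[of "%z. ap (ch (?P (ap f (pl z)))) (prr z)"])
    show "T (%e. ap (ch (?P (ap f (pl (e 0))))) (prr (e 0)))" by simp
    fix y assume "y eps Union X"
    then obtain x where x: "x eps X" "y eps x" by auto
    then obtain a b where ab: "a eps k" "ap f a = x" "b eps k" "ap (ch (?P x)) b = y" using f[OF x(1)] g[OF x(1)] x(2) by blast
    then have "Ord a" "Ord b" using k Ord_in unfolding icard_def by blast+
    then show "EX i. i eps k & ap (ch (?P (ap f (pl i)))) (prr i) = y"
      using ab pr_icard[OF k] by (intro exI[of _ "pr a b"]) (simp add: pl_pr prr_pr)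
  qed
qed

text \<open>The power set of \<open>k\<close> lies in a level, and a level is covered by its
  ordinal; if \<open>k\<close> covered all ordinals, it would cover its own power set.\<close>

lemma ex_not_cov: "EX a. Ord a & ~ cov k a"
proof (rule ccontr)
  assume n: "~ ?thesis"
  obtain a where a: "Ord a" "!!x. x eps Pow k ==> x eps V A a"
    using cst_subset_V[of "Pow k" A] VL unfolding cst_def by metis
  have "cov a (V A a)" unfolding V_def by (rule cov_imgs) simp
  then have "cov k (V A a)" using n a cov_trans by blast
  then have "cov k (Pow k)" using cov_sub a(2) unfolding sub_def by blast
  then show False using Cantor by blast
qed

text \<open>Hartogs' ordinal in terms of covering; for an infinite cardinal it is the successor
  cardinal.\<close>

definition hart where "hart k = Lst (%a. ~ cov k a)"

lemma hart: shows Ord_hart: "Ord (hart k)" and not_cov_hart: "~ cov k (hart k)"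
    and cov_hart: "a eps hart k ==> cov k a"
proof -
  obtain w where w: "Ord w" "~ cov k w" using ex_not_cov by blast
  show o: "Ord (hart k)" "~ cov k (hart k)" unfolding hart_def
    using Lst_Ord[of "%a. ~ cov k a" w] Lst_prop[of "%a. ~ cov k a" w] w by simp_all
  show "a eps hart k ==> cov k a"
    using Lst_least[of "%a. ~ cov k a" a] Ord_in[OF o(1)] unfolding hart_def by auto
qed

lemma mem_hart: "Ord a ==> a eps hart k <-> cov k a"
  using cov_hart not_cov_hart Ord_not_mem[OF _ Ord_hart] cov_sub by blast

lemma icard_hart: "icard k ==> icard (hart k)"
proof -
  assume k: "icard k"
  then have "k eps hart k" using mem_hart[of k k] unfolding icard_def by simp
  then have "sub k (hart k)" using Ord_trans[OF Ord_hart] unfolding sub_def by blast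
  then show ?thesis using k Ord_hart cov_hart not_cov_hart cov_trans unfolding icard_def sub_def by blast
qed

lemma k_hart: "icard k ==> k eps hart k" using mem_hart[of k k] unfolding icard_def by simp

lemma hart_regular:
  assumes "icard k" "cov k X" "!!x. x eps X ==> x eps hart k"
  shows "Union X eps hart k"
proof -
  have "Ord (Union X)" by (rule Ord_Union) (use assms(3) Ord_in[OF Ord_hart] in blast)
  moreover have "cov k (Union X)" by (rule cov_Union) (use assms cov_hart in blast)+
  ultimately show ?thesis using mem_hart by blast
qed

end

subsection \<open>Condensation\<close>

text \<open>Predicates are coded by quadruples of ordinals, which a collapse leaves in place as soon
  as it fixes these ordinals.\<close>

definition (in zf) quad where "quad m = prod m (prod m (prod m m))"
lemma (in zf) T_quad [simp]: "T a ==> T (%e. quad (a e))" unfolding quad_def by simp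

text \<open>\<open>k\<close> is the size of the hull, \<open>m\<close> bounds the ordinals occurring
  in \<open>A\<close>, and \<open>x0\<close> is the subset of \<open>k\<close> to be captured.
  Ordinals below \<open>m\<close> have size at most \<open>k\<close>, so the hull meets
  \<open>m\<close> in an initial segment.\<close>

locale hull = zfL +
  fixes k m x0
  assumes icard_k: "icard k" and A_quad: "sub A (quad m)" and Ord_m: "Ord m"
    and cov_m: "b eps m ==> cov k b" and x0_k: "sub x0 k"
begin

definition cover where "cover b = ch (%f. ALL x. x eps b --> (EX i. i eps k & ap f i = x))"

text \<open>Skolem functions on indices: 1 to 3 close under pairing and projections, 4 finds an
  element of a set, 5 and 6 find partners of \<open>v\<close> in a relation, 7 passes to the least
  index of a set, 8 and 9 translate between an ordinal and its index, 10 enumerates an ordinal by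
  \<open>k\<close>, and other codes give the index of \<open>x0\<close>. The default 0 keeps all
  values ordinals.\<close>

definition sk where
  "sk i u v = (if i = nn 1 then pr u v else if i = nn 2 then pl u else if i = nn 3 then prr u
    else if i = nn 4 then Lst (%z. Phi A z eps Phi A u) else if i = nn 5 then Lst (%z. opair (Phi A z) (Phi A v) eps Phi A u)
    else if i = nn 6 then Lst (%z. opair (Phi A v) (Phi A z) eps Phi A u) else if i = nn 7 then idx (Phi A u)
    else if i = nn 8 then idx u else if i = nn 9 then (if Ord (Phi A u) then Phi A u else emp)
    else if i = nn 10 then (if Ord (ap (cover u) v) then ap (cover u) v else emp) else idx x0)"

text \<open>Terms over the Skolem functions are coded by ordinals below \<open>k\<close>, which is
  closed under pairing; the tag 11 denotes the elements of \<open>k\<close>. So the hull is an image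
  of \<open>k\<close>: \<open>X\<close> holds its indices, \<open>Y\<close> the sets they
  denote.\<close>

definition PsiF where
  "PsiF p x f = (if pl x = nn 11 then pl (prr x) else sk (pl x) (ap f (pl (prr x))) (ap f (prr (prr x))))"
definition Psi where "Psi = rec PsiF emp"
definition X where "X = img k Psi"
definition Y where "Y = img X (Phi A)"

lemma T_cover [simp]: "T a ==> T (%e. cover (a e))" unfolding cover_def by (simp add: dft_rens)
lemma T_sk [simp]: "T a ==> T b ==> T c ==> T (%e. sk (a e) (b e) (c e))"
  unfolding sk_def by (simp add: dft_rens)
lemma T_PsiF: "T (%e. PsiF (e 0) (e 1) (e 2))" unfolding PsiF_def by simp
lemma T_Psi [simp]: "T a ==> T (%e. Psi (a e))" unfolding Psi_def by (rule T_rec[OF T_PsiF]) simp_all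

lemma Ord_k: "Ord k" using icard_k by (simp add: icard_def)
lemma nn_k: "nn i eps k" using icard_k nn_om[of i] by (auto simp: icard_def sub_def)

lemma Ord_sk: "Ord u ==> Ord v ==> Ord (sk i u v)"
  unfolding sk_def by (simp add: Ord_pr Ord_pl Ord_prr Ord_Lst Ord_idx)

lemma Psi_pr:
  assumes "a eps k" "b eps k" "i ~= 0"
  shows "Psi (pr (nn i) (pr a b)) = (if i = 11 then a else sk (nn i) (Psi a) (Psi b))"
proof -
  have o: "Ord a" "Ord b" using assms Ord_in[OF Ord_k] by auto
  let ?x = "pr (nn i) (pr a b)"
  have x: "Ord ?x" "pl ?x = nn i" "prr ?x = pr a b" using o by (simp_all add: Ord_pr pl_pr prr_pr)
  have "nn i ~= emp" using nn_eq[of i 0] assms(3) by simp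
  then have "a eps ?x" "b eps ?x" using comps_mem[OF x(1)] x o by (simp_all add: pl_pr prr_pr)
  moreover have "Psi ?x = PsiF emp ?x (lam ?x Psi)" unfolding Psi_def by (rule rec_eq[OF T_PsiF])
  ultimately have "Psi ?x = PsiF emp ?x (lam ?x Psi)" "ap (lam ?x Psi) a = Psi a" "ap (lam ?x Psi) b = Psi b"
    by (simp_all add: ap_lam)
  then show ?thesis by (simp only: PsiF_def x pl_pr[OF o] prr_pr[OF o] nn_eq)
qed

lemma Psi_any: "Ord x ==> (EX u v. (u = emp | u eps img x Psi) & (v = emp | v eps img x Psi) & Psi x = sk (pl x) u v) | Psi x = pl (prr x)"
proof -
  assume x: "Ord x"
  have 1: "Psi x = PsiF emp x (lam x Psi)" unfolding Psi_def by (rule rec_eq[OF T_PsiF])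
  have "ap (lam x Psi) y = emp | ap (lam x Psi) y eps img x Psi" for y
  proof (cases "y eps x")
    case True
    then show ?thesis by (auto simp: ap_lam mem_img)
  next
    case False
    then have "~ z eps ap (lam x Psi) y" for z by (auto simp: mem_ap mem_lam)
    then have "ap (lam x Psi) y = emp" using ex_mem_iff by blast
    then show ?thesis by simp
  qed
  then show ?thesis unfolding 1 PsiF_def by auto
qed

lemma Ord_Psi: "Ord x ==> Ord (Psi x)"
proof -
  have "Ord x --> Ord (Psi x)"
  proof (rule eps_induct[where P = "%x. Ord x --> Ord (Psi x)"])
    fix x assume IH: "!!y. y eps x ==> Ord y --> Ord (Psi y)"
    show "Ord x --> Ord (Psi x)"
    proof
      assume x: "Ord x"
      have i: "Ord u" if "u = emp | u eps img x Psi" for u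
      proof -
        have "u eps img x Psi <-> (EX y. y eps x & u = Psi y)" by (rule mem_img) simp
        then show ?thesis using that IH Ord_in[OF x] Ord_emp by blast
      qed
      show "Ord (Psi x)" using Psi_any[OF x]
      proof
        assume "Psi x = pl (prr x)"
        then show ?thesis using Ord_pl by simp
      next
        assume "EX u v. (u = emp | u eps img x Psi) & (v = emp | v eps img x Psi) & Psi x = sk (pl x) u v"
        then obtain u v where "Ord u" "Ord v" "Psi x = sk (pl x) u v" using i by blast
        then show ?thesis using Ord_sk by simp
      qed
    qed
  qed simp
  then show "Ord x ==> Ord (Psi x)" by blast
qed

lemma mem_X: "z eps X <-> (EX i. i eps k & z = Psi i)" unfolding X_def by (rule mem_img) simp
lemma mem_Y: "z eps Y <-> (EX i. i eps X & z = Phi A i)" unfolding Y_def by (rule mem_img) simp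
lemma X_Ord: "z eps X ==> Ord z" unfolding mem_X using Ord_Psi Ord_in[OF Ord_k] by auto
lemma cov_X: "cov k X" unfolding X_def by (rule cov_imgs) simp

lemma X_sk: "u eps X ==> v eps X ==> i ~= 0 ==> i ~= 11 ==> sk (nn i) u v eps X"
proof -
  assume a: "u eps X" "v eps X" "i ~= 0" "i ~= 11"
  then obtain a b where ab: "a eps k" "u = Psi a" "b eps k" "v = Psi b" unfolding mem_X by blast
  have "pr (nn i) (pr a b) eps k" using pr_icard[OF icard_k] nn_k ab by simp
  moreover have "Psi (pr (nn i) (pr a b)) = sk (nn i) u v" using Psi_pr[OF ab(1,3) a(3)] ab a by simp
  ultimately show ?thesis unfolding mem_X by metis
qed

lemma k_X: "a eps k ==> a eps X"
proof -
  assume a: "a eps k"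
  have "pr (nn 11) (pr a a) eps k" using pr_icard[OF icard_k] nn_k a by simp
  moreover have "Psi (pr (nn 11) (pr a a)) = a" using Psi_pr[OF a a, of 11] by simp
  ultimately show ?thesis unfolding mem_X by metis
qed

lemma X_closed:
  assumes u: "u eps X" and v: "v eps X"
  shows "pr u v eps X" "pl u eps X" "prr u eps X" "Lst (%z. Phi A z eps Phi A u) eps X"
    "Lst (%z. opair (Phi A z) (Phi A v) eps Phi A u) eps X" "Lst (%z. opair (Phi A v) (Phi A z) eps Phi A u) eps X"
    "idx (Phi A u) eps X" "idx u eps X" "Ord (Phi A u) ==> Phi A u eps X" "Ord (ap (cover u) v) ==> ap (cover u) v eps X" "idx x0 eps X"
  using X_sk[OF u v, of 1] X_sk[OF u v, of 2] X_sk[OF u v, of 3] X_sk[OF u v, of 4] X_sk[OF u v, of 5]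
    X_sk[OF u v, of 6] X_sk[OF u v, of 7] X_sk[OF u v, of 8] X_sk[OF u v, of 9] X_sk[OF u v, of 10] X_sk[OF u v, of 12]
  by (simp_all add: sk_def del: nn.simps)

lemma Y_gop: "u eps Y ==> v eps Y ==> i ~= 10 ==> gop A (nn i) u v eps Y"
proof -
  assume a: "u eps Y" "v eps Y" "i ~= 10"
  then obtain b c where bc: "b eps X" "u = Phi A b" "c eps X" "v = Phi A c" unfolding mem_Y by blast
  have "pr (nn i) (pr b c) eps X" using X_closed(1) k_X[OF nn_k] bc by blast
  moreover have "Phi A (pr (nn i) (pr b c)) = gop A (nn i) u v"
    using Phi_pr[OF X_Ord[OF bc(1)] X_Ord[OF bc(3)], of A i] a(3) bc by simp
  ultimately show ?thesis unfolding mem_Y by metis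
qed

lemma Y_ops:
  assumes "u eps Y" "v eps Y"
  shows "upair u v eps Y" "diff u v eps Y" "opair u v eps Y"
proof -
  have *: "upair x y eps Y" if "x eps Y" "y eps Y" for x y
    using Y_gop[OF that, of 1] by (simp add: gop_def)
  show "upair u v eps Y" "opair u v eps Y" using * assms by (auto simp: opair_def)
  show "diff u v eps Y" using Y_gop[OF assms, of 2] by (simp add: gop_def del: nn.simps)
qed

lemma Lst_Y:
  assumes "D (%e. P (e 0))" "P z" "Lst (%i. P (Phi A i)) eps X"
  shows "EX w. w eps Y & P w"
proof -
  have "P (Phi A (idx z))" using assms(2) by simp
  then have "P (Phi A (Lst (%i. P (Phi A i))))"
    using Lst_prop[of "%i. P (Phi A i)" "idx z", OF dfn_app1[OF assms(1)] Ord_idx] by simp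
  then show ?thesis using assms(3) unfolding mem_Y by blast
qed

lemma Y_elem: "u eps Y ==> z eps u ==> EX w. w eps Y & w eps u"
  using Lst_Y[of "%w. w eps u" z] X_closed(4) unfolding mem_Y[of u] by auto

lemma Y_upair: "upair u v eps Y ==> u eps Y & v eps Y"
proof -
  have *: "v eps Y" if a: "upair u v eps Y" "u eps Y" for u v
  proof (cases "u = v")
    case False
    have "diff (upair u v) (upair u u) eps Y" using Y_ops a by blast
    then obtain w where "w eps Y" "w eps diff (upair u v) (upair u u)"
      using Y_elem[of "diff (upair u v) (upair u u)" v] False by auto
    then show ?thesis by auto
  qed (use a in simp)
  assume a: "upair u v eps Y"
  then obtain w where "w eps Y" "w eps upair u v" using Y_elem[of "upair u v" u] by auto
  then consider "u eps Y" | "v eps Y" by auto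
  then show ?thesis
  proof cases
    case 2
    have "upair v u = upair u v" by (rule ext) auto
    then show ?thesis using *[of v u] 2 a by simp
  qed (use * a in blast)
qed

lemma Y_opair: "opair u v eps Y ==> u eps Y & v eps Y"
  unfolding opair_def using Y_upair by blast

abbreviation pi where "pi \<equiv> col Y"
abbreviation \<sigma> where "\<sigma> \<equiv> col X"

text \<open>\<open>Y\<close> is extensional: it is closed under differences and meets each of its
  nonempty elements.\<close>

lemma pi_inj: "u eps Y ==> v eps Y ==> pi u = pi v <-> u = v"
proof
  have "ALL v. u eps Y & v eps Y & pi u = pi v --> u = v"
  proof (rule eps_induct[where P = "%u. ALL v. u eps Y & v eps Y & pi u = pi v --> u = v"])
    fix u assume IH: "!!z. z eps u ==> ALL v. z eps Y & v eps Y & pi z = pi v --> z = v"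
    show "ALL v. u eps Y & v eps Y & pi u = pi v --> u = v"
    proof (intro allI impI, rule ccontr)
      fix v assume a: "u eps Y & v eps Y & pi u = pi v" and ne: "u ~= v"
      consider z where "z eps diff u v" | z where "z eps diff v u" using ext[of u v] ne by auto
      then show False
      proof cases
        case 1
        then obtain w where w: "w eps Y" "w eps u" "~ w eps v" using Y_elem Y_ops(2) a by (metis mem_diff)
        then have "pi w eps pi v" using col_mono[of w u Y] a by simp
        then obtain z where z: "z eps v" "z eps Y" "pi w = pi z" unfolding mem_col by blast
        then show False using IH[OF w(2)] w by blast
      next
        case 2
        then obtain w where w: "w eps Y" "w eps v" "~ w eps u" using Y_elem Y_ops(2) a by (metis mem_diff)
        then have "pi w eps pi u" using col_mono[of w v Y] a by simp
        then obtain z where z: "z eps u" "z eps Y" "pi w = pi z" unfolding mem_col by blast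
        then show False using IH[OF z(1)] w by metis
      qed
    qed
  qed simp
  then show "u eps Y ==> v eps Y ==> pi u = pi v ==> u = v" by blast
qed simp

lemma pi_mem: "u eps Y ==> v eps Y ==> pi u eps pi v <-> u eps v"
  using col_mono[of u v Y] mem_col[of "pi u" Y v] pi_inj by blast

lemma pi_upair: "u eps Y ==> v eps Y ==> pi (upair u v) = upair (pi u) (pi v)"
  by (rule ext, subst mem_col) auto

lemma pi_opair: "u eps Y ==> v eps Y ==> pi (opair u v) = opair (pi u) (pi v)"
  unfolding opair_def using pi_upair Y_ops(1) by simp

lemma pi_elem: "t eps pi u ==> EX z. z eps u & z eps Y & t = pi z"
  unfolding mem_col by blast

lemma pi_opair_inv:
  assumes w: "w eps Y" "pi w = opair t s"
  shows "EX a b. a eps Y & b eps Y & w = opair a b & t = pi a & s = pi b"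
proof -
  have "upair t s eps pi w" unfolding w(2) by (simp add: opair_def)
  then obtain p where p: "p eps Y" "upair t s = pi p" using pi_elem by blast
  have "t eps pi p" "s eps pi p" by (simp_all flip: p(2))
  then obtain a b where ab: "a eps Y" "b eps Y" "t = pi a" "s = pi b" using pi_elem by meson
  then have "pi w = pi (opair a b)" using w pi_opair by simp
  then have "w = opair a b" using pi_inj w Y_ops(3) ab by blast
  then show ?thesis using ab by blast
qed

lemma pi_eqI:
  assumes "w eps Y" "!!z. z eps w ==> z eps Y ==> pi z eps b" "!!t. t eps b ==> EX z. z eps w & z eps Y & t = pi z"
  shows "pi w = b"
  by (rule ext, subst mem_col) (use assms in blast)

text \<open>An initial segment of \<open>m\<close>, since each of its elements is enumerated by
  \<open>k\<close> through \<open>cover\<close> and \<open>k\<close> is part of \<open>X\<close>;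
  hence the collapse fixes it pointwise.\<close>

definition xi where "xi = inter X m"

lemma xi_trans: "b eps xi ==> z eps b ==> z eps xi"
proof -
  assume b: "b eps xi" and z: "z eps b"
  then have bm: "b eps X" "b eps m" "z eps m" using Ord_trans[OF Ord_m] by (auto simp: xi_def)
  let ?P = "%f. ALL x. x eps b --> (EX i. i eps k & ap f i = x)"
  obtain f where "?P f" using cov_m[OF bm(2)] unfolding cov_def by blast
  then have "?P (cover b)" unfolding cover_def by (intro ch[of ?P f]) simp
  then obtain i where i: "i eps k" "ap (cover b) i = z" using z by blast
  have "Ord z" using z Ord_in X_Ord[OF bm(1)] by blast
  then have "z eps X" using X_closed(10)[OF bm(1) k_X[OF i(1)]] i by simp
  then show ?thesis using bm by (simp add: xi_def)
qed

lemma Ord_xi: "Ord xi"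
proof (rule OrdI)
  show "Ord x" if "x eps xi" for x using that by (intro X_Ord) (simp add: xi_def)
  show "!!x y. x eps xi ==> y eps x ==> y eps xi" by (rule xi_trans)
qed

lemma X_Y: "z eps X ==> z eps Y"
  unfolding mem_Y using X_closed(8) by (intro exI[of _ "idx z"]) simp

lemma Y_X: "z eps Y ==> Ord z ==> z eps X"
  unfolding mem_Y using X_closed(9) by blast

lemma pi_fix:
  assumes s: "!!z w. z eps s ==> w eps z ==> w eps s" "!!z. z eps s ==> z eps X" and z: "z eps s"
  shows "pi z = z" "\<sigma> z = z"
proof -
  have "z eps s --> pi z = z & \<sigma> z = z"
  proof (rule eps_induct[where P = "%z. z eps s --> pi z = z & \<sigma> z = z"])
    fix z assume IH: "!!y. y eps z ==> y eps s --> pi y = y & \<sigma> y = y"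
    show "z eps s --> pi z = z & \<sigma> z = z"
    proof
      assume z: "z eps s"
      have y: "y eps X" "y eps Y" "pi y = y" "\<sigma> y = y" if "y eps z" for y
        using s z that IH[OF that] X_Y by auto
      have "w eps pi z <-> w eps z" for w unfolding mem_col using y by auto
      moreover have "w eps \<sigma> z <-> w eps z" for w unfolding mem_col using y by auto
      ultimately show "pi z = z & \<sigma> z = z" using ext[of "pi z" z] ext[of "\<sigma> z" z] by blast
    qed
  qed simp
  then show "pi z = z" "\<sigma> z = z" using z by auto
qed

lemma fix_k: "z eps k ==> pi z = z" "z eps k ==> \<sigma> z = z"
  using pi_fix[of k z] Ord_trans[OF Ord_k] k_X by blast+

lemma fix_xi: "z eps xi ==> pi z = z"
  by (rule pi_fix(1)[of xi z, OF xi_trans]) (simp_all add: xi_def)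

definition A' where "A' = inter A (quad xi)"

lemma quad_Y:
  assumes "z eps quad xi"
  shows "z eps Y" "pi z = z"
proof -
  obtain a b c d where abcd: "a eps xi" "b eps xi" "c eps xi" "d eps xi" "z = opair a (opair b (opair c d))"
    using assms unfolding quad_def mem_prod by blast
  then have y: "a eps Y" "b eps Y" "c eps Y" "d eps Y" using X_Y by (auto simp: xi_def)
  then show "z eps Y" using Y_ops(3) abcd by blast
  show "pi z = z" unfolding abcd(5) using pi_opair Y_ops(3) y fix_xi abcd(1-4) by simp
qed

lemma A_Y: "z eps Y ==> z eps A ==> z eps A'"
proof -
  assume z: "z eps Y" "z eps A"
  then have "z eps quad m" using A_quad by (auto simp: sub_def)
  then obtain a b c d where abcd: "a eps m" "b eps m" "c eps m" "d eps m" "z = opair a (opair b (opair c d))"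
    unfolding quad_def mem_prod by blast
  then have "a eps Y" "b eps Y" "c eps Y" "d eps Y" using Y_opair z by blast+
  then have "a eps xi" "b eps xi" "c eps xi" "d eps xi" using Y_X Ord_in[OF Ord_m] abcd by (auto simp: xi_def)
  then show ?thesis using z abcd by (simp add: A'_def quad_def)
qed

text \<open>The entries of a tuple in \<open>Y\<close> lie in \<open>Y\<close>. Only for domain and
  range a component is missing, and there a Skolem function finds it inside
  \<open>Y\<close>.\<close>

lemma pi_gop:
  assumes u: "u eps Y" and v: "v eps Y"
  shows "pi (gop A (nn i) u v) = gop A' (nn i) (pi u) (pi v)"
proof (cases "i = 10 | i = 0 | i > 10")
  case True
  have "nn i ~= nn n" if "n < 10" "n ~= 0" for n using True that by auto
  then have "gop B (nn i) u v = emp" for B u v by (simp add: gop_def del: nn.simps nn_eq)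
  moreover have "pi emp = emp" by (rule ext, subst mem_col) simp
  ultimately show ?thesis by simp
next
  case False
  have gY: "gop A (nn i) u v eps Y" using Y_gop u v False by simp
  consider "i = 1" | "i = 2" | "i = 3" | "i = 4" | "i = 5" | "i = 6" | "i = 7" | "i = 8" | "i = 9"
    using False by atomize_elim arith
  then show ?thesis
  proof cases
    case 1
    then show ?thesis using pi_upair[OF u v] by (simp add: gop_def)
  next
    case 2
    have g: "gop B (nn i) u v = diff u v" for B u v unfolding 2 by (simp add: gop_def del: nn.simps)
    show ?thesis unfolding g
    proof (rule pi_eqI)
      show "diff u v eps Y" using gY g by simp
      show "pi z eps diff (pi u) (pi v)" if "z eps diff u v" "z eps Y" for z using that pi_mem u v by simp
      fix t assume t: "t eps diff (pi u) (pi v)"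
      then obtain z where z: "z eps u" "z eps Y" "t = pi z" using pi_elem[of t u] by auto
      then have "~ z eps v" using t pi_mem[OF z(2) v] by simp
      then show "EX z. z eps diff u v & z eps Y & t = pi z" using z by auto
    qed
  next
    case 3
    have g: "gop B (nn i) u v = prod u v" for B u v unfolding 3 by (simp add: gop_def del: nn.simps)
    show ?thesis unfolding g
    proof (rule pi_eqI)
      show "prod u v eps Y" using gY g by simp
      fix z assume "z eps prod u v" "z eps Y"
      then obtain a b where "a eps u" "b eps v" "z = opair a b" "a eps Y" "b eps Y" unfolding mem_prod using Y_opair by blast
      then show "pi z eps prod (pi u) (pi v)" using pi_opair pi_mem u v by simp
    next
      fix t assume "t eps prod (pi u) (pi v)"
      then obtain a b where "a eps u" "a eps Y" "b eps v" "b eps Y" "t = opair (pi a) (pi b)" unfolding mem_prod using pi_elem by blast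
      then show "EX z. z eps prod u v & z eps Y & t = pi z" using pi_opair Y_ops(3) by (intro exI[of _ "opair a b"]) simp
    qed
  next
    case 4
    have g: "gop B (nn i) u v = dm u" for B u v unfolding 4 by (simp add: gop_def del: nn.simps)
    show ?thesis unfolding g
    proof (rule pi_eqI)
      show "dm u eps Y" using gY g by simp
      fix z assume z: "z eps dm u" "z eps Y"
      then obtain b where b: "opair z b eps u" unfolding mem_dm by blast
      obtain c d where "c eps X" "u = Phi A c" "d eps X" "z = Phi A d" using u z unfolding mem_Y by blast
      then have "EX w. w eps Y & opair z w eps u" using Lst_Y[of "%w. opair z w eps u" b] b X_closed(6) by simp
      then obtain w where w: "w eps Y" "opair z w eps u" by blast
      then have "opair (pi z) (pi w) eps pi u" using pi_mem[OF Y_ops(3)[OF z(2) w(1)] u] pi_opair z by simp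
      then show "pi z eps dm (pi u)" unfolding mem_dm by blast
    next
      fix t assume "t eps dm (pi u)"
      then obtain s w where "w eps u" "w eps Y" "opair t s = pi w" unfolding mem_dm using pi_elem by blast
      then show "EX z. z eps dm u & z eps Y & t = pi z" unfolding mem_dm using pi_opair_inv[of w t s] by auto
    qed
  next
    case 5
    have g: "gop B (nn i) u v = rn u" for B u v unfolding 5 by (simp add: gop_def del: nn.simps)
    show ?thesis unfolding g
    proof (rule pi_eqI)
      show "rn u eps Y" using gY g by simp
      fix z assume z: "z eps rn u" "z eps Y"
      then obtain b where b: "opair b z eps u" unfolding mem_rn by blast
      obtain c d where "c eps X" "u = Phi A c" "d eps X" "z = Phi A d" using u z unfolding mem_Y by blast
      then have "EX w. w eps Y & opair w z eps u" using Lst_Y[of "%w. opair w z eps u" b] b X_closed(5) by simp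
      then obtain w where w: "w eps Y" "opair w z eps u" by blast
      then have "opair (pi w) (pi z) eps pi u" using pi_mem[OF Y_ops(3)[OF w(1) z(2)] u] pi_opair z by simp
      then show "pi z eps rn (pi u)" unfolding mem_rn by blast
    next
      fix t assume "t eps rn (pi u)"
      then obtain s w where "w eps u" "w eps Y" "opair s t = pi w" unfolding mem_rn using pi_elem by blast
      then show "EX z. z eps rn u & z eps Y & t = pi z" unfolding mem_rn using pi_opair_inv[of w s t] by auto
    qed
  next
    case 6
    have g: "gop B (nn i) u v = swp u" for B u v unfolding 6 by (simp add: gop_def del: nn.simps)
    show ?thesis unfolding g
    proof (rule pi_eqI)
      show "swp u eps Y" using gY g by simp
      fix z assume z: "z eps swp u" "z eps Y"
      then obtain a b s where s: "z = opair a (opair b s)" "opair b (opair a s) eps u" unfolding mem_swp by blast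
      then have y: "a eps Y" "b eps Y" "s eps Y" using z Y_opair by blast+
      then have "pi (opair b (opair a s)) eps pi u" using pi_mem[OF Y_ops(3)[OF y(2) Y_ops(3)[OF y(1,3)]] u] s(2) by simp
      moreover have "pi (opair b (opair a s)) = opair (pi b) (opair (pi a) (pi s))" "pi z = opair (pi a) (opair (pi b) (pi s))"
        using s(1) y pi_opair Y_ops(3) by simp_all
      ultimately show "pi z eps swp (pi u)" unfolding mem_swp by metis
    next
      fix t assume "t eps swp (pi u)"
      then obtain a b s w where w: "t = opair a (opair b s)" "w eps u" "w eps Y" "pi w = opair b (opair a s)"
        unfolding mem_swp using pi_elem[of _ u] by (metis (no_types))
      obtain b' p where p: "b' eps Y" "p eps Y" "w = opair b' p" "b = pi b'" "pi p = opair a s"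
        using pi_opair_inv[OF w(3,4)] by metis
      obtain a' s' where q: "a' eps Y" "s' eps Y" "p = opair a' s'" "a = pi a'" "s = pi s'"
        using pi_opair_inv[OF p(2,5)] by metis
      have "opair a' (opair b' s') eps swp u" unfolding mem_swp using w(2) p(3) q(3) by blast
      then show "EX z. z eps swp u & z eps Y & t = pi z"
        using w(1) p q pi_opair Y_ops(3) by (intro exI[of _ "opair a' (opair b' s')"]) simp
    qed
  next
    case 7
    have g: "gop B (nn i) u v = mrel u v" for B u v unfolding 7 by (simp add: gop_def del: nn.simps)
    show ?thesis unfolding g
    proof (rule pi_eqI)
      show "mrel u v eps Y" using gY g by simp
      fix z assume z: "z eps mrel u v" "z eps Y"
      then obtain a b s where s: "z = opair a (opair b s)" "a eps u" "b eps u" "s eps v" "a eps b" unfolding mem_mrel by blast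
      then have y: "a eps Y" "b eps Y" "s eps Y" using z Y_opair by blast+
      have "pi z = opair (pi a) (opair (pi b) (pi s))" using s(1) y pi_opair Y_ops(3) by simp
      then show "pi z eps mrel (pi u) (pi v)" unfolding mem_mrel using s y u v pi_mem by blast
    next
      fix t assume "t eps mrel (pi u) (pi v)"
      then obtain a b s where s: "t = opair a (opair b s)" "a eps pi u" "b eps pi u" "s eps pi v" "a eps b" unfolding mem_mrel by blast
      obtain a' where a': "a' eps u" "a' eps Y" "a = pi a'" using pi_elem s by blast
      obtain b' where b': "b' eps u" "b' eps Y" "b = pi b'" using pi_elem s by blast
      obtain s' where s': "s' eps v" "s' eps Y" "s = pi s'" using pi_elem s by blast
      have "a' eps b'" using s(5) a' b' pi_mem by simp
      then have "opair a' (opair b' s') eps mrel u v" unfolding mem_mrel using a' b' s' by blast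
      then show "EX z. z eps mrel u v & z eps Y & t = pi z"
        using s(1) a' b' s' pi_opair Y_ops(3) by (intro exI[of _ "opair a' (opair b' s')"]) simp
    qed
  next
    case 8
    have g: "gop B (nn i) u v = erel u v" for B u v unfolding 8 by (simp add: gop_def del: nn.simps)
    show ?thesis unfolding g
    proof (rule pi_eqI)
      show "erel u v eps Y" using gY g by simp
      fix z assume z: "z eps erel u v" "z eps Y"
      then obtain a s where s: "z = opair a (opair a s)" "a eps u" "s eps v" unfolding mem_erel by blast
      then have y: "a eps Y" "s eps Y" using z Y_opair by blast+
      have "pi z = opair (pi a) (opair (pi a) (pi s))" using s(1) y pi_opair Y_ops(3) by simp
      then show "pi z eps erel (pi u) (pi v)" unfolding mem_erel using s y u v pi_mem by blast
    next
      fix t assume "t eps erel (pi u) (pi v)"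
      then obtain a s where s: "t = opair a (opair a s)" "a eps pi u" "s eps pi v" unfolding mem_erel by blast
      obtain a' where a': "a' eps u" "a' eps Y" "a = pi a'" using pi_elem s by blast
      obtain s' where s': "s' eps v" "s' eps Y" "s = pi s'" using pi_elem s by blast
      have "opair a' (opair a' s') eps erel u v" unfolding mem_erel using a' s' by blast
      then show "EX z. z eps erel u v & z eps Y & t = pi z"
        using s(1) a' s' pi_opair Y_ops(3) by (intro exI[of _ "opair a' (opair a' s')"]) simp
    qed
  next
    case 9
    have g: "gop B (nn i) u v = inter u B" for B u v unfolding 9 by (simp add: gop_def del: nn.simps)
    show ?thesis unfolding g
    proof (rule pi_eqI)
      show "inter u A eps Y" using gY g by simp
      fix z assume z: "z eps inter u A" "z eps Y"
      then have zA: "z eps A'" using A_Y by simp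
      then have "pi z = z" using quad_Y(2) by (simp add: A'_def)
      moreover have "pi z eps pi u" using z pi_mem u by simp
      ultimately show "pi z eps inter (pi u) A'" using zA by simp
    next
      fix t assume t: "t eps inter (pi u) A'"
      then obtain z where z: "z eps u" "z eps Y" "t = pi z" using pi_elem[of t u] by auto
      have tq: "t eps Y" "pi t = t" using quad_Y t by (auto simp: A'_def)
      then have "t = z" using z pi_inj by metis
      then show "EX z. z eps inter u A & z eps Y & t = pi z" using t tq z by (intro exI[of _ t]) (simp add: A'_def)
    qed
  qed
qed

text \<open>By \<open>col_pr\<close> a collapsed index keeps its tag, natural numbers being fixed,
  and its components collapse with it; so the recursion for \<open>Phi\<close> can be followed step
  by step. This is condensation.\<close>

lemma pi_Phi: "z eps X ==> pi (Phi A z) = Phi A' (\<sigma> z)"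
proof -
  have "z eps X --> pi (Phi A z) = Phi A' (\<sigma> z)"
  proof (rule eps_induct[where P = "%z. z eps X --> pi (Phi A z) = Phi A' (\<sigma> z)"])
    fix z assume IH: "!!y. y eps z ==> y eps X --> pi (Phi A y) = Phi A' (\<sigma> y)"
    show "z eps X --> pi (Phi A z) = Phi A' (\<sigma> z)"
    proof
      assume z: "z eps X"
      have o: "Ord z" using X_Ord z by blast
      have so: "Ord (\<sigma> y)" if "y eps X" for y using Ord_col X_Ord that by blast
      have c: "\<sigma> y = pr (\<sigma> (pl y)) (\<sigma> (prr y))" if "y eps X" for y
        by (rule col_pr[OF _ _ that]) (simp_all add: X_closed X_Ord)
      have px: "pl y eps X" "prr y eps X" if "y eps X" for y using X_closed(2,3)[OF that that] .
      have pls: "pl (\<sigma> y) = \<sigma> (pl y)" "prr (\<sigma> y) = \<sigma> (prr y)" if "y eps X" for y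
        unfolding c[OF that] using so px that by (simp_all add: pl_pr prr_pr)
      let ?a = "pl (prr z)" let ?b = "prr (prr z)"
      have ab: "?a eps X" "?b eps X" using px z by blast+
      have n: "(\<sigma> (pl z) = nn i) = (pl z = nn i)" for i
        using col_inj_Ord[of X "pl z" "nn i"] X_Ord px[OF z] k_X[OF nn_k] fix_k(2)[OF nn_k] by metis
      have e: "\<sigma> (pl z) = pl z" if "pl z = nn i" for i using that fix_k(2)[OF nn_k] by simp
      have S: "Phi A' (\<sigma> z) = (if pl z = nn 10 then img (\<sigma> ?a) (Phi A')
          else gop A' (\<sigma> (pl z)) (Phi A' (\<sigma> ?a)) (Phi A' (\<sigma> ?b)))"
        unfolding Phi_eq[OF so[OF z], of A'] pls[OF z] pls[OF px(2)[OF z]] n by simp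
      show "pi (Phi A z) = Phi A' (\<sigma> z)"
      proof (cases "EX i. i ~= 0 & i ~= 10 & i < 10 & pl z = nn i")
        case True
        then obtain i where i: "i ~= 0" "i ~= 10" "pl z = nn i" by blast
        have "pl z ~= emp" using i nn_eq[of i 0] by simp
        then have m: "?a eps z" "?b eps z" using comps_mem[OF o] by auto
        have "Phi A z = gop A (nn i) (Phi A ?a) (Phi A ?b)" unfolding Phi_eq[OF o, of A] using i by simp
        moreover have "Phi A' (\<sigma> z) = gop A' (nn i) (Phi A' (\<sigma> ?a)) (Phi A' (\<sigma> ?b))"
          unfolding S using i e by simp
        moreover have "Phi A ?a eps Y" "Phi A ?b eps Y" using ab unfolding mem_Y by blast+
        ultimately show ?thesis using pi_gop IH[OF m(1)] IH[OF m(2)] ab by simp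
      next
        case False
        show ?thesis
        proof (cases "pl z = nn 10")
          case True
          have "pl z ~= emp" using True nn_eq[of 10 0] by simp
          then have az: "?a eps z" using comps_mem[OF o] by auto
          have P: "Phi A z = img ?a (Phi A)" "Phi A' (\<sigma> z) = img (\<sigma> ?a) (Phi A')"
            using Phi_eq[OF o, of A] S True by simp_all
          have mi: "t eps img d (Phi B) <-> (EX y. y eps d & t = Phi B y)" for t d B by (rule mem_img) simp
          have IH': "pi (Phi A y) = Phi A' (\<sigma> y)" if "y eps ?a" "y eps X" for y
            using IH Ord_trans[OF o az that(1)] that by blast
          show ?thesis
          proof (rule pi_eqI)
            show "Phi A z eps Y" using z unfolding mem_Y by blast
            fix y assume y: "y eps Phi A z" "y eps Y"
            then obtain d where d: "d eps ?a" "y = Phi A d" unfolding P mi by blast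
            obtain g where g: "g eps X" "y = Phi A g" using y unfolding mem_Y by blast
            \<comment> \<open>The index \<open>d\<close> below \<open>?a\<close> need not belong to
              the hull; the least index of \<open>y\<close> does and is no larger.\<close>
            have "idx y eps X" using X_closed(7)[OF g(1) g(1)] g by simp
            moreover have "idx y eps ?a"
              using idx_sub[of d y] Ord_sub_iff[OF Ord_idx, of d y] Ord_in[OF Ord_pl d(1)] d Ord_trans[OF Ord_pl d(1)] by auto
            ultimately have "pi y = Phi A' (\<sigma> (idx y))" "\<sigma> (idx y) eps \<sigma> ?a"
              using IH'[of "idx y"] col_mono by simp_all
            then show "pi y eps Phi A' (\<sigma> z)" unfolding P mi by blast
          next
            fix t assume "t eps Phi A' (\<sigma> z)"
            then obtain s where s: "s eps \<sigma> ?a" "t = Phi A' s" unfolding P mi by blast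
            then obtain y where y: "y eps ?a" "y eps X" "s = \<sigma> y" using mem_col[of s X ?a] by blast
            then have "t = pi (Phi A y)" using IH' s by simp
            moreover have "Phi A y eps Phi A z" unfolding P mi using y by blast
            moreover have "Phi A y eps Y" using y unfolding mem_Y by blast
            ultimately show "EX w. w eps Phi A z & w eps Y & t = pi w" by blast
          qed
        next
          case n10: False
          have ne: "pl z ~= nn i" if "i ~= 0" "i < 10" for i using that False by auto
          have E: "gop B (pl z) u v = emp" for B u v
            unfolding gop_def using ne[of 1] ne[of 2] ne[of 3] ne[of 4] ne[of 5] ne[of 6] ne[of 7] ne[of 8] ne[of 9]
            by (simp del: nn.simps)
          have E': "gop B (\<sigma> (pl z)) u v = emp" for B u v
            unfolding gop_def n using ne[of 1] ne[of 2] ne[of 3] ne[of 4] ne[of 5] ne[of 6] ne[of 7] ne[of 8] ne[of 9]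
            by (simp del: nn.simps)
          have "pi emp = emp" by (rule ext, subst mem_col) simp
          then show ?thesis unfolding S Phi_eq[OF o, of A] using n10 E E' by simp
        qed
      qed
    qed
  qed simp
  then show "z eps X ==> pi (Phi A z) = Phi A' (\<sigma> z)" by blast
qed

text \<open>As \<open>x0\<close> is a subset of \<open>k\<close>, the collapse leaves it in place;
  it is therefore named by two ordinals of size at most \<open>k\<close>, an index and the bound
  \<open>xi\<close>.\<close>

lemma x0_condensed: "EX b. b eps hart k & xi eps hart k & x0 = Phi (inter A (quad xi)) b"
proof -
  have i: "idx x0 eps X" using X_closed(11) k_X[OF nn_k] by blast
  have "z eps x0 ==> z eps k" for z using x0_k by (auto simp: sub_def)
  then have z: "z eps Y" "pi z = z" if "z eps x0" for z using that k_X X_Y fix_k(1) by blast+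
  have "pi x0 = x0" by (rule ext, subst mem_col) (use z in auto)
  then have x0: "x0 = Phi A' (\<sigma> (idx x0))" using pi_Phi[OF i] by simp
  have "cov k (otp X)" using cov_X cov_trans cov_imgs[of \<sigma> X] unfolding otp_def by simp
  then have "otp X eps hart k" using mem_hart Ord_otp X_Ord by blast
  then have s: "\<sigma> (idx x0) eps hart k" using i Ord_trans[OF Ord_hart] unfolding mem_otp[symmetric] by (metis mem_otp)
  have "cov k xi" using cov_X by (rule cov_sub) (simp add: xi_def sub_def)
  then have "xi eps hart k" using mem_hart Ord_xi by blast
  then show ?thesis using x0 s unfolding A'_def[symmetric] by (intro exI[of _ "\<sigma> (idx x0)"] conjI)
qed

end

context zfL
begin

lemma gch:
  assumes "icard k" "sub A (quad m)" "Ord m" "!!b. b eps m ==> cov k b"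
  shows "cov (hart k) (Pow k)"
proof (rule cov_img[of "%z. Phi (inter A (quad (pl z))) (prr z)"])
  fix x0 assume "x0 eps Pow k"
  then interpret hull mem A k m x0 by unfold_locales (use assms in auto)
  obtain b where b: "b eps hart k" "xi eps hart k" "x0 = Phi (inter A (quad xi)) b" using x0_condensed by blast
  then have "Ord b" "Ord xi" using Ord_in[OF Ord_hart] by blast+
  then show "EX i. i eps hart k & Phi (inter A (quad (pl i))) (prr i) = x0"
    using b pr_icard[OF icard_hart[OF assms(1)]] by (intro exI[of _ "pr xi b"]) (simp add: pl_pr prr_pr)
qed simp

end

section \<open>Forcing\<close>

lemma dfn_app3:
  assumes P: "dfn E (%e. P (e 0) (e 1) (e 2))" and t: "dft E t" and u: "dft E u" and v: "dft E v"
  shows "dfn E (%e. P (t e) (u e) (v e))"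
proof -
  have "dfn E (%e. P (e 2) (e 1) (e 0))"
    using dfn_ren[OF P, of "%i. if i = 0 then 2 else if i = 1 then 1 else 0"] by simp
  then have "dfn E (%e. P (t e) (e 1) (e 0))" if "dft E t" for t
    using dfn_subst[of E "%e x. P x (e 1) (e 0)" t] that
      dfn_ren[of E "%e. P (e 2) (e 1) (e 0)" "%i. if i = 0 then 1 else if i = 1 then 2 else 0"] by (simp add: numeral_2_eq_2)
  from this[OF dft_ren[OF t, of "%i. Suc (Suc i)"]]
  show ?thesis using dfn_binder2[of E "%e x y. P (t e) x y" u v "%i. i"] u v by simp
qed

locale poset = zfL +
  fixes P and le
  assumes D_le [simp]: "T a ==> T b ==> D (%e. le (a e) (b e))"
    and le_P: "le q p ==> q eps P & p eps P"
    and le_refl: "p eps P ==> le p p"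
    and le_trans: "le r q ==> le q p ==> le r p"
begin

text \<open>
  Names are arbitrary sets: the pair \<open>opair z r\<close> in a name makes \<open>z\<close> an element once \<open>r\<close> is in the
  generic filter. Forced equality is the greatest bisimulation, which spares a recursion on names.
\<close>

definition half where
  "half R p x y <-> (ALL z r q. opair z r eps x & le q p & le q r -->
    (EX s w t. le s q & opair w t eps y & le s t & R s z w))"

definition bis where
  "bis R <-> (ALL p x y. R p x y --> p eps P & half R p x y & half (%s w z. R s z w) p y x)"

definition feq where
  "feq p x y <-> (EX B. opair p (opair x y) eps B & bis (%p x y. opair p (opair x y) eps B))"

definition fmem where
  "fmem p x y <-> p eps P & (ALL q. le q p --> (EX s w t. le s q & opair w t eps y & le s t & feq s x w))"

lemma D_feq [simp]: "T a ==> T b ==> T c ==> D (%e. feq (a e) (b e) (c e))"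
  unfolding feq_def bis_def half_def by (simp add: dft_rens)

lemma D_fmem [simp]: "T a ==> T b ==> T c ==> D (%e. fmem (a e) (b e) (c e))"
  unfolding fmem_def by (simp add: dft_rens)

lemma half_mono: "half R p x y ==> (!!s z w. R s z w ==> R' s z w) ==> half R' p x y"
  unfolding half_def by meson

lemma half_le: "half R p x y ==> le q p ==> half R q x y"
  unfolding half_def using le_trans by blast

lemma bisI:
  assumes "!!p x y. R p x y ==> p eps P" "!!p x y. R p x y ==> half R p x y"
    "!!p x y. R p x y ==> half (%s w z. R s z w) p y x"
  shows "bis R"
  unfolding bis_def
proof (intro allI impI)
  fix p x y assume R: "R p x y"
  show "p eps P & half R p x y & half (%s w z. R s z w) p y x"
    by (rule conjI[OF assms(1)[OF R] conjI[OF assms(2)[OF R] assms(3)[OF R]]])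
qed

lemma bis_feq: "bis feq"
proof -
  have "p eps P & half feq p x y & half (%s w z. feq s z w) p y x" if f: "feq p x y" for p x y
  proof -
    obtain B where B: "opair p (opair x y) eps B" "bis (%p x y. opair p (opair x y) eps B)"
      using f unfolding feq_def by blast
    then have h: "p eps P" "half (%p x y. opair p (opair x y) eps B) p x y" "half (%p y x. opair p (opair x y) eps B) p y x"
      unfolding bis_def by blast+
    have f: "feq s z w" if "opair s (opair z w) eps B" for s z w
      unfolding feq_def using that B(2) by blast
    show ?thesis by (intro conjI h(1) half_mono[OF h(2) f] half_mono[OF h(3) f])
  qed
  then show ?thesis unfolding bis_def by blast
qed

lemma feq_P: "feq p x y ==> p eps P" and feq_half: "feq p x y ==> half feq p x y"
    and feq_half2: "feq p x y ==> half (%s w z. feq s z w) p y x"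
  using bis_feq unfolding bis_def by blast+

text \<open>The definition of \<open>feq\<close> asks for a set as bisimulation; a definable class
  is cut down to the transitive closure of both names, which contains all names reachable from
  them.\<close>

lemma feq_coinduct:
  assumes D: "D (%e. R (e 0) (e 1) (e 2))" and b: "bis R" and R: "R p x y"
  shows "feq p x y"
proof -
  let ?C = "tcl (upair x y)"
  have t: "z eps ?C" if "z eps u" "u eps ?C" for z u using trans_tcl that unfolding trans_def sub_def by blast
  have C: "x eps ?C" "y eps ?C" using t[OF _ tcl_self] by simp_all
  have Ce: "z eps ?C" if "opair z r eps u" "u eps ?C" for z r u
    using opair_comps[OF trans_tcl t[OF that]] by simp
  let ?B = "sep (prod P (prod ?C ?C)) (%z. R (fs z) (fs (sn z)) (sn (sn z)))"
  have "D (%e. R (fs (e 0)) (fs (sn (e 0))) (sn (sn (e 0))))" by (rule dfn_app3[OF D]) simp_all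
  then have B: "opair p (opair x y) eps ?B <-> p eps P & x eps ?C & y eps ?C & R p x y" for p x y
    by (auto simp: mem_sep)
  have bB: "bis (%p x y. opair p (opair x y) eps ?B)"
  proof (rule bisI)
    fix p x' y' assume a: "opair p (opair x' y') eps ?B"
    then have h: "p eps P" "half R p x' y'" "half (%s w z. R s z w) p y' x'" and c: "x' eps ?C" "y' eps ?C"
      using b unfolding B bis_def by blast+
    show "p eps P" by fact
    show "half (%p x y. opair p (opair x y) eps ?B) p x' y'" unfolding half_def B
    proof (intro allI impI)
      fix z r q assume z: "opair z r eps x' & le q p & le q r"
      then obtain s w t where "le s q" "opair w t eps y'" "le s t" "R s z w" using h(2) unfolding half_def by blast
      then show "EX s w t. le s q & opair w t eps y' & le s t & s eps P & z eps ?C & w eps ?C & R s z w"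
        using Ce[OF _ c(1)] Ce[OF _ c(2)] z le_P by blast
    qed
    show "half (%s w z. opair s (opair z w) eps ?B) p y' x'" unfolding half_def B
    proof (intro allI impI)
      fix z r q assume z: "opair z r eps y' & le q p & le q r"
      then obtain s w t where "le s q" "opair w t eps x'" "le s t" "R s w z" using h(3) unfolding half_def by blast
      then show "EX s w t. le s q & opair w t eps x' & le s t & s eps P & w eps ?C & z eps ?C & R s w z"
        using Ce[OF _ c(1)] Ce[OF _ c(2)] z le_P by blast
    qed
  qed
  have "p eps P" using b R unfolding bis_def by blast
  then have "opair p (opair x y) eps ?B" unfolding B using C R by blast
  then show ?thesis unfolding feq_def using bB by blast
qed

lemma feq_refl: "p eps P ==> feq p x x"
proof (rule feq_coinduct[of "%p x y. p eps P & x = y"])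
  have h: "half R p x x" if "!!s z. s eps P ==> R s z z" for R p x
    unfolding half_def using that le_refl le_P by blast
  show "bis (%p x y. p eps P & x = y)" by (rule bisI; elim conjE; hypsubst; (rule h)?; simp)
qed simp_all

lemma feq_sym: "feq p x y ==> feq p y x"
proof (rule feq_coinduct[of "%p x y. feq p y x"])
  show "bis (%p x y. feq p y x)" by (rule bisI) (simp_all add: feq_P feq_half feq_half2)
qed simp_all

lemma feq_mono: "feq p x y ==> le q p ==> feq q x y"
proof (rule feq_coinduct[of "%p x y. EX q. le p q & feq q x y"])
  have s: "EX q. le s q & feq q z w" if "feq s z w" for s z w using that le_refl feq_P by blast
  show "bis (%p x y. EX q. le p q & feq q x y)"
  proof (rule bisI; elim exE conjE)
    fix p x y q assume a: "le p q" "feq q x y"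
    show "p eps P" using a le_P by blast
    show "half (%p x y. EX q. le p q & feq q x y) p x y"
      by (rule half_mono[OF half_le[OF feq_half[OF a(2)] a(1)] s])
    show "half (%p y x. EX q. le p q & feq q x y) p y x"
      by (rule half_mono[OF half_le[OF feq_half2[OF a(2)] a(1)] s])
  qed
qed (auto simp: dft_rens)

lemma feq_trans: "feq p x y ==> feq p y z ==> feq p x z"
proof (rule feq_coinduct[of "%p x z. EX y. feq p x y & feq p y z"])
  have h: "half (%p x z. EX y. feq p x y & feq p y z) p x z" if a: "feq p x y" "feq p y z" for p x y z
    unfolding half_def
  proof (intro allI impI)
    fix u r q assume u: "opair u r eps x & le q p & le q r"
    then obtain s v t where s: "le s q" "opair v t eps y" "le s t" "feq s u v"
      using feq_half[OF a(1)] unfolding half_def by blast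
    then have "le s p" using u le_trans by blast
    then obtain s' w t' where s': "le s' s" "opair w t' eps z" "le s' t'" "feq s' v w"
      using feq_half[OF a(2)] s unfolding half_def by blast
    then show "EX s w t. le s q & opair w t eps z & le s t & (EX y. feq s u y & feq s y w)"
      using s le_trans feq_mono by blast
  qed
  show "bis (%p x z. EX y. feq p x y & feq p y z)"
  proof (rule bisI; elim exE conjE)
    fix p x y z assume a: "feq p x z" "feq p z y"
    show "p eps P" using a feq_P by blast
    show "half (%p x z. EX y. feq p x y & feq p y z) p x y" using h a .
    show "half (%p z x. EX y. feq p x y & feq p y z) p y x"
      by (rule half_mono[OF h[OF feq_sym[OF a(2)] feq_sym[OF a(1)]]]) (use feq_sym in blast)
  qed
qed (auto simp: dft_rens)

lemma feq_stable: "p eps P ==> (!!q. le q p ==> EX s. le s q & feq s x y) ==> feq p x y"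
proof (rule feq_coinduct[of "%p x y. p eps P & (ALL q. le q p --> (EX s. le s q & feq s x y))"])
  let ?R = "%p x y. p eps P & (ALL q. le q p --> (EX s. le s q & feq s x y))"
  have s: "?R s z w" if "feq s z w" for s z w using that le_refl feq_P feq_mono le_P by blast
  have *: "half feq p x y" if R: "?R p x y" for p x y unfolding half_def
  proof (intro allI impI)
    fix u r q assume u: "opair u r eps x & le q p & le q r"
    then obtain s where s: "le s q" "feq s x y" using R by blast
    then have "le s r" "le s s" using u le_trans le_refl feq_P by blast+
    then obtain s' w t where "le s' s" "opair w t eps y" "le s' t" "feq s' u w"
      using feq_half[OF s(2)] u unfolding half_def by blast
    then show "EX s w t. le s q & opair w t eps y & le s t & feq s u w" using s le_trans by blast
  qed
  have **: "?R p y x" if "?R p x y" for p x y using that feq_sym by blast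
  show "bis ?R"
  proof (rule bisI)
    fix p x y assume R: "?R p x y"
    show "half ?R p x y" by (rule half_mono[OF *[OF R] s])
    show "half (%s w z. ?R s z w) p y x" by (rule half_mono[OF *[OF **[OF R]] **[OF s]])
  qed blast
qed (auto simp: dft_rens)

lemma feqI:
  assumes "p eps P" "!!z r q. opair z r eps x ==> le q p ==> le q r ==> EX s w t. le s q & opair w t eps y & le s t & feq s z w"
    "!!z r q. opair z r eps y ==> le q p ==> le q r ==> EX s w t. le s q & opair w t eps x & le s t & feq s z w"
  shows "feq p x y"
proof (rule feq_coinduct[of "%p x y. p eps P & half feq p x y & half (%s w z. feq s z w) p y x"])
  let ?R = "%p x y. p eps P & half feq p x y & half (%s w z. feq s z w) p y x"
  show "D (%e. ?R (e 0) (e 1) (e 2))" unfolding half_def by (simp add: dft_rens)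
  have s: "?R s z w" if "feq s z w" for s z w using that feq_P feq_half feq_half2 by blast
  show "bis ?R"
  proof (rule bisI; elim conjE)
    fix p x y assume "p eps P" and h: "half feq p x y" "half (%s w z. feq s z w) p y x"
    show "p eps P" by fact
    show "half ?R p x y" by (rule half_mono[OF h(1) s])
    show "half (%s w z. ?R s z w) p y x" by (rule half_mono[OF h(2) s])
  qed
  have "half feq p y x" unfolding half_def using assms(3) by blast
  then have "half (%s w z. feq s z w) p y x" by (rule half_mono) (rule feq_sym)
  moreover have "half feq p x y" unfolding half_def using assms(2) by blast
  ultimately show "?R p x y" using assms(1) by blast
qed

lemma fmem_P: "fmem p x y ==> p eps P" by (simp add: fmem_def)

lemma fmem_mono: "fmem p x y ==> le q p ==> fmem q x y"
  unfolding fmem_def using le_trans le_P by blast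

lemma fmem_stable: "p eps P ==> (!!q. le q p ==> EX s. le s q & fmem s x y) ==> fmem p x y"
proof -
  assume p: "p eps P" "!!q. le q p ==> EX s. le s q & fmem s x y"
  have "EX s w t. le s q & opair w t eps y & le s t & feq s x w" if q: "le q p" for q
  proof -
    obtain s where s: "le s q" "fmem s x y" using p(2)[OF q] by blast
    then obtain s' w t where "le s' s" "opair w t eps y" "le s' t" "feq s' x w"
      using le_refl[of s] unfolding fmem_def by blast
    then show ?thesis using le_trans s(1) by blast
  qed
  then show ?thesis using p(1) unfolding fmem_def by blast
qed

lemma fmem_elem: "opair w t eps y ==> le p t ==> fmem p w y"
  unfolding fmem_def using le_refl le_P le_trans feq_refl by blast

lemma fmem_cong:
  assumes "fmem p x y" "feq p x x'" "feq p y y'"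
  shows "fmem p x' y'"
  unfolding fmem_def
proof (intro conjI allI impI)
  show "p eps P" using assms fmem_P by blast
  fix q assume q: "le q p"
  then obtain s w t where s: "le s q" "opair w t eps y" "le s t" "feq s x w"
    using assms(1) unfolding fmem_def by blast
  have sp: "le s p" using s q le_trans by blast
  then obtain s' w' t' where s': "le s' s" "opair w' t' eps y'" "le s' t'" "feq s' w w'"
    using feq_half[OF assms(3)] s unfolding half_def by blast
  have "feq s' x' w'"
    using feq_trans[OF feq_mono[OF feq_sym[OF assms(2)] le_trans[OF s'(1) sp]] feq_trans[OF feq_mono[OF s(4) s'(1)] s'(4)]] .
  then show "EX s w t. le s q & opair w t eps y' & le s t & feq s x' w" using s' s le_trans by blast
qed

text \<open>With falsity, implication and the universal quantifier as the only connectives, the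
  clauses can do without double negations: atoms are stable under density and the clauses preserve
  this, see \<open>forces_stable\<close>.\<close>

primrec forces :: "fm => 'a => (nat => 'a) => bool" where
  "forces Bot p e <-> False"
| "forces (Mem i j) p e <-> fmem p (e i) (e j)"
| "forces (Eq i j) p e <-> feq p (e i) (e j)"
| "forces (Imp \<phi> \<psi>) p e <-> (ALL q. le q p --> forces \<phi> q e --> forces \<psi> q e)"
| "forces (All \<phi>) p e <-> (ALL x. forces \<phi> p (case_nat x e))"

lemma forces_mono: "forces \<phi> p e ==> le q p ==> forces \<phi> q e"
  by (induction \<phi> arbitrary: e) (auto intro: fmem_mono feq_mono le_trans)

lemma forces_stable:
  "p eps P ==> (!!q. le q p ==> EX s. le s q & forces \<phi> s e) ==> forces \<phi> p e"
proof (induction \<phi> arbitrary: p e)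
  case Bot
  then show ?case using le_refl by auto
next
  case (Mem i j)
  then show ?case using fmem_stable by simp
next
  case (Eq i j)
  then show ?case using feq_stable by simp
next
  case (Imp \<phi> \<psi>)
  show ?case unfolding forces.simps
  proof (intro allI impI)
    fix q assume q: "le q p" "forces \<phi> q e"
    show "forces \<psi> q e"
    proof (rule Imp.IH(2))
      show "q eps P" using q le_P by blast
      fix r assume r: "le r q"
      then obtain s where s: "le s r" "forces (Imp \<phi> \<psi>) s e" using Imp.prems(2)[of r] le_trans q by blast
      have "forces \<phi> s e" "le s s" using forces_mono[OF q(2)] s r le_trans le_refl le_P by blast+
      then show "EX s. le s r & forces \<psi> s e" using s by auto
    qed
  qed
next
  case (All \<phi>)
  show ?case unfolding forces.simps
  proof (rule allI, rule All.IH[OF All.prems(1)])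
    fix x q assume "le q p"
    then show "EX s. le s q & forces \<phi> s (case_nat x e)" using All.prems(2) by auto
  qed
qed

lemma D_forces: "D (%e. forces \<phi> (e 0) (%i. e (Suc i)))"
proof (induction \<phi>)
  case (Imp \<phi> \<psi>)
  have "D (%e. forces \<phi> (e 0) (%i. e (Suc (Suc i))))" "D (%e. forces \<psi> (e 0) (%i. e (Suc (Suc i))))"
    using dfn_ren[OF Imp.IH(1), of "case_nat 0 (%i. Suc (Suc i))"] dfn_ren[OF Imp.IH(2), of "case_nat 0 (%i. Suc (Suc i))"] by simp_all
  then show ?case by (simp add: dft_rens)
next
  case (All \<phi>)
  have "(%i. e (case i of 0 => 0 | Suc i => Suc (Suc i))) = case_nat (e 0) (%i. e (Suc (Suc i)))" for e :: "nat => 'a"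
    by (rule HOL.ext) (simp split: nat.split)
  then have "D (%e. forces \<phi> (e 1) (case_nat (e 0) (%i. e (Suc (Suc i)))))"
    using dfn_ren[OF All, of "case_nat 1 (case_nat 0 (%i. Suc (Suc i)))"] by simp
  then show ?case by simp
qed simp_all

text \<open>Every condition occurs in the name, as the order is not assumed to have a largest
  element.\<close>

definition check where "check = rec (%a x f. prod (img x (ap f)) P) emp"

lemma T_check [simp]: "T a ==> T (%e. check (a e))"
  unfolding check_def by (rule T_rec) simp_all

lemma check_eq: "check x = prod (img x check) P"
proof -
  have "check x = prod (img x (ap (lam x check))) P"
    unfolding check_def by (rule rec_eq) simp
  moreover have "img x (ap (lam x check)) = img x check"
    by (rule ext) (auto simp: mem_img ap_lam)
  ultimately show ?thesis by simp
qed

lemma mem_check: "opair w t eps check x <-> t eps P & (EX y. y eps x & w = check y)"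
  by (subst check_eq) (auto simp: mem_img)

lemma feq_check: "feq p (check x) (check y) ==> x = y"
proof -
  have "ALL y p. feq p (check x) (check y) --> x = y"
  proof (rule eps_induct[of "%x. ALL y p. feq p (check x) (check y) --> x = y"])
    fix x assume IH: "!!y. y eps x ==> ALL y' p. feq p (check y) (check y') --> y = y'"
    show "ALL y p. feq p (check x) (check y) --> x = y"
    proof (intro allI impI)
      fix y p assume f: "feq p (check x) (check y)"
      have p: "p eps P" "le p p" using feq_P[OF f] le_refl by blast+
      show "x = y"
      proof (rule ext, rule iffI)
        fix z assume z: "z eps x"
        then have "opair (check z) p eps check x" unfolding mem_check using p by blast
        then obtain s w t where "opair w t eps check y" "feq s (check z) w"
          using feq_half[OF f] p(2) unfolding half_def by blast
        then show "z eps y" unfolding mem_check using IH[OF z] by blast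
      next
        fix z assume z: "z eps y"
        then have "opair (check z) p eps check y" unfolding mem_check using p by blast
        then obtain s w t where w: "opair w t eps check x" "feq s w (check z)"
          using feq_half2[OF f] p(2) unfolding half_def by blast
        then obtain v where v: "v eps x" "w = check v" unfolding mem_check by blast
        then have "v = z" using IH[OF v(1)] w(2) by blast
        then show "z eps x" using v by simp
      qed
    qed
  qed (simp add: dft_rens)
  then show "feq p (check x) (check y) ==> x = y" by blast
qed

end

section \<open>Generic filters and the generic extension\<close>

locale generic = poset +
  fixes G
  assumes G_P: "p \<in> G ==> p eps P"
    and G_up: "p \<in> G ==> le p q ==> q \<in> G"
    and G_dir: "p \<in> G ==> q \<in> G ==> EX r. r \<in> G & le r p & le r q"
    and G_dense: "(!!p. p eps P ==> EX q. le q p & q eps d) ==> EX p. p \<in> G & p eps d"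
begin

text \<open>The conditions that belong to a definable class or have no extension in it form a dense
  set; so \<open>G\<close> decides each such class.\<close>

lemma dich: "D (%e. Q (e 0)) ==> EX p. p \<in> G & (Q p | (ALL s. le s p --> ~ Q s))"
proof -
  assume D: "D (%e. Q (e 0))"
  have D': "D (%e. Q (e 0) | (ALL s. le s (e 0) --> ~ Q s))" by (simp add: D dft_rens dfn_app1[OF D])
  let ?d = "sep P (%p. Q p | (ALL s. le s p --> ~ Q s))"
  have m: "p eps ?d <-> p eps P & (Q p | (ALL s. le s p --> ~ Q s))" for p by (rule mem_sep[OF D'])
  have "EX p. p \<in> G & p eps ?d" by (rule G_dense) (use m le_refl le_P in blast)
  then show ?thesis unfolding m by blast
qed

lemma G_below:
  assumes p: "p \<in> G" and D: "D (%e. Q (e 0))" and d: "!!q. le q p ==> EX s. le s q & Q s"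
  shows "EX s. s \<in> G & Q s"
proof -
  obtain r where r: "r \<in> G" "Q r | (ALL s. le s r --> ~ Q s)" using dich[OF D] by blast
  obtain q where "le q p" "le q r" using G_dir[OF p r(1)] by blast
  then show ?thesis using d[of q] r le_trans by blast
qed

lemma ex_G: "EX p. p \<in> G" using dich[of "%_. True"] by auto

lemma G_mem: "p \<in> G ==> fmem p x y <-> fmem p x y & (EX w t. opair w t eps y & t \<in> G & (EX q. q \<in> G & feq q x w))"
proof -
  assume p: "p \<in> G"
  have "EX w t. opair w t eps y & t \<in> G & (EX q. q \<in> G & feq q x w)" if f: "fmem p x y"
  proof -
    have "EX s. s \<in> G & (EX w t. opair w t eps y & le s t & feq s x w)"
      by (rule G_below[OF p]) (use f in \<open>auto simp: dft_rens fmem_def\<close>)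
    then show ?thesis using G_up by blast
  qed
  then show ?thesis by blast
qed

end

text \<open>Names cannot be evaluated by recursion from outside if the ground model is ill-founded.
  The elements of the extension are classes of names that some condition in \<open>G\<close> forces
  to be equal.\<close>

locale gext = generic +
  fixes h :: "'a => 'b" and E :: "'b => 'b => bool"
  assumes h_surj: "EX x. a = h x"
    and h_eq: "h x = h y <-> (EX p. p \<in> G & feq p x y)"
    and E_h: "E (h x) (h y) <-> (EX p. p \<in> G & fmem p x y)"
begin

lemma mem_h: "E a (h y) <-> (EX w t. opair w t eps y & t \<in> G & a = h w)"
proof
  obtain x where x: "a = h x" using h_surj by blast
  assume "E a (h y)"
  then obtain p where "p \<in> G" "fmem p x y" unfolding x E_h by blast
  then show "EX w t. opair w t eps y & t \<in> G & a = h w" unfolding x h_eq using G_mem by blast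
next
  assume "EX w t. opair w t eps y & t \<in> G & a = h w"
  then show "E a (h y)" unfolding E_h using fmem_elem le_refl G_P E_h by metis
qed

lemma D_forces_env: "D (%e. forces \<phi> (e k) (%i. if b i then e (f i) else c i))"
proof -
  let ?f = "case_nat (2 * k) (%i. if b i then 2 * f i else 2 * i + 1)"
  have "(%i. mrg c e (?f (Suc i))) = (%i. if b i then e (f i) else c i)" for e
    by (auto simp: mrg_def fun_eq_iff)
  then show ?thesis using dfn_params[OF dfn_ren[OF D_forces[of \<phi>], of ?f], where c = c] by (simp add: mrg_def)
qed

lemma D_forces_const: "D (%e'. forces \<phi> (e' 0) e)"
  using D_forces_env[where \<phi> = \<phi> and k = 0 and b = "%_. False" and c = e] by simp

lemma D_forces_case: "D (%e'. forces \<phi> (e' 0) (case_nat (e' 1) e))"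
proof -
  have "(%i. if i = 0 then e' 1 else e (i - 1)) = case_nat (e' 1) e" for e' :: "nat => 'a"
    by (auto simp: fun_eq_iff split: nat.split)
  then show ?thesis using D_forces_env[where \<phi> = \<phi> and k = 0 and b = "%i. i = 0" and f = "%_. 1" and c = "%i. e (i - 1)"] by simp
qed

lemma truth: "(EX p. p \<in> G & forces \<phi> p e) <-> sat E (%i. h (e i)) \<phi>"
proof (induction \<phi> arbitrary: e)
  case (Imp \<phi> \<psi>)
  show ?case
  proof
    assume "EX p. p \<in> G & forces (Imp \<phi> \<psi>) p e"
    then obtain p where p: "p \<in> G" "forces (Imp \<phi> \<psi>) p e" by blast
    have "EX q. q \<in> G & forces \<psi> q e" if q: "q \<in> G" "forces \<phi> q e" for q
    proof -
      obtain r where r: "r \<in> G" "le r p" "le r q" using G_dir p q by blast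
      then show ?thesis using p(2) forces_mono[OF q(2)] by auto
    qed
    then show "sat E (%i. h (e i)) (Imp \<phi> \<psi>)"
      unfolding sat_on.simps Imp.IH[symmetric] by blast
  next
    assume t: "sat E (%i. h (e i)) (Imp \<phi> \<psi>)"
    \<comment> \<open>The conditions that refute the implication outright. None lies in
      \<open>G\<close>, so some condition in \<open>G\<close> excludes them below it and forces the
      implication by stability.\<close>
    let ?Q = "%p. forces \<phi> p e & (ALL s. le s p --> ~ forces \<psi> s e)"
    have "D (%e'. ?Q (e' 0))" by (simp add: D_forces_const dfn_app1[OF D_forces_const] dft_rens)
    then obtain p where p: "p \<in> G" "?Q p | (ALL s. le s p --> ~ ?Q s)" using dich[of ?Q] by blast
    have "~ ?Q p"
    proof
      assume Q: "?Q p"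
      then have "sat E (%i. h (e i)) \<psi>" using t p(1) Imp.IH(1)[of e] by auto
      then obtain q where q: "q \<in> G" "forces \<psi> q e" using Imp.IH(2)[of e] by blast
      then show False using G_dir[OF p(1) q(1)] Q forces_mono by blast
    qed
    then have n: "~ ?Q s" if "le s p" for s using p(2) that by blast
    have "forces (Imp \<phi> \<psi>) p e" unfolding forces.simps
    proof (intro allI impI)
      fix q assume q: "le q p" "forces \<phi> q e"
      show "forces \<psi> q e"
      proof (rule forces_stable)
        show "q eps P" using q le_P by blast
        fix r assume r: "le r q"
        then show "EX s. le s r & forces \<psi> s e" using n[of r] le_trans q forces_mono by blast
      qed
    qed
    then show "EX p. p \<in> G & forces (Imp \<phi> \<psi>) p e" using p by blast
  qed
next
  case (All \<phi>)
  have c: "(%i. h (case_nat x e i)) = case_nat (h x) (%i. h (e i))" for x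
    by (simp add: fun_eq_iff split: nat.split)
  show ?case
  proof
    assume "EX p. p \<in> G & forces (All \<phi>) p e"
    then have "sat E (case_nat (h x) (%i. h (e i))) \<phi>" for x using All.IH[of "case_nat x e"] unfolding c by auto
    then show "sat E (%i. h (e i)) (All \<phi>)" using h_surj unfolding sat_on.simps by metis
  next
    assume t: "sat E (%i. h (e i)) (All \<phi>)"
    let ?Q = "%p. EX x. ALL s. le s p --> ~ forces \<phi> s (case_nat x e)"
    have "D (%e'. ?Q (e' 0))"
      using dfn_app2[OF D_forces_case, of "%e. e 0" "%e. e 1"] by (simp add: dft_rens)
    then obtain p where p: "p \<in> G" "?Q p | (ALL s. le s p --> ~ ?Q s)" using dich[of ?Q] by blast
    have "~ ?Q p"
    proof
      assume "?Q p"
      then obtain x where x: "!!s. le s p ==> ~ forces \<phi> s (case_nat x e)" by blast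
      have "sat E (%i. h (case_nat x e i)) \<phi>" using t unfolding c by simp
      then obtain q where q: "q \<in> G" "forces \<phi> q (case_nat x e)" using All.IH by blast
      then show False using G_dir[OF p(1) q(1)] x forces_mono by blast
    qed
    then have n: "~ ?Q s" if "le s p" for s using p(2) that by blast
    have "forces \<phi> p (case_nat x e)" for x
      by (rule forces_stable) (use n G_P[OF p(1)] in blast)+
    then show "EX p. p \<in> G & forces (All \<phi>) p e" using p by auto
  qed
qed (simp_all add: h_eq E_h)

text \<open>A definable relation of the extension is traced by a monotone definable relation of the
  ground model between conditions and names. Separation, collection and the preservation theorems
  use this form.\<close>

lemma rel:
  assumes "dfn E Q"
  shows "EX F. D (%e. F (e 0) (%i. e (Suc i))) & (ALL p q e. F p e --> le q p --> F q e)
    & (ALL e. Q (%i. h (e i)) <-> (EX p. p \<in> G & F p e))"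
proof -
  obtain \<phi> c where \<phi>: "!!e. Q e = sat E (mrg c e) \<phi>" using assms unfolding dfn_def by blast
  define c' where "c' i = (SOME x. c i = h x)" for i
  have c': "h (c' i) = c i" for i unfolding c'_def using someI_ex[OF h_surj[of "c i"]] by simp
  have "mrg c (%i. h (e i)) = (%i. h (mrg c' e i))" for e by (auto simp: mrg_def c' fun_eq_iff)
  then have "Q (%i. h (e i)) <-> (EX p. p \<in> G & forces \<phi> p (mrg c' e))" for e unfolding \<phi> truth by simp
  moreover have "(%i. if even i then e (Suc (i div 2)) else c' (i div 2)) = mrg c' (%i. e (Suc i))" for e
    by (auto simp: mrg_def fun_eq_iff)
  then have "D (%e. forces \<phi> (e 0) (mrg c' (%i. e (Suc i))))"
    using D_forces_env[where \<phi> = \<phi> and k = 0 and b = even and f = "%i. Suc (i div 2)" and c = "%i. c' (i div 2)"] by simp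
  ultimately show ?thesis using forces_mono by (intro exI[of _ "%p e. forces \<phi> p (mrg c' e)"]) blast
qed

lemma rel2:
  assumes "dfn E (%e. Q (e 0) (e 1))"
  obtains F where "D (%e. F (e 0) (e 1) (e 2))" "!!p q x y. F p x y ==> le q p ==> F q x y"
    "!!x y. Q (h x) (h y) <-> (EX p. p \<in> G & F p x y)"
proof -
  obtain F where F: "D (%e. F (e 0) (%i. e (Suc i)))" "!!p q e. F p e ==> le q p ==> F q e"
    "!!e. Q (h (e 0)) (h (e 1)) <-> (EX p. p \<in> G & F p e)" using rel[OF assms] by blast
  let ?f = "case_nat 0 (%i. if i = 0 then 1 else 2)"
  have "(%i. e (?f (Suc i))) = case_nat (e 1) (%_. e 2)" for e :: "nat => 'a" by (auto simp: fun_eq_iff split: nat.split)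
  then have "D (%e. F (e 0) (case_nat (e 1) (%_. e 2)))" using dfn_ren[OF F(1), of ?f] by simp
  moreover have "Q (h x) (h y) <-> (EX p. p \<in> G & F p (case_nat x (%_. y)))" for x y
    using F(3)[of "case_nat x (%_. y)"] by simp
  ultimately show ?thesis using that[of "%p x y. F p (case_nat x (%_. y))"] F(2) by blast
qed

lemma mem_h_prod: "E a (h (prod X P)) <-> (EX w. w eps X & a = h w)"
  unfolding mem_h using ex_G G_P by auto

lemma mem_h_check: "E a (h (check x)) <-> (EX y. y eps x & a = h (check y))"
  unfolding mem_h mem_check using ex_G G_P by blast

text \<open>\<open>G\<close> decides whether some listed element of one name is kept out of the
  other; as this is impossible, a condition in \<open>G\<close> forces the names equal.\<close>

lemma h_ext:
  assumes "!!a. E a (h x) <-> E a (h y)"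
  shows "h x = h y"
proof -
  let ?Q = "%x y r. EX z q. opair z q eps x & le r q & (ALL s. le s r --> ~ fmem s z y)"
  have n: "~ ?Q x y p" if p: "p \<in> G" and e: "!!a. E a (h x) ==> E a (h y)" for x y p
  proof
    assume "?Q x y p"
    then obtain z q where z: "opair z q eps x" "le p q" "!!s. le s p ==> ~ fmem s z y" by blast
    then have "E (h z) (h y)" using e mem_h[of "h z" x] G_up p by blast
    then obtain q' where "q' \<in> G" "fmem q' z y" unfolding E_h by blast
    then show False using z(3) G_dir[OF p] fmem_mono by blast
  qed
  have "D (%e. ?Q x y (e 0) | ?Q y x (e 0))" by (simp add: dft_rens)
  then obtain p where p: "p \<in> G" "!!s. le s p ==> ~ ?Q x y s" "!!s. le s p ==> ~ ?Q y x s"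
    using dich[of "%p. ?Q x y p | ?Q y x p"] n assms by blast
  have *: "EX s w t. le s q & opair w t eps y & le s t & feq s z w"
    if Q: "!!s. le s p ==> ~ ?Q x y s" "opair z r eps x" "le q p" "le q r" for x y z r q
  proof -
    obtain s where s: "le s q" "fmem s z y" using Q by blast
    then obtain s' w t where "le s' s" "opair w t eps y" "le s' t" "feq s' z w"
      using le_refl[OF fmem_P[OF s(2)]] unfolding fmem_def by blast
    then show ?thesis using le_trans s(1) by blast
  qed
  have "feq p x y" by (rule feqI[OF G_P[OF p(1)] *[OF p(2)] *[OF p(3)]])
  then show ?thesis unfolding h_eq using p by blast
qed

lemma tcl_name: "opair v s eps w ==> w eps tcl x ==> v eps tcl x"
  using opair_comps[OF trans_tcl, of v s x] trans_tcl[of x] unfolding trans_def sub_def by blast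

text \<open>A component \<open>v\<close> of a name lies several membership steps below it, inside an
  ordered pair; the hypothesis is therefore carried for elements and their elements as well.\<close>

lemma name_induct:
  assumes D: "D (%e. Q (e 0))" and step: "!!x. (!!v t. opair v t eps x ==> Q v) ==> Q x"
  shows "Q x"
proof -
  let ?R = "%x. Q x & (ALL u. u eps x --> Q u & (ALL v. v eps u --> Q v))"
  have "?R x"
  proof (rule eps_induct[of ?R])
    show "D (%e. ?R (e 0))" by (simp add: dft_rens dfn_app1[OF D])
    fix x assume IH: "!!y. y eps x ==> ?R y"
    have "Q x"
    proof (rule step)
      fix v t assume "opair v t eps x"
      from IH[OF this] show "Q v" by (auto simp: opair_def)
    qed
    then show "?R x" using IH by blast
  qed
  then show ?thesis by blast
qed

text \<open>If foundation failed, some condition would force every element of \<open>x\<close> to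
  have an element in \<open>x\<close>; by induction on names nothing is then forced into
  \<open>x\<close> below that condition.\<close>

lemma found_h:
  assumes "E a (h x)"
  shows "EX b. E b (h x) & (ALL c. E c (h x) --> ~ E c b)"
proof (rule ccontr)
  assume n: "~ ?thesis"
  let ?\<phi> = "All (Imp (Mem 0 1) (Imp (All (Imp (Mem 0 (Suc (Suc 0))) (Imp (Mem 0 1) Bot))) Bot))"
  have "sat E (%_. h x) ?\<phi>" using n by auto
  then obtain p where p: "p \<in> G" "forces ?\<phi> p (%_. x)" using truth[of ?\<phi> "%_. x"] by blast
  have *: "EX b s t. le s q & fmem s b x & le t s & fmem t b w" if "le q p" "fmem q w x" for q w
    using p(2) that le_refl[OF fmem_P[OF that(2)]] by auto
  have "ALL q. le q p --> ~ fmem q w x" for w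
  proof (rule name_induct[of "%w. ALL q. le q p --> ~ fmem q w x"], simp add: dft_rens, intro allI impI notI)
    fix w q assume IH: "!!v t. opair v t eps w ==> ALL q. le q p --> ~ fmem q v x" and q: "le q p" "fmem q w x"
    obtain b s t where b: "le s q" "fmem s b x" "le t s" "fmem t b w" using *[OF q] by blast
    obtain t' v u where t: "le t' t" "opair v u eps w" "feq t' b v"
      using b(4) le_refl[OF fmem_P[OF b(4)]] unfolding fmem_def by blast
    have "le t' s" using t b le_trans by blast
    then have "fmem t' v x" using fmem_cong[OF fmem_mono[OF b(2)] t(3) feq_refl] le_P by blast
    moreover have "le t' p" using \<open>le t' s\<close> b q le_trans by blast
    ultimately show False using IH[OF t(2)] by blast
  qed
  moreover obtain w where w: "a = h w" using h_surj by blast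
  obtain q where q: "q \<in> G" "fmem q w x" using assms unfolding w E_h by blast
  obtain r where "le r q" "le r p" using G_dir[OF q(1) p(1)] by blast
  ultimately show False using fmem_mono q by blast
qed

lemma zf_E: "zf E"
proof (rule zf_intro)
  fix x y assume e: "!!z. E z x <-> E z y"
  obtain x' y' where "x = h x'" "y = h y'" using h_surj by metis
  then show "x = y" using h_ext[of x' y'] e by simp
next
  fix x y assume "E y x"
  moreover obtain x' where "x = h x'" using h_surj by blast
  ultimately show "EX y. E y x & (ALL z. E z x --> ~ E z y)" using found_h[of y x'] by blast
next
  fix Q a assume Q: "dfn E (%e. Q (e 0))"
  then obtain F where F: "D (%e. F (e 0) (e 1) (e 2))" "!!p q x y. F p x y ==> le q p ==> F q x y"
    "!!x y. Q (h x) <-> (EX p. p \<in> G & F p x y)" using rel2[of "%x y. Q x"] by blast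
  obtain x where x: "a = h x" using h_surj by blast
  \<comment> \<open>A name for the separated set: it pairs each potential element with the
    conditions that force both membership and \<open>Q\<close>.\<close>
  let ?y = "sep (prod (tcl x) P) (%z. fmem (sn z) (fs z) x & F (sn z) (fs z) emp)"
  have "D (%e. F (sn (e 0)) (fs (e 0)) emp)" by (rule dfn_app3[OF F(1)]) simp_all
  then have y: "opair w t eps ?y <-> w eps tcl x & t eps P & fmem t w x & F t w emp" for w t by (auto simp: mem_sep)
  have "E b (h ?y) <-> E b (h x) & Q b" for b
  proof
    assume "E b (h ?y)"
    then obtain w t where "b = h w" "t \<in> G" "fmem t w x" "F t w emp" unfolding mem_h[of b ?y] y by blast
    then show "E b (h x) & Q b" using E_h[of w x] F(3)[of w emp] by blast
  next
    assume b: "E b (h x) & Q b"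
    then obtain w t where w: "opair w t eps x" "t \<in> G" "b = h w" unfolding mem_h by blast
    then obtain p where p: "p \<in> G" "F p w emp" using F(3)[of w emp] b by blast
    obtain r where r: "r \<in> G" "le r t" "le r p" using G_dir[OF w(2) p(1)] by blast
    have "opair w r eps ?y" unfolding y
      using tcl_name[OF w(1) tcl_self] fmem_elem[OF w(1) r(2)] F(2)[OF p(2) r(3)] G_P r(1) by blast
    then show "E b (h ?y)" unfolding mem_h[of b ?y] using r w by blast
  qed
  then show "EX b. ALL x. E x b <-> E x a & Q x" unfolding x by blast
next
  fix x y
  obtain x' y' where x: "x = h x'" "y = h y'" using h_surj by metis
  show "EX p. E x p & E y p" unfolding x by (intro exI[of _ "h (prod (upair x' y') P)"]) (auto simp: mem_h_prod)
next
  fix x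
  obtain x' where x: "x = h x'" using h_surj by blast
  have "E z (h (prod (tcl x') P))" if y: "E y x" and z: "E z y" for y z
  proof -
    obtain w t where w: "opair w t eps x'" "y = h w" using y unfolding x mem_h by blast
    obtain v s where v: "opair v s eps w" "z = h v" using z unfolding w mem_h by blast
    have "v eps tcl x'" using tcl_name[OF v(1) tcl_name[OF w(1) tcl_self]] .
    then show ?thesis unfolding mem_h_prod using v by blast
  qed
  then show "EX u. ALL y z. E y x --> E z y --> E z u" by blast
next
  fix x
  obtain x' where x: "x = h x'" using h_surj by blast
  have "E z (h (prod (Pow (prod (tcl x') P)) P))" if z: "!!w. E w z ==> E w x" for z
  proof -
    obtain z0 where z0: "z = h z0" using h_surj by blast
    \<comment> \<open>Every subset of \<open>x\<close> has a name of this form, so the subsets of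
      one set of the ground model name all of them.\<close>
    let ?z = "sep (prod (tcl x') P) (%u. fmem (sn u) (fs u) z0)"
    have m: "opair w t eps ?z <-> w eps tcl x' & t eps P & fmem t w z0" for w t by (auto simp: mem_sep)
    have "h ?z = h z0"
    proof (rule h_ext)
      fix a
      have "EX w t. opair w t eps ?z & t \<in> G & a = h w" if a: "E a (h z0)"
      proof -
        have "E a (h x')" using z a unfolding x z0 by blast
        then obtain w t where w: "opair w t eps x'" "a = h w" unfolding mem_h by blast
        obtain p where "p \<in> G" "fmem p w z0" using a unfolding w E_h by blast
        then show ?thesis unfolding m using w tcl_name[OF w(1) tcl_self] G_P by blast
      qed
      then show "E a (h ?z) <-> E a (h z0)" unfolding mem_h[of a ?z] m using E_h by blast
    qed
    moreover have "sub ?z (prod (tcl x') P)" unfolding sub_def by (simp add: mem_sep)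
    ultimately show ?thesis unfolding mem_h_prod z0 mem_Pow by metis
  qed
  then show "EX p. ALL z. (ALL w. E w z --> E w x) --> E z p" by blast
next
  have "EX s. (ALL z. E z s <-> E z y | z = y) & E s (h (check om))" if y: "E y (h (check om))" for y
  proof -
    obtain n where n: "n eps om" "y = h (check n)" using y unfolding mem_h_check by blast
    have "E z (h (check (suc n))) <-> E z y | z = y" for z unfolding n mem_h_check by auto
    then show ?thesis using n mem_h_check[of _ om] suc_om by blast
  qed
  moreover have "~ E z (h (check emp))" for z by (simp add: mem_h_check)
  moreover have "E (h (check emp)) (h (check om))" unfolding mem_h_check using emp_om by blast
  ultimately show "EX x. (EX e. (ALL z. ~ E z e) & E e x) & (ALL y. E y x --> (EX s. (ALL z. E z s <-> E z y | z = y) & E s x))" by blast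
next
  fix Q a assume "dfn E (%e. Q (e 0) (e 1))"
  then obtain F where F: "D (%e. F (e 0) (e 1) (e 2))" "!!p q x y. F p x y ==> le q p ==> F q x y"
    "!!x y. Q (h x) (h y) <-> (EX p. p \<in> G & F p x y)"
    using rel2[of Q] by blast
  obtain x where x: "a = h x" using h_surj by blast
  \<comment> \<open>For each name and condition the global choice of the ground model picks one
    witness; these witnesses form a set.\<close>
  let ?c = "%u. ch (%y. F (sn u) (fs u) y)"
  let ?b = "img (prod (tcl x) P) ?c"
  have "D (%e. F (sn (e 1)) (fs (e 1)) (e 0))" by (rule dfn_app3[OF F(1)]) simp_all
  then have T: "T (%e. ?c (e 0))" by simp
  have "EX y. E y (h (prod ?b P)) & Q z y" if z: "E z a" and q: "Q z y" for z y
  proof -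
    obtain w t where w: "opair w t eps x" "z = h w" using z unfolding x mem_h by blast
    obtain y0 where y0: "y = h y0" using h_surj by blast
    obtain p where p: "p \<in> G" "F p w y0" using q unfolding w y0 F(3) by blast
    have "D (%e. F p w (e 0))" by (rule dfn_app3[OF F(1)]) simp_all
    then have "F p w (?c (opair w p))" using ch[of "F p w"] p(2) by simp
    then have "Q z (h (?c (opair w p)))" unfolding w F(3) using p by blast
    moreover have "?c (opair w p) eps ?b" unfolding mem_img[OF T]
      using tcl_name[OF w(1) tcl_self] G_P[OF p(1)] by (intro exI[of _ "opair w p"]) simp
    ultimately show ?thesis unfolding mem_h_prod by blast
  qed
  then show "EX b. ALL x. E x a --> (EX y. Q x y) --> (EX y. E y b & Q x y)" by blast
qed

lemma emb_check: "emb mem E (%x. h (check x))"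
proof (intro emb.intro zf_axioms zf_E emb_axioms.intro)
  fix x y
  have "h (check x) = h (check z) <-> x = z" for z unfolding h_eq using feq_check ex_G G_P feq_refl by blast
  note e = this
  show "E (h (check x)) (h (check y)) <-> x eps y" unfolding mem_h_check e by blast
qed (use mem_h_check in blast)

end

text \<open>All sets of the countable ground model are listed, so a descending sequence meets each
  dense set at its turn.\<close>

lemma (in poset) generic_exists:
  fixes enum :: "nat => 'a"
  assumes "surj enum" "p0 eps P"
  shows "EX G. generic mem A P le G"
proof -
  define nxt where "nxt d p = (if EX q. le q p & q eps d then SOME q. le q p & q eps d else p)" for d p
  define f where "f = rec_nat p0 (%n p. nxt (enum n) p)"
  have f: "f 0 = p0" "f (Suc n) = nxt (enum n) (f n)" for n by (simp_all add: f_def)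
  have n: "le (nxt d p) p" "(EX q. le q p & q eps d) ==> nxt d p eps d" if "p eps P" for d p
    using someI_ex[of "%q. le q p & q eps d"] le_refl[OF that] unfolding nxt_def by auto
  have "nxt d p eps P" if "p eps P" for d p using n(1)[OF that] le_P by blast
  then have fP: "f n eps P" for n by (induction n) (simp_all add: assms(2) f)
  have "le (f (Suc n)) (f n)" for n unfolding f by (rule n(1)[OF fP])
  then have fle: "le (f (n + k)) (f n)" for n k
    by (induction k) (auto simp: fP le_refl intro: le_trans)
  have fle': "le (f m) (f n)" if "n \<le> m" for n m using fle[of n "m - n"] that by simp
  show ?thesis
  proof (intro exI[of _ "{p. EX n. le (f n) p}"] generic.intro poset_axioms generic_axioms.intro; (simp only: mem_Collect_eq)?)
    fix p q assume "EX n. le (f n) p" "EX n. le (f n) q"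
    then obtain n m where nm: "le (f n) p" "le (f m) q" by blast
    have "le (f (max n m)) p" by (rule le_trans[OF fle' nm(1)]) simp
    moreover have "le (f (max n m)) q" by (rule le_trans[OF fle' nm(2)]) simp
    ultimately show "EX r. (EX n. le (f n) r) & le r p & le r q" using le_refl[OF fP] by blast
  next
    fix d assume d: "!!p. p eps P ==> EX q. le q p & q eps d"
    obtain m where m: "d = enum m" using assms(1) by (metis surjD)
    have "f (Suc m) eps d" unfolding f m[symmetric] by (rule n(2)[OF fP d[OF fP]])
    then show "EX p. (EX n. le (f n) p) & p eps d" using le_refl[OF fP] by blast
  qed (use le_P le_trans in blast)+
qed

text \<open>The classes of names are countable, and infinite because of the check names; so the
  extension can be placed on all natural numbers.\<close>

lemma (in generic) gext_exists:
  fixes enum :: "nat => 'a"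
  assumes "surj enum" "infinite (UNIV :: 'a set)"
  shows "EX (h :: 'a => nat) E. gext mem A P le G h E"
proof -
  let ?R = "%x y. EX p. p \<in> G & feq p x y"
  define rep where "rep x = (SOME y. ?R x y)" for x
  have refl: "?R x x" for x using ex_G G_P feq_refl by blast
  have sym: "?R x y ==> ?R y x" for x y using feq_sym by blast
  have tr: "?R x z" if xy: "?R x y" "?R y z" for x y z
  proof -
    obtain p q where p: "p \<in> G" "feq p x y" "q \<in> G" "feq q y z" using xy by blast
    then obtain r where r: "r \<in> G" "le r p" "le r q" using G_dir by blast
    show ?thesis using feq_trans[OF feq_mono[OF p(2) r(2)] feq_mono[OF p(4) r(3)]] r by blast
  qed
  have rep: "?R x (rep x)" for x unfolding rep_def using someI_ex[of "?R x"] refl by blast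
  have rep_eq: "rep x = rep y <-> ?R x y" for x y
  proof
    assume "rep x = rep y"
    then show "?R x y" using tr[OF rep[of x]] sym[OF rep[of y]] by simp
  next
    assume "?R x y"
    then have "?R x z <-> ?R y z" for z using tr sym by blast
    then show "rep x = rep y" unfolding rep_def by presburger
  qed
  let ?U = "range rep"
  have "inj (%x. rep (check x))" using rep_eq feq_check by (intro injI) blast
  then have "infinite (range (%x. rep (check x)))" using assms(2) finite_imageD by blast
  then have "infinite ?U" by (rule infinite_super[rotated]) auto
  moreover have "countable ?U" using assms(1) countable_image[of "UNIV :: nat set" "rep \<circ> enum"] by (metis countableI_type image_comp)
  ultimately have b: "bij_betw (to_nat_on ?U) ?U UNIV" using to_nat_on_infinite by blast
  let ?h = "%x. to_nat_on ?U (rep x)"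
  let ?E = "%a b. EX x y. a = ?h x & b = ?h y & (EX p. p \<in> G & fmem p x y)"
  have h: "?h x = ?h y <-> ?R x y" for x y 
    using inj_on_eq_iff[OF bij_betw_imp_inj_on[OF b], of "rep x" "rep y"] rep_eq[of x y] by simp
  have "gext mem A P le G ?h ?E"
  proof (intro gext.intro generic_axioms gext_axioms.intro)
    fix a show "EX x. a = ?h x" using b unfolding bij_betw_def by blast
    fix x y show "?h x = ?h y <-> ?R x y" by (rule h)
    show "?E (?h x) (?h y) <-> (EX p. p \<in> G & fmem p x y)"
    proof
      assume "?E (?h x) (?h y)"
      then obtain x' y' p where "?R x' x" "?R y' y" "p \<in> G" "fmem p x' y'" unfolding h using sym by blast
      then obtain q r where q: "q \<in> G" "feq q x' x" "r \<in> G" "feq r y' y" by blast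
      obtain s where s: "s \<in> G" "le s p" "le s q" using G_dir \<open>p \<in> G\<close> q by blast
      obtain t where t: "t \<in> G" "le t s" "le t r" using G_dir s q by blast
      have "fmem t x y"
        by (rule fmem_cong[OF fmem_mono[OF \<open>fmem p x' y'\<close>] feq_mono[OF q(2)] feq_mono[OF q(4)]])
          (use s t le_trans in blast)+
      then show "EX p. p \<in> G & fmem p x y" using t by blast
    qed blast
  qed
  then show ?thesis by blast
qed

section \<open>The poset\<close>

locale cground = zfL +
  assumes CH: "cov (hart om) (Pow om)"
begin

abbreviation o1 where "o1 \<equiv> hart om"
abbreviation o2 where "o2 \<equiv> hart o1"

definition Ct where "Ct X = sep (Pow X) (%y. cov om y)"
lemma T_Ct [simp]: "T a ==> T (%e. Ct (a e))" unfolding Ct_def by (simp add: dft_rens)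
lemma mem_Ct: "y eps Ct X <-> sub y X & cov om y" unfolding Ct_def by (simp add: mem_sep)

lemma icard_o1: "icard o1" by (rule icard_hart) simp
lemma icard_o2: "icard o2" by (rule icard_hart[OF icard_o1])
lemma Ord_o1: "Ord o1" and Ord_o2: "Ord o2" by (rule Ord_hart)+
lemma om_o1: "om eps o1" by (rule k_hart) simp
lemma o1_o2: "o1 eps o2" by (rule k_hart[OF icard_o1])
lemma sub_om_o1: "sub om o1" using om_o1 Ord_trans[OF Ord_o1] by (auto simp: sub_def)
lemma emp_o1 [simp]: "emp eps o1" using sub_om_o1 by (auto simp: sub_def)
lemma o2_Ord: "x eps o2 ==> Ord x" by (rule Ord_in[OF Ord_o2])
lemma suc_o2: "x eps o2 ==> suc x eps o2" by (rule suc_icard[OF icard_o2])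
lemma suc_o1: "x eps o1 ==> suc x eps o1" by (rule suc_icard[OF icard_o1])
lemma cov_o1: "cov om x ==> cov o1 x" by (rule cov_mono[OF _ sub_om_o1])
lemma cov_un: "icard k ==> cov k x ==> cov k y ==> cov k (un x y)"
  unfolding un_def
proof (rule cov_Union)
  assume k: "icard k" "cov k x" "cov k y"
  have "emp eps k" using nn_om[of 0] k(1) by (auto simp: icard_def sub_def)
  moreover have "suc emp eps k" using nn_om[of 1] k(1) by (auto simp: icard_def sub_def)
  ultimately show "cov k (upair x y)"
    by (intro cov_img[of "%i. if i = emp then x else y"]) (auto intro: exI[of _ emp] exI[of _ "suc emp"])
qed auto
lemma cov_sng: "cov om (sng x)" by (rule cov_img[of "%_. x"]) (auto intro: exI[of _ emp])
lemma cov_img': "T (%e. F (e 0)) ==> cov k x ==> cov k (img x F)"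
  using cov_trans cov_imgs by blast

text \<open>After replacing \<open>X\<close> by \<open>o1\<close>, a countable subset is bounded
  below \<open>o1\<close> by regularity and is the image of a subset of \<omega> under a fixed
  enumeration of the bound; CH counts these data.\<close>

lemma cov_Ct:
  assumes "cov o1 X"
  shows "cov o1 (Ct X)"
proof -
  let ?e = "%a. ch (%f. ALL x. x eps a --> (EX n. n eps om & ap f n = x))"
  obtain f where f: "!!x. x eps X ==> EX i. i eps o1 & ap f i = x" using assms unfolding cov_def by blast
  have "cov (prod o1 (Pow om)) (Ct X)"
  proof (rule cov_img[of "%z. img (img (sn z) (ap (?e (fs z)))) (ap f)"])
    fix Y assume Y: "Y eps Ct X"
    let ?l = "%y. Lst (%i. i eps o1 & ap f i = y)"
    have l: "?l y eps o1 & ap f (?l y) = y" if "y eps Y" for y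
    proof -
      have "y eps X" using Y that by (auto simp: mem_Ct sub_def)
      then obtain i where i: "i eps o1" "ap f i = y" using f by blast
      then show ?thesis using Lst_prop[of "%i. i eps o1 & ap f i = y" i] Ord_in[OF Ord_o1] by simp
    qed
    have Ti: "T (%e. ?l (e 0))" by simp
    let ?Z = "img Y ?l"
    have Z: "z eps ?Z <-> (EX y. y eps Y & z = ?l y)" for z by (rule mem_img[OF Ti])
    let ?a = "Union (img ?Z suc)"
    have m: "z eps img ?Z suc <-> (EX w. w eps ?Z & z = suc w)" for z by (rule mem_img) simp
    have "cov om (img ?Z suc)" using Y by (intro cov_img' Ti) (simp_all add: mem_Ct)
    then have a: "?a eps o1" by (rule hart_regular[OF icard_om]) (use l suc_o1 m Z in auto)
    have Za: "z eps ?a" if "z eps ?Z" for z unfolding mem_Union m using that by (intro exI[of _ "suc z"]) auto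
    obtain g where "ALL x. x eps ?a --> (EX n. n eps om & ap g n = x)" using cov_hart[OF a] unfolding cov_def by blast
    then have e: "ALL x. x eps ?a --> (EX n. n eps om & ap (?e ?a) n = x)"
      by (intro ch[of "%f. ALL x. x eps ?a --> (EX n. n eps om & ap f n = x)" g]) simp
    let ?s = "sep om (%n. ap (?e ?a) n eps ?Z)"
    have s: "n eps ?s <-> n eps om & ap (?e ?a) n eps ?Z" for n by (rule mem_sep) simp
    have m1: "z eps img ?s (ap (?e ?a)) <-> (EX n. n eps ?s & z = ap (?e ?a) n)" for z by (rule mem_img) simp
    have i1: "img ?s (ap (?e ?a)) = ?Z"
    proof (rule ext, unfold m1 s, rule iffI)
      fix z assume z: "z eps ?Z"
      then obtain n where "n eps om" "ap (?e ?a) n = z" using e Za by blast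
      then show "EX n. (n eps om & ap (?e ?a) n eps ?Z) & z = ap (?e ?a) n" using z by (intro exI[of _ n]) simp
    qed auto
    have m2: "y eps img ?Z (ap f) <-> (EX z. z eps ?Z & y = ap f z)" for y by (rule mem_img) simp
    have i2: "img ?Z (ap f) = Y"
    proof (rule ext, unfold m2 Z, rule iffI)
      fix y assume "y eps Y"
      then show "EX z. (EX y. y eps Y & z = ?l y) & y = ap f z" using l[of y] by (intro exI[of _ "?l y"]) auto
    qed (use l in auto)
    have "opair ?a ?s eps prod o1 (Pow om)" using a s by (auto simp: sub_def)
    moreover have "img (img (sn (opair ?a ?s)) (ap (?e (fs (opair ?a ?s))))) (ap f) = Y"
      unfolding fs_opair sn_opair i1 i2 by (rule refl)
    ultimately show "EX z. z eps prod o1 (Pow om) & img (img (sn z) (ap (?e (fs z)))) (ap f) = Y" by blast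
  qed (simp add: dft_rens)
  then show ?thesis using cov_trans[OF cov_prod[OF icard_o1 cov_refl CH]] by blast
qed

definition nl where "nl b <-> b ~= emp & (ALL x. x eps b --> (EX y. y eps b & x eps y))"
lemma D_nl [simp]: "T a ==> D (%e. nl (a e))" unfolding nl_def by (simp add: dft_rens)

text \<open>
  A condition is \<open>opair a (opair g B)\<close>: a countable set \<open>a\<close>, a colouring \<open>g\<close> of its pairs, and
  promises \<open>opair b nu\<close>: every new point below \<open>b\<close> will have the colour \<open>nu\<close> with some element of \<open>b\<close>.
\<close>

abbreviation pa where "pa p \<equiv> fs p"
abbreviation pB where "pB p \<equiv> sn (sn p)"
text \<open>Colours are read at increasing pairs only; the default 0 makes \<open>cl\<close>
  harmless on all other arguments.\<close>

definition cl where "cl p al be = (if al eps be then ap (fs (sn p)) (opair al be) else emp)"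
lemma T_cl [simp]: "T p ==> T a ==> T b ==> T (%e. cl (p e) (a e) (b e))" unfolding cl_def by simp

definition Q where
  "Q = sep (prod (Pow o2) (prod (Pow (prod (prod o2 o2) o1)) (Pow (prod (Pow o2) o1))))
    (%p. cov om (pa p) & cov om (pB p) & (ALL al be. al eps pa p & be eps pa p --> cl p al be eps o1)
      & (ALL b nu. opair b nu eps pB p --> nl b & sub b (pa p)))"

lemma mem_Q: "p eps Q <-> p eps prod (Pow o2) (prod (Pow (prod (prod o2 o2) o1)) (Pow (prod (Pow o2) o1)))
    & cov om (pa p) & cov om (pB p) & (ALL al be. al eps pa p & be eps pa p --> cl p al be eps o1)
    & (ALL b nu. opair b nu eps pB p --> nl b & sub b (pa p))"
  unfolding Q_def by (rule mem_sep) (simp add: dft_rens)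

lemma Q_props:
  assumes "p eps Q"
  shows Q_a: "x eps pa p ==> x eps o2" and Q_cov: "cov om (pa p)" and Q_covB: "cov om (pB p)"
    and Q_cl: "al eps pa p ==> be eps pa p ==> cl p al be eps o1"
    and Q_B: "z eps pB p ==> EX b nu. z = opair b nu & nu eps o1 & nl b & sub b (pa p)"
proof -
  obtain a g B where p: "p = opair a (opair g B)" "sub a o2" "sub B (prod (Pow o2) o1)"
    using assms unfolding mem_Q mem_prod by auto
  show "x eps pa p ==> x eps o2" using p by (auto simp: sub_def)
  show "cov om (pa p)" "cov om (pB p)" "al eps pa p ==> be eps pa p ==> cl p al be eps o1"
    using assms unfolding mem_Q by blast+
  assume z: "z eps pB p"
  then have "z eps prod (Pow o2) o1" using p by (auto simp: sub_def)
  then obtain b nu where "z = opair b nu" "nu eps o1" unfolding mem_prod by blast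
  then show "EX b nu. z = opair b nu & nu eps o1 & nl b & sub b (pa p)" using assms z unfolding mem_Q by blast
qed

definition mk where "mk a F B = opair a (opair (lam (prod a a) (%z. F (fs z) (sn z))) B)"

lemma mk:
  assumes T: "T (%e. F (e 0) (e 1))" and "!!x. x eps a ==> x eps o2" "cov om a" "cov om B"
    "!!al be. al eps a ==> be eps a ==> F al be eps o1" "!!z. z eps B ==> EX b nu. z = opair b nu & nu eps o1 & nl b & sub b a"
  shows mk_Q: "mk a F B eps Q" and mk_cl: "al eps a ==> be eps a ==> al eps be ==> cl (mk a F B) al be = F al be"
    and "pa (mk a F B) = a" "pB (mk a F B) = B"
proof -
  show e: "pa (mk a F B) = a" "pB (mk a F B) = B" by (simp_all add: mk_def)
  have T': "T (%e. F (fs (e 0)) (sn (e 0)))" by (rule dft_app2[OF T]) simp_all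
  show c: "cl (mk a F B) al be = F al be" if "al eps a" "be eps a" "al eps be" for al be
    using that ap_lam[OF T', of "opair al be"] by (simp add: cl_def mk_def)
  have "cl (mk a F B) al be eps o1" if "al eps a" "be eps a" for al be
    using c[OF that] assms(5)[OF that] by (cases "al eps be") (simp_all add: cl_def)
  moreover have "sub (lam (prod a a) (%z. F (fs z) (sn z))) (prod (prod o2 o2) o1)"
    unfolding sub_def mem_lam[OF T'] using assms(2,5) by (auto simp: mem_prod)
  moreover have "sub a o2" using assms(2) by (simp add: sub_def)
  moreover have "sub B (prod (Pow o2) o1)" unfolding sub_def
  proof (intro allI impI)
    fix z assume "z eps B"
    then obtain b nu where z: "z = opair b nu" "nu eps o1" "sub b a" using assms(6) by blast
    then have "sub b o2" using assms(2) unfolding sub_def by blast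
    then show "z eps prod (Pow o2) o1" using z by simp
  qed
  moreover have "nl b & sub b a" if "opair b nu eps B" for b nu using assms(6)[OF that] by auto
  ultimately show "mk a F B eps Q" unfolding mem_Q e using assms(3,4) by (simp add: mk_def)
qed

definition shadow where
  "shadow q a be d <-> (EX al al'. al eps d & al' eps d & al ~= al' & cl q al be = cl q al' be)
    | (EX et. et eps a & sub d et & (ALL al. al eps d --> cl q al be = cl q al et))"

definition leq where
  "leq q p <-> q eps Q & p eps Q & sub (pa p) (pa q) & sub (pB p) (pB q)
    & (ALL al be. al eps pa p & be eps pa p --> cl q al be = cl p al be)
    & (ALL al b nu. al eps pa q & ~ al eps pa p & opair b nu eps pB p & (ALL be. be eps b --> al eps be)
        --> (EX be. be eps b & cl q al be = nu))
    & (ALL be d. be eps pa q & ~ be eps pa p & nl d & sub d (pa p) & sub d be --> shadow q (pa p) be d)"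

lemma D_leq: "T a ==> T b ==> D (%e. leq (a e) (b e))"
  unfolding leq_def shadow_def by (simp add: dft_rens)

lemma leqI:
  assumes "q eps Q" "p eps Q" "!!x. x eps pa p ==> x eps pa q" "!!x. x eps pB p ==> x eps pB q"
    "!!al be. al eps pa p ==> be eps pa p ==> al eps be ==> cl q al be = cl p al be"
    "!!al b nu. al eps pa q ==> ~ al eps pa p ==> opair b nu eps pB p ==> (!!be. be eps b ==> al eps be) ==> EX be. be eps b & cl q al be = nu"
    "!!be d. be eps pa q ==> ~ be eps pa p ==> nl d ==> sub d (pa p) ==> sub d be ==> shadow q (pa p) be d"
  shows "leq q p"
proof -
  have "cl q al be = cl p al be" if "al eps pa p" "be eps pa p" for al be
    using assms(5)[OF that] by (cases "al eps be") (simp_all add: cl_def)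
  then show ?thesis unfolding leq_def using assms(1-4,6,7) by (simp add: sub_def)
qed

lemma leq:
  assumes "leq q p"
  shows leq_a: "x eps pa p ==> x eps pa q" and leq_B: "z eps pB p ==> z eps pB q"
    and leq_cl: "al eps pa p ==> be eps pa p ==> cl q al be = cl p al be"
    and leq_promise: "al eps pa q ==> ~ al eps pa p ==> opair b nu eps pB p ==> (!!be. be eps b ==> al eps be) ==> EX be. be eps b & cl q al be = nu"
    and leq_shadow: "be eps pa q ==> ~ be eps pa p ==> nl d ==> sub d (pa p) ==> sub d be ==> shadow q (pa p) be d"
    and leq_Q: "q eps Q" "p eps Q"
  using assms unfolding leq_def sub_def by blast+

lemma shadow_cong:
  assumes "shadow q a be d" "!!al. al eps d ==> cl r al be' = cl q al be"
    "!!al et. al eps d ==> et eps a ==> cl r al et = cl q al et"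
  shows "shadow r a be' d"
  using assms(1) unfolding shadow_def
proof (elim disjE exE conjE)
  fix al al' assume "al eps d" "al' eps d" "al ~= al'" "cl q al be = cl q al' be"
  then show "(EX al al'. al eps d & al' eps d & al ~= al' & cl r al be' = cl r al' be') | R" for R using assms(2) by metis
next
  fix et assume "et eps a" "sub d et" "ALL al. al eps d --> cl q al be = cl q al et"
  then show "R | (EX et. et eps a & sub d et & (ALL al. al eps d --> cl r al be' = cl r al et))" for R
    using assms(2,3) by (intro disjI2 exI[of _ et]) simp
qed

lemma shadow_up:
  assumes "leq r q" "shadow q a be d" "be eps pa q" "sub d (pa q)" "sub a (pa q)"
  shows "shadow r a be d"
  by (rule shadow_cong[OF assms(2)]) (use leq_cl[OF assms(1)] assms(3-5) in \<open>auto simp: sub_def\<close>)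

lemma leq_refl: "p eps Q ==> leq p p"
  by (rule leqI) auto

lemma leq_trans:
  assumes rq: "leq r q" and qp: "leq q p"
  shows "leq r p"
proof (rule leqI)
  show "r eps Q" "p eps Q" using leq_Q rq qp by blast+
  show "x eps pa r" if "x eps pa p" for x using leq_a[OF rq leq_a[OF qp that]] .
  show "x eps pB r" if "x eps pB p" for x using leq_B[OF rq leq_B[OF qp that]] .
  have c: "cl r al be = cl q al be" if "al eps pa q" "be eps pa q" for al be using leq_cl[OF rq that] .
  show "cl r al be = cl p al be" if "al eps pa p" "be eps pa p" for al be
    using c leq_cl[OF qp that] leq_a[OF qp] that by simp
  show "EX be. be eps b & cl r al be = nu"
    if al: "al eps pa r" "~ al eps pa p" and b: "opair b nu eps pB p" "!!be. be eps b ==> al eps be" for al b nu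
  proof (cases "al eps pa q")
    case True
    then obtain be where be: "be eps b" "cl q al be = nu" using leq_promise[OF qp _ al(2) b] by blast
    have "be eps pa p" using Q_B[OF leq_Q(2)[OF qp] b(1)] be by (auto simp: sub_def)
    then show ?thesis using c[OF True] leq_a[OF qp] be by auto
  next
    case False
    show ?thesis by (rule leq_promise[OF rq al(1) False leq_B[OF qp b(1)] b(2)])
  qed
  show "shadow r (pa p) be d"
    if be: "be eps pa r" "~ be eps pa p" and d: "nl d" "sub d (pa p)" "sub d be" for be d
  proof (cases "be eps pa q")
    case True
    show ?thesis
      by (rule shadow_up[OF rq leq_shadow[OF qp True be(2) d] True]) (use d leq_a[OF qp] in \<open>auto simp: sub_def\<close>)
  next
    case False
    have dq: "sub d (pa q)" using d leq_a[OF qp] by (auto simp: sub_def)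
    from leq_shadow[OF rq be(1) False d(1) dq d(3)]
    consider "EX al al'. al eps d & al' eps d & al ~= al' & cl r al be = cl r al' be"
      | et where "et eps pa q" "sub d et" "!!al. al eps d ==> cl r al be = cl r al et"
      unfolding shadow_def by blast
    then show ?thesis
    proof cases
      case 1
      then show ?thesis unfolding shadow_def by blast
    next
      case 2
      show ?thesis
      proof (cases "et eps pa p")
        case True
        then show ?thesis unfolding shadow_def using 2 by blast
      next
        case False
        \<comment> \<open>The copied point may itself be new over \<open>p\<close>; then it is
          shadowed in turn, and being shadowed depends only on the colours on
          \<open>d\<close>.\<close>
        have "shadow r (pa p) et d"
          by (rule shadow_up[OF rq leq_shadow[OF qp 2(1) False d(1,2) 2(2)] 2(1) dq])
            (use leq_a[OF qp] in \<open>auto simp: sub_def\<close>)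
        then show ?thesis by (rule shadow_cong) (simp_all add: 2(3))
      qed
    qed
  qed
qed

sublocale poset mem A Q leq
  by unfold_locales (use D_leq leq_Q leq_refl leq_trans in \<open>blast+\<close>)

end

section \<open>Closure, density and amalgamation of conditions\<close>

context cground
begin

lemma pa_mk: "pa (mk a F B) = a" and pB_mk: "pB (mk a F B) = B" by (simp_all add: mk_def)

lemma om_pred: "m eps om ==> Union (suc m) = m"
proof (rule ext)
  fix z assume "m eps om"
  then show "z eps Union (suc m) <-> z eps m" using Ord_trans[OF Ord_om_elem] by auto
qed

lemma om_rec:
  assumes F: "T (%e. F (e 0) (e 1))"
  obtains f where "T (%e. f (e 0))" "f emp = a" "!!n. n eps om ==> f (suc n) = F n (f n)"
proof -
  define R where "R a x g = (if x = emp then a else F (Union x) (ap g (Union x)))" for a x g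
  have TF: "T (%e. F (Union (e 1)) (ap (e 2) (Union (e 1))))" by (rule dft_app2[OF F]) simp_all
  then have R: "T (%e. R (e 0) (e 1) (e 2))" unfolding R_def by simp
  define f where "f = rec R a"
  have f: "f x = R a x (lam x f)" for x unfolding f_def by (rule rec_eq[OF R])
  have T: "T (%e. f (e 0))" unfolding f_def by (rule T_rec[OF R]) simp_all
  moreover have "f emp = a" by (subst f) (simp add: R_def)
  moreover have "f (suc n) = F n (f n)" if "n eps om" for n
    by (subst f) (simp add: R_def om_pred[OF that] ap_lam[OF T])
  ultimately show ?thesis using that by blast
qed

lemma sigma_closed:
  assumes f: "T (%e. f (e 0))" and d: "!!n. n eps om ==> leq (f (suc n)) (f n)"
  shows "EX r. ALL n. n eps om --> leq r (f n)"
proof -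
  have fQ: "f n eps Q" if "n eps om" for n using leq_Q[OF d[OF that]] by blast
  have step: "leq (f n) (f m)" if m: "m eps om" and n: "n eps om" and mn: "m eps n | m = n" for m n
  proof -
    have D: "D (%e. m eps e 0 | m = e 0 --> leq (f (e 0)) (f m))" 
      by (rule dfn_imp[OF _ D_leq[OF f dft_const]]) simp
    have "m eps n | m = n --> leq (f n) (f m)"
    proof (rule om_induct[of n "%n. m eps n | m = n --> leq (f n) (f m)", OF n D])
      fix n assume n: "n eps om" "m eps n | m = n --> leq (f n) (f m)"
      show "m eps suc n | m = suc n --> leq (f (suc n)) (f m)"
      proof
        assume "m eps suc n | m = suc n"
        then consider "m eps n | m = n" | "m = suc n" by auto
        then show "leq (f (suc n)) (f m)"
        proof cases
          case 1
          then show ?thesis using n(2) leq_trans[OF d[OF n(1)]] by blast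
        qed (use leq_refl[OF fQ[OF suc_om[OF n(1)]]] in simp)
      qed
    qed (use leq_refl[OF fQ[OF emp_om]] in auto)
    then show ?thesis using mn by blast
  qed
  let ?a = "Union (img om (%n. pa (f n)))" and ?B = "Union (img om (%n. pB (f n)))"
  have Tf: "T (%e. pa (f (e 0)))" "T (%e. pB (f (e 0)))" using f by simp_all
  have a: "x eps ?a <-> (EX n. n eps om & x eps pa (f n))" for x unfolding mem_Union mem_img[OF Tf(1)] by blast
  have B: "x eps ?B <-> (EX n. n eps om & x eps pB (f n))" for x unfolding mem_Union mem_img[OF Tf(2)] by blast
  \<comment> \<open>The limit takes its colours from the first stage containing both points, with
    which all later stages agree.\<close>
  let ?l = "%al be. Lst (%n. n eps om & al eps pa (f n) & be eps pa (f n))"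
  let ?F = "%al be. cl (f (?l al be)) al be"
  have T0: "T (%e. f (t e))" if "T t" for t by (rule dft_app1[OF f that])
  have Fcl: "?F al be = cl (f n) al be" if n: "n eps om" "al eps pa (f n)" "be eps pa (f n)" for al be n
  proof -
    have "?l al be eps om & al eps pa (f (?l al be)) & be eps pa (f (?l al be))"
      using Lst_prop[of "%n. n eps om & al eps pa (f n) & be eps pa (f n)" n] n Ord_om_elem Tf by simp
    moreover from this have "leq (f n) (f (?l al be)) | leq (f (?l al be)) (f n)"
      using step[OF n(1), of "?l al be"] step[OF _ n(1), of "?l al be"]
        Ord_linear[OF Ord_om_elem[OF n(1)] Ord_om_elem, of "?l al be"] by blast
    ultimately show ?thesis using leq_cl[of "f n" "f (?l al be)" al be] leq_cl[of "f (?l al be)" "f n" al be] n(2,3) by auto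
  qed
  have pair: "EX n. n eps om & leq (f n) (f m) & al eps pa (f n) & be eps pa (f n)"
    if m: "m eps om" "al eps ?a" "be eps pa (f m)" for al be m
  proof -
    obtain k where k: "k eps om" "al eps pa (f k)" using m(2) unfolding a by blast
    have "m eps k | m = k | k eps m" using Ord_linear Ord_om_elem k m by blast
    then show ?thesis using step k m leq_a leq_refl[OF fQ] by metis
  qed
  let ?r = "mk ?a ?F ?B"
  have TF: "T (%e. ?F (e 0) (e 1))" by (simp add: T0 dft_rens)
  have aux: "x eps o2" if "x eps ?a" for x using that Q_a[OF fQ] unfolding a by blast
  have aux2: "cov om ?a" "cov om ?B"
    using Q_cov[OF fQ] Q_covB[OF fQ] by (auto intro!: cov_Union[OF icard_om] cov_imgs Tf simp: mem_img[OF Tf(1)] mem_img[OF Tf(2)])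
  have aux3: "?F al be eps o1" if al: "al eps ?a" "be eps ?a" for al be
  proof -
    obtain m where m: "m eps om" "be eps pa (f m)" using al unfolding a by blast
    then show ?thesis using pair[OF m(1) al(1) m(2)] Fcl Q_cl[OF fQ] by auto
  qed
  have aux4: "EX b nu. z = opair b nu & nu eps o1 & nl b & sub b ?a" if z: "z eps ?B" for z
  proof -
    obtain m where m: "m eps om" "z eps pB (f m)" using z unfolding B by blast
    then obtain b nu where "z = opair b nu" "nu eps o1" "nl b" "sub b (pa (f m))" using Q_B[OF fQ] by blast
    then show ?thesis using m(1) unfolding sub_def a by blast
  qed
  note r = mk[of ?F ?a ?B, OF TF aux aux2 aux3 aux4]
  have rcl: "cl ?r al be = cl (f n) al be" if n: "n eps om" "al eps pa (f n)" "be eps pa (f n)" for al be n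
  proof (cases "al eps be")
    case True
    then show ?thesis using r(2)[of al be] Fcl[OF n] n a by auto
  qed (simp add: cl_def)
  have "leq ?r (f m)" if m: "m eps om" for m
  proof (rule leqI; (unfold pa_mk pB_mk)?)
    show "?r eps Q" by (rule r(1))
    show "f m eps Q" using fQ m by blast
    show "x eps ?a" if "x eps pa (f m)" for x using that m a by blast
    show "x eps ?B" if "x eps pB (f m)" for x using that m B by blast
    show "cl ?r al be = cl (f m) al be" if "al eps pa (f m)" "be eps pa (f m)" for al be using rcl m that by blast
    show "EX be. be eps b & cl ?r al be = nu"
      if al: "al eps ?a" "~ al eps pa (f m)" and b: "opair b nu eps pB (f m)" "!!be. be eps b ==> al eps be" for al b nu
    proof -
      have bs: "nl b" "sub b (pa (f m))" using Q_B[OF fQ[OF m] b(1)] by auto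
      then obtain x where x: "x eps b" unfolding nl_def using ex_mem_iff by blast
      then have "x eps pa (f m)" using bs by (simp add: sub_def)
      then obtain n where n: "n eps om" "leq (f n) (f m)" "al eps pa (f n)" using pair[OF m al(1)] by blast
      obtain be where be: "be eps b" "cl (f n) al be = nu" using leq_promise[OF n(2,3) al(2) b] by blast
      have "be eps pa (f n)" using leq_a[OF n(2)] be bs by (simp add: sub_def)
      then show ?thesis using rcl[OF n(1,3)] be by auto
    qed
    show "shadow ?r (pa (f m)) be d"
      if be: "be eps ?a" "~ be eps pa (f m)" and d: "nl d" "sub d (pa (f m))" "sub d be" for be d
    proof -
      obtain x where x: "x eps d" using d unfolding nl_def using ex_mem_iff by blast
      then have "x eps pa (f m)" using d by (simp add: sub_def)
      then obtain n where n: "n eps om" "leq (f n) (f m)" "be eps pa (f n)" using pair[OF m be(1)] by blast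
      have e: "al eps pa (f n)" if "al eps pa (f m)" for al using leq_a[OF n(2) that] .
      show ?thesis
        by (rule shadow_cong[OF leq_shadow[OF n(2,3) be(2) d]]) (use rcl[OF n(1)] e n(3) d in \<open>auto simp: sub_def\<close>)
    qed
  qed
  then show ?thesis by blast
qed

text \<open>Countably many open dense requirements, given uniformly, are met by one condition: a
  descending sequence through them, chosen by \<open>ch\<close>, has a lower bound.\<close>

lemma sigma_dense:
  assumes D: "D (%e. R (e 0) (e 1))" and p: "p eps Q"
    and mono: "!!n s t. R n s ==> leq t s ==> R n t"
    and dense: "!!n q. n eps om ==> leq q p ==> EX s. leq s q & R n s"
  shows "EX r. leq r p & (ALL n. n eps om --> R n r)"
proof -
  let ?F = "%n q. ch (%s. leq s q & R n s)"
  have D': "D (%e. leq (e 0) (e 2) & R (e 1) (e 0))"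
    using dfn_app2[OF D, of "%e. e 1" "%e. e 0"] by (simp add: D_leq)
  then have TF: "T (%e. ?F (e 0) (e 1))" by (simp add: numeral_2_eq_2)
  obtain f where f: "T (%e. f (e 0))" "f emp = p" "!!n. n eps om ==> f (suc n) = ?F n (f n)"
    using om_rec[of ?F p, OF TF] by blast
  have F: "leq (?F n q) q & R n (?F n q)" if nq: "n eps om" "leq q p" for n q
  proof -
    obtain s where s: "leq s q & R n s" using dense[OF nq] by blast
    show ?thesis
    proof (rule ch[of "%s. leq s q & R n s", OF _ s])
      show "D (%e. leq (e 0) q & R n (e 0))" using dfn_app2[OF D, of "%e. n" "%e. e 0"] by (simp add: D_leq)
    qed
  qed
  have fp: "leq (f n) p" if "n eps om" for n
  proof (rule om_induct[of n "%n. leq (f n) p", OF that])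
    show "D (%e. leq (f (e 0)) p)" using f(1) by (simp add: D_leq)
    show "leq (f emp) p" using f(2) leq_refl[OF p] by simp
    fix n assume n: "n eps om" "leq (f n) p"
    then show "leq (f (suc n)) p" using F[OF n] leq_trans f(3)[OF n(1)] by auto
  qed
  have fs: "leq (f (suc n)) (f n) & R n (f (suc n))" if "n eps om" for n using F[OF that fp[OF that]] f(3)[OF that] by simp
  obtain r where r: "!!n. n eps om ==> leq r (f n)" using sigma_closed[OF f(1)] fs by blast
  have "leq r p" using r[of emp] f(2) by simp
  moreover have "R n r" if "n eps om" for n using mono[of n "f (suc n)" r] fs[OF that] r suc_om[OF that] by blast
  ultimately show ?thesis by blast
qed

text \<open>The promised sets have no maximum, so they are infinite and have distinct
  representatives; giving each representative the colour of its promise fulfils countably many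
  promises with a single new point.\<close>

lemma greedy:
  assumes B: "cov om B" "!!z. z eps B ==> EX b nu. z = opair b nu & nu eps o1 & nl b & (ALL x. x eps b --> Ord x)"
  obtains c where "T (%e. c (e 0))" "!!x. c x eps o1" "!!b nu. opair b nu eps B ==> EX be. be eps b & c be = nu"
proof -
  obtain e where e: "!!z. z eps B ==> EX n. n eps om & ap e n = z" using B(1) unfolding cov_def by blast
  define F where "F a x g = ch (%be. be eps fs (ap a x) & ~ (EX i. i eps x & be = ap g i))" for a x g
  have F: "T (%e. F (e 0) (e 1) (e 2))" unfolding F_def by (simp add: dft_rens)
  define s where "s = rec F e"
  have Ts: "T (%e. s (e 0))" unfolding s_def by (rule T_rec[OF F]) simp_all
  have s: "s n = ch (%be. be eps fs (ap e n) & ~ (EX i. i eps n & be = s i))" for n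
  proof -
    have "s n = F e n (lam n s)" unfolding s_def by (rule rec_eq[OF F])
    moreover have "(EX i. i eps n & be = ap (lam n s) i) <-> (EX i. i eps n & be = s i)" for be using ap_lam[OF Ts] by auto
    ultimately show ?thesis unfolding F_def by simp
  qed
  have Tss: "T t ==> T (%e. s (t e))" for t by (rule dft_app1[OF Ts])
  have sn: "s n eps b & (ALL i. i eps n --> s n ~= s i)" if n: "n eps om" "ap e n = opair b nu" "opair b nu eps B" for n b nu
  proof -
    have b: "nl b" "!!x. x eps b ==> Ord x" using B(2)[OF n(3)] by auto
    \<comment> \<open>The elements used before form a finite set, which has a maximum if it is
      nonempty; the promised set has none.\<close>
    let ?X = "inter b (img n s)"
    have X: "x eps ?X <-> x eps b & (EX i. i eps n & x = s i)" for x by (simp add: mem_img[OF Ts])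
    have "cov n ?X" by (rule cov_sub[OF cov_imgs[OF Ts]]) (simp add: sub_def)
    then have mx: "EX m. m eps ?X & (ALL x. x eps ?X --> x eps m | x = m)" if "x eps ?X" for x
      using cov_om_max[OF n(1), of ?X x] b(2) that by simp
    have "EX y. y eps b & ~ y eps ?X"
    proof (cases "EX x. x eps ?X")
      case True
      then obtain m where m: "m eps b" "!!x. x eps ?X ==> x eps m | x = m" using mx by (auto simp: X)
      obtain y where y: "y eps b" "m eps y" using b(1) m(1) unfolding nl_def by blast
      then have "~ y eps ?X" using m(2)[of y] not_mem_sym[OF y(2)] by auto
      then show ?thesis using y by blast
    next
      case False
      then show ?thesis using b(1) ex_mem_iff[of b] unfolding nl_def by blast
    qed
    then obtain y where y: "y eps fs (ap e n) & ~ (EX i. i eps n & y = s i)" unfolding X n(2) by auto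
    have "s n eps fs (ap e n) & ~ (EX i. i eps n & s n = s i)"
      by (subst (1 2) s, rule ch[of "%be. be eps fs (ap e n) & ~ (EX i. i eps n & be = s i)", OF _ y]) (simp add: Tss dft_rens)
    then show ?thesis unfolding n(2) by auto
  qed
  define l where "l x = Lst (%n. n eps om & s n = x)" for x
  define c where "c x = (if sn (ap e (l x)) eps o1 then sn (ap e (l x)) else emp)" for x
  have "T (%e. c (e 0))" unfolding c_def l_def by (simp add: Tss dft_rens)
  moreover have "c x eps o1" for x by (simp add: c_def)
  moreover have "EX be. be eps b & c be = nu" if b: "opair b nu eps B" for b nu
  proof -
    obtain n where n: "n eps om" "ap e n = opair b nu" using e[OF b] by blast
    have D: "D (%e. e 0 eps om & s (e 0) = s n)" by (simp add: Tss)
    have o: "Ord n" using n Ord_om_elem by blast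
    have "l (s n) eps om" "s (l (s n)) = s n" "~ n eps l (s n)"
      using Lst_prop[of "%m. m eps om & s m = s n", OF D o] Lst_least[of "%m. m eps om & s m = s n", OF D o] n(1)
      unfolding l_def by simp_all
    then have "l (s n) = n" using sn[OF n b] Ord_linear[OF o Ord_om_elem] by metis
    then have "c (s n) = nu" using n(2) B(2)[OF b] by (auto simp: c_def)
    then show ?thesis using sn[OF n b] by blast
  qed
  ultimately show ?thesis using that by blast
qed

lemma promise_Ord: "p eps Q ==> z eps pB p ==> EX b nu. z = opair b nu & nu eps o1 & nl b & (ALL x. x eps b --> Ord x)"
proof -
  assume p: "p eps Q" "z eps pB p"
  then obtain b nu where "z = opair b nu" "nu eps o1" "nl b" "sub b (pa p)" using Q_B by blast
  then show ?thesis using Q_a[OF p(1)] o2_Ord unfolding sub_def by blast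
qed

lemma dense_point:
  assumes p: "p eps Q" and x: "x eps o2"
  shows "EX q. leq q p & x eps pa q"
proof (cases "x eps pa p")
  case True
  then show ?thesis using leq_refl[OF p] by blast
next
  case False
  obtain c where c: "T (%e. c (e 0))" "!!x. c x eps o1" "!!b nu. opair b nu eps pB p ==> EX be. be eps b & c be = nu"
    using greedy[OF Q_covB[OF p] promise_Ord[OF p]] by blast
  let ?a = "un (pa p) (sng x)"
  \<comment> \<open>Colours towards points above come from \<open>greedy\<close>; towards all points
    below the new point gets the colour 0, a repetition on every \<open>d\<close> with two
    elements.\<close>
  let ?F = "%al be. if be = x then emp else if al = x then c be else cl p al be"
  have TF: "T (%e. ?F (e 0) (e 1))" using dft_app1[OF c(1), of "%e. e 1"] by simp
  have a: "z eps o2" if "z eps ?a" for z using that x Q_a[OF p] by auto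
  have F: "?F al be eps o1" if "al eps ?a" "be eps ?a" for al be using that Q_cl[OF p] c(2) by auto
  have B: "EX b nu. z = opair b nu & nu eps o1 & nl b & sub b ?a" if "z eps pB p" for z
    using Q_B[OF p that] by (auto simp: sub_def)
  let ?q = "mk ?a ?F (pB p)"
  note q = mk[of ?F ?a "pB p", OF TF a cov_un[OF icard_om Q_cov[OF p] cov_sng] Q_covB[OF p] F B]
  have "leq ?q p"
  proof (rule leqI; (unfold pa_mk pB_mk)?)
    show "?q eps Q" by (rule q(1))
    show "cl ?q al be = cl p al be" if "al eps pa p" "be eps pa p" "al eps be" for al be
    proof -
      have "be ~= x" "al ~= x" using that False by auto
      then show ?thesis using q(2)[of al be] that by simp
    qed
    show "EX be. be eps b & cl ?q al be = nu"
      if al: "al eps ?a" "~ al eps pa p" and b: "opair b nu eps pB p" "!!be. be eps b ==> al eps be" for al b nu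
    proof -
      obtain be where be: "be eps b" "c be = nu" using c(3)[OF b(1)] by blast
      have "al = x" using al by simp
      moreover have bp: "be eps pa p" using Q_B[OF p b(1)] be by (auto simp: sub_def)
      moreover have "be ~= x" using bp False by auto
      ultimately show ?thesis using q(2)[of x be] b(2)[OF be(1)] be by auto
    qed
    show "shadow ?q (pa p) be d"
      if be: "be eps ?a" "~ be eps pa p" and d: "nl d" "sub d (pa p)" "sub d be" for be d
    proof -
      obtain y where y: "y eps d" using d(1) ex_mem_iff unfolding nl_def by blast
      then obtain z where z: "z eps d" "y eps z" using d(1) unfolding nl_def by blast
      have bx: "be = x" using be by simp
      have "cl ?q w be = emp" if "w eps d" for w
        using q(2)[of w x] d(2,3) that unfolding bx sub_def by simp
      then have "cl ?q y be = cl ?q z be" using y z by simp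
      moreover have "y ~= z" using z(2) by auto
      ultimately show ?thesis unfolding shadow_def using y z by blast
    qed
  qed (use p in auto)
  moreover have "x eps pa ?q" by (simp add: pa_mk)
  ultimately show ?thesis by blast
qed

lemma dense_points:
  assumes p: "p eps Q" and b: "cov om b" "sub b o2"
  shows "EX q. leq q p & sub b (pa q)"
proof -
  obtain f where f: "!!x. x eps b ==> EX n. n eps om & ap f n = x" using b(1) unfolding cov_def by blast
  let ?R = "%n q. ap f n eps o2 --> ap f n eps pa q"
  have "EX r. leq r p & (ALL n. n eps om --> ?R n r)"
  proof (rule sigma_dense[OF _ p])
    show "?R n t" if "?R n s" "leq t s" for n s t using that leq_a by blast
    show "EX s. leq s q & ?R n s" if "leq q p" for n q using dense_point[of q "ap f n"] leq_Q[OF that] leq_refl by blast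
  qed simp
  then show ?thesis using f b(2) unfolding sub_def by metis
qed

lemma add_promise:
  assumes p: "p eps Q" and b: "nl b" "sub b (pa p)" and n: "nu eps o1"
  shows "EX q. leq q p & opair b nu eps pB q"
proof -
  let ?B = "un (pB p) (sng (opair b nu))"
  have B: "EX b nu. z = opair b nu & nu eps o1 & nl b & sub b (pa p)" if "z eps ?B" for z
    using Q_B[OF p] b n that unfolding mem_un mem_sng by blast
  note q = mk[of "cl p" "pa p" ?B, OF _ Q_a[OF p] Q_cov[OF p] cov_un[OF icard_om Q_covB[OF p] cov_sng] Q_cl[OF p] B]
  have "leq (mk (pa p) (cl p) ?B) p"
    by (rule leqI; (unfold pa_mk pB_mk)?) (use q p in simp_all)
  moreover have "opair b nu eps pB (mk (pa p) (cl p) ?B)" by (simp add: pB_mk)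
  ultimately show ?thesis by blast
qed

text \<open>\<open>p\<close> lies below \<delta>, the points of \<open>q\<close> below \<delta> lie
  below \<open>ze\<close>, and both conditions look alike there. By \<open>tpq\<close> and
  \<open>tqp\<close> each point of one side outside \<open>ze\<close> has a counterpart on the other
  side with the same colours over the common part; it serves as the copied point.\<close>

lemma amalgamate:
  assumes p: "p eps Q" and q: "q eps Q" and ze: "Ord ze" and \<delta>: "Ord \<delta>" "ze eps \<delta>"
    and r: "inter (pa p) ze = inter (pa q) ze" and ap: "!!x. x eps pa p ==> x eps \<delta>"
    and aq: "!!x. x eps pa q ==> x eps \<delta> ==> x eps ze"
    and c: "!!al be. al eps pa p ==> be eps pa p ==> al eps ze ==> be eps ze ==> cl p al be = cl q al be"
    and tpq: "!!et. et eps pa p ==> ~ et eps ze ==> EX et'. et' eps pa q & ~ et' eps ze & (ALL al. al eps pa p & al eps ze --> cl p al et = cl q al et')"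
    and tqp: "!!et. et eps pa q ==> ~ et eps ze ==> EX et'. et' eps pa p & ~ et' eps ze & (ALL al. al eps pa p & al eps ze --> cl q al et = cl p al et')"
  shows "EX s. leq s p & leq s q"
proof -
  obtain g where g: "T (%e. g (e 0))" "!!x. g x eps o1" "!!b nu. opair b nu eps pB q ==> EX be. be eps b & g be = nu"
    using greedy[OF Q_covB[OF q] promise_Ord[OF q]] by blast
  have rr: "x eps pa p <-> x eps pa q" if "x eps ze" for x
    using r that mem_inter[of x "pa p" ze] mem_inter[of x "pa q" ze] by simp
  have ze\<delta>: "x eps \<delta>" if "x eps ze" for x using Ord_trans[OF \<delta>] that .
  have both: "x eps ze" if "x eps pa p" "x eps pa q" for x using aq[OF that(2) ap[OF that(1)]] .
  have ordp: "Ord x" if "x eps pa p | x eps pa q" for x using that Q_a[OF p] Q_a[OF q] o2_Ord by blast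
  have low: "x eps y" if "x eps ze" "~ y eps ze" "Ord y" for x y
    using Ord_not_mem[OF that(3) ze] that unfolding sub_def by blast
  have high: "x eps y" if "x eps pa p" "y eps pa q" "~ y eps ze" for x y
  proof -
    have "~ y eps \<delta>" using aq that by blast
    then show ?thesis using Ord_not_mem[OF _ \<delta>(1)] ordp that ap unfolding sub_def by blast
  qed
  let ?a = "un (pa p) (pa q)" and ?B = "un (pB p) (pB q)"
  \<comment> \<open>Cross pairs get a colour that depends on the upper point alone: this keeps the
    promises of \<open>q\<close> towards the new points of \<open>p\<close>, and makes any two lower
    points outside \<open>ze\<close> repeat a colour.\<close>
  let ?F = "%al be. if al eps pa p & be eps pa p then cl p al be else if al eps pa q & be eps pa q then cl q al be else g be"
  have TF: "T (%e. ?F (e 0) (e 1))" using dft_app1[OF g(1), of "%e. e 1"] by simp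
  have B: "EX b nu. z = opair b nu & nu eps o1 & nl b & sub b ?a" if "z eps ?B" for z
    using that Q_B[OF p, of z] Q_B[OF q, of z] unfolding mem_un sub_def by blast
  have Fo: "?F al be eps o1" if "al eps ?a" "be eps ?a" for al be using that Q_cl[OF p] Q_cl[OF q] g(2) by auto
  have ao: "x eps o2" if "x eps ?a" for x using that Q_a[OF p] Q_a[OF q] by auto
  let ?s = "mk ?a ?F ?B"
  note s = mk[of ?F ?a ?B, OF TF ao cov_un[OF icard_om Q_cov[OF p] Q_cov[OF q]] cov_un[OF icard_om Q_covB[OF p] Q_covB[OF q]] Fo B]
  have sp: "cl ?s al be = cl p al be" if "al eps pa p" "be eps pa p" for al be
    using s(2)[of al be] that by (cases "al eps be") (simp_all add: cl_def)
  have sq: "cl ?s al be = cl q al be" if "al eps pa q" "be eps pa q" for al be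
  proof (cases "al eps pa p & be eps pa p")
    case True
    then show ?thesis using sp c both that by simp
  next
    case False
    then show ?thesis using s(2)[of al be] that by (cases "al eps be") (auto simp: cl_def)
  qed
  have sc: "cl ?s al be = g be" if "al eps pa p" "~ al eps ze" "be eps pa q" "~ be eps ze" for al be
    using s(2)[of al be] high[OF that(1,3,4)] that both by auto
  have "leq ?s q"
  proof (rule leqI; (unfold pa_mk pB_mk)?)
    show "?s eps Q" by (rule s(1))
    show "cl ?s al be = cl q al be" if "al eps pa q" "be eps pa q" for al be using sq that .
    fix al assume "al eps ?a" "~ al eps pa q"
    then have al: "al eps pa p" "~ al eps ze" using rr by auto
    show "EX be. be eps b & cl ?s al be = nu" if b: "opair b nu eps pB q" "!!be. be eps b ==> al eps be" for b nu
    proof -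
      obtain be where be: "be eps b" "g be = nu" using g(3)[OF b(1)] by blast
      have bq: "be eps pa q" using Q_B[OF q b(1)] be by (auto simp: sub_def)
      \<comment> \<open>The promised set lies above the new point of \<open>p\<close>, hence outside
        \<open>ze\<close>, where the cross colours apply.\<close>
      have "~ be eps ze" using Ord_trans[OF ze _ b(2)[OF be(1)]] al(2) by blast
      then show ?thesis using sc[OF al bq] be by auto
    qed
    show "shadow ?s (pa q) al d" if d: "nl d" "sub d (pa q)" "sub d al" for d
    proof -
      \<comment> \<open>All points of \<open>q\<close> outside \<open>ze\<close> lie above the
        points of \<open>p\<close>, so a set \<open>d\<close> below \<open>al\<close> is contained
        in the common part.\<close>
      have dr: "x eps pa p & x eps pa q & x eps ze" if "x eps d" for x
      proof -
        have x: "x eps pa q" "x eps al" using d that by (auto simp: sub_def)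
        have "x eps ze"
        proof (rule ccontr)
          assume "~ x eps ze"
          then show False using high[OF al(1) x(1)] not_mem_sym x(2) by blast
        qed
        then show ?thesis using x rr by blast
      qed
      obtain et where et: "et eps pa q" "~ et eps ze" "!!x. x eps pa p ==> x eps ze ==> cl p x al = cl q x et" using tpq[OF al] by blast
      have "cl ?s x al = cl ?s x et" if "x eps d" for x
        using dr[OF that] sp[of x al] sq[of x et] et al by simp
      moreover have "sub d et" unfolding sub_def using dr low et ordp by blast
      ultimately show ?thesis unfolding shadow_def using et(1) by blast
    qed
  qed (use q in auto)
  moreover have "leq ?s p"
  proof (rule leqI; (unfold pa_mk pB_mk)?)
    show "?s eps Q" by (rule s(1))
    show "cl ?s al be = cl p al be" if "al eps pa p" "be eps pa p" for al be using sp that .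
    fix be assume "be eps ?a" "~ be eps pa p"
    then have be: "be eps pa q" "~ be eps ze" using rr by auto
    show "EX \<gamma>. \<gamma> eps b & cl ?s be \<gamma> = nu" if b: "opair b nu eps pB p" "!!\<gamma>. \<gamma> eps b ==> be eps \<gamma>" for b nu
    proof -
      \<comment> \<open>No promise of \<open>p\<close> can apply, as the new points lie above all of
        \<open>p\<close>.\<close>
      obtain x where "x eps b" "x eps pa p" using Q_B[OF p b(1)] ex_mem_iff[of b] by (auto simp: sub_def nl_def)
      then have False using high[OF _ be] b(2) not_mem_sym by blast
      then show ?thesis ..
    qed
    show "shadow ?s (pa p) be d" if d: "nl d" "sub d (pa p)" "sub d be" for d
    proof (cases "sub d ze")
      case True
      then have dr: "x eps pa p & x eps pa q & x eps ze" if "x eps d" for x using that d(2) rr unfolding sub_def by blast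
      obtain et where et: "et eps pa p" "~ et eps ze" "!!x. x eps pa p ==> x eps ze ==> cl q x be = cl p x et" using tqp[OF be] by blast
      have "cl ?s x be = cl ?s x et" if "x eps d" for x
        using dr[OF that] sp[of x et] sq[of x be] et be by simp
      moreover have "sub d et" unfolding sub_def using dr low et ordp by blast
      ultimately show ?thesis unfolding shadow_def using et(1) by blast
    next
      case False
      \<comment> \<open>As \<open>d\<close> has no maximum, one point outside \<open>ze\<close>
        yields a second one; both have the same cross colour with \<open>be\<close>.\<close>
      then obtain x where x: "x eps d" "~ x eps ze" unfolding sub_def by blast
      then obtain y where y: "y eps d" "x eps y" using d(1) unfolding nl_def by blast
      have "~ y eps ze" using Ord_trans[OF ze _ y(2)] x(2) by blast
      then have "cl ?s x be = cl ?s y be" using sc[of x be] sc[of y be] x y d(2) be unfolding sub_def by simp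
      moreover have "x ~= y" using y(2) by auto
      ultimately show ?thesis unfolding shadow_def using x y by blast
    qed
  qed (use p in auto)
  ultimately show ?thesis by blast
qed

end

section \<open>The chain condition by counting types of conditions\<close>

context cground
begin

text \<open>What \<open>amalgamate\<close> has to know of \<open>p\<close> at \<open>ze\<close>: the
  trace, its colouring, and the set of colour patterns over the trace that points outside
  \<open>ze\<close> realize. The extra entry \<open>i\<close> carries an ordinal below
  \<open>o1\<close> that has to agree too.\<close>

definition dat where
  "dat p i ze = opair (inter (pa p) ze) (opair (lam (prod (inter (pa p) ze) (inter (pa p) ze)) (%z. cl p (fs z) (sn z)))
    (opair (img (diff (pa p) ze) (%et. lam (inter (pa p) ze) (%al. cl p al et))) i))"

definition dats where
  "dats ze = prod (Ct ze) (prod (Ct (prod (prod ze ze) o1)) (prod (Ct (Ct (prod ze o1))) o1))"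

lemma T_dat [simp]: "T p ==> T i ==> T z ==> T (%e. dat (p e) (i e) (z e))"
  unfolding dat_def by (simp add: dft_rens)
lemma T_dats [simp]: "T a ==> T (%e. dats (a e))" unfolding dats_def by simp

lemma cov_lam: "T (%e. F (e 0)) ==> cov k a ==> cov k (lam a F)"
  unfolding lam_def by (rule cov_img') simp_all

lemma cov_inter: "cov k a ==> cov k (inter a b)" by (rule cov_sub) (auto simp: sub_def)

lemma dat_dats: "p eps Q ==> i eps o1 ==> dat p i ze eps dats ze"
proof -
  assume p: "p eps Q" and i: "i eps o1"
  let ?r = "inter (pa p) ze"
  have r: "cov om ?r" by (rule cov_inter[OF Q_cov[OF p]])
  have 1: "?r eps Ct ze" using r by (simp add: mem_Ct sub_def)
  have T2: "T (%e. cl p (fs (e 0)) (sn (e 0)))" by simp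
  have "sub (lam (prod ?r ?r) (%z. cl p (fs z) (sn z))) (prod (prod ze ze) o1)"
    unfolding sub_def mem_lam[OF T2] using Q_cl[OF p] by (auto simp: mem_prod)
  then have 2: "lam (prod ?r ?r) (%z. cl p (fs z) (sn z)) eps Ct (prod (prod ze ze) o1)"
    using cov_lam[OF T2 cov_prod[OF icard_om r r]] by (simp add: mem_Ct)
  have T3: "T (%e. cl p (e 0) et)" for et by simp
  have 3: "lam ?r (%al. cl p al et) eps Ct (prod ze o1)" if "et eps pa p" for et
    using cov_lam[OF T3 r] Q_cl[OF p _ that] by (auto simp: mem_Ct sub_def mem_lam[OF T3])
  have T4: "T (%e. lam ?r (%al. cl p al (e 0)))" by simp
  have "cov om (diff (pa p) ze)" by (rule cov_sub[OF Q_cov[OF p]]) (simp add: sub_def)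
  then have 4: "img (diff (pa p) ze) (%et. lam ?r (%al. cl p al et)) eps Ct (Ct (prod ze o1))"
    using cov_img'[OF T4] 3 by (auto simp: mem_Ct[of _ "Ct _"] sub_def mem_img[OF T4])
  show ?thesis unfolding dat_def dats_def using 1 2 4 i by simp
qed

text \<open>CH enters here: countable sets, and countable sets of countable sets, over something of
  size at most \<open>o1\<close> number at most \<open>o1\<close>.\<close>

lemma cov_dats: "ze eps o2 ==> cov o1 (dats ze)"
  unfolding dats_def by (intro cov_prod[OF icard_o1] cov_Ct cov_hart cov_refl)

lemma dat_eq:
  assumes "dat p i ze = dat q i' ze"
  shows "inter (pa p) ze = inter (pa q) ze" "i = i'"
    "al eps pa p ==> be eps pa p ==> al eps ze ==> be eps ze ==> cl p al be = cl q al be"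
    "et eps pa p ==> ~ et eps ze ==> EX et'. et' eps pa q & ~ et' eps ze & (ALL al. al eps pa p & al eps ze --> cl p al et = cl q al et')"
proof -
  let ?r = "inter (pa p) ze"
  let ?c = "%p. lam (prod ?r ?r) (%z. cl p (fs z) (sn z))" and ?l = "%p et. lam ?r (%al. cl p al et)"
  show r: "?r = inter (pa q) ze" and "i = i'" using assms unfolding dat_def opair_inject by blast+
  have e: "?c p = ?c q" "img (diff (pa p) ze) (?l p) = img (diff (pa q) ze) (?l q)"
    using assms unfolding dat_def opair_inject r by blast+
  show "cl p al be = cl q al be" if "al eps pa p" "be eps pa p" "al eps ze" "be eps ze"
  proof -
    have "ap (?c p) (opair al be) = ap (?c q) (opair al be)" using e(1) by simp
    then show ?thesis using that by (simp add: ap_lam)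
  qed
  have m: "w eps img (diff (pa p) ze) (?l p) <-> (EX et. et eps diff (pa p) ze & w = ?l p et)"
    "w eps img (diff (pa q) ze) (?l q) <-> (EX et. et eps diff (pa q) ze & w = ?l q et)" for w
    by (rule mem_img; simp)+
  assume "et eps pa p" "~ et eps ze"
  then have "?l p et eps img (diff (pa q) ze) (?l q)" unfolding e(2)[symmetric] m by auto
  then obtain et' where et': "et' eps diff (pa q) ze" "?l p et = ?l q et'" unfolding m by blast
  have "cl p al et = cl q al et'" if "al eps pa p" "al eps ze" for al
  proof -
    have "ap (?l p et) al = ap (?l q et') al" using et'(2) by simp
    then show ?thesis using that by (simp add: ap_lam)
  qed
  then show "EX et'. et' eps pa q & ~ et' eps ze & (ALL al. al eps pa p & al eps ze --> cl p al et = cl q al et')"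
    using et'(1) by auto
qed

text \<open>
  Close off under representatives of all data to get \<open>\<delta> < o2\<close> of cofinality \<open>o1\<close>. The condition
  at \<open>\<delta>\<close> meets \<open>\<delta>\<close> in a subset of some \<open>ze < \<delta>\<close>, and so it is compatible with the representative
  of its own datum at \<open>ze\<close>.
\<close>

lemma knaster:
  assumes Tp: "T (%e. pp (e 0))" and Ti: "T (%e. ii (e 0))"
    and P: "!!be. be eps o2 ==> pp be eps Q" and I: "!!be. be eps o2 ==> ii be eps o1"
  shows "EX be be' s. be eps o2 & be' eps o2 & be ~= be' & ii be = ii be' & leq s (pp be) & leq s (pp be')"
proof -
  define C where "C d ze be <-> be eps o2 & dat (pp be) (ii be) ze = d" for d ze be
  define rp where "rp d ze = ch (C d ze)" for d ze
  \<comment> \<open>\<open>W d ze\<close> exceeds the chosen representative of the datum and all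
    points of its condition; \<open>nx ze\<close> exceeds these bounds for all data at
    \<open>ze\<close>.\<close>
  define W where "W d ze = (if C d ze (rp d ze) then un (suc (rp d ze)) (Union (img (pa (pp (rp d ze))) suc)) else emp)" for d ze
  define nx where "nx ze = un (suc ze) (Union (img (dats ze) (%d. W d ze)))" for ze
  have Tpp: "T t ==> T (%e. pp (t e))" for t by (rule dft_app1[OF Tp])
  have Tii: "T t ==> T (%e. ii (t e))" for t by (rule dft_app1[OF Ti])
  have DC: "T a ==> T b ==> T c ==> D (%e. C (a e) (b e) (c e))" for a b c
    unfolding C_def by (simp add: Tpp Tii dft_rens)
  have Trp: "T a ==> T b ==> T (%e. rp (a e) (b e))" for a b
    unfolding rp_def by (simp add: DC dft_rens)
  have TW: "T a ==> T b ==> T (%e. W (a e) (b e))" for a b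
    unfolding W_def by (simp add: DC Trp Tpp dft_rens)
  have Tnx: "T (%e. nx (e 0))" unfolding nx_def by (simp add: TW)
  have mW: "w eps img (dats ze) (%d. W d ze) <-> (EX d. d eps dats ze & w = W d ze)" for w ze
    by (rule mem_img) (simp add: TW)
  have ms: "w eps img a suc <-> (EX x. x eps a & w = suc x)" for w a by (rule mem_img) simp
  have un_o2: "un a b eps o2" if "a eps o2" "b eps o2" for a b using that un_Ord[OF o2_Ord o2_Ord] by simp
  have emp_o2: "emp eps o2" using emp_o1 Ord_trans[OF Ord_o2 o1_o2] by blast
  have Wo2: "W d ze eps o2" for d ze
  proof (cases "C d ze (rp d ze)")
    case True
    then have b: "rp d ze eps o2" unfolding C_def by blast
    have "Union (img (pa (pp (rp d ze))) suc) eps o2"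
      by (rule hart_regular[OF icard_o1 cov_o1[OF cov_img'[OF _ Q_cov[OF P[OF b]]]]])
        (use Q_a[OF P[OF b]] suc_o2 ms in auto)
    then show ?thesis using True un_o2 suc_o2 b by (simp add: W_def)
  qed (simp add: W_def emp_o2)
  have nxo2: "nx ze eps o2" if "ze eps o2" for ze
  proof -
    have "Union (img (dats ze) (%d. W d ze)) eps o2"
      by (rule hart_regular[OF icard_o1 cov_img'[OF _ cov_dats[OF that]]]) (use Wo2 mW TW in auto)
    then show ?thesis unfolding nx_def using un_o2 suc_o2[OF that] by blast
  qed
  define H where "H a x f = Union (img x (%y. nx (ap f y)))" for a x f :: 'a
  have H: "T (%e. H (e 0) (e 1) (e 2))" unfolding H_def using dft_app1[OF Tnx] by simp
  define z where "z = rec H emp"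
  have Tz: "T (%e. z (e 0))" unfolding z_def by (rule T_rec[OF H]) simp_all
  have Tnz: "T (%e. nx (z (e 0)))" by (rule dft_app1[OF Tnx Tz])
  have z: "w eps z x <-> (EX y. y eps x & w eps nx (z y))" for w x
  proof -
    have "z x = H emp x (lam x z)" unfolding z_def by (rule rec_eq[OF H])
    moreover have "T (%e. nx (ap (lam x z) (e 0)))" by (rule dft_app1[OF Tnx]) (simp add: dft_app1[OF Tz])
    ultimately show ?thesis using ap_lam[OF Tz] by (auto simp: H_def mem_img)
  qed
  have zo2: "x eps suc o1 --> z x eps o2" for x
  proof (rule eps_induct[of "%x. x eps suc o1 --> z x eps o2"])
    show "D (%e. e 0 eps suc o1 --> z (e 0) eps o2)" using Tz by simp
    fix x assume IH: "!!y. y eps x ==> y eps suc o1 --> z y eps o2"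
    show "x eps suc o1 --> z x eps o2"
    proof
      assume x: "x eps suc o1"
      have s: "sub x o1" using x Ord_trans[OF Ord_o1] by (auto simp: sub_def)
      have m: "w eps img x (%y. nx (z y)) <-> (EX y. y eps x & w = nx (z y))" for w by (rule mem_img[OF Tnz])
      have "Union (img x (%y. nx (z y))) eps o2"
        by (rule hart_regular[OF icard_o1 cov_img'[OF Tnz cov_subset[OF s]]])
          (use m IH s nxo2 in \<open>auto simp: sub_def\<close>)
      moreover have "Union (img x (%y. nx (z y))) = z x" by (rule ext) (use m z in auto)
      ultimately show "z x eps o2" by simp
    qed
  qed
  let ?\<delta> = "z o1"
  have \<delta>: "?\<delta> eps o2" using zo2[of o1] by simp
  have nx\<delta>: "w eps ?\<delta>" if "y eps o1" "w eps nx (z y)" for w y using z that by blast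
  let ?q = "pp ?\<delta>"
  \<comment> \<open>The stage at which an element of \<delta> appears. Countably many stages are
    bounded below \<open>o1\<close>, so the trace on \<delta> of the condition at \<delta> is
    already contained in a single \<open>z ?Y\<close>.\<close>
  let ?y = "%e. Lst (%y. y eps o1 & e eps nx (z y))"
  have Ty: "T (%e. ?y (e 0))" by (simp add: Tnz dft_app1[OF Tnz])
  have y: "?y e eps o1 & e eps nx (z (?y e))" if e: "e eps ?\<delta>" for e
  proof -
    obtain y where y: "y eps o1" "e eps nx (z y)" using e unfolding z[of _ o1] by blast
    show ?thesis
      by (rule Lst_prop[of "%y. y eps o1 & e eps nx (z y)" y]) (use y Ord_in[OF Ord_o1] Tnz in simp_all)
  qed
  let ?Y = "Union (img (img (inter (pa ?q) ?\<delta>) ?y) suc)"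
  have mY: "w eps img (inter (pa ?q) ?\<delta>) ?y <-> (EX x. x eps inter (pa ?q) ?\<delta> & w = ?y x)" for w by (rule mem_img[OF Ty])
  have "cov om (img (img (inter (pa ?q) ?\<delta>) ?y) suc)"
    by (intro cov_img'[OF _ cov_img'[OF Ty cov_inter[OF Q_cov[OF P[OF \<delta>]]]]]) simp
  then have Y: "?Y eps o1"
    by (rule hart_regular[OF icard_om]) (use mY ms y suc_o1 in auto)
  let ?ze = "z ?Y"
  have ze: "?ze eps o2" using zo2[of ?Y] Y by simp
  have ze\<delta>: "?ze eps ?\<delta>" by (rule nx\<delta>[OF Y]) (simp add: nx_def)
  have qze: "x eps ?ze" if "x eps pa ?q" "x eps ?\<delta>" for x
  proof -
    have "?y x eps img (inter (pa ?q) ?\<delta>) ?y" unfolding mY using that by auto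
    then have "?y x eps ?Y" unfolding mem_Union ms by (intro exI[of _ "suc (?y x)"]) auto
    then show ?thesis using z[of x ?Y] y[OF that(2)] by blast
  qed
  define d where "d = dat ?q (ii ?\<delta>) ?ze"
  let ?b = "rp d ?ze"
  have "C d ?ze ?\<delta>" unfolding C_def d_def using \<delta> by simp
  then have Cb: "C d ?ze ?b" unfolding rp_def by (intro ch[of "C d ?ze"]) (simp_all add: DC)
  then have b: "?b eps o2" and e: "dat (pp ?b) (ii ?b) ?ze = dat ?q (ii ?\<delta>) ?ze" unfolding C_def d_def by blast+
  have "d eps dats ?ze" unfolding d_def by (rule dat_dats[OF P[OF \<delta>] I[OF \<delta>]])
  then have W: "w eps ?\<delta>" if "w eps W d ?ze" for w
    by (intro nx\<delta>[OF Y]) (use that mW in \<open>auto simp: nx_def\<close>)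
  have "?b eps ?\<delta>" by (rule W) (simp add: W_def Cb)
  then have ne: "?b ~= ?\<delta>" using not_mem_self by metis
  have pb: "x eps ?\<delta>" if "x eps pa (pp ?b)" for x
  proof (rule W)
    have "suc x eps img (pa (pp ?b)) suc" unfolding ms using that by blast
    then show "x eps W d ?ze" unfolding W_def using Cb by auto
  qed
  have r: "inter (pa (pp ?b)) ?ze = inter (pa ?q) ?ze" by (rule dat_eq(1)[OF e])
  then have r': "x eps pa (pp ?b) & x eps ?ze <-> x eps pa ?q & x eps ?ze" for x
    using mem_inter[of x "pa (pp ?b)" ?ze] mem_inter[of x "pa ?q" ?ze] by simp
  have "EX s. leq s (pp ?b) & leq s ?q"
  proof (rule amalgamate[OF P[OF b] P[OF \<delta>] o2_Ord[OF ze] o2_Ord[OF \<delta>] ze\<delta> r pb qze])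
    fix et assume "et eps pa ?q" "~ et eps ?ze"
    then show "EX et'. et' eps pa (pp ?b) & ~ et' eps ?ze & (ALL al. al eps pa (pp ?b) & al eps ?ze --> cl ?q al et = cl (pp ?b) al et')"
      unfolding r' by (rule dat_eq(4)[OF e[symmetric]])
  qed (use dat_eq(3,4)[OF e] in blast)+
  then show ?thesis using b \<delta> ne dat_eq(2)[OF e] by blast
qed

end

section \<open>Cardinals and subsets of \<omega> in the extension\<close>

locale cext = cground mem A + gext mem A "cground.Q mem" "cground.leq mem" G h E
  for mem :: "'a => 'a => bool" (infix "eps" 50) and A G and h :: "'a => 'b" and E
begin

sublocale N: zf E by (rule zf_E)

abbreviation j where "j x \<equiv> h (check x)"

sublocale emb mem E j by (rule emb_check)

text \<open>By \<sigma>-closure one condition in \<open>G\<close> decides a value for every n, so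
  \<omega> choices made in the extension from a set of the ground model are given by a function of
  the ground model.\<close>

lemma new_sequence:
  assumes R: "dfn E (%e. R (e 0) (e 1))" and ex: "!!n. n eps om ==> EX v. v eps X & R (j n) (j v)"
  shows "EX g. ALL n. n eps om --> ap g n eps X & R (j n) (j (ap g n))"
proof -
  obtain F where F: "D (%e. F (e 0) (e 1) (e 2))" "!!p q x y. F p x y ==> leq q p ==> F q x y"
    "!!x y. R (h x) (h y) <-> (EX p. p \<in> G & F p x y)" using rel2[OF R] by blast
  have DF: "T a ==> T b ==> T c ==> D (%e. F (a e) (check (b e)) (check (c e)))" for a b c
    by (rule dfn_app3[OF F(1)]) simp_all
  let ?Q = "%r. EX n. n eps om & (ALL s. leq s r --> (ALL v. v eps X --> ~ F s (check n) (check v)))"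
  have "D (%e. ?Q (e 0))" by (simp add: DF dft_rens)
  then obtain p where p: "p \<in> G" "?Q p | (ALL s. leq s p --> ~ ?Q s)" using dich[of ?Q] by blast
  have "~ ?Q p"
  proof
    assume "?Q p"
    then obtain n where n: "n eps om" "!!s v. leq s p ==> v eps X ==> ~ F s (check n) (check v)" by blast
    then obtain v q where v: "v eps X" "q \<in> G" "F q (check n) (check v)" using ex F(3) by blast
    obtain r where "leq r p" "leq r q" using G_dir p(1) v(2) by blast
    then show False using n(2) v F(2) by blast
  qed
  then have d: "EX t v. leq t s & v eps X & F t (check n) (check v)" if "leq s p" "n eps om" for s n using p(2) that by blast
  let ?R = "%n s. EX v. v eps X & F s (check n) (check v)"
  have DR: "D (%e. ?R (e 0) (e 1))" by (simp add: DF dft_rens)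
  have "EX r. r \<in> G & (ALL n. n eps om --> ?R n r)"
  proof (rule G_below[OF p(1)])
    show "D (%e. ALL n. n eps om --> ?R n (e 0))" by (simp add: DF dft_rens)
    fix q assume q: "leq q p"
    show "EX s. leq s q & (ALL n. n eps om --> ?R n s)"
    proof (rule sigma_dense[OF DR])
      show "q eps Q" using leq_Q q by blast
      show "EX s. leq s q' & ?R n s" if "n eps om" "leq q' q" for n q' using d[OF leq_trans[OF that(2) q] that(1)] by blast
    qed (use F(2) in blast)
  qed
  then obtain r where r: "r \<in> G" "!!n. n eps om ==> ?R n r" by blast
  let ?c = "%n. ch (%v. v eps X & F r (check n) (check v))"
  have T: "T (%e. ?c (e 0))" by (simp add: DF)
  have "?c n eps X & R (j n) (j (?c n))" if n: "n eps om" for n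
  proof -
    obtain v where "v eps X & F r (check n) (check v)" using r(2)[OF n] by blast
    then have "?c n eps X & F r (check n) (check (?c n))"
      by (intro ch[of "%v. v eps X & F r (check n) (check v)"]) (simp add: DF)
    then show ?thesis using F(3) r(1) by blast
  qed
  then show ?thesis using ap_lam[OF T] by (intro exI[of _ "lam om ?c"]) simp
qed

text \<open>This brings the countable sets in both properties of the colouring into the ground
  model, where conditions can speak of them.\<close>

lemma countable_subset:
  assumes c: "N.cov (j om) y" and s: "N.sub y (j X)"
  obtains Y where "y = j Y" "sub Y X" "cov om Y"
proof (cases "y = N.emp")
  case True
  then show ?thesis using that[of emp] j_emp cov_sub[OF cov_refl[of om], of emp] by simp
next
  case False
  then obtain y0 where y0: "E y0 y" using N.ex_mem_iff by blast
  have yX: "EX v. v eps X & w = j v" if w: "E w y" for w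
  proof -
    have "E w (j X)" using s w unfolding N.sub_def by blast
    then show ?thesis using j_down j_mem by blast
  qed
  obtain f where f: "!!x. E x y ==> EX i. E i (j om) & N.ap f i = x" using c unfolding N.cov_def by blast
  \<comment> \<open>Where \<open>f\<close> leaves \<open>y\<close> any member of \<open>y\<close>
    will do, which makes the choice total.\<close>
  let ?R = "%n v. E v y & (E (N.ap f n) y --> N.ap f n = v)"
  have "EX v. v eps X & ?R (j n) (j v)" for n
  proof (cases "E (N.ap f (j n)) y")
    case True
    then show ?thesis using yX by metis
  next
    case False
    then show ?thesis using yX[OF y0] y0 by auto
  qed
  then obtain g where g: "!!n. n eps om ==> ap g n eps X & ?R (j n) (j (ap g n))" using new_sequence[of ?R X] by auto
  let ?Y = "img om (ap g)"
  have Y: "v eps ?Y <-> (EX n. n eps om & v = ap g n)" for v by (rule mem_img) simp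
  have "y = j ?Y"
  proof (rule N.ext, rule iffI)
    fix w assume w: "E w y"
    then obtain i where i: "E i (j om)" "N.ap f i = w" using f by blast
    then obtain n where n: "i = j n" "n eps om" using j_down j_mem by blast
    then have e: "w = j (ap g n)" using g[OF n(2)] i w by (simp del: j_ap)
    show "E w (j ?Y)" unfolding e j_mem Y using n by blast
  next
    fix w assume "E w (j ?Y)"
    then obtain v where v: "w = j v" "v eps ?Y" using j_down j_mem by blast
    then obtain n where "n eps om" "v = ap g n" unfolding Y by blast
    then show "E w y" using g v by blast
  qed
  moreover have "sub ?Y X" unfolding sub_def Y using g by auto
  moreover have "cov om ?Y" by (rule cov_imgs) simp
  ultimately show ?thesis using that by blast
qed

lemma not_cov_o1: "~ N.cov (j om) (j o1)"
proof
  assume "N.cov (j om) (j o1)"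
  then obtain f where f: "!!x. E x (j o1) ==> EX i. E i (j om) & N.ap f i = x" unfolding N.cov_def by blast
  let ?R = "%n v. E (N.ap f n) (j o1) --> N.ap f n = v"
  have "EX v. v eps o1 & ?R (j n) (j v)" for n using j_down[of _ o1] j_mem emp_o1 by metis
  then obtain g where g: "!!n. n eps om ==> ?R (j n) (j (ap g n))" using new_sequence[of ?R o1] by auto
  have "EX n. n eps om & ap g n = x" if x: "x eps o1" for x
  proof -
    obtain i where i: "E i (j om)" "N.ap f i = j x" using f[of "j x"] x by auto
    then obtain n where n: "i = j n" "n eps om" using j_down j_mem by blast
    have "j (ap g n) = j x" using g[OF n(2)] i x n(1) by (simp del: j_ap)
    then show ?thesis unfolding j_eq using n(2) by blast
  qed
  then have "cov om o1" unfolding cov_def by blast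
  then show False using not_cov_hart by blast
qed

text \<open>Below one condition every b < \<open>o2\<close> has a condition deciding some i <
  \<open>o1\<close> that is sent to b. By \<open>knaster\<close> two different b with the same i
  have compatible conditions, and two values would be forced at one argument.\<close>

lemma not_cov_o2: "~ N.cov (j o1) (j o2)"
proof
  assume "N.cov (j o1) (j o2)"
  then obtain f where f: "!!x. E x (j o2) ==> EX i. E i (j o1) & N.ap f i = x" unfolding N.cov_def by blast
  let ?R = "%i v. N.ap f i = v"
  have R: "dfn E (%e. ?R (e 0) (e 1))" by simp
  obtain F where F: "D (%e. F (e 0) (e 1) (e 2))" "!!p q x y. F p x y ==> leq q p ==> F q x y"
    "!!x y. ?R (h x) (h y) <-> (EX p. p \<in> G & F p x y)" using rel2[OF R] by blast
  have DF: "T a ==> T b ==> T c ==> D (%e. F (a e) (check (b e)) (check (c e)))" for a b c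
    by (rule dfn_app3[OF F(1)]) simp_all
  let ?Q1 = "%r. EX b. b eps o2 & (ALL s. leq s r --> (ALL i. i eps o1 --> ~ F s (check i) (check b)))"
  have "D (%e. ?Q1 (e 0))" by (simp add: DF dft_rens)
  then obtain p1 where p1: "p1 \<in> G" "?Q1 p1 | (ALL s. leq s p1 --> ~ ?Q1 s)" using dich[of ?Q1] by blast
  have "~ ?Q1 p1"
  proof
    assume "?Q1 p1"
    then obtain b where b: "b eps o2" "!!s i. leq s p1 ==> i eps o1 ==> ~ F s (check i) (check b)" by blast
    obtain i' where "E i' (j o1)" "N.ap f i' = j b" using f[of "j b"] b(1) by auto
    then obtain i where i: "i eps o1" "N.ap f (j i) = j b" using j_down j_mem by blast
    then obtain q where q: "q \<in> G" "F q (check i) (check b)" using F(3) by blast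
    obtain r where "leq r p1" "leq r q" using G_dir p1(1) q(1) by blast
    then show False using b(2) i q F(2) by blast
  qed
  then have d: "EX t i. leq t s & i eps o1 & F t (check i) (check b)" if "leq s p1" "b eps o2" for s b using p1(2) that by blast
  let ?Q2 = "%r. EX i b b'. b ~= b' & F r (check i) (check b) & F r (check i) (check b')"
  have "D (%e. ?Q2 (e 0))" by (simp add: DF dft_rens)
  then obtain p2 where p2: "p2 \<in> G" "?Q2 p2 | (ALL s. leq s p2 --> ~ ?Q2 s)" using dich[of ?Q2] by blast
  have "~ ?Q2 p2"
  proof
    assume "?Q2 p2"
    then obtain i b b' where b: "b ~= b'" "F p2 (check i) (check b)" "F p2 (check i) (check b')" by blast
    then have "j b = j b'" using F(3)[of "check i" "check b"] F(3)[of "check i" "check b'"] p2(1) by metis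
    then show False using b(1) by simp
  qed
  then have n: "~ ?Q2 s" if "leq s p2" for s using p2(2) that by blast
  obtain p where p: "p \<in> G" "leq p p1" "leq p p2" using G_dir p1(1) p2(1) by blast
  let ?C = "%b z. leq (fs z) p & sn z eps o1 & F (fs z) (check (sn z)) (check b)"
  let ?c = "%b. ch (?C b)"
  have Tc: "T (%e. ?c (e 0))" by (simp add: DF)
  have c: "?C b (?c b)" if b: "b eps o2" for b
  proof -
    obtain t i where "leq t p" "i eps o1" "F t (check i) (check b)" using d[OF p(2) b] by blast
    then have "?C b (opair t i)" by simp
    then show ?thesis by (intro ch[of "?C b" "opair t i"]) (simp_all add: DF)
  qed
  have "EX b b' s. b eps o2 & b' eps o2 & b ~= b' & sn (?c b) = sn (?c b') & leq s (fs (?c b)) & leq s (fs (?c b'))"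
    by (rule knaster[of "%b. fs (?c b)" "%b. sn (?c b)"]) (use Tc c leq_Q in auto)
  then obtain b b' s where s: "b eps o2" "b' eps o2" "b ~= b'" "sn (?c b) = sn (?c b')" "leq s (fs (?c b))" "leq s (fs (?c b'))"
    by blast
  have "F s (check (sn (?c b))) (check b)" "F s (check (sn (?c b))) (check b')"
    using c[OF s(1)] c[OF s(2)] F(2) s(4-6) by auto
  moreover have "leq s p2" using c[OF s(1)] leq_trans[OF s(5)] leq_trans[OF _ p(3)] by blast
  ultimately show False using n[of s] s(3) by blast
qed

text \<open>\<open>new_sequence\<close> is applied to the characteristic function of the
  subset.\<close>

lemma Pow_om: "N.sub (N.Pow (j om)) (j (Pow om))"
  unfolding N.sub_def N.mem_Pow
proof (intro allI impI)
  fix s assume s: "ALL z. E z s --> E z (j om)"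
  let ?R = "%n v. E n s <-> v ~= N.emp"
  have "EX v. v eps upair emp (sng emp) & ?R (j n) (j v)" for n
  proof -
    have "sng emp ~= emp" using ex_mem_iff[of "sng emp"] by auto
    then show ?thesis unfolding j_emp[symmetric] j_eq by (cases "E (j n) s") auto
  qed
  then obtain g where g: "!!n. n eps om ==> ?R (j n) (j (ap g n))" using new_sequence[of ?R "upair emp (sng emp)"] by auto
  let ?S = "sep om (%n. ap g n ~= emp)"
  have S: "n eps ?S <-> n eps om & ap g n ~= emp" for n by (rule mem_sep) simp
  have "s = j ?S"
  proof (rule N.ext)
    fix z
    have "E z s <-> (EX n. z = j n & n eps om & E (j n) s)" using s j_down[of z om] j_mem by blast
    also have "\<dots> <-> (EX n. z = j n & n eps ?S)" unfolding S using g unfolding j_emp[symmetric] j_eq by blast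
    also have "\<dots> <-> E z (j ?S)" using j_down[of z ?S] j_mem by blast
    finally show "E z s <-> E z (j ?S)" .
  qed
  moreover have "?S eps Pow om" using S by (simp add: sub_def)
  ultimately show "E s (j (Pow om))" by simp
qed

end

section \<open>The coded predicate for the final model\<close>

context zf
begin

lemma quad_mem: "opair t (opair a (opair n x)) eps quad m <-> t eps m & a eps m & n eps m & x eps m"
  by (simp add: quad_def)

lemma mem_quad: "z eps quad m ==> EX t a n x. z = opair t (opair a (opair n x))"
  unfolding quad_def mem_prod by blast

end

context cground
begin

definition onto where "onto k b = ch (%f. ALL x. x eps b --> (EX i. i eps k & ap f i = x))"
definition pows where "pows = ch (%f. ALL x. x eps Pow om --> (EX i. i eps o1 & ap f i = x))"

lemma T_onto [simp]: "T a ==> T b ==> T (%e. onto (a e) (b e))" unfolding onto_def by (simp add: dft_rens)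

lemma onto: "cov k b ==> x eps b ==> EX i. i eps k & ap (onto k b) i = x"
proof -
  assume "cov k b" and x: "x eps b"
  then obtain f where "ALL x. x eps b --> (EX i. i eps k & ap f i = x)" unfolding cov_def by blast
  then have "ALL x. x eps b --> (EX i. i eps k & ap (onto k b) i = x)"
    unfolding onto_def by (intro ch[of "%f. ALL x. x eps b --> (EX i. i eps k & ap f i = x)" f]) simp
  then show ?thesis using x by blast
qed

text \<open>
  The final model will be constructible from one set of quadruples of ordinals, the tag 0 marking
  the generic colouring. The part with the tags 1, 2, 3 lies in the ground model and codes
  surjections that keep the cardinals and CH.
\<close>

definition A0 where
  "A0 = sep (quad o2) (%z.
    fs z = nn 1 & fs (sn z) eps o1 & fs (sn (sn z)) eps om & sn (sn (sn z)) = ap (onto om (fs (sn z))) (fs (sn (sn z)))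
    | fs z = nn 2 & fs (sn (sn z)) eps o1 & sn (sn (sn z)) = ap (onto o1 (fs (sn z))) (fs (sn (sn z)))
    | fs z = nn 3 & fs (sn (sn z)) eps om & sn (sn (sn z)) eps ap pows (fs (sn z)))"

lemma mem_A0: "opair t (opair a (opair n x)) eps A0 <-> t eps o2 & a eps o2 & n eps o2 & x eps o2 &
   (t = nn 1 & a eps o1 & n eps om & x = ap (onto om a) n | t = nn 2 & n eps o1 & x = ap (onto o1 a) n
    | t = nn 3 & n eps om & x eps ap pows a)"
proof -
  have "D (%e. fs (e 0) = nn 1 & fs (sn (e 0)) eps o1 & fs (sn (sn (e 0))) eps om & sn (sn (sn (e 0))) = ap (onto om (fs (sn (e 0)))) (fs (sn (sn (e 0))))
    | fs (e 0) = nn 2 & fs (sn (sn (e 0))) eps o1 & sn (sn (sn (e 0))) = ap (onto o1 (fs (sn (e 0)))) (fs (sn (sn (e 0))))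
    | fs (e 0) = nn 3 & fs (sn (sn (e 0))) eps om & sn (sn (sn (e 0))) eps ap pows (fs (sn (e 0))))"
    by (simp del: nn.simps)
  from mem_sep[OF this, of "opair t (opair a (opair n x))" "quad o2"] show ?thesis
    unfolding A0_def fs_opair sn_opair quad_mem by blast
qed

lemma o1_sub_o2: "x eps o1 ==> x eps o2" using Ord_trans[OF Ord_o2 o1_o2] .
lemma om_sub_o1: "x eps om ==> x eps o1" using sub_om_o1 by (simp add: sub_def)
lemma nn_o2: "nn k eps o2" by (rule o1_sub_o2[OF om_sub_o1[OF nn_om]])

lemma A0_1: "a eps o1 ==> x eps a ==> EX n. n eps om & opair (nn 1) (opair a (opair n x)) eps A0"
proof -
  assume a: "a eps o1" and x: "x eps a"
  obtain n where n: "n eps om" "ap (onto om a) n = x" using onto[OF cov_hart[OF a] x] by blast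
  then show ?thesis unfolding mem_A0
    using a o1_sub_o2 om_sub_o1 nn_o2[of 1] Ord_trans[OF Ord_o1 a x] by (intro exI[of _ n]) auto
qed

lemma A0_2: "a eps o2 ==> x eps a ==> EX n. n eps o1 & opair (nn 2) (opair a (opair n x)) eps A0"
proof -
  assume a: "a eps o2" and x: "x eps a"
  obtain n where n: "n eps o1" "ap (onto o1 a) n = x" using onto[OF cov_hart[OF a] x] by blast
  then show ?thesis unfolding mem_A0
    using a o1_sub_o2 nn_o2[of 2] Ord_trans[OF Ord_o2 a x] by (intro exI[of _ n]) auto
qed

lemma A0_3: "sub s om ==> EX i. i eps o1 & (ALL x. opair (nn 3) (opair i (opair emp x)) eps A0 <-> x eps s)"
proof -
  assume s: "sub s om"
  obtain f where "ALL x. x eps Pow om --> (EX i. i eps o1 & ap f i = x)" using CH unfolding cov_def by blast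
  then have "ALL x. x eps Pow om --> (EX i. i eps o1 & ap pows i = x)"
    unfolding pows_def by (intro ch[of "%f. ALL x. x eps Pow om --> (EX i. i eps o1 & ap f i = x)" f]) simp
  then obtain i where i: "i eps o1" "ap pows i = s" using s by auto
  have "x eps o2" if "x eps s" for x using s that o1_sub_o2 om_sub_o1 by (simp add: sub_def)
  then show ?thesis unfolding mem_A0
    using i nn_o2[of 3] nn_o2[of 0] o1_sub_o2[OF i(1)] nn_eq[of 3 1] nn_eq[of 3 2]
    by (intro exI[of _ i]) (auto simp del: nn.simps nn_eq simp flip: nn.simps(1))
qed

lemma A0_fun: "t = nn 1 | t = nn 2 ==> opair t (opair a (opair n x)) eps A0 ==> opair t (opair a (opair n y)) eps A0 ==> x = y"
  unfolding mem_A0 using nn_eq[of 1 2] nn_eq[of 1 3] nn_eq[of 2 3] by auto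

lemma A0_tag: "~ opair emp (opair a (opair n x)) eps A0"
  unfolding mem_A0 using nn_eq[of 0 1] nn_eq[of 0 2] nn_eq[of 0 3] by auto

text \<open>The order type of \<open>R\<close> is at least \<open>hart om\<close>; \<open>d\<close>
  consists of the first \<omega> elements, found through the collapse.\<close>

lemma (in zfL) uncountable_ordinals:
  assumes R: "!!x. x eps R ==> Ord x" and unc: "~ cov om R"
  shows "cov R (hart om)"
    and "EX d. sub d R & cov om d & d ~= emp & (ALL x. x eps d --> (EX y. y eps d & x eps y)) & (ALL x y. x eps d & y eps R --> y eps d | x eps y)"
proof -
  let ?o = "otp R"
  have o: "Ord ?o" by (rule Ord_otp[OF R])
  have eR: "cov k R" if "cov k ?o" for k
  proof -
    obtain f where f: "!!x. x eps ?o ==> EX i. i eps k & ap f i = x" using \<open>cov k ?o\<close> unfolding cov_def by blast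
    show ?thesis
    \<comment> \<open>The collapse is inverted in the manner of \<open>ap\<close>: the preimages
      form a singleton, whose union is the point sought.\<close>
    proof (rule cov_img[of "%i. Union (sep R (%x. col R x = ap f i))"])
      show "T (%e. Union (sep R (%x. col R x = ap f (e 0))))" by (simp add: dft_rens)
      fix x assume x: "x eps R"
      then obtain i where i: "i eps k" "ap f i = col R x" using f[of "col R x"] unfolding mem_otp by blast
      have "sep R (%y. col R y = ap f i) = sng x"
      proof (rule ext)
        fix z have "z eps sep R (%y. col R y = ap f i) <-> z eps R & col R z = col R x" unfolding i(2) by (rule mem_sep) simp
        also have "\<dots> <-> z = x" using x col_inj_Ord[of R z x] R by blast
        finally show "z eps sep R (%y. col R y = ap f i) <-> z eps sng x" by simp
      qed
      moreover have "Union (sng x) = x" by (rule ext) simp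
      ultimately show "EX i. i eps k & Union (sep R (%x. col R x = ap f i)) = x" using i by (intro exI[of _ i]) simp
    qed
  qed
  then have no: "~ cov om ?o" using unc by blast
  have ho: "sub (hart om) ?o" using Ord_not_mem[OF o Ord_hart] mem_hart[OF o] no by blast
  have "cov R ?o" unfolding otp_def by (rule cov_imgs) simp
  then show "cov R (hart om)" using cov_sub ho by blast
  have omo: "n eps ?o" if n: "n eps suc om" for n
  proof -
    have "cov om n"
    proof (rule cov_subset)
      show "sub n om" using n Ord_trans[OF Ord_om] by (auto simp: sub_def)
    qed
    then have "n eps hart om" using mem_hart[of n] Ord_in[OF Ord_suc[OF Ord_om] n] by blast
    then show ?thesis using ho by (simp add: sub_def)
  qed
  let ?d = "sep R (%x. col R x eps om)"
  have d: "x eps ?d <-> x eps R & col R x eps om" for x by (rule mem_sep) simp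
  have ex: "EX x. x eps ?d & col R x = n" if n: "n eps om" for n
    using omo[of n] n unfolding mem_otp d by auto
  have cd: "cov om ?d"
  proof (rule cov_img[of "%i. Union (sep R (%x. col R x = i))"])
    show "T (%e. Union (sep R (%x. col R x = e 0)))" by (simp add: dft_rens)
    fix x assume x: "x eps ?d"
    have "sep R (%y. col R y = col R x) = sng x"
    proof (rule ext)
      fix z have "z eps sep R (%y. col R y = col R x) <-> z eps R & col R z = col R x" by (rule mem_sep) simp
      also have "\<dots> <-> z = x" using x col_inj_Ord[of R z x] R unfolding d by blast
      finally show "z eps sep R (%y. col R y = col R x) <-> z eps sng x" by simp
    qed
    moreover have "Union (sng x) = x" by (rule ext) simp
    ultimately show "EX i. i eps om & Union (sep R (%x. col R x = i)) = x" using x unfolding d by (intro exI[of _ "col R x"]) simp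
  qed
  have "?d ~= emp" using ex[of emp] ex_mem_iff[of ?d] by auto
  moreover have "EX y. y eps ?d & x eps y" if x: "x eps ?d" for x
  proof -
    have n: "col R x eps om" "x eps R" using x unfolding d by auto
    obtain y where y: "y eps ?d" "col R y = suc (col R x)" using ex[OF suc_om[OF n(1)]] by blast
    have "y eps R" using y unfolding d by blast
    then have "x eps y" using col_mem_Ord[of R x y] R n y(2) by simp
    then show ?thesis using y by blast
  qed
  moreover have "y eps ?d | x eps y" if xy: "x eps ?d" "y eps R" for x y
  proof (rule disjCI)
    assume n: "~ x eps y"
    have x: "x eps R" "col R x eps om" using xy unfolding d by auto
    have "y = x | y eps x" using Ord_linear R x xy n by blast
    then have "y = x | col R y eps col R x" using col_mono xy(2) by blast
    then have "col R y eps om" using x Ord_trans[OF Ord_om] by blast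
    then show "y eps ?d" unfolding d using xy by blast
  qed
  moreover have "sub ?d R" unfolding sub_def d by blast
  ultimately show "EX d. sub d R & cov om d & d ~= emp & (ALL x. x eps d --> (EX y. y eps d & x eps y)) & (ALL x y. x eps d & y eps R --> y eps d | x eps y)"
    using cd by blast
qed

end

section \<open>The generic colouring in the extension\<close>

context cext
begin

text \<open>A name for the colouring: under the tag 0 each coloured pair is listed with every
  condition that contains it.\<close>

definition dot where
  "dot = img (sep (prod (prod o2 (prod o2 o1)) Q) (%u. fs (fs u) eps fs (sn (fs u)) & fs (fs u) eps pa (sn u)
      & fs (sn (fs u)) eps pa (sn u) & sn (sn (fs u)) = cl (sn u) (fs (fs u)) (fs (sn (fs u)))))
    (%u. opair (check (opair emp (fs u))) (sn u))"

lemma E_dot: "E a (h dot) <-> (EX p al be. p \<in> G & al eps be & al eps pa p & be eps pa p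
    & a = j (opair emp (opair al (opair be (cl p al be)))))"
proof -
  let ?S = "sep (prod (prod o2 (prod o2 o1)) Q) (%u. fs (fs u) eps fs (sn (fs u)) & fs (fs u) eps pa (sn u)
      & fs (sn (fs u)) eps pa (sn u) & sn (sn (fs u)) = cl (sn u) (fs (fs u)) (fs (sn (fs u))))"
  have S: "u eps ?S <-> u eps prod (prod o2 (prod o2 o1)) Q & fs (fs u) eps fs (sn (fs u)) & fs (fs u) eps pa (sn u)
      & fs (sn (fs u)) eps pa (sn u) & sn (sn (fs u)) = cl (sn u) (fs (fs u)) (fs (sn (fs u)))" for u
    by (rule mem_sep) simp
  have d: "z eps dot <-> (EX u. u eps ?S & z = opair (check (opair emp (fs u))) (sn u))" for z
    unfolding dot_def by (rule mem_img) simp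
  have "opair w p eps dot <-> p eps Q & (EX al be. al eps be & al eps pa p & be eps pa p & w = check (opair emp (opair al (opair be (cl p al be)))))" for w p
  proof
    assume "opair w p eps dot"
    then obtain u where u: "u eps ?S" "w = check (opair emp (fs u))" "p = sn u" unfolding d by auto
    then obtain al be nu p' where u': "u = opair (opair al (opair be nu)) p'" "p' eps Q" unfolding S by (auto simp: mem_prod)
    show "p eps Q & (EX al be. al eps be & al eps pa p & be eps pa p & w = check (opair emp (opair al (opair be (cl p al be)))))"
      using u u'(2) unfolding S u'(1) fs_opair sn_opair by auto
  next
    assume "p eps Q & (EX al be. al eps be & al eps pa p & be eps pa p & w = check (opair emp (opair al (opair be (cl p al be)))))"
    then obtain al be where p: "p eps Q" "al eps be" "al eps pa p" "be eps pa p" "w = check (opair emp (opair al (opair be (cl p al be))))" by blast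
    then have "opair (opair al (opair be (cl p al be))) p eps ?S" unfolding S using Q_a[OF p(1)] Q_cl[OF p(1)] by simp
    then show "opair w p eps dot" unfolding d p(5) by (intro exI[of _ "opair (opair al (opair be (cl p al be))) p"]) simp
  qed
  note m = this
  show ?thesis unfolding mem_h[of a dot] m
  proof
    assume "EX p al be. p \<in> G & al eps be & al eps pa p & be eps pa p & a = j (opair emp (opair al (opair be (cl p al be))))"
    then obtain p al be where p: "p \<in> G" "al eps be" "al eps pa p" "be eps pa p" and a: "a = j (opair emp (opair al (opair be (cl p al be))))" by blast
    show "EX w t. (t eps Q & (EX al be. al eps be & al eps pa t & be eps pa t & w = check (opair emp (opair al (opair be (cl t al be)))))) & t \<in> G & a = h w"
      by (intro exI conjI; (rule G_P[OF p(1)] p a refl)?)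
  qed blast
qed

text \<open>The generic colouring seen from outside, as a relation on the ground model; the
  combinatorics below is stated for it.\<close>

definition gg where
  "gg al be nu <-> (EX p. p \<in> G & al eps be & al eps pa p & be eps pa p & nu = cl p al be)"

lemma G_points: "cov om b ==> sub b o2 ==> EX p. p \<in> G & sub b (pa p)"
proof -
  assume b: "cov om b" "sub b o2"
  obtain p where p: "p \<in> G" using ex_G by blast
  show ?thesis by (rule G_below[OF p]) (use dense_points[OF _ b] leq_Q in auto)
qed

lemma G_point: "p \<in> G ==> x eps o2 ==> EX q. q \<in> G & leq q p & x eps pa q"
proof -
  assume p: "p \<in> G" and x: "x eps o2"
  obtain q where q: "q \<in> G" "sub (sng x) (pa q)" using G_points[OF cov_sng, of x] x by (auto simp: sub_def)
  obtain r where "r \<in> G" "leq r p" "leq r q" using G_dir p q by blast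
  then show ?thesis using leq_a[of r q x] q(2) by (auto simp: sub_def)
qed

lemma gg_props:
  assumes "gg al be nu"
  shows "al eps be" "al eps o2" "be eps o2" "nu eps o1"
  using assms G_P Q_a Q_cl unfolding gg_def by blast+

lemma gg_fun: "gg al be nu ==> gg al be nu' ==> nu = nu'"
proof -
  assume "gg al be nu" "gg al be nu'"
  then obtain p q where pq: "p \<in> G" "q \<in> G" "al eps pa p" "be eps pa p" "nu = cl p al be" "al eps pa q" "be eps pa q" "nu' = cl q al be"
    unfolding gg_def by blast
  obtain r where "leq r p" "leq r q" using G_dir pq by blast
  then show ?thesis using leq_cl[of r p al be] leq_cl[of r q al be] pq by simp
qed

lemma gg_total: "al eps be ==> be eps o2 ==> EX nu. gg al be nu"
proof -
  assume a: "al eps be" "be eps o2"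
  obtain p where "p \<in> G" using ex_G by blast
  then obtain q where q: "q \<in> G" "be eps pa q" using G_point a(2) by blast
  obtain r where "r \<in> G" "leq r q" "al eps pa r" using G_point[OF q(1)] Ord_trans[OF Ord_o2 a(2,1)] by blast
  then show ?thesis unfolding gg_def using a(1) leq_a q(2) by blast
qed

text \<open>The set \<open>b\<close> belongs to the ground model, and by density some condition in
  \<open>G\<close> contains the promise for it and \<open>nu\<close>. That condition is countable,
  so \<open>a\<close> has an element that is new over it, at which the promise is kept.\<close>

lemma establishes_N:
  assumes a: "N.sub a (j o2)" "N.cov a (j o1)" and b: "N.sub b (j o2)" "N.cov (j om) b" "b ~= N.emp"
      "!!x. E x b ==> EX y. E y b & E x y" and ab: "!!x y. E x a ==> E y b ==> E x y" and nu: "nu eps o1"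
  shows "EX al be. E (j al) a & E (j be) b & gg al be nu"
proof -
  obtain b' where b': "b = j b'" "sub b' o2" "cov om b'" using countable_subset[OF b(2,1)] by blast
  have nl: "nl b'" unfolding nl_def
  proof (intro conjI allI impI)
    show "b' ~= emp" using b(3) b'(1) j_emp by blast
    fix x assume "x eps b'"
    then obtain y where "E y b" "E (j x) y" using b(4)[of "j x"] b'(1) by auto
    then show "EX y. y eps b' & x eps y" using j_down[of y b'] b'(1) by auto
  qed
  obtain p0 where p0: "p0 \<in> G" "sub b' (pa p0)" using G_points[OF b'(3,2)] by blast
  have "EX s. s \<in> G & opair b' nu eps pB s"
  proof (rule G_below[OF p0(1)])
    fix q assume q: "leq q p0"
    have "sub b' (pa q)" using p0(2) leq_a[OF q] unfolding sub_def by blast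
    then show "EX s. leq s q & opair b' nu eps pB s" using add_promise[OF leq_Q(1)[OF q] nl _ nu] by blast
  qed simp
  then obtain p where p: "p \<in> G" "opair b' nu eps pB p" by blast
  have bp: "x eps pa p" if "x eps b'" for x using Q_B[OF G_P[OF p(1)] p(2)] that by (auto simp: sub_def)
  have "EX x. E x a & ~ E x (j (pa p))"
  proof (rule ccontr)
    assume "~ (EX x. E x a & ~ E x (j (pa p)))"
    then have s: "N.sub a (j (pa p))" unfolding N.sub_def by blast
    have "N.cov (j om) (j (pa p))" by (rule j_cov[OF Q_cov[OF G_P[OF p(1)]]])
    then have "N.cov (j om) (j o1)" using N.cov_sub[OF _ s] N.cov_trans a(2) by blast
    then show False using not_cov_o1 by blast
  qed
  then obtain al where al: "E (j al) a" "al eps o2" "~ al eps pa p" using a(1) j_down[of _ o2] unfolding N.sub_def by force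
  obtain q where q: "q \<in> G" "leq q p" "al eps pa q" using G_point[OF p(1) al(2)] by blast
  have l: "al eps be" if "be eps b'" for be using ab[OF al(1), of "j be"] that b'(1) by simp
  obtain be where be: "be eps b'" "cl q al be = nu" using leq_promise[OF q(2,3) al(3) p(2) l] by blast
  have "gg al be nu" unfolding gg_def using q l[OF be(1)] be leq_a[OF q(2) bp[OF be(1)]] by blast
  then show ?thesis using al(1) be(1) b'(1) by auto
qed

lemma no_rainbow_N:
  assumes R: "N.sub R (j o2)" "~ N.cov (j om) R" and d: "N.sub d R" "N.cov (j om) d" "d ~= N.emp"
      "!!x. E x d ==> EX y. E y d & E x y" "!!x y. E x d ==> E y R ==> E y d | E x y"
  shows "EX al be al' be' nu. E (j al) R & E (j be) R & E (j al') R & E (j be') R & gg al be nu & gg al' be' nu & ~ (al = al' & be = be')"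
proof (rule ccontr)
  assume "~ ?thesis"
  then have inj: "al = al' & be = be'" if "gg al be nu" "gg al' be' nu" "E (j al) R" "E (j be) R" "E (j al') R" "E (j be') R" for al be al' be' nu
    using that by blast
  have "N.sub d (j o2)" using d(1) R(1) unfolding N.sub_def by blast
  then obtain d' where d': "d = j d'" "sub d' o2" "cov om d'" using countable_subset[OF d(2)] by blast
  have nl: "nl d'" unfolding nl_def
  proof (intro conjI allI impI)
    show "d' ~= emp" using d(3) d'(1) j_emp by blast
    fix x assume "x eps d'"
    then obtain y where "E y d" "E (j x) y" using d(4)[of "j x"] d'(1) by auto
    then show "EX y. y eps d' & x eps y" using j_down[of y d'] d'(1) by auto
  qed
  obtain d0 where d0: "d0 eps d'" using nl ex_mem_iff unfolding nl_def by blast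
  then obtain d1 where d1: "d1 eps d'" "d0 eps d1" using nl unfolding nl_def by blast
  have dR: "E (j x) R" if "x eps d'" for x using d(1) d'(1) that unfolding N.sub_def by simp
  obtain p where p: "p \<in> G" "sub d' (pa p)" using G_points[OF d'(3,2)] by blast
  \<comment> \<open>Injectivity of the colours on \<open>R\<close> excludes a repetition on
    \<open>d'\<close>, so each further point of \<open>R\<close> copies an old point and in
    particular shares its colour at \<open>d0\<close>.\<close>
  have key: "EX et nu. et eps pa p & gg d0 be nu & gg d0 et nu" if be: "E (j be) R" "~ be eps pa p" for be
  proof -
    have "~ E (j be) d" using be(2) p(2) d'(1) by (auto simp: sub_def)
    then have lt: "x eps be" if "x eps d'" for x using d(5)[of "j x" "j be"] be(1) that d'(1) by auto
    have "be eps o2" using R(1) be(1) unfolding N.sub_def by auto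
    then obtain q where q: "q \<in> G" "leq q p" "be eps pa q" using G_point[OF p(1)] by blast
    have dq: "x eps pa q" if "x eps d'" for x using leq_a[OF q(2)] p(2) that by (auto simp: sub_def)
    have gq: "gg x y (cl q x y)" if "x eps d'" "x eps y" "y eps pa q" for x y unfolding gg_def using dq that q(1) by blast
    have "sub d' be" unfolding sub_def using lt by blast
    from leq_shadow[OF q(2,3) be(2) nl p(2) this]
    consider al al' where "al eps d'" "al' eps d'" "al ~= al'" "cl q al be = cl q al' be"
      | et where "et eps pa p" "sub d' et" "!!al. al eps d' ==> cl q al be = cl q al et" unfolding shadow_def by blast
    then show ?thesis
    proof cases
      case 1
      then have "gg al be (cl q al be)" "gg al' be (cl q al be)" using gq[OF _ lt q(3)] by metis+
      then show ?thesis using inj[of al be _ al' be] dR 1 be(1) by blast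
    next
      case 2
      have "gg d0 be (cl q d0 be)" using gq[OF d0 lt[OF d0] q(3)] .
      moreover have "gg d0 et (cl q d0 et)" using gq[OF d0 _ leq_a[OF q(2) 2(1)]] 2(2) d0 unfolding sub_def by blast
      ultimately show ?thesis using 2(1) 2(3)[OF d0] by metis
    qed
  qed
  \<comment> \<open>A further point is recovered from the old point that it copies, as the only
    element of \<open>R\<close> with that colour at \<open>d0\<close>. Pairs with second entry
    \<open>d0\<close> code these points, pairs with \<open>d1\<close> the old ones; so
    \<open>R\<close> would be countable.\<close>
  let ?W = "%et. N.sep R (%be. EX nu. E (N.opair N.emp (N.opair (j d0) (N.opair be nu))) (h dot) & E (N.opair N.emp (N.opair (j d0) (N.opair et nu))) (h dot))"
  let ?F = "%z. if N.sn z = j d0 then N.Union (?W (N.fs z)) else N.fs z"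
  have dot: "E (N.opair N.emp (N.opair (j al) (N.opair (j be) v))) (h dot) <-> (EX nu. v = j nu & gg al be nu)" for al be v
  proof -
    have "E (N.opair N.emp (N.opair (j al) (N.opair (j be) v))) (h dot) <->
      (EX p al' be'. p \<in> G & al' eps be' & al' eps pa p & be' eps pa p & al = al' & be = be' & v = j (cl p al' be'))"
      unfolding E_dot by simp
    then show ?thesis unfolding gg_def by blast
  qed
  have "N.cov (N.prod (j (pa p)) (j (pa p))) R"
  proof (rule N.cov_img[of ?F])
    show "N.T (%e. ?F (e 0))" by (simp add: dft_rens)
    fix x assume x: "E x R"
    then obtain be where be: "x = j be" "be eps o2" using R(1) j_down[of x o2] unfolding N.sub_def by auto
    have dp: "d0 eps pa p" "d1 eps pa p" using p(2) d0 d1 by (auto simp: sub_def)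
    show "EX z. E z (N.prod (j (pa p)) (j (pa p))) & ?F z = x"
    proof (cases "be eps pa p")
      case True
      have "d1 ~= d0" using d1(2) by auto
      then show ?thesis using True dp(2) be(1) by (intro exI[of _ "N.opair (j be) (j d1)"]) simp
    next
      case False
      then obtain et nu where et: "et eps pa p" "gg d0 be nu" "gg d0 et nu" using key x be(1) by blast
      have W: "E y (?W (j et)) <-> E y R & (EX nu. E (N.opair N.emp (N.opair (j d0) (N.opair y nu))) (h dot) & E (N.opair N.emp (N.opair (j d0) (N.opair (j et) nu))) (h dot))" for y
        by (rule N.mem_sep) (simp add: dft_rens)
      have "?W (j et) = N.sng x"
      proof (rule N.ext, unfold W, rule iffI)
        fix y assume y: "E y R & (EX nu. E (N.opair N.emp (N.opair (j d0) (N.opair y nu))) (h dot) & E (N.opair N.emp (N.opair (j d0) (N.opair (j et) nu))) (h dot))"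
        then obtain be' where be': "y = j be'" using R(1) j_down[of y o2] unfolding N.sub_def by auto
        then obtain nu' where "gg d0 be' nu'" "gg d0 et nu'" using y unfolding be' dot by auto
        then have "gg d0 be' nu" using gg_fun[OF et(3)] by blast
        then have "be' = be" using inj[OF _ et(2)] dR[OF d0] x y unfolding be' be(1) by blast
        then show "E y (N.sng x)" using be' be(1) by simp
      next
        fix y assume "E y (N.sng x)"
        then have "y = j be" using be(1) by simp
        then show "E y R & (EX nu. E (N.opair N.emp (N.opair (j d0) (N.opair y nu))) (h dot) & E (N.opair N.emp (N.opair (j d0) (N.opair (j et) nu))) (h dot))"
          using x be(1) et unfolding dot by (simp only: dot) blast
      qed
      moreover have "N.Union (N.sng x) = x" by (rule N.ext) simp
      ultimately show ?thesis using dp(1) et(1) by (intro exI[of _ "N.opair (j et) (j d0)"]) simp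
    qed
  qed
  moreover have "N.cov (j om) (j (prod (pa p) (pa p)))"
    by (rule j_cov[OF cov_prod[OF icard_om Q_cov[OF G_P[OF p(1)]] Q_cov[OF G_P[OF p(1)]]]])
  ultimately show False using N.cov_trans R(2) by (metis j_prod)
qed

end

section \<open>The inner model of the colouring\<close>

text \<open>The interface between forcing and the formal sentences: the colouring is read off
  \<open>A\<close> under the tag 0, and coverings take the place of cardinalities and order
  types.\<close>

locale coloured = zfL +
  fixes C
  defines "C al be nu \<equiv> opair emp (opair al (opair be nu)) eps A"
  assumes gch_all: "icard k ==> cov (hart k) (Pow k)"
    and C_total: "al eps be ==> be eps hart (hart om) ==> EX nu. C al be nu"
    and C_fun: "C al be nu ==> C al be nu' ==> nu = nu'"
    and C_range: "C al be nu ==> al eps be & be eps hart (hart om) & nu eps hart om"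
    and C_establishes: "sub a (hart (hart om)) ==> cov a (hart om) ==> sub b (hart (hart om)) ==> cov om b ==> b ~= emp
      ==> (!!x. x eps b ==> EX y. y eps b & x eps y) ==> (!!x y. x eps a ==> y eps b ==> x eps y) ==> nu eps hart om
      ==> EX al be. al eps a & be eps b & C al be nu"
    and C_no_rainbow: "sub R (hart (hart om)) ==> ~ cov om R ==>
      EX al be al' be' nu. al eps R & be eps R & al' eps R & be' eps R & C al be nu & C al' be' nu & ~ (al = al' & be = be')"

lemma (in zfL) hart_eqI: "Ord l ==> ~ cov k l ==> (!!a. a eps l ==> cov k a) ==> hart k = l"
  using Ord_linear[OF Ord_hart[of k], of l] cov_hart[of l k] not_cov_hart[of k] by blast

context cext
begin

definition AN where "AN = N.un (h dot) (j A0)"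

lemma mem_AN: "E z AN <-> (EX al be nu. gg al be nu & z = j (opair emp (opair al (opair be nu)))) | (EX u. u eps A0 & z = j u)"
proof -
  have "E z (h dot) <-> (EX al be nu. gg al be nu & z = j (opair emp (opair al (opair be nu))))"
    unfolding E_dot gg_def by blast
  moreover have "E z (j A0) <-> (EX u. u eps A0 & z = j u)" using j_down j_mem by blast
  ultimately show ?thesis unfolding AN_def N.mem_un by blast
qed

lemma AN_j: "E (j (opair t (opair a (opair n x)))) AN <-> t = emp & gg a n x | opair t (opair a (opair n x)) eps A0"
  unfolding mem_AN j_eq by auto

lemma AN_colour: "E (N.opair N.emp (N.opair u (N.opair v w))) AN <-> (EX al be nu. gg al be nu & u = j al & v = j be & w = j nu)"
proof -
  have "False" if z: "z eps A0" "N.opair N.emp (N.opair u (N.opair v w)) = j z" for z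
  proof -
    have "z eps quad o2" using z(1) unfolding A0_def by (simp add: mem_sep)
    then obtain t a n x where q: "z = opair t (opair a (opair n x))" using mem_quad by blast
    then have "j t = j emp" using z(2) by simp
    then show False using z(1) A0_tag unfolding q j_eq by blast
  qed
  then show ?thesis unfolding mem_AN by auto
qed

lemma j_quad: "j (quad m) = N.quad (j m)" by (simp add: quad_def N.quad_def)

lemma AN_sub: "N.sub AN (N.quad (j o2))"
  unfolding N.sub_def
proof (intro allI impI)
  fix z assume "E z AN"
  then show "E z (N.quad (j o2))" unfolding mem_AN j_quad[symmetric]
  proof (elim disjE exE conjE)
    fix al be nu assume "gg al be nu" "z = j (opair emp (opair al (opair be nu)))"
    then show "E z (j (quad o2))" using gg_props nn_o2[of 0] o1_sub_o2 by (simp only: j_mem quad_mem nn.simps)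
  next
    fix u assume "u eps A0" "z = j u"
    then show "E z (j (quad o2))" unfolding A0_def by (simp add: mem_sep)
  qed
qed

end

locale kext = cext +
  fixes i :: "'c => 'b"
  assumes i: "bij_betw i UNIV {x. N.cst AN x}"
begin

definition KE where "KE x y <-> E (i x) (i y)"

lemma KE: "KE = (%x y. E (i x) (i y))" by (intro HOL.ext) (simp add: KE_def)

text \<open>\<open>AN\<close> is its own intersection with the constructible set of quadruples below
  \<open>o2\<close>, an instance of the operation 9.\<close>

lemma AN_cst: "N.cst AN AN"
proof -
  have "N.cst AN (j o2)" by (rule N.cst_Ord) (simp add: Ord_o2)
  then have "N.cst AN (N.quad (j o2))" unfolding N.quad_def by (intro N.cst_ops(3))
  then have "N.cst AN (N.inter (N.quad (j o2)) AN)" by (intro N.cst_ops(9)) 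
  moreover have "N.inter (N.quad (j o2)) AN = AN" by (rule N.ext) (use AN_sub in \<open>auto simp: N.sub_def\<close>)
  ultimately show ?thesis by simp
qed

definition a0 where "a0 = (SOME x. i x = AN)"
definition k1 where "k1 = (SOME x. i x = j o1)"
definition k2 where "k2 = (SOME x. i x = j o2)"

lemma i_some: "N.cst AN y ==> i (SOME x. i x = y) = y"
proof -
  assume "N.cst AN y"
  then have "EX x. i x = y" using N.cst_iff_range[OF i] by metis
  then show ?thesis by (rule someI_ex)
qed

lemma i_a0 [simp]: "i a0 = AN" unfolding a0_def by (rule i_some[OF AN_cst])
lemma i_k1 [simp]: "i k1 = j o1" unfolding k1_def by (intro i_some N.cst_Ord) (simp add: Ord_o1)
lemma i_k2 [simp]: "i k2 = j o2" unfolding k2_def by (intro i_some N.cst_Ord) (simp add: Ord_o2)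

sublocale K: zfL KE a0
proof (intro zfL.intro zfL_axioms.intro)
  show "zf KE" unfolding KE by (rule N.zf_cst[OF i])
  show "EX l. zf.Ord KE l & zf.Phi KE a0 l = x" for x unfolding KE by (rule N.constructible_in_cst[OF i i_a0])
qed

sublocale I: inner KE E i unfolding KE by (rule N.inner_cst[OF i])

lemma i_om: "i K.om = j om" using I.j_om j_om by simp

lemma KE_dn: "KE x y ==> i y = j y' ==> EX x'. x' eps y' & i x = j x'"
proof -
  assume a: "KE x y" "i y = j y'"
  then have "E (i x) (j y')" by (simp add: KE_def)
  then show ?thesis using j_down[of "i x" y'] by auto
qed

lemma KE_up: "x' eps y' ==> i y = j y' ==> EX x. KE x y & i x = j x'"
proof -
  assume a: "x' eps y'" "i y = j y'"
  then have e: "E (j x') (i y)" by simp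
  then obtain x where x: "j x' = i x" using I.j_down by blast
  from e have "KE x y" unfolding KE_def x .
  then show ?thesis using x[symmetric] by blast
qed

lemma j_nn: "j (nn k) = N.nn k" by (induction k) simp_all

lemma K_AN: "i t = j t' ==> i a = j a' ==> i n = j n' ==> i x = j x' ==>
    KE (K.opair t (K.opair a (K.opair n x))) a0 <-> t' = emp & gg a' n' x' | opair t' (opair a' (opair n' x')) eps A0"
  unfolding AN_j[symmetric] KE_def by simp

lemma K_AN_dn: "KE (K.opair t (K.opair a (K.opair n x))) a0 ==> i a = j a' ==> i n = j n' ==> EX x'. i x = j x'"
proof -
  assume a: "KE (K.opair t (K.opair a (K.opair n x))) a0" "i a = j a'" "i n = j n'"
  then have "E (N.opair (i t) (N.opair (j a') (N.opair (j n') (i x)))) AN" unfolding KE_def by simp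
  then obtain u where u: "N.opair (i t) (N.opair (j a') (N.opair (j n') (i x))) = j u" unfolding mem_AN by blast
  then show ?thesis using j_opair_down by metis
qed

text \<open>The inner model may lack the surjections of the ground model, but it can decode them
  from its predicate; the class term is again the union of a unique value.\<close>

lemma K_cov:
  assumes t: "t = 1 | t = 2" and l: "i l = j l'" and a: "i a = j a'"
    and s: "!!x. x eps a' ==> EX n. n eps l' & opair (nn t) (opair a' (opair n x)) eps A0"
  shows "K.cov l a"
proof (rule K.cov_img[of "%n. K.Coll (%w. EX x. KE (K.opair (K.nn t) (K.opair a (K.opair n x))) a0 & KE w x)"])
  show "K.T (%e. K.Coll (%w. EX x. KE (K.opair (K.nn t) (K.opair a (K.opair (e 0) x))) a0 & KE w x))" by (simp add: dft_rens)
  have it: "i (K.nn t) = j (nn t)" using I.j_nn j_nn by simp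
  fix x assume x: "KE x a"
  obtain x' where x': "x' eps a'" "i x = j x'" using KE_dn[OF x a] by blast
  obtain n' where n': "n' eps l'" "opair (nn t) (opair a' (opair n' x')) eps A0" using s[OF x'(1)] by blast
  obtain n where n: "KE n l" "i n = j n'" using KE_up[OF n'(1) l] by blast
  have 1: "KE (K.opair (K.nn t) (K.opair a (K.opair n x))) a0" using K_AN[OF it a n(2) x'(2)] n'(2) by simp
  have 2: "y = x" if y: "KE (K.opair (K.nn t) (K.opair a (K.opair n y))) a0" for y
  proof -
    obtain y' where y': "i y = j y'" using K_AN_dn[OF y a n(2)] by blast
    have "nn t ~= emp" using nn_eq[of t 0] t by auto
    then have "opair (nn t) (opair a' (opair n' y')) eps A0" using K_AN[OF it a n(2) y'] y by simp
    then have "y' = x'" using A0_fun[OF _ _ n'(2)] t by blast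
    then have "i y = i x" using x' y' by simp
    then show ?thesis by (simp only: I.j_eq)
  qed
  have "K.Coll (%w. EX y. KE (K.opair (K.nn t) (K.opair a (K.opair n y))) a0 & KE w y) = K.Coll (%w. KE w x)"
    using 1 2 by (intro K.Coll_cong) blast
  then show "EX n. KE n l & K.Coll (%w. EX y. KE (K.opair (K.nn t) (K.opair a (K.opair n y))) a0 & KE w y) = x"
    using n(1) by (intro exI[of _ n]) simp
qed

text \<open>A covering of \<open>k1\<close> by \<omega> in the inner model would persist in the
  extension; conversely the tag 1 keeps every smaller ordinal countable. The tag 2 does the same for
  \<open>hart_o1\<close>.\<close>

lemma hart_om: "K.hart K.om = k1"
proof (rule K.hart_eqI)
  have "N.Ord (i k1)" by (simp add: Ord_o1)
  then show "K.Ord k1" by (simp only: I.j_Ord)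
  show "~ K.cov K.om k1" using I.j_cov[of K.om k1] not_cov_o1 unfolding i_om i_k1 by blast
  fix a assume "KE a k1"
  then obtain a' where a': "a' eps o1" "i a = j a'" using KE_dn[OF _ i_k1] by blast
  show "K.cov K.om a" using K_cov[of 1, OF _ i_om a'(2)] A0_1[OF a'(1)] by simp
qed

lemma hart_o1: "K.hart k1 = k2"
proof (rule K.hart_eqI)
  have "N.Ord (i k2)" by (simp add: Ord_o2)
  then show "K.Ord k2" by (simp only: I.j_Ord)
  show "~ K.cov k1 k2" using I.j_cov[of k1 k2] not_cov_o2 unfolding i_k1 i_k2 by blast
  fix a assume "KE a k2"
  then obtain a' where a': "a' eps o2" "i a = j a'" using KE_dn[OF _ i_k2] by blast
  show "K.cov k1 a" using K_cov[of 2, OF _ i_k1 a'(2)] A0_2[OF a'(1)] by simp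
qed

text \<open>Every subset of \<omega> in the inner model belongs to the extension, hence to the
  ground model, and is listed in the predicate under the tag 3.\<close>

lemma CH_K: "K.cov k1 (K.Pow K.om)"
proof (rule K.cov_img[of "%l. K.sep K.om (%x. KE (K.opair (K.nn 3) (K.opair l (K.opair K.emp x))) a0)"])
  show "K.T (%e. K.sep K.om (%x. KE (K.opair (K.nn 3) (K.opair (e 0) (K.opair K.emp x))) a0))"
    by (simp add: dft_rens del: K.nn.simps)
  fix s assume "KE s (K.Pow K.om)"
  then have s: "K.sub s K.om" by simp
  then have "N.sub (i s) (i K.om)" by (simp only: I.j_sub)
  then have "E (i s) (N.Pow (j om))" unfolding i_om N.mem_Pow .
  then have "E (i s) (j (Pow om))" using Pow_om unfolding N.sub_def by blast
  then obtain s' where s': "i s = j s'" "sub s' om" using j_down[of "i s" "Pow om"] by auto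
  obtain l' where l': "l' eps o1" "!!x. opair (nn 3) (opair l' (opair emp x)) eps A0 <-> x eps s'" using A0_3[OF s'(2)] by blast
  obtain l where l: "KE l k1" "i l = j l'" using KE_up[OF l'(1) i_k1] by blast
  have it: "i (K.nn 3) = j (nn 3)" using I.j_nn j_nn by simp
  have ie: "i K.emp = j emp" by simp
  have ne: "nn 3 ~= emp" using nn_eq[of 3 0] by simp
  have "K.sep K.om (%x. KE (K.opair (K.nn 3) (K.opair l (K.opair K.emp x))) a0) = s"
  proof (rule K.ext)
    fix x
    have "KE x (K.sep K.om (%x. KE (K.opair (K.nn 3) (K.opair l (K.opair K.emp x))) a0)) <->
      KE x K.om & KE (K.opair (K.nn 3) (K.opair l (K.opair K.emp x))) a0" by (rule K.mem_sep) (simp del: K.nn.simps)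
    moreover have "KE (K.opair (K.nn 3) (K.opair l (K.opair K.emp x))) a0 <-> KE x s" if x: "KE x K.om"
    proof -
      obtain x' where x': "i x = j x'" using KE_dn[OF x i_om] by blast
      have "KE x s <-> E (j x') (j s')" unfolding KE_def x' s'(1) ..
      then show ?thesis using K_AN[OF it l(2) ie x'] l'(2) ne by simp
    qed
    moreover have "KE x K.om" if "KE x s" using s that unfolding K.sub_def by blast
    ultimately show "KE x (K.sep K.om (%x. KE (K.opair (K.nn 3) (K.opair l (K.opair K.emp x))) a0)) <-> KE x s" by blast
  qed
  then show "EX l. KE l k1 & K.sep K.om (%x. KE (K.opair (K.nn 3) (K.opair l (K.opair K.emp x))) a0) = s" using l(1) by blast
qed

text \<open>Condensation applies from \<open>k1\<close> onwards, because the predicate lives on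
  ordinals below \<open>k2\<close> and these have size at most \<open>k1\<close>; \<omega> is left
  to \<open>CH_K\<close>.\<close>

lemma gch_K:
  assumes k: "K.icard k"
  shows "K.cov (K.hart k) (K.Pow k)"
proof (cases "k = K.om")
  case True
  then show ?thesis using CH_K hart_om by simp
next
  case False
  have ok: "K.Ord k" "K.sub K.om k" "!!a. KE a k ==> ~ K.cov a k" using k unfolding K.icard_def by blast+
  then have "KE K.om k" using K.Ord_sub_iff[OF K.Ord_om ok(1)] False by blast
  then have "~ KE k k1" using K.mem_hart[OF ok(1), of K.om] ok(3) unfolding hart_om by blast
  then have s: "K.sub k1 k" using K.Ord_not_mem[OF ok(1)] K.Ord_hart[of K.om] unfolding hart_om by blast
  show ?thesis
  proof (rule K.gch[OF k, of k2])
    have "i (K.quad k2) = N.quad (j o2)" by (simp add: K.quad_def N.quad_def)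
    then have "N.sub (i a0) (i (K.quad k2))" using AN_sub by simp
    then show "K.sub a0 (K.quad k2)" by (simp only: I.j_sub)
    show "K.Ord k2" using K.Ord_hart[of k1] unfolding hart_o1 .
    fix b assume "KE b k2"
    then have "K.cov k1 b" using K.cov_hart[of b k1] unfolding hart_o1 by blast
    then show "K.cov k b" using K.cov_mono s by blast
  qed
qed

abbreviation CK where "CK al be nu \<equiv> KE (K.opair K.emp (K.opair al (K.opair be nu))) a0"

lemma CK: "CK u v w <-> (EX al be nu. gg al be nu & i u = j al & i v = j be & i w = j nu)"
  unfolding AN_colour[symmetric] KE_def by simp

lemma CKI: "gg al be nu ==> i u = j al ==> i v = j be ==> EX w. CK u v w & i w = j nu"
proof -
  assume a: "gg al be nu" "i u = j al" "i v = j be"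
  obtain w where "i w = j nu" using KE_up[OF gg_props(4)[OF a(1)] i_k1] by blast
  then show ?thesis unfolding CK using a by blast
qed

text \<open>Subsets and coverings of the inner model persist in the extension, so the two properties
  descend. Uncountability by itself need not persist; \<open>uncountable_ordinals\<close> first
  turns it into a covering of \<open>k1\<close>.\<close>

lemma coloured_K: "coloured KE a0"
proof (intro coloured.intro coloured_axioms.intro, unfold hart_om hart_o1)
  show "zfL KE a0" by (rule K.zfL_axioms)
  show "K.cov (K.hart k) (K.Pow k)" if "K.icard k" for k by (rule gch_K[OF that])
  show "EX w. CK u v w" if uv: "KE u v" "KE v k2" for u v
  proof -
    obtain v' where v': "v' eps o2" "i v = j v'" using KE_dn[OF uv(2) i_k2] by blast
    obtain u' where u': "u' eps v'" "i u = j u'" using KE_dn[OF uv(1) v'(2)] by blast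
    obtain nu where "gg u' v' nu" using gg_total[OF u'(1) v'(1)] by blast
    then show ?thesis using CKI u' v' by blast
  qed
  show "w = w'" if w: "CK u v w" "CK u v w'" for u v w w'
  proof -
    obtain al be nu al' be' nu' where g: "gg al be nu" "i u = j al" "i v = j be" "i w = j nu"
      "gg al' be' nu'" "i u = j al'" "i v = j be'" "i w' = j nu'" using w unfolding CK by blast
    then have "al' = al" "be' = be" by (metis j_eq)+
    then have "nu = nu'" using gg_fun g by blast
    then have "i w = i w'" using g by simp
    then show ?thesis by (simp only: I.j_eq)
  qed
  show "KE u v & KE v k2 & KE w k1" if w: "CK u v w" for u v w
  proof -
    obtain al be nu where g: "gg al be nu" "i u = j al" "i v = j be" "i w = j nu" using w unfolding CK by blast
    then show ?thesis unfolding KE_def using gg_props[OF g(1)] by simp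
  qed
  fix a b w
  assume ab: "K.sub a k2" "K.cov a k1" "K.sub b k2" "K.cov K.om b" "b ~= K.emp"
    "!!x. KE x b ==> EX y. KE y b & KE x y" "!!x y. KE x a ==> KE y b ==> KE x y" and w: "KE w k1"
  obtain nu where nu: "nu eps o1" "i w = j nu" using KE_dn[OF w i_k1] by blast
  have 1: "N.sub (i a) (j o2)" "N.sub (i b) (j o2)" "N.cov (i a) (j o1)" "N.cov (j om) (i b)"
    using ab(1,3) I.j_sub[of _ k2] I.j_cov[OF ab(2)] I.j_cov[OF ab(4)] unfolding i_k1 i_k2 i_om by blast+
  have "i b ~= N.emp" using ab(5) I.j_emp I.j_eq by metis
  moreover have "EX y. E y (i b) & E x y" if x: "E x (i b)" for x
  proof -
    obtain x' where x': "x = i x'" using I.j_down x by blast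
    then obtain y where "KE y b" "KE x' y" using ab(6)[of x'] x unfolding KE_def by blast
    then show ?thesis unfolding x' KE_def by blast
  qed
  moreover have "E x y" if xy: "E x (i a)" "E y (i b)" for x y
  proof -
    obtain x' y' where x': "x = i x'" "y = i y'" using I.j_down xy by metis
    then show ?thesis using ab(7)[of x' y'] xy unfolding KE_def by blast
  qed
  ultimately obtain al be where g: "E (j al) (i a)" "E (j be) (i b)" "gg al be nu"
    using establishes_N[OF 1(1,3,2,4) _ _ _ nu(1)] by blast
  obtain u where u: "j al = i u" using I.j_down[OF g(1)] by blast
  obtain v where v: "j be = i v" using I.j_down[OF g(2)] by blast
  have "CK u v w" unfolding CK using g(3) u[symmetric] v[symmetric] nu(2) by blast
  moreover have "KE u a" "KE v b" using g(1,2) unfolding u v KE_def .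
  ultimately show "EX u v. KE u a & KE v b & CK u v w" by blast
next
  fix R assume R: "K.sub R k2" "~ K.cov K.om R"
  have RO: "K.Ord x" if "KE x R" for x
    using that R(1) K.Ord_in[OF K.Ord_hart[of k1]] unfolding hart_o1 K.sub_def by blast
  have c: "K.cov R k1" using K.uncountable_ordinals(1)[OF RO R(2)] unfolding hart_om .
  obtain d where d: "K.sub d R" "K.cov K.om d" "d ~= K.emp" "!!x. KE x d ==> EX y. KE y d & KE x y"
    "!!x y. KE x d ==> KE y R ==> KE y d | KE x y" using K.uncountable_ordinals(2)[OF RO R(2)] by blast
  have 1: "N.sub (i R) (j o2)" "N.sub (i d) (i R)" "N.cov (i R) (j o1)" "N.cov (j om) (i d)"
    using R(1) d(1) I.j_sub[of _ k2] I.j_sub[of d R] I.j_cov[OF c] I.j_cov[OF d(2)] unfolding i_k1 i_k2 i_om by blast+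
  have 2: "~ N.cov (j om) (i R)" using N.cov_trans[OF _ 1(3)] not_cov_o1 by blast
  have 3: "i d ~= N.emp" using d(3) I.j_emp I.j_eq by metis
  have 4: "EX y. E y (i d) & E x y" if x: "E x (i d)" for x
  proof -
    obtain x' where x': "x = i x'" using I.j_down x by blast
    then obtain y where "KE y d" "KE x' y" using d(4)[of x'] x unfolding KE_def by blast
    then show ?thesis unfolding x' KE_def by blast
  qed
  have 5: "E y (i d) | E x y" if xy: "E x (i d)" "E y (i R)" for x y
  proof -
    obtain x' y' where x': "x = i x'" "y = i y'" using I.j_down xy by metis
    then show ?thesis using d(5)[of x' y'] xy unfolding KE_def by blast
  qed
  obtain al be al' be' nu where g: "E (j al) (i R)" "E (j be) (i R)" "E (j al') (i R)" "E (j be') (i R)"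
    "gg al be nu" "gg al' be' nu" "~ (al = al' & be = be')"
    using no_rainbow_N[OF 1(1) 2 1(2,4) 3 4 5] by blast
  have up: "EX u. i u = j \<gamma> & KE u R" if e: "E (j \<gamma>) (i R)" for \<gamma>
  proof -
    obtain u where "j \<gamma> = i u" using I.j_down e by blast
    then show ?thesis using e unfolding KE_def by metis
  qed
  obtain u where u: "i u = j al" "KE u R" using up[OF g(1)] by blast
  obtain v where v: "i v = j be" "KE v R" using up[OF g(2)] by blast
  obtain u' where u': "i u' = j al'" "KE u' R" using up[OF g(3)] by blast
  obtain v' where v': "i v' = j be'" "KE v' R" using up[OF g(4)] by blast
  obtain w where w: "CK u v w" "i w = j nu" using CKI[OF g(5) u(1) v(1)] by blast
  have w': "CK u' v' w" unfolding CK using g(6) u' v' w(2) by blast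
  have "~ (u = u' & v = v')" using g(7) u(1) v(1) u'(1) v'(1) by (metis j_eq)
  then show "EX u v u' v' w. KE u R & KE v R & KE u' R & KE v' R & CK u v w & CK u' v' w & ~ (u = u' & v = v')"
    using u v u' v' w(1) w' by blast
qed

end

section \<open>Evaluation of the sentences\<close>

definition val :: "nat => (nat => 'a) => var => 'a" where "val n e x = e (n - Suc x)"

lemma val_new [simp]: "val (Suc n) (case_nat a e) n = a"
  by (simp add: val_def)

lemma val_old [simp]: "x < n ==> val (Suc n) (case_nat a e) x = val n e x"
  by (auto simp: val_def dest!: less_imp_Suc_add)

context
  fixes U :: "'a set" and E :: "'a => 'a => bool"
begin

lemma sat_forms [simp]:
  "sat_on U E e ((x \<^bold>\<in> y) n) <-> E (val n e x) (val n e y)"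
  "sat_on U E e ((x \<^bold>= y) n) <-> val n e x = val n e y"
  "sat_on U E e ((P \<^bold>\<longrightarrow> Q) n) <-> (sat_on U E e (P n) --> sat_on U E e (Q n))"
  "sat_on U E e ((\<^bold>\<not> P) n) <-> ~ sat_on U E e (P n)"
  "sat_on U E e ((P \<^bold>\<and> Q) n) <-> sat_on U E e (P n) & sat_on U E e (Q n)"
  "sat_on U E e ((P \<^bold>\<or> Q) n) <-> sat_on U E e (P n) | sat_on U E e (Q n)"
  "sat_on U E e ((P \<^bold>\<longleftrightarrow> Q) n) <-> (sat_on U E e (P n) <-> sat_on U E e (Q n))"
  "sat_on U E e ((\<^bold>\<forall>x. F x) n) <-> (\<forall>a\<in>U. sat_on U E (case_nat a e) (F n (Suc n)))"
  "sat_on U E e ((\<^bold>\<exists>x. F x) n) <-> (\<exists>a\<in>U. sat_on U E (case_nat a e) (F n (Suc n)))"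
  by (auto simp: fmem_def feq_def fimp_def fnot_def fconj_def fdisj_def fiff_def fall_def fex_def val_def)

lemma sat_app:
  assumes "closed_below (length vs + k) p" "!!i. i < k ==> val n e i = c i"
  shows "sat_on U E e (app p vs n) = sat_on U E (%i. if i < length vs then val n e (vs ! i) else c (i - length vs)) p"
  unfolding app_def sat_on_ren
proof (rule sat_on_closed_below[OF assms(1)])
  fix i assume "i < length vs + k"
  then show "(e \<circ> (%i. n - Suc (if i < length vs then vs ! i else i - length vs))) i =
      (if i < length vs then val n e (vs ! i) else c (i - length vs))"
    using assms(2)[of "i - length vs"] by (cases "i < length vs") (simp_all add: val_def)
qed

lemma sat_univ_closure:
  assumes "!!e. sat_on U E e (F k)"
  shows "sat_on U E e (univ_closure k F)"
proof -
  have "sat_on U E e ((All ^^ l) (F k))" for l e by (induction l arbitrary: e) (simp_all add: assms)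
  then show ?thesis unfolding univ_closure_def .
qed

lemma sat_univ_closureD:
  assumes "sat_on U E e (univ_closure k F)" "!!i. c i \<in> U"
  shows "EX e'. (ALL i<k. val k e' i = c i) & sat_on U E e' (F k)"
proof -
  have *: "sat_on U E (%i. if i < l then d i else e (i - l)) q" if "sat_on U E e ((All ^^ l) q)" "!!i. d i \<in> U" for l q d e
    using that
  proof (induction l arbitrary: e)
    case (Suc l)
    have "sat_on U E (case_nat (d l) e) ((All ^^ l) q)" using Suc.prems by simp
    moreover have "(%i. if i < l then d i else case_nat (d l) e (i - l)) = (%i. if i < Suc l then d i else e (i - Suc l))"
      by (auto simp: fun_eq_iff less_Suc_eq split: nat.split intro!: arg_cong[of _ _ e])
    ultimately show ?case using Suc.IH[of "case_nat (d l) e"] Suc.prems(2) by simp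
  qed simp
  \<comment> \<open>Level i among k levels is the index k - Suc i, so the parameters enter in
    reverse order.\<close>
  show ?thesis
    by (rule exI, rule conjI[OF _ *[OF assms(1)[unfolded univ_closure_def], of "%i. c (k - Suc i)"]])
      (use assms(2) in \<open>auto simp: val_def\<close>)
qed

lemma sat_subset [simp]: "x < n ==> y < n ==>
    sat_on U E e (subset x y n) <-> (\<forall>z\<in>U. E z (val n e x) --> E z (val n e y))"
  and sat_empty [simp]: "x < n ==> sat_on U E e (is_empty x n) <-> (\<forall>z\<in>U. ~ E z (val n e x))"
  and sat_upair [simp]: "x < n ==> y < n ==> p < n ==>
    sat_on U E e (is_upair p x y n) <-> (\<forall>z\<in>U. E z (val n e p) <-> z = val n e x | z = val n e y)"
  and sat_succ [simp]: "x < n ==> y < n ==>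
    sat_on U E e (is_succ y x n) <-> (\<forall>z\<in>U. E z (val n e y) <-> E z (val n e x) | z = val n e x)"
  by (simp_all add: subset_def is_empty_def is_upair_def is_succ_def)

lemma sat_Pow [simp]: "x < n ==> p < n ==> sat_on U E e (is_Pow p x n) <->
    (\<forall>z\<in>U. E z (val n e p) <-> (\<forall>w\<in>U. E w z --> E w (val n e x)))"
  by (simp add: is_Pow_def)

text \<open>A finite model would have a set \<open>v\<close> of all sets, contradicting foundation for the singleton of \<open>v\<close>.\<close>

lemma infinite_model:
  assumes p: "sat_on U E e (Pairing 0)" and u: "sat_on U E e (Union_ax 0)" and f: "sat_on U E e (Foundation 0)" and ne: "U ~= {}"
  shows "infinite U"
proof
  have p: "\<exists>p\<in>U. \<forall>z\<in>U. E z p <-> z = x | z = y" if "x \<in> U" "y \<in> U" for x y using p that by (simp add: Pairing_def)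
  have u: "\<exists>u\<in>U. \<forall>z\<in>U. E z u <-> (\<exists>y\<in>U. E y x & E z y)" if "x \<in> U" for x using u that by (simp add: Union_ax_def)
  assume "finite U"
  have "\<exists>v\<in>U. \<forall>x\<in>S. E x v" if "S \<subseteq> U" for S
    using finite_subset[OF that \<open>finite U\<close>] that
  proof (induction S rule: finite_induct)
    case (insert x S)
    then obtain v where v: "v \<in> U" "\<forall>x\<in>S. E x v" by blast
    obtain s where s: "s \<in> U" "E x s" using p[of x x] insert by blast
    obtain q where q: "q \<in> U" "E v q" "E s q" using p[of v s] v s by blast
    then show ?case using u[OF q(1)] v s insert.prems by blast
  qed (use ne in blast)
  then obtain v where v: "v \<in> U" "\<forall>x\<in>U. E x v" by blast
  obtain s where s: "s \<in> U" "\<forall>z\<in>U. E z s <-> z = v" using p[OF v(1) v(1)] by auto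
  have "(\<exists>z\<in>U. E z s) --> (\<exists>y\<in>U. E y s & ~ (\<exists>z\<in>U. E z s & E z y))" using f s(1) by (simp add: Foundation_def)
  moreover have vs: "E v s" "E v v" using v s by auto
  ultimately obtain y where y: "y \<in> U" "E y s" "~ (\<exists>z\<in>U. E z s & E z y)" using v(1) by blast
  have "y = v" using s(2) y(1,2) by blast
  then show False using y(3) vs v(1) by blast
qed

end

section \<open>The axioms of ZFC as sentences\<close>

lemma zf_if_ZFC:
  assumes ZFC: "!!p. p \<in> ZFC ==> sat mem e p"
  shows "zf mem"
proof unfold_locales
  have ax: "sat mem e (Extensionality 0)" "sat mem e (Foundation 0)" "sat mem e (Pairing 0)" "sat mem e (Union_ax 0)"
    "sat mem e (Power_set 0)" "sat mem e (Infinity 0)" using ZFC by (simp_all add: ZFC_def)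
  show "x = y" if "!!z. mem z x <-> mem z y" for x y using ax(1) that by (simp add: Extensionality_def)
  show "EX y. mem y x & (ALL z. mem z x --> ~ mem z y)" if "mem y x" for x y
    using ax(2) that by (simp add: Foundation_def) blast
  show "EX p. ALL z. mem z p <-> z = x | z = y" for x y using ax(3) by (simp add: Pairing_def)
  show "EX u. ALL z. mem z u <-> (EX y. mem y x & mem z y)" for x using ax(4) by (simp add: Union_ax_def)
  show "EX p. ALL z. mem z p <-> (ALL w. mem w z --> mem w x)" for x using ax(5) by (simp add: Power_set_def)
  show "EX x. (EX e. (ALL z. ~ mem z e) & mem e x) & (ALL y. mem y x --> (EX s. (ALL z. mem z s <-> mem z y | z = y) & mem s x))"
    using ax(6) by (simp add: Infinity_def)
next
  fix P a assume "dfn mem (%e. P (e 0))"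
  then obtain p c where p: "!!e. P (e 0) = sat mem (mrg c e) p" unfolding dfn_def by blast
  \<comment> \<open>A definable class has one argument at the even places and infinitely many
    parameters at the odd ones. The argument becomes index 0; as the formula mentions finitely many
    variables, a closure over k parameters suffices.\<close>
  let ?q = "ren (%i. if even i then 0 else Suc (i div 2)) p"
  have "mrg c (%_. x) = case_nat x c \<circ> (%i. if even i then 0 else Suc (i div 2))" for x
    by (auto simp: mrg_def fun_eq_iff)
  then have P: "P x = sat mem (case_nat x c) ?q" for x using p[of "%_. x"] unfolding sat_on_ren by simp
  obtain k where "closed_below k ?q" using ex_closed_below by blast
  from closed_below_mono[OF this, of "k + 1"] have k: "closed_below (k + 1) ?q" by simp
  have "univ_closure k (Separation ?q) \<in> ZFC" unfolding ZFC_def using k by blast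
  then obtain e' where e': "!!i. i < k ==> val k e' i = c i" "sat mem e' (Separation ?q k)"
    using sat_univ_closureD[OF ZFC, of k _ c] by auto
  have A: "sat mem e (app ?q [u] n) = P (val n e u)" if "!!i. i < k ==> val n e i = c i" for e u n
  proof -
    have "sat mem e (app ?q [u] n) = sat mem (%i. if i < length [u] then val n e ([u] ! i) else c (i - length [u])) ?q"
      by (rule sat_app) (use k that in simp_all)
    also have "(%i. if i < length [u] then val n e ([u] ! i) else c (i - length [u])) = case_nat (val n e u) c"
      by (auto simp: fun_eq_iff split: nat.split)
    finally show ?thesis using P by simp
  qed
  show "EX b. ALL x. mem x b <-> mem x a & P x" using e'(2) by (simp add: Separation_def A e'(1))
next
  fix F :: "'a => 'a => bool" and a
  assume "dfn mem (%e. F (e 0) (e 1))" and fn: "!!x y z. mem x a ==> F x y ==> F x z ==> y = z"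
  then obtain p c where p: "!!e. F (e 0) (e 1) = sat mem (mrg c e) p" unfolding dfn_def by blast
  let ?f = "%i. if even i then (if i = 0 then 0 else 1) else Suc (Suc (i div 2))"
  let ?q = "ren ?f p"
  have "mrg c (%i. if i = 0 then x else y) = case_nat x (case_nat y c) \<circ> ?f" for x y
    by (auto simp: mrg_def fun_eq_iff elim!: evenE)
  then have P: "F x y = sat mem (case_nat x (case_nat y c)) ?q" for x y
    using p[of "%i. if i = 0 then x else y"] unfolding sat_on_ren by simp
  obtain k where "closed_below k ?q" using ex_closed_below by blast
  from closed_below_mono[OF this, of "k + 2"] have k: "closed_below (k + 2) ?q" by simp
  have "univ_closure k (Replacement ?q) \<in> ZFC" unfolding ZFC_def using k by blast
  then obtain e' where e': "!!i. i < k ==> val k e' i = c i" "sat mem e' (Replacement ?q k)"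
    using sat_univ_closureD[OF ZFC, of k _ c] by auto
  have A: "sat mem e (app ?q [u, v] n) = F (val n e u) (val n e v)" if "!!i. i < k ==> val n e i = c i" for e u v n
  proof -
    have "sat mem e (app ?q [u, v] n) = sat mem (%i. if i < length [u, v] then val n e ([u, v] ! i) else c (i - length [u, v])) ?q"
      by (rule sat_app) (use k that in simp_all)
    also have "(%i. if i < length [u, v] then val n e ([u, v] ! i) else c (i - length [u, v])) = case_nat (val n e u) (case_nat (val n e v) c)"
      by (auto simp: fun_eq_iff split: nat.split)
    finally show ?thesis using P by simp
  qed
  have "(ALL x. mem x a --> (ALL y z. F x y & F x z --> y = z)) --> (EX b. ALL y. mem y b <-> (EX x. mem x a & F x y))"
    using e'(2) by (simp add: Replacement_def A e'(1))
  then show "EX b. ALL y. mem y b <-> (EX x. mem x a & F x y)" using fn by blast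
qed

lemma D_sat_env: "dfn E (%e. sat E (%i. if b i then e (f i) else c i) p)"
proof -
  have "(%i. mrg c e (if b i then 2 * f i else 2 * i + 1)) = (%i. if b i then e (f i) else c i)" for e
    by (auto simp: mrg_def fun_eq_iff)
  then show ?thesis
    using dfn_params[OF dfn_sat[of E "%i. if b i then 2 * f i else 2 * i + 1" p], of c] by simp
qed

context zf
begin

lemma sat_Separation:
  assumes "closed_below (k + 1) p"
  shows "sat mem e (univ_closure k (Separation p))"
proof (rule sat_univ_closure)
  fix e :: "nat => 'a"
  define c where "c i = val k e i" for i
  define P where "P x = sat mem (%i. if i < 1 then x else c (i - 1)) p" for x
  have *: "sat mem e' (app p [u] n) = P (val n e' u)" if "!!i. i < k ==> val n e' i = c i" for e' u n
  proof -
    have "sat mem e' (app p [u] n) = sat mem (%i. if i < length [u] then val n e' ([u] ! i) else c (i - length [u])) p"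
      by (rule sat_app) (use assms that in simp_all)
    also have "(%i. if i < length [u] then val n e' ([u] ! i) else c (i - length [u])) = (%i. if i < 1 then val n e' u else c (i - 1))"
      by (auto simp: fun_eq_iff)
    finally show ?thesis unfolding P_def .
  qed
  have "D (%e. P (e 0))" unfolding P_def by (rule D_sat_env[where f = "%_. 0"])
  then have "EX b. ALL x. x eps b <-> x eps a & P x" for a by (rule sep_ax)
  then show "sat mem e (Separation p k)" by (simp add: Separation_def * c_def[symmetric])
qed

lemma sat_Replacement:
  assumes "closed_below (k + 2) p"
  shows "sat mem e (univ_closure k (Replacement p))"
proof (rule sat_univ_closure)
  fix e :: "nat => 'a"
  define c where "c i = val k e i" for i
  define F where "F x y = sat mem (%i. if i < 2 then (if i = 0 then x else y) else c (i - 2)) p" for x y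
  have *: "sat mem e' (app p [u, v] n) = F (val n e' u) (val n e' v)" if "!!i. i < k ==> val n e' i = c i" for e' u v n
  proof -
    have "sat mem e' (app p [u, v] n) = sat mem (%i. if i < length [u, v] then val n e' ([u, v] ! i) else c (i - length [u, v])) p"
      by (rule sat_app) (use assms that in simp_all)
    also have "(%i. if i < length [u, v] then val n e' ([u, v] ! i) else c (i - length [u, v])) =
      (%i. if i < 2 then (if i = 0 then val n e' u else val n e' v) else c (i - 2))"
      by (auto simp: fun_eq_iff less_Suc_eq numeral_2_eq_2)
    finally show ?thesis unfolding F_def .
  qed
  have "(%i. if i < 2 then (if i = 0 then e' 0 else e' 1) else c (i - 2)) = (%i. if i < 2 then e' i else c (i - 2))" for e' :: "nat => 'a"
    by (auto simp: fun_eq_iff less_Suc_eq numeral_2_eq_2)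
  then have D: "D (%e. F (e 0) (e 1))" unfolding F_def using D_sat_env[of mem "%i. i < 2" "%i. i" "%i. c (i - 2)" p] by simp
  have "(ALL x. x eps a --> (ALL y z. F x y & F x z --> y = z)) --> (EX b. ALL y. y eps b <-> (EX x. x eps a & F x y))" for a
    using repl_ax[OF D, of a] by blast
  then show "sat mem e (Replacement p k)" by (simp add: Replacement_def * c_def[symmetric])
qed

end

lemma (in zfL) sat_ZFC: "p \<in> ZFC ==> sat mem e p"
proof -
  have ax: "sat mem e (Extensionality 0)" "sat mem e (Foundation 0)" "sat mem e (Pairing 0)" "sat mem e (Union_ax 0)"
    "sat mem e (Power_set 0)" "sat mem e (Infinity 0)"
    using ext found pair_ax union_ax pow_ax inf_ax
    by (auto simp: Extensionality_def Foundation_def Pairing_def Union_ax_def Power_set_def Infinity_def)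
  have "sat mem e (Choice 0) <-> (ALL x. (ALL y. y eps x --> (EX z. z eps y)) &
      (ALL y z. y eps x & z eps x & y ~= z --> (ALL u. u eps y --> ~ u eps z)) -->
      (EX c. ALL y. y eps x --> (EX u. u eps y & u eps c & (ALL v. v eps y & v eps c --> v = u))))"
    by (simp add: Choice_def fex1_def)
  also have "\<dots>"
  proof (intro allI impI)
    fix x
    assume a: "(ALL y. y eps x --> (EX z. z eps y)) & (ALL y z. y eps x & z eps x & y ~= z --> (ALL u. u eps y --> ~ u eps z))"
    have "EX c. ALL y. y eps x --> (EX!u. u eps y & u eps c)"
      by (rule choice) (use a ex_mem_iff in blast)+
    then show "EX c. ALL y. y eps x --> (EX u. u eps y & u eps c & (ALL v. v eps y & v eps c --> v = u))" unfolding Ex1_def conj_assoc .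
  qed
  finally have "sat mem e (Choice 0)" .
  then show "p \<in> ZFC ==> sat mem e p"
    unfolding ZFC_def using ax sat_Separation sat_Replacement by blast
qed

context zf
begin

lemma sub_iff: "(ALL z. z eps x --> z eps y) <-> sub x y" by (simp add: sub_def)

lemma set_iffs: "(ALL z. ~ z eps x) <-> x = emp" "(ALL z. z eps p <-> z = x | z = y) <-> p = upair x y"
  "(ALL z. z eps q <-> sub z x) <-> q = Pow x" "(ALL z. z eps p <-> z = x) <-> p = upair x x"
  using ex_mem_iff[of x] by (auto intro: ext)

lemma sat_opair [simp]: "p < n ==> x < n ==> y < n ==>
    sat mem e (is_opair p x y n) <-> val n e p = opair (val n e x) (val n e y)"
  by (simp add: is_opair_def opair_def set_iffs)

lemma sat_maps [simp]: "f < n ==> x < n ==> y < n ==>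
    sat mem e (maps f x y n) <-> opair (val n e x) (val n e y) eps val n e f"
  by (simp add: maps_def)

definition isfun where
  "isfun f a b <-> (ALL p. p eps f --> (EX x y. x eps a & y eps b & p = opair x y)) & (ALL x. x eps a --> (EX!y. opair x y eps f))"

definition isinj where
  "isinj f a b <-> isfun f a b & (ALL x x' y. opair x y eps f & opair x' y eps f --> x = x')"

lemma isbij_iff: "isbij f a b <-> isinj f a b & (ALL y. y eps b --> (EX x. opair x y eps f))"
  by (simp only: isbij_def isinj_def isfun_def conj_assoc)

lemma sat_function [simp]: "f < n ==> a < n ==> b < n ==>
    sat mem e (is_function f a b n) <-> isfun (val n e f) (val n e a) (val n e b)"
  by (simp add: is_function_def fex1_def isfun_def Ex1_def)

lemma sat_injection [simp]: "f < n ==> a < n ==> b < n ==>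
    sat mem e (is_injection f a b n) <-> isinj (val n e f) (val n e a) (val n e b)"
  by (simp add: is_injection_def isinj_def)

lemma sat_bijection [simp]: "f < n ==> a < n ==> b < n ==>
    sat mem e (is_bijection f a b n) <-> isbij (val n e f) (val n e a) (val n e b)"
  by (simp add: is_bijection_def isbij_iff)

lemma sat_equipotent [simp]: "a < n ==> b < n ==>
    sat mem e (equipotent a b n) <-> equi (val n e a) (val n e b)"
  by (simp add: equipotent_def equi_def)

text \<open>The right-hand side is the notion of ordinal in the formal sentence; foundation provides
  the least elements.\<close>

lemma Ord_iff:
  "Ord x <-> (ALL y. y eps x --> sub y x) & (ALL y. y eps x --> ~ y eps y)
    & (ALL y z u. y eps x & z eps x & u eps x & y eps z & z eps u --> y eps u)
    & (ALL y z. y eps x & z eps x --> y eps z | y = z | z eps y)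
    & (ALL s. sub s x & s ~= emp --> (EX m. m eps s & (ALL y. y eps s --> m = y | m eps y)))" (is "_ <-> ?R")
proof
  assume x: "Ord x"
  have o: "Ord y" if "y eps x" for y using Ord_in[OF x that] .
  have "EX m. m eps s & (ALL y. y eps s --> m = y | m eps y)" if s: "sub s x" "s ~= emp" for s
  proof -
    obtain y where "y eps s" using s(2) ex_mem_iff by blast
    then obtain m where m: "m eps s" "!!z. z eps s ==> ~ z eps m" using found by blast
    then show ?thesis using Ord_linear o s(1) unfolding sub_def by blast
  qed
  moreover have "sub y x" if "y eps x" for y unfolding sub_def using Ord_trans[OF x that] by blast
  moreover have "y eps u" if "u eps x" "y eps z" "z eps u" for y z u using Ord_trans[OF o[OF that(1)] that(3,2)] .
  ultimately show ?R using Ord_linear o not_mem_self by blast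
next
  assume R: ?R
  then have t: "z eps x" if "y eps x" "z eps y" for y z using that unfolding sub_def by blast
  have tr: "y eps u" if "y eps x" "z eps x" "u eps x" "y eps z" "z eps u" for y z u using R that by blast
  have "sub z y" if "y eps x" "z eps y" for y z
    unfolding sub_def using tr[OF t[OF t[OF that]] t[OF that] that(1) _ that(2)] by blast
  then show "Ord x" unfolding Ord_def trans_def using R by blast
qed

lemma sat_ordinal [simp]: "x < n ==> sat mem e (ordinal x n) <-> Ord (val n e x)"
  unfolding Ord_iff by (simp add: ordinal_def transitive_def well_ordered_by_mem_def sub_iff set_iffs)

definition limit where "limit x <-> Ord x & x ~= emp & (ALL y. y eps x --> (EX z. z eps x & y eps z))"

lemma sat_limit [simp]: "x < n ==> sat mem e (limit_ordinal x n) <-> limit (val n e x)"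
  by (simp add: limit_ordinal_def limit_def set_iffs)

text \<open>Every nonzero natural number is a successor, hence no limit; linearity of the ordinals
  gives uniqueness.\<close>

lemma om_iff: "limit w & (ALL y. y eps w --> ~ limit y) <-> w = om"
proof -
  have l: "limit om" unfolding limit_def using ex_mem_iff[of om] emp_om suc_om mem_suc by (metis Ord_om)
  have n: "~ limit y" if om: "y eps om" for y
  proof
    assume y: "limit y"
    then obtain m where m: "m eps om" "y = suc m" using om_cases[OF om] unfolding limit_def by blast
    then obtain z where "z eps suc m" "m eps z" using y unfolding limit_def by auto
    then show False using not_mem_sym by auto
  qed
  have "w = om" if w: "limit w" "ALL y. y eps w --> ~ limit y"
  proof -
    have "Ord w" using w(1) by (simp add: limit_def)
    then show ?thesis using Ord_linear[OF Ord_om, of w] w l n by blast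
  qed
  then show ?thesis using l n by blast
qed

lemma sat_omega [simp]: "w < n ==> sat mem e (is_omega w n) <-> val n e w = om"
  unfolding om_iff[symmetric] by (simp add: is_omega_def)

lemma sat_cardinal [simp]: "k < n ==> sat mem e (cardinal k n) <-> card (val n e k)"
  by (simp add: cardinal_def card_iff)

lemma sat_infinite_cardinal [simp]: "k < n ==> sat mem e (infinite_cardinal k n) <-> icard (val n e k)"
  by (auto simp: infinite_cardinal_def sub_iff icard_def card_def)

lemma sat_succ_cardinal [simp]: "k < n ==> l < n ==> sat mem e (is_succ_cardinal l k n) <->
    card (val n e l) & val n e k eps val n e l & (ALL m. card m & val n e k eps m --> sub (val n e l) m)"
  by (simp add: is_succ_cardinal_def sub_iff)

lemma sat_pairs [simp]: "d < n ==> x < n ==> sat mem e (is_pairs d x n) <->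
    (ALL p. p eps val n e d <-> (EX u v. u eps val n e x & v eps val n e x & u ~= v & p = upair u v))"
  by (simp add: is_pairs_def set_iffs)

lemma sat_cross [simp]: "c < n ==> a < n ==> b < n ==> sat mem e (is_cross c a b n) <->
    (ALL p. p eps val n e c <-> (EX u v. u eps val n e a & v eps val n e b & u ~= v & p = upair u v))"
  by (simp add: is_cross_def set_iffs)

lemma sat_image [simp]: "y < n ==> g < n ==> c < n ==> sat mem e (is_image y g c n) <->
    (ALL z. z eps val n e y <-> (EX x. x eps val n e c & opair x z eps val n e g))"
  by (simp add: is_image_def)

definition otype where
  "otype a t <-> (EX f. isbij f t a & (ALL x y x' y'. opair x x' eps f & opair y y' eps f --> (x eps y <-> x' eps y')))"

lemma sat_order_type [simp]: "a < n ==> t < n ==> sat mem e (has_order_type a t n) <-> otype (val n e a) (val n e t)"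
  by (simp add: has_order_type_def otype_def)

lemma otype_om:
  assumes "otype b om"
  shows "cov om b" "b ~= emp" "x eps b ==> EX y. y eps b & x eps y"
proof -
  obtain f where f: "isbij f om b" "!!x y x' y'. opair x x' eps f ==> opair y y' eps f ==> x eps y <-> x' eps y'"
    using assms unfolding otype_def by blast
  have "equi om b" unfolding equi_def using f(1) by blast
  then show "cov om b" by (rule equi_cov)
  have t: "EX y. opair n y eps f & y eps b" if "n eps om" for n
    using f(1) isbij_ap[OF f(1)] that unfolding isbij_def by blast
  from t[OF emp_om] show "b ~= emp" by auto
  assume "x eps b"
  then obtain n where n: "opair n x eps f" using f(1) unfolding isbij_def by blast
  then have "n eps om" using isbij_ap[OF f(1)] by blast
  then obtain y where y: "opair (suc n) y eps f" "y eps b" using t suc_om by blast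
  have "x eps y" using f(2)[OF n y(1)] by simp
  then show "EX y. y eps b & x eps y" using y by blast
qed

lemma sat_uncountable [simp]: "x < n ==> sat mem e (Defs.uncountable x n) <-> ~ (EX f. isinj f (val n e x) om)"
  by (simp add: Defs.uncountable_def)

text \<open>The least ordinal that covers \<open>x\<close> is at most \<omega> and equipotent with
  \<open>x\<close>.\<close>

lemma cov_om_inj:
  assumes "cov om x"
  shows "EX f. isinj f x om"
proof -
  let ?l = "Lst (%a. cov a x)"
  have l: "Ord ?l" "cov ?l x" "sub ?l om"
    using Lst_Ord[of "%a. cov a x" om] Lst_prop[of "%a. cov a x" om] Lst_sub[of "%a. cov a x" om] assms by simp_all
  have "~ cov a x" if "a eps ?l" for a
    using Lst_least[of "%a. cov a x" a] Ord_in[OF l(1) that] that by auto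
  then obtain f where "isbij f x ?l" using equi_if_cov[OF l(1,2)] unfolding equi_def by blast
  then have "isinj f x om" unfolding isbij_iff isinj_def isfun_def using l(3) unfolding sub_def by blast
  then show ?thesis by blast
qed

end

context zfL
begin

lemma succ_cardinal_hart:
  assumes "icard k"
  shows "card l & k eps l & (ALL m. card m & k eps m --> sub l m) <-> l = hart k"
proof -
  have c: "card (hart k)" using icard_hart[OF assms] unfolding icard_def card_def by blast
  have m: "sub (hart k) m" if "card m" "k eps m" for m
    using that mem_hart[of m k] Ord_not_mem[of m "hart k"] Ord_hart unfolding card_def by blast
  show ?thesis using c m k_hart[OF assms] sub_antisym by blast
qed

end

section \<open>Truth of the two sentences\<close>

context coloured
begin

abbreviation w1 where "w1 \<equiv> hart om"
abbreviation w2 where "w2 \<equiv> hart w1"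

lemma sat_GCH: "sat mem e (GCH 0)"
proof -
  have "equi (Pow k) (hart k)" if k: "icard k" for k
  proof (rule equi_if_cov[OF Ord_hart gch_all[OF k]])
    fix a assume "a eps hart k"
    then show "~ cov a (Pow k)" using cov_hart cov_trans Cantor by blast
  qed
  then have "icard k & (card l & k eps l & (ALL m. card m & k eps m --> sub l m)) & p = Pow k --> equi p l" for k l p
    using succ_cardinal_hart[of k l] by (metis (no_types))
  then show ?thesis by (simp add: GCH_def sub_iff set_iffs)
qed

lemma D_C [simp]: "T a ==> T b ==> T c ==> D (%e. C (a e) (b e) (c e))"
  unfolding C_def by simp

text \<open>The sentence asks for a function on unordered pairs, while \<open>C\<close> lives on
  increasing ones; membership orients each pair uniquely.\<close>

definition prs where "prs = sep (Pow w2) (%p. EX u v. u eps w2 & v eps w2 & u ~= v & p = upair u v)"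
definition g where "g = sep (prod prs w1) (%z. EX u v. fs z = upair u v & C u v (sn z))"

lemma mem_prs: "p eps prs <-> (EX u v. u eps w2 & v eps w2 & u ~= v & p = upair u v)"
proof -
  have "p eps prs <-> p eps Pow w2 & (EX u v. u eps w2 & v eps w2 & u ~= v & p = upair u v)"
    unfolding prs_def by (rule mem_sep) (simp add: dft_rens)
  then show ?thesis by (auto simp: sub_def)
qed

lemma C_w2: "C u v c ==> u eps v & u eps w2 & v eps w2 & u ~= v & c eps w1"
  using C_range Ord_trans[OF Ord_hart[of w1]] not_mem_self by blast

lemma g_iff: "opair p c eps g <-> (EX u v. p = upair u v & C u v c)"
proof -
  have "opair p c eps g <-> opair p c eps prod prs w1 & (EX u v. fs (opair p c) = upair u v & C u v (sn (opair p c)))"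
    unfolding g_def by (rule mem_sep) (simp add: dft_rens)
  then show ?thesis unfolding opair_mem_prod fs_opair sn_opair mem_prs using C_w2 by blast
qed

lemma C_upair: "C u v c ==> C u' v' c' ==> upair u v = upair u' v' ==> u = u' & v = v'"
  using C_w2 not_mem_sym unfolding upair_eq_iff by blast

lemma isfun_g: "isfun g prs w1"
  unfolding isfun_def
proof (intro conjI allI impI)
  fix z assume "z eps g"
  then have "z eps prod prs w1" unfolding g_def by (simp add: mem_sep dft_rens)
  then show "EX x y. x eps prs & y eps w1 & z = opair x y" unfolding mem_prod by blast
next
  fix p assume "p eps prs"
  then obtain u v where uv: "u eps w2" "v eps w2" "u ~= v" "p = upair u v" unfolding mem_prs by blast
  have "EX u v. p = upair u v & u eps v & v eps w2"
  proof (cases "u eps v")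
    case False
    then have "v eps u" using Ord_linear uv(1-3) Ord_in[OF Ord_hart[of w1]] by blast
    moreover have "p = upair v u" unfolding uv(4) upair_eq_iff by simp
    ultimately show ?thesis using uv by blast
  qed (use uv in blast)
  then obtain u v where p: "p = upair u v" "u eps v" "v eps w2" by blast
  obtain c where c: "C u v c" using C_total[OF p(2,3)] by blast
  show "EX!y. opair p y eps g" unfolding g_iff
  proof (rule ex1I[of _ c])
    show "EX u v. p = upair u v & C u v c" using p c by blast
    fix y assume "EX u v. p = upair u v & C u v y"
    then obtain u' v' where "p = upair u' v'" "C u' v' y" by blast
    then show "y = c" using C_upair[OF c, of u' v' y] p(1) C_fun[OF c] by metis
  qed
qed

lemma establishes_g:
  assumes a: "sub a w2" "otype a w1" and b: "sub b w2" "otype b om" and ab: "!!x y. x eps a ==> y eps b ==> x eps y"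
  shows "EX c. (ALL p. p eps c <-> (EX u v. u eps a & v eps b & u ~= v & p = upair u v)) & (ALL z. z eps w1 <-> (EX x. x eps c & opair x z eps g))"
proof -
  let ?c = "sep prs (%p. EX u v. u eps a & v eps b & u ~= v & p = upair u v)"
  have "p eps ?c <-> p eps prs & (EX u v. u eps a & v eps b & u ~= v & p = upair u v)" for p
    by (rule mem_sep) (simp add: dft_rens)
  then have c: "p eps ?c <-> (EX u v. u eps a & v eps b & u ~= v & p = upair u v)" for p
    unfolding mem_prs using a(1) b(1) unfolding sub_def by blast
  have "equi w1 a" using a(2) unfolding otype_def equi_def by blast
  then have cov: "cov a w1" by (rule equi_cov)
  have "z eps w1 <-> (EX x. x eps ?c & opair x z eps g)" for z
  proof
    assume "z eps w1"
    then obtain u v where uv: "u eps a" "v eps b" "C u v z"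
      using C_establishes[OF a(1) cov b(1) otype_om(1,2)[OF b(2)] otype_om(3)[OF b(2)] ab] by blast
    then have "upair u v eps ?c" unfolding c using C_w2 by blast
    moreover have "opair (upair u v) z eps g" unfolding g_iff using uv by blast
    ultimately show "EX x. x eps ?c & opair x z eps g" by blast
  next
    assume "EX x. x eps ?c & opair x z eps g"
    then show "z eps w1" unfolding g_iff using C_w2 by blast
  qed
  then show ?thesis using c by blast
qed

lemma rainbow_g:
  assumes r: "sub r w2" and d: "!!p. p eps d <-> (EX u v. u eps r & v eps r & u ~= v & p = upair u v)"
    and inj: "!!p q z. p eps d ==> q eps d ==> opair p z eps g ==> opair q z eps g ==> p = q"
  shows "EX f. isinj f r om"
proof (rule cov_om_inj, rule ccontr)
  assume "~ cov om r"
  then obtain u v u' v' c where uv: "u eps r" "v eps r" "u' eps r" "v' eps r" "C u v c" "C u' v' c" "~ (u = u' & v = v')"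
    using C_no_rainbow[OF r] by blast
  have "upair u v eps d" "upair u' v' eps d" unfolding d using uv C_w2 by blast+
  then have "upair u v = upair u' v'" using inj g_iff uv(5,6) by blast
  then show False using C_upair[OF uv(5,6)] uv(7) by blast
qed

lemma sat_colouring: "sat mem e (ex_colouring_without_rainbow 0)"
proof -
  have e: "sat mem e (establishes (Suc (Suc (Suc (Suc 0)))) 0 (Suc 0) (Suc (Suc 0)) (Suc (Suc (Suc (Suc (Suc 0))))))"
    if "e = case_nat g (case_nat prs (case_nat w2 (case_nat w1 (case_nat om e'))))" for e e'
  proof -
    have "ALL a b. sub a w2 & otype a w1 & sub b w2 & otype b om & (ALL x y. x eps a & y eps b --> x eps y) -->
      (EX c. (ALL p. p eps c <-> (EX u v. u eps a & v eps b & u ~= v & p = upair u v)) & (ALL z. z eps w1 <-> (EX x. x eps c & opair x z eps g)))"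
      using establishes_g by blast
    then show ?thesis unfolding that by (simp add: establishes_def sub_iff set_iffs)
  qed
  have r: "sat mem e ((\<^bold>\<not> (\<^bold>\<exists>r. rainbow r (Suc (Suc (Suc (Suc 0)))) (Suc (Suc 0)) \<^bold>\<and> Defs.uncountable r)) (Suc (Suc (Suc (Suc (Suc 0))))))"
    if "e = case_nat g (case_nat prs (case_nat w2 (case_nat w1 (case_nat om e'))))" for e e'
  proof -
    have "~ (EX r. (sub r w2 & (EX d. (ALL p. p eps d <-> (EX u v. u eps r & v eps r & u ~= v & p = upair u v))
      & (ALL p q z. p eps d & q eps d & opair p z eps g & opair q z eps g --> p = q))) & ~ (EX f. isinj f r om))"
    proof
      assume "EX r. (sub r w2 & (EX d. (ALL p. p eps d <-> (EX u v. u eps r & v eps r & u ~= v & p = upair u v))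
        & (ALL p q z. p eps d & q eps d & opair p z eps g & opair q z eps g --> p = q))) & ~ (EX f. isinj f r om)"
      then obtain r d where "sub r w2" "ALL p. p eps d <-> (EX u v. u eps r & v eps r & u ~= v & p = upair u v)"
        "ALL p q z. p eps d & q eps d & opair p z eps g & opair q z eps g --> p = q" "~ (EX f. isinj f r om)" by blast
      then show False using rainbow_g[of r d] by blast
    qed
    then show ?thesis unfolding that by (simp add: rainbow_def sub_iff set_iffs)
  qed
  have 1: "card w1 & om eps w1 & (ALL m. card m & om eps m --> sub w1 m)" using succ_cardinal_hart[OF icard_om] by blast
  have 2: "card w2 & w1 eps w2 & (ALL m. card m & w1 eps m --> sub w2 m)"
    using succ_cardinal_hart[OF icard_hart[OF icard_om]] by blast
  show ?thesis unfolding ex_colouring_without_rainbow_def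
    by (simp only: sat_forms, intro bexI[of _ om] bexI[of _ w1] bexI[of _ w2] bexI[of _ prs] bexI[of _ g] UNIV_I conjI,
        insert e r 1 2 mem_prs isfun_g, simp_all)
qed

lemma consistent_colouring: "consistent (ZFC \<union> {GCH 0, ex_colouring_without_rainbow 0})"
  by (rule consistent_if_model[of _ mem "%_. emp"]) (use sat_ZFC sat_GCH sat_colouring in auto)

end

lemma (in cground) Q_nonempty: "EX p. p eps Q"
  using mk_Q[of "%_ _. emp" emp emp] cov_subset[of emp om] by auto

text \<open>The ordinals \<open>nn k\<close> are constructible and distinct, so the class is
  countably infinite and inner models too can live on the natural numbers.\<close>

lemma (in zf) bij_cst:
  fixes f :: "'a => nat"
  assumes "inj f"
  shows "EX i :: nat => 'a. bij_betw i UNIV {x. cst A x}"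
proof -
  have "range nn \<subseteq> {x. cst A x}" using cst_Ord by auto
  moreover have "infinite (range nn)" using range_inj_infinite[of nn] by (simp add: inj_def)
  ultimately have "infinite {x. cst A x}" using infinite_super by blast
  moreover have "countable {x. cst A x}" using assms by (metis countableI inj_on_subset subset_UNIV)
  ultimately show ?thesis using bij_betw_from_nat_into by blast
qed

lemma coloured_if_zf:
  fixes mem :: "nat => nat => bool"
  assumes "zf mem"
  shows "EX (mem' :: nat => nat => bool) A. coloured mem' A"
proof -
  interpret M: zf mem by fact
  obtain i :: "nat => nat" where i: "bij_betw i UNIV {x. M.cst M.emp x}" using M.bij_cst[of id] by auto
  obtain A where A: "i A = M.emp" using M.cst_iff_range[OF i] M.cst_emp by metis
  define mem0 where "mem0 = (%x y. mem (i x) (i y))"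
  interpret L: zfL mem0 A
    unfolding mem0_def by (intro zfL.intro zfL_axioms.intro M.zf_cst[OF i] M.constructible_in_cst[OF i A])
  have "~ mem0 z A" for z unfolding mem0_def A by simp
  then have A: "A = L.emp" using L.ext[of A L.emp] by simp
  \<comment> \<open>With an empty predicate the bound \<open>m\<close> can be 0, and condensation at
    \<omega> yields CH.\<close>
  interpret cground mem0 A
    by unfold_locales (rule L.gch[of _ L.emp]; simp add: A)
  obtain p0 where p0: "mem0 p0 Q" using Q_nonempty by blast
  obtain G where "generic mem0 A Q leq G" using generic_exists[of id, OF _ p0] by auto
  then interpret generic mem0 A Q leq G .
  obtain h :: "nat => nat" and E where "gext mem0 A Q leq G h E" using gext_exists[of id] by auto
  then interpret G: gext mem0 A Q leq G h E .
  interpret cext mem0 A G h E by unfold_locales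
  obtain i' :: "nat => nat" where i': "bij_betw i' UNIV {x. N.cst AN x}" using N.bij_cst[of id] by auto
  interpret kext mem0 A G h E i' by unfold_locales (rule i')
  show ?thesis using coloured_K by blast
qed

theorem theorem2p6:
  shows "consistent ZFC \<Longrightarrow> consistent (ZFC \<union> {GCH 0, ex_colouring_without_rainbow 0})"
proof -
  assume "consistent ZFC"
  then obtain U :: "nat set" and E e where U: "range e \<subseteq> U" "!!p. p \<in> ZFC ==> sat_on U E e p"
    by (rule model_existence_on) (rule that; assumption)
  \<comment> \<open>An infinite carrier of natural numbers can be reindexed by all of them, which
    removes the carrier.\<close>
  have "infinite U" by (rule infinite_model[of U E e]) (use U in \<open>auto simp: ZFC_def\<close>)
  then have "bij_betw (from_nat_into U) UNIV U" by (rule bij_betw_from_nat_into[OF countableI_type])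
  then obtain j :: "nat => nat" where j: "bij_betw j UNIV U" ..
  then have "EX n. e i = j n" for i using U(1) unfolding bij_betw_def by blast
  then have "j (SOME n. e i = j n) = e i" for i using someI_ex[of "%n. e i = j n"] by metis
  then have "e = j \<circ> (%i. SOME n. e i = j n)" by (simp add: fun_eq_iff)
  then obtain e' where "e = j \<circ> e'" by blast
  then have "zf (%x y. E (j x) (j y))" using U(2) sat_on_reindex[OF j] by (intro zf_if_ZFC[of _ e']) simp
  then obtain mem :: "nat => nat => bool" and A where "coloured mem A" using coloured_if_zf by blast
  then show ?thesis by (rule coloured.consistent_colouring)
qed

end
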